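(* Let $\varrho>0$ and $V^\varrho=\frac1{(1+\varrho)^2}$, and let $$D(t)=\frac1{t\,\varrho(1+\varrho)}\sum_{i\in\mathbb Z}(i-V^\varrho t)^2\,S(i,t),\qquad S(i,t)=\mathbf E^\varrho\big(\omega_i(t)\omega_0(0)\big)-\varrho^2,$$ be the diffusivity of the stationary constant rate totally asymmetric zero range process (TAZRP) $\underline\omega(\cdot)$ with density $\varrho$. Then there exist constants $0<t_0,C<\infty$ such that for all $t\ge t_0$ $$C^{-1}t^{1/3}\;\le\; D(t)\;\le\; C\,t^{1/3}.$$
   Context: TAZRP: the Markov process on $\Omega=\{0,1,2,\dots\}^{\mathbb Z}$ in which, independently at different sites, the jump $(\omega_i,\omega_{i+1})\to(\omega_i-1,\omega_{i+1}+1)$ occurs with rate $\mathbb I_{(\omega_i>0)}$. $\mu_\varrho(k)=\left(\frac{\varrho}{1+\varrho}\right)^k\frac1{1+\varrho}$, $k=0,1,2,\dots$ (geometric with mean $\varrho$). $\mathbf E^\varrho$ is the expectation in the stationary process started from $\mu_\varrho^{\otimes\mathbb Z}$. *)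

theory Defs
  imports "HOL-Probability.Probability"
begin

text \<open>
  The constant rate totally asymmetric zero range process is realised by its graphical
  construction: every site carries an independent rate one Poisson clock, and when the clock
  of site \<open>i\<close> rings while site \<open>i\<close> is occupied, one particle jumps from \<open>i\<close> to \<open>i + 1\<close>.
  So the jump from \<open>i\<close> happens at rate one when the site is occupied and at rate zero otherwise.
  A sample point is a pair \<open>(\<eta>, \<xi>)\<close> of an initial configuration and the waiting times between
  successive rings of the clocks.
\<close>

type_synonym config = "int \<Rightarrow> nat"
type_synonym waiting = "int \<times> nat \<Rightarrow> real"

definition site_law :: "real \<Rightarrow> nat pmf" where
  "site_law \<rho> = geometric_pmf (1 / (1 + \<rho>))"

lemma pmf_site_law:
  assumes "\<rho> > 0"
  shows "pmf (site_law \<rho>) k = (\<rho> / (1 + \<rho>)) ^ k * (1 / (1 + \<rho>))"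
proof -
  have "1 - 1 / (1 + \<rho>) = \<rho> / (1 + \<rho>)"
    using assms by (simp add: field_simps)
  then show ?thesis
    using assms by (simp add: site_law_def)
qed

text \<open>
  The measure is completed because \<open>tazrp\<close> below is only specified up to a null set of
  sample points.
\<close>

definition tazrp_space :: "real \<Rightarrow> (config \<times> waiting) measure" where
  "tazrp_space \<rho> = completion
     ((\<Pi>\<^sub>M i\<in>UNIV. measure_pmf (site_law \<rho>)) \<Otimes>\<^sub>M
      (\<Pi>\<^sub>M p\<in>UNIV. density lborel (exponential_density 1)))"

definition ring_time :: "waiting \<Rightarrow> int \<Rightarrow> nat \<Rightarrow> real" where
  "ring_time \<xi> i n = (\<Sum>k\<le>n. \<xi> (i, k))"

text \<open>
  The number of jumps from \<open>i\<close> to \<open>i + 1\<close> up to time \<open>t\<close> along the path \<open>x\<close>: the rings of the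
  clock at \<open>i\<close> at which the site was occupied immediately before the ring.
\<close>

definition jump_count :: "waiting \<Rightarrow> (real \<Rightarrow> config) \<Rightarrow> int \<Rightarrow> real \<Rightarrow> nat" where
  "jump_count \<xi> x i t =
     card {n. ring_time \<xi> i n \<le> t \<and> (\<forall>\<^sub>F u in at_left (ring_time \<xi> i n). x u i > 0)}"

text \<open>
  Since almost surely all ring times are positive, the equation below says \<open>x t = \<eta>\<close> for \<open>t \<le> 0\<close>.
\<close>

definition tazrp_path :: "config \<times> waiting \<Rightarrow> (real \<Rightarrow> config) \<Rightarrow> bool" where
  "tazrp_path s x \<longleftrightarrow>
     (\<forall>t i. int (x t i) =
        int (fst s i) + int (jump_count (snd s) x (i - 1) t) - int (jump_count (snd s) x i t))"

text \<open>
  Almost surely there is exactly one such path: up to any fixed time there are clocks arbitrarily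
  far to the left that have not rung, and particles move only to the right, so that the occupation
  numbers are determined successively to the right of such a site.
\<close>

definition tazrp :: "config \<times> waiting \<Rightarrow> real \<Rightarrow> config" where
  "tazrp s = (THE x. tazrp_path s x)"

definition two_point :: "real \<Rightarrow> int \<Rightarrow> real \<Rightarrow> real" where
  "two_point \<rho> i t =
     (LINT s|tazrp_space \<rho>. real (tazrp s t i) * real (tazrp s 0 0)) - \<rho>\<^sup>2"

definition char_speed :: "real \<Rightarrow> real" where
  "char_speed \<rho> = 1 / (1 + \<rho>)\<^sup>2"

definition diffusivity :: "real \<Rightarrow> real \<Rightarrow> real" where
  "diffusivity \<rho> t = 1 / (t * \<rho> * (1 + \<rho>)) *
     (\<Sum>\<^sub>\<infinity>i\<in>UNIV. (real_of_int i - char_speed \<rho> * t)\<^sup>2 * two_point \<rho> i t)"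

end

theory Submission imports Defs begin

text \<open>
  Let \<open>V\<close> be the characteristic speed, \<open>\<kappa> = \<rho> (1 + \<rho>)\<close>, \<open>c\<^sub>x = (\<Sum>i<x. (x - i) S(i, t))\<close> and
  \<open>d\<^sub>x = c\<^sub>x + \<kappa> (V t - x)\<close>. Summation by parts gives, up to a bounded term,
  \<open>t \<kappa> D(t) = 2 (\<Sum>x\<le>V t. c\<^sub>x) + 2 (\<Sum>x>V t. d\<^sub>x)\<close>. Now \<open>c\<^sub>x\<close> and \<open>d\<^sub>x\<close> are the covariances of the
  flux through \<open>x\<close> sites with the initial particles, up to the sign, and with the arriving ones; both
  are nonnegative.

  Discretising time turns the process into queues in tandem with Bernoulli clocks, for which Burke's
  theorem holds. Tilting the boundary data turns arrivals of fugacity \<open>u\<close> and sites of fugacity \<open>v\<close>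
  into a stationary pair, so that the mean of \<open>exp ((u - v) flux)\<close> is explicit. The flux is a first
  passage time, and a minimising path leaves only one of the two boundaries; hence the flux is at least
  the smaller of the two fluxes in which one boundary has been replaced, and all exponential moments
  reduce to explicit ones. Coupling the initial particles, or the arrivals, at two fugacities at
  distance \<open>\<delta>\<close> bounds \<open>c\<^sub>x\<close> and \<open>d\<^sub>x\<close> by \<open>1 / \<delta>\<close> times a difference of mean fluxes, which the
  exponential moments control; optimising yields
  \<open>O(t powr (2 / 3) (1 + r t powr (- 2 / 3)) powr (- 3 / 2))\<close> with \<open>r = \<bar>x - V t\<bar>\<close>. Conversely, the
  third derivative of the cumulant generating function does not vanish, and the inequality of Paley and
  Zygmund forces \<open>c\<^sub>x\<close> to be of order \<open>t powr (2 / 3)\<close> for about \<open>t powr (2 / 3)\<close> sites below \<open>V t\<close>.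
\<close>

section \<open>Queues in tandem\<close>

text \<open>Two sequences are needed because \<open>cov_limit\<close> decays only to the left of the
  characteristic: to its right it grows like \<kappa> (x - V t), and \<open>excess_limit\<close>,
  which differs from it by exactly this linear term, is the one that decays there. The bound by a
  difference of mean fluxes avoids any separate study of the place where minimising paths leave the
  boundary. A Stein identity for the boundary law expresses the covariance through one number R, the
  mean weight of the boundary before the exit, and the coupling of two densities changes the mean
  flux by at least a multiple of the same R. The exponent comes from \<open>limit_partition\<close>:
  its first derivative is minus the mean flux, its second derivative \<kappa> (V t - x) vanishes on
  the characteristic, its third is of order t there, so the natural tilts s have s^3 t of order one.
  In discrete time all laws are laws of finite lists, open to induction. The lattice clocks arise by
  rounding each exponential waiting time; they are then exactly Bernoulli and live on the
  probability space of the process, where the occupations eventually coincide with those of the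
  process.\<close>

text \<open>
  One queue observed at successive time steps: an arriving customer may already be served in the
  time step of its arrival.
\<close>

fun column :: "nat \<Rightarrow> bool list \<Rightarrow> bool list \<Rightarrow> nat \<times> bool list" where
  "column q (a # as) (b # bs) =
     (let d = b \<and> (a \<or> 0 < q); r = column (q + of_bool a - of_bool d) as bs
      in (fst r, d # snd r))"
| "column q [] bs = (q, [])"
| "column q as [] = (q, [])"

fun tandem :: "nat list \<Rightarrow> bool list list \<Rightarrow> bool list \<Rightarrow> nat list \<times> bool list" where
  "tandem (q # qs) (b # bs) w =
     (let r = column q w b; r' = tandem qs bs (snd r) in (fst r # fst r', snd r'))"
| "tandem [] bs w = ([], w)"
| "tandem qs [] w = ([], w)"

abbreviation trues :: "bool list \<Rightarrow> nat" where
  "trues xs \<equiv> (\<Sum>x\<leftarrow>xs. of_bool x)"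

lemma trues_le_length: "trues xs \<le> length xs"
  by (induction xs) auto

lemma column_length:
  "length as = length bs \<Longrightarrow> length (snd (column q as bs)) = length bs"
  by (induction q as bs rule: column.induct) (auto simp: Let_def)

lemma column_conservation:
  "length as = length bs \<Longrightarrow> fst (column q as bs) + trues (snd (column q as bs)) = q + trues as"
  by (induction q as bs rule: column.induct) (auto simp: Let_def)

lemma tandem_length:
  assumes "length qs = length bs" "\<forall>b\<in>set bs. length b = length w"
  shows "length (fst (tandem qs bs w)) = length qs" "length (snd (tandem qs bs w)) = length w"
  using assms
  by (induction qs bs w rule: tandem.induct) (auto simp: Let_def column_length)

lemma tandem_conservation:
  assumes "length qs = length bs" "\<forall>b\<in>set bs. length b = length w"
  shows "sum_list (fst (tandem qs bs w)) + trues (snd (tandem qs bs w)) = sum_list qs + trues w"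
  using assms
proof (induction qs bs w rule: tandem.induct)
  case (1 q qs b bs w)
  have "length (snd (column q w b)) = length w"
    using 1 by (auto simp: column_length)
  with 1 column_conservation[of w b q] show ?case
    by (auto simp: Let_def)
qed auto

text \<open>Lindley's formula. Let j be the time just after the last wasted service: whatever was
  present or arrived until j has left by then, and every later service is used. If no service is
  wasted, the number of services is attained instead.\<close>

lemma column_min:
  assumes "length as = length bs" "m \<le> length bs"
  shows "trues (take m (snd (column q as bs))) \<le> trues (take m bs) \<and>
    (\<forall>j\<le>m. trues (take m (snd (column q as bs))) \<le>
        q + trues (take j as) + trues (drop j (take m bs))) \<and>
    (trues (take m (snd (column q as bs))) = trues (take m bs) \<or>
     (\<exists>j\<le>m. trues (take m (snd (column q as bs))) =
        q + trues (take j as) + trues (drop j (take m bs))))"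
  using assms
proof (induction as bs arbitrary: q m rule: list_induct2)
  case (Cons a as b bs)
  show ?case
  proof (cases m)
    case 0
    then show ?thesis by simp
  next
    case (Suc n)
    define d where "d = (b \<and> (a \<or> 0 < q))"
    define q' where "q' = q + of_bool a - of_bool d"
    have q': "int q' = int q + of_bool a - of_bool d"
      by (auto simp: q'_def d_def)
    define N where "N = trues (take n (snd (column q' as bs)))"
    have len: "length as = length bs" "n \<le> length bs"
      using Cons Suc by auto
    have IH: "N \<le> trues (take n bs)"
      "\<And>j. j \<le> n \<Longrightarrow> N \<le> q' + trues (take j as) + trues (drop j (take n bs))"
      "N = trues (take n bs) \<or> (\<exists>j\<le>n. N = q' + trues (take j as) + trues (drop j (take n bs)))"
      using Cons.IH[of n q'] len by (auto simp: N_def)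
    have eq: "trues (take m (snd (column q (a # as) (b # bs)))) = of_bool d + N"
      by (simp add: Suc Let_def N_def q'_def d_def)
    have le: "of_bool d + N \<le> trues (take (Suc n) (b # bs))"
      using IH(1) by (auto simp: d_def)
    have le': "of_bool d + N \<le> q + trues (take j (a # as)) + trues (drop j (take (Suc n) (b # bs)))"
      if "j \<le> Suc n" for j
      using that IH(1) IH(2)[of "j - 1"] q' by (cases j) (auto simp: d_def)
    have "of_bool d + N = trues (take (Suc n) (b # bs)) \<or>
        (\<exists>j\<le>Suc n. of_bool d + N = q + trues (take j (a # as)) + trues (drop j (take (Suc n) (b # bs))))"
        using IH(3)
      proof
        assume N: "N = trues (take n bs)"
        show ?thesis
        proof (cases "d = b")
          case True
          then show ?thesis using N by simp
        next
          case False
          then have "b" "\<not> a" "q = 0" "\<not> d"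
            by (auto simp: d_def)
          \<comment> \<open>The service of this step is wasted, so the queue is empty after it, and
            all later services are used: the cut lies right after the first step.\<close>
          then show ?thesis using N by (intro disjI2 exI[of _ 1]) auto
        qed
      next
        assume "\<exists>j\<le>n. N = q' + trues (take j as) + trues (drop j (take n bs))"
        then obtain j where "j \<le> n" "N = q' + trues (take j as) + trues (drop j (take n bs))"
          by auto
        then show ?thesis
          using q' by (intro disjI2 exI[of _ "Suc j"]) auto
      qed
    with le le' show ?thesis
      unfolding eq unfolding Suc by blast
  qed
qed auto

text \<open>The current between opposite corners of the space-time rectangle. By conservation it
  also equals the arrivals minus the final particles (\<open>flux_eq\<close>); having both forms is
  what lets a tilt be moved from one boundary to the other.\<close>

definition flux :: "bool list list \<Rightarrow> bool list \<Rightarrow> nat list \<Rightarrow> int" where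
  "flux bs w qs = int (trues (snd (tandem qs bs w))) - int (sum_list qs)"

lemma flux_eq:
  assumes "length qs = length bs" "\<forall>b\<in>set bs. length b = length w"
  shows "flux bs w qs = int (trues w) - int (sum_list (fst (tandem qs bs w)))"
  using tandem_conservation[OF assms] unfolding flux_def by linarith

text \<open>
  An exit \<open>(m, k, c)\<close> stands for the lattice paths that leave the boundary after the first
  \<open>m\<close> time steps (if \<open>k = 0\<close>) or after the first \<open>k\<close> sites (if \<open>m = 0\<close>) and collect the weight
  \<open>c\<close> in the bulk: the flux is a first passage time.
\<close>

fun exit_value :: "bool list \<Rightarrow> nat list \<Rightarrow> nat \<times> nat \<times> int \<Rightarrow> int" where
  "exit_value w qs (m, k, c) = int (trues (take m w)) - int (sum_list (take k qs)) + c"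

text \<open>The set \<open>A\<close> depends on the clocks alone, and the boundary data enter only
  through \<open>exit_value\<close>; this makes it possible to compare different boundary data under
  the same clocks. Induction over the sites: \<open>column_min\<close> rewrites the departures of
  the first site, which are the arrivals for the remaining ones.\<close>

lemma flux_min_exits:
  assumes "\<forall>b\<in>set bs. length b = M"
  shows "\<exists>A. (\<forall>(m, k, c)\<in>A. m = 0 \<or> k = 0) \<and>
    (\<forall>w qs. length w = M \<longrightarrow> length qs = length bs \<longrightarrow>
       (\<forall>e\<in>A. flux bs w qs \<le> exit_value w qs e) \<and> (\<exists>e\<in>A. flux bs w qs = exit_value w qs e))"
  using assms
proof (induction bs)
  case Nil
  show ?case
    by (rule exI[of _ "{(M, 0, 0)}"]) (auto simp: flux_def)
next
  case (Cons b bs)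
  then obtain A where A: "\<And>m k c. (m, k, c) \<in> A \<Longrightarrow> m = 0 \<or> k = 0"
    and le: "\<And>w qs e. length w = M \<Longrightarrow> length qs = length bs \<Longrightarrow> e \<in> A \<Longrightarrow>
      flux bs w qs \<le> exit_value w qs e"
    and ex: "\<And>w qs. length w = M \<Longrightarrow> length qs = length bs \<Longrightarrow>
      \<exists>e\<in>A. flux bs w qs = exit_value w qs e"
    by fastforce
  define P where "P j m = int (trues (drop j (take m b)))" for j m
  \<comment> \<open>The three families are the old exits through sites, shifted by the new site; the
    exits through time whose departure count is a count of services, which now leave through the new
    site; and those that enter the bulk of the new site at step j. Cutting at \<open>min m M\<close>
    replaces an invariant m \<le> M.\<close>
  define A' where "A' = {(0, Suc k, c) | k c. (0, k, c) \<in> A}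
    \<union> {(0, 1, c + P 0 (min m M)) | m c. (m, 0, c) \<in> A}
    \<union> {(j, 0, c + P j (min m M)) | j m c. (m, 0, c) \<in> A \<and> j \<le> min m M}"
  have "(\<forall>e\<in>A'. flux (b # bs) w qs' \<le> exit_value w qs' e) \<and>
        (\<exists>e\<in>A'. flux (b # bs) w qs' = exit_value w qs' e)"
    if w: "length w = M" and qs': "length qs' = length (b # bs)" for w qs'
  proof -
    obtain q qs where q: "qs' = q # qs" and qs: "length qs = length bs"
      using qs' by (cases qs') auto
    define d where "d = snd (column q w b)"
    have lb: "length b = M" using Cons by simp
    have d: "length d = M"
      unfolding d_def using w lb by (simp add: column_length)
    have fl: "flux (b # bs) w qs' = flux bs d qs - int q"
      by (simp add: flux_def q Let_def d_def)
    define N where "N m = int (trues (take m d))" for m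
    have N_min: "N m = N (min m M)" for m
      by (simp add: N_def d min_def)
    have N1: "N m \<le> P 0 m"
      and N2: "j \<le> m \<Longrightarrow> N m \<le> int q + int (trues (take j w)) + P j m"
      and N3: "N m = P 0 m \<or> (\<exists>j\<le>m. N m = int q + int (trues (take j w)) + P j m)"
      if "m \<le> M" for m j
      using column_min[of w b m q] w lb that unfolding N_def P_def d_def
      by (auto simp flip: of_nat_add)
    show ?thesis
    proof (intro conjI ballI)
      fix e assume "e \<in> A'"
      then consider k c where "e = (0, Suc k, c)" "(0, k, c) \<in> A"
        | m c where "e = (0, 1, c + P 0 (min m M))" "(m, 0, c) \<in> A"
        | j m c where "e = (j, 0, c + P j (min m M))" "(m, 0, c) \<in> A" "j \<le> min m M"
        unfolding A'_def by blast
      then show "flux (b # bs) w qs' \<le> exit_value w qs' e"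
      proof cases
        case 1
        then show ?thesis using le[OF d qs 1(2)] by (simp add: fl[unfolded q] q)
      next
        case 2
        then show ?thesis
          using le[OF d qs 2(2)] N1[of "min m M"] N_min[of m] by (simp add: fl[unfolded q] q N_def)
      next
        case 3
        then show ?thesis
          using le[OF d qs 3(2)] N2[of "min m M" j] N_min[of m] by (simp add: fl[unfolded q] q N_def)
      qed
    next
      obtain m k c where e: "(m, k, c) \<in> A" "flux bs d qs = exit_value d qs (m, k, c)"
        using ex[OF d qs] by auto
      show "\<exists>e\<in>A'. flux (b # bs) w qs' = exit_value w qs' e"
      proof (cases "k = 0")
        case True
        then have f: "flux bs d qs = N (min m M) + c" "(m, 0, c) \<in> A"
          using e N_min[of m] by (auto simp: N_def)
        consider "N (min m M) = P 0 (min m M)"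
          | j where "j \<le> min m M" "N (min m M) = int q + int (trues (take j w)) + P j (min m M)"
          using N3[of "min m M"] by auto
        then show ?thesis
        proof cases
          case 1
          then show ?thesis using f
            by (intro bexI[of _ "(0, 1, c + P 0 (min m M))"]) (auto simp: A'_def fl[unfolded q] q)
        next
          case 2
          then show ?thesis using f
            by (intro bexI[of _ "(j, 0, c + P j (min m M))"]) (auto simp: A'_def fl[unfolded q] q)
        qed
      next
        case False
        then have "m = 0" using A[OF e(1)] by simp
        then show ?thesis
          using e by (intro bexI[of _ "(0, Suc k, c)"]) (auto simp: A'_def fl[unfolded q] q)
      qed
    qed
  qed
  moreover have "\<forall>(m, k, c)\<in>A'. m = 0 \<or> k = 0"
    by (auto simp: A'_def)
  ultimately show ?case by blast
qed

text \<open>An optimal exit touches only one of the two boundaries, so its value survives the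
  replacement of the other boundary and bounds the new flux from above.\<close>

lemma flux_ge_min:
  assumes "\<forall>b\<in>set bs. length b = M" "length w = M" "length w' = M"
    "length qs = length bs" "length qs' = length bs"
  shows "min (flux bs w qs') (flux bs w' qs) \<le> flux bs w qs"
proof -
  obtain A where A: "\<And>m k c. (m, k, c) \<in> A \<Longrightarrow> m = 0 \<or> k = 0"
    and le: "\<And>w qs e. length w = M \<Longrightarrow> length qs = length bs \<Longrightarrow> e \<in> A \<Longrightarrow>
      flux bs w qs \<le> exit_value w qs e"
    and ex: "\<And>w qs. length w = M \<Longrightarrow> length qs = length bs \<Longrightarrow>
      \<exists>e\<in>A. flux bs w qs = exit_value w qs e"
    using flux_min_exits[OF assms(1)] by fastforce
  obtain m k c where e: "(m, k, c) \<in> A" "flux bs w qs = exit_value w qs (m, k, c)"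
    using ex[OF assms(2,4)] by auto
  from A[OF e(1)] show ?thesis
  proof
    assume "m = 0"
    then show ?thesis using e(2) le[OF assms(3,4) e(1)] by simp
  next
    assume "k = 0"
    then show ?thesis using e(2) le[OF assms(2,5) e(1)] by simp
  qed
qed

lemma sum_list_take_map2_add:
  fixes xs ys :: "nat list"
  assumes "length xs = length ys"
  shows "sum_list (take k (map2 (+) xs ys)) = sum_list (take k xs) + sum_list (take k ys)"
  using assms
proof (induction xs ys arbitrary: k rule: list_induct2)
  case (Cons x xs y ys)
  then show ?case by (cases k) auto
qed auto

lemma sum_list_take_increment:
  fixes xs :: "nat list"
  assumes "i < length xs"
  shows "sum_list (take k (xs[i := Suc (xs ! i)])) = sum_list (take k xs) + of_bool (i < k)"
  using assms
proof (induction xs arbitrary: i k)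
  case (Cons x xs)
  then show ?case by (cases k; cases i) auto
qed auto

lemma trues_take_remove:
  assumes "i < length w" "w ! i"
  shows "int (trues (take k (w[i := False]))) = int (trues (take k w)) - of_bool (i < k)"
  using assms
proof (induction w arbitrary: i k)
  case (Cons x xs)
  then show ?case by (cases k; cases i) auto
qed auto

text \<open>\<open>Z\<close> is the rightmost exit among the minimisers, cut at the number of sites.
  A particle added before \<open>Z\<close> lowers a minimiser. Beyond \<open>Z\<close> it lowers
  only exits that are not minimal, and these are at least one unit above the minimum because all
  values are integers.\<close>

lemma flux_exit_site:
  assumes "\<forall>b\<in>set bs. length b = M" "length w = M" "length qs = length bs"
  shows "\<exists>Z. (\<forall>zs. length zs = length bs \<longrightarrow>
      flux bs w (map2 (+) qs zs) \<le> flux bs w qs - int (sum_list (take Z zs))) \<and>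
    (\<forall>i<length bs. flux bs w (qs[i := Suc (qs ! i)]) = flux bs w qs - of_bool (i < Z))"
proof -
  obtain A where A: "\<And>m k c. (m, k, c) \<in> A \<Longrightarrow> m = 0 \<or> k = 0"
    and le: "\<And>w qs e. length w = M \<Longrightarrow> length qs = length bs \<Longrightarrow> e \<in> A \<Longrightarrow>
      flux bs w qs \<le> exit_value w qs e"
    and ex: "\<And>w qs. length w = M \<Longrightarrow> length qs = length bs \<Longrightarrow>
      \<exists>e\<in>A. flux bs w qs = exit_value w qs e"
    using flux_min_exits[OF assms(1)] by fastforce
  define x where "x = length bs"
  define K where "K = {min k x | m k c. (m, k, c) \<in> A \<and> flux bs w qs = exit_value w qs (m, k, c)}"
  have K: "finite K" "K \<noteq> {}"
  proof -
    have "K \<subseteq> {..x}" by (auto simp: K_def)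
    then show "finite K" by (rule finite_subset) auto
    show "K \<noteq> {}" using ex[OF assms(2,3)] by (fastforce simp: K_def)
  qed
  define Z where "Z = Max K"
  have take_min: "take k ys = take (min k x) ys" if "length ys = x" for k and ys :: "nat list"
    using that by (simp add: min_def)
  have lqs: "length qs = x" using assms by (simp add: x_def)
  obtain m k c where e: "(m, k, c) \<in> A" "flux bs w qs = exit_value w qs (m, k, c)" "min k x = Z"
    using Max_in[OF K] unfolding Z_def[symmetric] by (auto simp: K_def)
  show ?thesis
  proof (intro exI[of _ Z] conjI allI impI)
    fix zs :: "nat list" assume zs: "length zs = length bs"
    show "flux bs w (map2 (+) qs zs) \<le> flux bs w qs - int (sum_list (take Z zs))"
      using le[OF assms(2) _ e(1), of "map2 (+) qs zs"] e(2) zs lqs take_min[of zs k]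
        sum_list_take_map2_add[of qs zs k] by (simp add: e(3)[unfolded x_def] x_def)
  next
    fix i assume i: "i < length bs"
    define qs' where "qs' = qs[i := Suc (qs ! i)]"
    have qs': "length qs' = length bs" using assms by (simp add: qs'_def)
    have inc: "sum_list (take k qs') = sum_list (take k qs) + of_bool (i < k)" for k
      unfolding qs'_def using i assms by (intro sum_list_take_increment) simp
    have up: "flux bs w qs' \<le> flux bs w qs - of_bool (i < Z)"
      using le[OF assms(2) qs' e(1)] e(2,3) i by (cases "i < k") (auto simp: inc x_def)
    obtain m' k' c' where e': "(m', k', c') \<in> A" "flux bs w qs' = exit_value w qs' (m', k', c')"
      using ex[OF assms(2) qs'] by auto
    have le': "flux bs w qs \<le> exit_value w qs (m', k', c')"
      using le[OF assms(2,3) e'(1)] .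
    have "flux bs w qs' \<ge> flux bs w qs - of_bool (i < Z)"
    proof (cases "i < Z")
      case True
      then show ?thesis using e'(2) le' by (auto simp: inc)
    next
      case False
      show ?thesis
      proof (cases "i < k'")
        case True
        have "min k' x > Z" using True False i by (simp add: x_def)
        then have "min k' x \<notin> K" unfolding Z_def using Max_ge[OF K(1)] by fastforce
        then have "flux bs w qs \<noteq> exit_value w qs (m', k', c')"
          using e'(1) unfolding K_def by blast
        then show ?thesis using le' e'(2) by (auto simp: inc)
      next
        case False
        then show ?thesis using le' e'(2) by (auto simp: inc)
      qed
    qed
    with up show "flux bs w (qs[i := Suc (qs ! i)]) = flux bs w qs - of_bool (i < Z)"
      by (simp add: qs'_def)
  qed
qed

text \<open>Counterpart of \<open>flux_exit_site\<close> on the other boundary: \<open>Z\<close> is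
  now the latest exit through time among the minimisers.\<close>

lemma flux_exit_time:
  assumes "\<forall>b\<in>set bs. length b = M" "length w = M" "length qs = length bs"
  shows "\<exists>Z. (\<forall>w'. length w' = M \<longrightarrow>
      flux bs w' qs \<le> flux bs w qs - (int (trues (take Z w)) - int (trues (take Z w')))) \<and>
    (\<forall>i<M. w ! i \<longrightarrow> flux bs (w[i := False]) qs = flux bs w qs - of_bool (i < Z))"
proof -
  obtain A where A: "\<And>m k c. (m, k, c) \<in> A \<Longrightarrow> m = 0 \<or> k = 0"
    and le: "\<And>w qs e. length w = M \<Longrightarrow> length qs = length bs \<Longrightarrow> e \<in> A \<Longrightarrow>
      flux bs w qs \<le> exit_value w qs e"
    and ex: "\<And>w qs. length w = M \<Longrightarrow> length qs = length bs \<Longrightarrow>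
      \<exists>e\<in>A. flux bs w qs = exit_value w qs e"
    using flux_min_exits[OF assms(1)] by fastforce
  define K where "K = {min m M | m k c. (m, k, c) \<in> A \<and> flux bs w qs = exit_value w qs (m, k, c)}"
  have K: "finite K" "K \<noteq> {}"
  proof -
    have "K \<subseteq> {..M}" by (auto simp: K_def)
    then show "finite K" by (rule finite_subset) auto
    show "K \<noteq> {}" using ex[OF assms(2,3)] by (fastforce simp: K_def)
  qed
  define Z where "Z = Max K"
  have take_min: "take k ys = take (min k M) ys" if "length ys = M" for k and ys :: "bool list"
    using that by (simp add: min_def)
  obtain m k c where e: "(m, k, c) \<in> A" "flux bs w qs = exit_value w qs (m, k, c)" "min m M = Z"
    using Max_in[OF K] unfolding Z_def[symmetric] by (auto simp: K_def)
  have eZ: "take m w' = take Z w'" if "length w' = M" for w' :: "bool list"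
    using take_min[OF that, of m] e(3) by simp
  show ?thesis
  proof (intro exI[of _ Z] conjI allI impI)
    fix w' :: "bool list" assume w': "length w' = M"
    show "flux bs w' qs \<le> flux bs w qs - (int (trues (take Z w)) - int (trues (take Z w')))"
      using le[OF w' assms(3) e(1)] e(2) eZ[OF w'] eZ[OF assms(2)] by simp
  next
    fix i assume i: "i < M" "w ! i"
    define w' where "w' = w[i := False]"
    have w': "length w' = M" using assms by (simp add: w'_def)
    have dec: "int (trues (take k w')) = int (trues (take k w)) - of_bool (i < k)" for k
      unfolding w'_def using i assms by (intro trues_take_remove) auto
    have up: "flux bs w' qs \<le> flux bs w qs - of_bool (i < Z)"
      using le[OF w' assms(3) e(1)] e(2) eZ[OF w'] eZ[OF assms(2)] by (simp add: dec)
    obtain m' k' c' where e': "(m', k', c') \<in> A" "flux bs w' qs = exit_value w' qs (m', k', c')"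
      using ex[OF w' assms(3)] by auto
    have le': "flux bs w qs \<le> exit_value w qs (m', k', c')"
      using le[OF assms(2,3) e'(1)] .
    have "flux bs w' qs \<ge> flux bs w qs - of_bool (i < Z)"
    proof (cases "i < Z")
      case True
      then show ?thesis using e'(2) le' by (auto simp: dec)
    next
      case False
      show ?thesis
      proof (cases "i < m'")
        case True
        have "min m' M > Z" using True False i by simp
        then have "min m' M \<notin> K" unfolding Z_def using Max_ge[OF K(1)] by fastforce
        then have "flux bs w qs \<noteq> exit_value w qs (m', k', c')"
          using e'(1) unfolding K_def by blast
        then show ?thesis using le' e'(2) by (auto simp: dec)
      next
        case False
        then show ?thesis using le' e'(2) by (auto simp: dec)
      qed
    qed
    with up show "flux bs (w[i := False]) qs = flux bs w qs - of_bool (i < Z)"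
      by (simp add: w'_def)
  qed
qed

section \<open>Burke's theorem in discrete time\<close>

lemma pmf_bind_bernoulli:
  assumes "0 \<le> p" "p \<le> 1"
  shows "pmf (bind_pmf (bernoulli_pmf p) f) x = p * pmf (f True) x + (1 - p) * pmf (f False) x"
  using assms by (simp add: pmf_bind mult.commute)

text \<open>The hypothesis \<open>balance\<close> is detailed balance of the geometric weights
  between k and k + 1 customers. It gives more than stationarity: the departure has the law of the
  arrival and is independent of the customers left behind, which is one step of Burke's
  theorem.\<close>

lemma queue_step_stationary:
  assumes p: "0 < p" "p < 1" and a: "0 < a" "a < 1" and \<beta>: "0 < \<beta>" "\<beta> < 1"
    and balance: "\<beta> * (1 - a) * p = a * (1 - p)"
  shows "do {x \<leftarrow> bernoulli_pmf a; b \<leftarrow> bernoulli_pmf p; q \<leftarrow> geometric_pmf (1 - \<beta>);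
      return_pmf (q + of_bool x - of_bool (b \<and> (x \<or> 0 < q)), b \<and> (x \<or> 0 < q))} =
    pair_pmf (geometric_pmf (1 - \<beta>)) (bernoulli_pmf a)"
proof (rule pmf_eqI)
  fix y :: "nat \<times> bool"
  obtain k d where y: "y = (k, d)" by (cases y)
  let ?G = "geometric_pmf (1 - \<beta>)"
  let ?f = "\<lambda>x b q. (q + of_bool x - of_bool (b \<and> (x \<or> 0 < q)), b \<and> (x \<or> 0 < q)) :: nat \<times> bool"
  have vim: "?f True True -` {(k, d)} = (if d then {k} else {})"
    "?f True False -` {(k, d)} = (if d \<or> k = 0 then {} else {k - 1})"
    "?f False False -` {(k, d)} = (if d then {} else {k})"
    "?f False True -` {(k, d)} = (if d then {Suc k} else if k = 0 then {0} else {})"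
    unfolding vimage_def by (cases d; cases k; auto)+
  have G: "measure_pmf.prob ?G {j} = \<beta> ^ j * (1 - \<beta>)" for j
    using \<beta> by (simp add: measure_pmf_single)
  have "pmf (do {x \<leftarrow> bernoulli_pmf a; b \<leftarrow> bernoulli_pmf p; q \<leftarrow> ?G; return_pmf (?f x b q)}) y
      = pmf (do {x \<leftarrow> bernoulli_pmf a; b \<leftarrow> bernoulli_pmf p; map_pmf (?f x b) ?G}) (k, d)"
    by (simp add: y map_pmf_def)
  also have "\<dots> = a * (p * measure_pmf.prob ?G (if d then {k} else {})
        + (1 - p) * measure_pmf.prob ?G (if d \<or> k = 0 then {} else {k - 1}))
      + (1 - a) * (p * measure_pmf.prob ?G (if d then {Suc k} else if k = 0 then {0} else {})
        + (1 - p) * measure_pmf.prob ?G (if d then {} else {k}))"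
    using p a by (simp only: pmf_bind_bernoulli less_imp_le pmf_map vim)
  also have "\<dots> = \<beta> ^ k * (1 - \<beta>) * (if d then a else 1 - a)"
  proof (cases d)
    case True
    have "a * (p * (\<beta> ^ k * (1 - \<beta>))) + (1 - a) * (p * (\<beta> ^ Suc k * (1 - \<beta>)))
        = \<beta> ^ k * (1 - \<beta>) * (a * p + \<beta> * (1 - a) * p)"
      by (simp add: algebra_simps)
    also have "\<dots> = \<beta> ^ k * (1 - \<beta>) * a"
      unfolding balance by (simp add: algebra_simps)
    finally show ?thesis using True by (simp add: G del: power_Suc)
  next
    case False
    show ?thesis
    proof (cases k)
      case 0
      then show ?thesis using False by (simp add: G algebra_simps)
    next
      case (Suc j)
      have "a * ((1 - p) * (\<beta> ^ j * (1 - \<beta>))) + (1 - a) * ((1 - p) * (\<beta> ^ Suc j * (1 - \<beta>)))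
        = \<beta> ^ j * (1 - \<beta>) * (a * (1 - p)) + (1 - a) * ((1 - p) * (\<beta> ^ Suc j * (1 - \<beta>)))"
        by (simp add: algebra_simps)
      also have "\<dots> = \<beta> ^ Suc j * (1 - \<beta>) * (1 - a)"
        unfolding balance[symmetric] by (simp add: algebra_simps)
      finally show ?thesis using False Suc by (simp add: G del: power_Suc)
    qed
  qed
  also have "\<dots> = pmf (pair_pmf ?G (bernoulli_pmf a)) y"
    using a \<beta> by (simp add: y pmf_pair)
  finally show "pmf (do {x \<leftarrow> bernoulli_pmf a; b \<leftarrow> bernoulli_pmf p; q \<leftarrow> ?G;
      return_pmf (?f x b q)}) y = pmf (pair_pmf ?G (bernoulli_pmf a)) y" .
qed

text \<open>After the first step the departure bit is independent of the new content, so the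
  remaining steps start afresh from the stationary law. The commutations only gather the variables
  of the first step at the front.\<close>

lemma column_stationary:
  assumes "0 < p" "p < 1" "0 < a" "a < 1" "0 < \<beta>" "\<beta> < 1" "\<beta> * (1 - a) * p = a * (1 - p)"
  shows "do {bs \<leftarrow> replicate_pmf M (bernoulli_pmf p); q \<leftarrow> geometric_pmf (1 - \<beta>);
      as \<leftarrow> replicate_pmf M (bernoulli_pmf a); return_pmf (column q as bs)} =
    pair_pmf (geometric_pmf (1 - \<beta>)) (replicate_pmf M (bernoulli_pmf a))"
proof (induction M)
  case 0
  show ?case by (simp add: bind_return_pmf pair_pmf_def)
next
  case (Suc M)
  let ?G = "geometric_pmf (1 - \<beta>)" and ?A = "bernoulli_pmf a" and ?B = "bernoulli_pmf p"
  let ?As = "replicate_pmf M ?A" and ?Bs = "replicate_pmf M ?B"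
  have "do {bs \<leftarrow> replicate_pmf (Suc M) ?B; q \<leftarrow> ?G; as \<leftarrow> replicate_pmf (Suc M) ?A;
        return_pmf (column q as bs)}
    = do {b \<leftarrow> ?B; bs \<leftarrow> ?Bs; q \<leftarrow> ?G; x \<leftarrow> ?A; as \<leftarrow> ?As; return_pmf (column q (x # as) (b # bs))}"
    by (simp add: bind_assoc_pmf bind_return_pmf)
  also have "\<dots> = do {b \<leftarrow> ?B; q \<leftarrow> ?G; bs \<leftarrow> ?Bs; x \<leftarrow> ?A; as \<leftarrow> ?As;
        return_pmf (column q (x # as) (b # bs))}"
    by (subst bind_commute_pmf[of ?Bs]) simp
  also have "\<dots> = do {b \<leftarrow> ?B; q \<leftarrow> ?G; x \<leftarrow> ?A; bs \<leftarrow> ?Bs; as \<leftarrow> ?As;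
        return_pmf (column q (x # as) (b # bs))}"
    by (subst bind_commute_pmf[of ?Bs]) simp
  also have "\<dots> = do {b \<leftarrow> ?B; x \<leftarrow> ?A; q \<leftarrow> ?G; bs \<leftarrow> ?Bs; as \<leftarrow> ?As;
        return_pmf (column q (x # as) (b # bs))}"
    by (subst bind_commute_pmf[of ?G]) simp
  also have "\<dots> = do {x \<leftarrow> ?A; b \<leftarrow> ?B; q \<leftarrow> ?G; bs \<leftarrow> ?Bs; as \<leftarrow> ?As;
        return_pmf (column q (x # as) (b # bs))}"
    by (subst bind_commute_pmf[of ?B]) simp
  also have "\<dots> = do {y \<leftarrow> do {x \<leftarrow> ?A; b \<leftarrow> ?B; q \<leftarrow> ?G;
        return_pmf (q + of_bool x - of_bool (b \<and> (x \<or> 0 < q)), b \<and> (x \<or> 0 < q))};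
      bs \<leftarrow> ?Bs; as \<leftarrow> ?As;
      r \<leftarrow> return_pmf (column (fst y) as bs); return_pmf (fst r, snd y # snd r)}"
    by (simp add: bind_assoc_pmf bind_return_pmf Let_def)
  also have "\<dots> = do {y \<leftarrow> pair_pmf ?G ?A; bs \<leftarrow> ?Bs; as \<leftarrow> ?As;
      r \<leftarrow> return_pmf (column (fst y) as bs); return_pmf (fst r, snd y # snd r)}"
    by (subst queue_step_stationary) (use assms in auto)
  also have "\<dots> = do {q \<leftarrow> ?G; d \<leftarrow> ?A; bs \<leftarrow> ?Bs; as \<leftarrow> ?As;
      r \<leftarrow> return_pmf (column q as bs); return_pmf (fst r, d # snd r)}"
    by (simp add: pair_pmf_def bind_assoc_pmf bind_return_pmf)
  also have "\<dots> = do {d \<leftarrow> ?A; q \<leftarrow> ?G; bs \<leftarrow> ?Bs; as \<leftarrow> ?As;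
      r \<leftarrow> return_pmf (column q as bs); return_pmf (fst r, d # snd r)}"
    by (subst bind_commute_pmf[of ?G]) simp
  also have "\<dots> = do {d \<leftarrow> ?A; bs \<leftarrow> ?Bs; q \<leftarrow> ?G; as \<leftarrow> ?As;
      r \<leftarrow> return_pmf (column q as bs); return_pmf (fst r, d # snd r)}"
    by (subst bind_commute_pmf[of ?G]) simp
  also have "\<dots> = do {d \<leftarrow> ?A; r \<leftarrow> do {bs \<leftarrow> ?Bs; q \<leftarrow> ?G; as \<leftarrow> ?As; return_pmf (column q as bs)};
      return_pmf (fst r, d # snd r)}"
    by (simp add: bind_assoc_pmf)
  also have "\<dots> = do {d \<leftarrow> ?A; q \<leftarrow> ?G; ds \<leftarrow> ?As; return_pmf (q, d # ds)}"
    unfolding Suc by (simp add: pair_pmf_def bind_assoc_pmf bind_return_pmf)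
  also have "\<dots> = do {q \<leftarrow> ?G; d \<leftarrow> ?A; ds \<leftarrow> ?As; return_pmf (q, d # ds)}"
    by (subst bind_commute_pmf[of ?G]) simp
  also have "\<dots> = pair_pmf ?G (replicate_pmf (Suc M) ?A)"
    by (simp add: pair_pmf_def bind_assoc_pmf bind_return_pmf)
  finally show ?case .
qed

text \<open>The departures of the first queue are again Bernoulli and independent of what it finally
  holds, hence they feed the next queue exactly as the original arrivals did.\<close>

lemma tandem_stationary:
  assumes "0 < p" "p < 1" "0 < a" "a < 1" "0 < \<beta>" "\<beta> < 1" "\<beta> * (1 - a) * p = a * (1 - p)"
  shows "do {bs \<leftarrow> replicate_pmf x (replicate_pmf M (bernoulli_pmf p));
      qs \<leftarrow> replicate_pmf x (geometric_pmf (1 - \<beta>));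
      w \<leftarrow> replicate_pmf M (bernoulli_pmf a); return_pmf (tandem qs bs w)} =
    pair_pmf (replicate_pmf x (geometric_pmf (1 - \<beta>))) (replicate_pmf M (bernoulli_pmf a))"
proof (induction x)
  case 0
  show ?case by (simp add: bind_return_pmf pair_pmf_def)
next
  case (Suc x)
  let ?G = "geometric_pmf (1 - \<beta>)"
  let ?W = "replicate_pmf M (bernoulli_pmf a)" and ?B = "replicate_pmf M (bernoulli_pmf p)"
  let ?Gs = "replicate_pmf x ?G" and ?Bs = "replicate_pmf x ?B"
  have "do {bs \<leftarrow> replicate_pmf (Suc x) ?B; qs \<leftarrow> replicate_pmf (Suc x) ?G; w \<leftarrow> ?W;
        return_pmf (tandem qs bs w)}
    = do {b \<leftarrow> ?B; bs \<leftarrow> ?Bs; q \<leftarrow> ?G; qs \<leftarrow> ?Gs; w \<leftarrow> ?W; return_pmf (tandem (q # qs) (b # bs) w)}"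
    by (simp add: bind_assoc_pmf bind_return_pmf)
  also have "\<dots> = do {b \<leftarrow> ?B; q \<leftarrow> ?G; bs \<leftarrow> ?Bs; qs \<leftarrow> ?Gs; w \<leftarrow> ?W;
        return_pmf (tandem (q # qs) (b # bs) w)}"
    by (subst bind_commute_pmf[of ?Bs]) simp
  also have "\<dots> = do {b \<leftarrow> ?B; q \<leftarrow> ?G; bs \<leftarrow> ?Bs; w \<leftarrow> ?W; qs \<leftarrow> ?Gs;
        return_pmf (tandem (q # qs) (b # bs) w)}"
    by (subst bind_commute_pmf[of ?Gs]) simp
  also have "\<dots> = do {b \<leftarrow> ?B; q \<leftarrow> ?G; w \<leftarrow> ?W; bs \<leftarrow> ?Bs; qs \<leftarrow> ?Gs;
        return_pmf (tandem (q # qs) (b # bs) w)}"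
    by (subst bind_commute_pmf[of ?Bs]) simp
  also have "\<dots> = do {y \<leftarrow> do {b \<leftarrow> ?B; q \<leftarrow> ?G; w \<leftarrow> ?W; return_pmf (column q w b)};
      bs \<leftarrow> ?Bs; qs \<leftarrow> ?Gs;
      r \<leftarrow> return_pmf (tandem qs bs (snd y)); return_pmf (fst y # fst r, snd r)}"
    by (simp add: bind_assoc_pmf bind_return_pmf Let_def)
  also have "\<dots> = do {y \<leftarrow> pair_pmf ?G ?W; bs \<leftarrow> ?Bs; qs \<leftarrow> ?Gs;
      r \<leftarrow> return_pmf (tandem qs bs (snd y)); return_pmf (fst y # fst r, snd r)}"
    by (subst column_stationary) (use assms in auto)
  also have "\<dots> = do {q \<leftarrow> ?G; w \<leftarrow> ?W; bs \<leftarrow> ?Bs; qs \<leftarrow> ?Gs;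
      r \<leftarrow> return_pmf (tandem qs bs w); return_pmf (q # fst r, snd r)}"
    by (simp add: pair_pmf_def bind_assoc_pmf bind_return_pmf)
  also have "\<dots> = do {q \<leftarrow> ?G; bs \<leftarrow> ?Bs; w \<leftarrow> ?W; qs \<leftarrow> ?Gs;
      r \<leftarrow> return_pmf (tandem qs bs w); return_pmf (q # fst r, snd r)}"
    by (subst bind_commute_pmf[of ?W]) simp
  also have "\<dots> = do {q \<leftarrow> ?G; bs \<leftarrow> ?Bs; qs \<leftarrow> ?Gs; w \<leftarrow> ?W;
      r \<leftarrow> return_pmf (tandem qs bs w); return_pmf (q # fst r, snd r)}"
    by (subst bind_commute_pmf[of ?W]) simp
  also have "\<dots> = do {q \<leftarrow> ?G; r \<leftarrow> do {bs \<leftarrow> ?Bs; qs \<leftarrow> ?Gs; w \<leftarrow> ?W; return_pmf (tandem qs bs w)};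
      return_pmf (q # fst r, snd r)}"
    by (simp add: bind_assoc_pmf)
  also have "\<dots> = pair_pmf (replicate_pmf (Suc x) ?G) ?W"
    unfolding Suc by (simp add: pair_pmf_def bind_assoc_pmf bind_return_pmf)
  finally show ?case .
qed

section \<open>Exponential moments of the flux\<close>

lemma nn_integral_pmf_cong:
  assumes "\<And>x. x \<in> set_pmf p \<Longrightarrow> f x = g x"
  shows "(\<integral>\<^sup>+x. f x \<partial>measure_pmf p) = (\<integral>\<^sup>+x. g x \<partial>measure_pmf p)"
  using assms by (intro nn_integral_cong_AE) (simp add: AE_measure_pmf_iff)

lemma nn_integral_pmf_mono:
  assumes "\<And>x. x \<in> set_pmf p \<Longrightarrow> f x \<le> g x"
  shows "(\<integral>\<^sup>+x. f x \<partial>measure_pmf p) \<le> (\<integral>\<^sup>+x. g x \<partial>measure_pmf p)"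
  using assms by (intro nn_integral_mono_AE) (simp add: AE_measure_pmf_iff)

lemma nn_integral_pmf_commute:
  "(\<integral>\<^sup>+x. \<integral>\<^sup>+y. f x y \<partial>measure_pmf q \<partial>measure_pmf p) =
   (\<integral>\<^sup>+y. \<integral>\<^sup>+x. f x y \<partial>measure_pmf p \<partial>measure_pmf q)"
proof -
  have "(\<integral>\<^sup>+z. (case z of (x, y) \<Rightarrow> f x y) \<partial>bind_pmf p (\<lambda>x. bind_pmf q (\<lambda>y. return_pmf (x, y)))) =
    (\<integral>\<^sup>+z. (case z of (x, y) \<Rightarrow> f x y) \<partial>bind_pmf q (\<lambda>y. bind_pmf p (\<lambda>x. return_pmf (x, y))))"
    by (subst bind_commute_pmf) simp
  then show ?thesis by simp
qed

lemma nn_integral_bernoulli: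
  assumes "0 \<le> p" "p \<le> 1"
  shows "(\<integral>\<^sup>+x. f x \<partial>bernoulli_pmf p) = ennreal p * f True + ennreal (1 - p) * f False"
  using assms by (simp add: nn_integral_bernoulli_pmf mult.commute)

lemma set_pmf_replicate_length: "xs \<in> set_pmf (replicate_pmf n p) \<Longrightarrow> length xs = n"
  by (simp add: set_replicate_pmf)

text \<open>A change of measure by exponential tilting: every success contributes the factor r c to
  the density and every failure the factor c.\<close>

lemma nn_integral_bernoulli_list_density:
  assumes "0 < a" "a < 1" "0 < a'" "a' < 1" "0 < r" "0 < c" "a' = a * r * c" "1 - a' = (1 - a) * c"
  shows "(\<integral>\<^sup>+w. g w \<partial>replicate_pmf M (bernoulli_pmf a')) =
    (\<integral>\<^sup>+w. ennreal (r ^ trues w * c ^ M) * g w \<partial>replicate_pmf M (bernoulli_pmf a))"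
proof (induction M arbitrary: g)
  case 0
  show ?case by simp
next
  case (Suc M)
  let ?W = "replicate_pmf M (bernoulli_pmf a)"
  have "(\<integral>\<^sup>+w. g w \<partial>replicate_pmf (Suc M) (bernoulli_pmf a')) =
    ennreal a' * (\<integral>\<^sup>+w. ennreal (r ^ trues w * c ^ M) * g (True # w) \<partial>?W) +
    ennreal (1 - a') * (\<integral>\<^sup>+w. ennreal (r ^ trues w * c ^ M) * g (False # w) \<partial>?W)"
    using assms(1-4) by (simp add: nn_integral_bernoulli Suc mult.commute)
  also have "\<dots> = ennreal a * (\<integral>\<^sup>+w. ennreal (r ^ Suc (trues w) * c ^ Suc M) * g (True # w) \<partial>?W) +
    ennreal (1 - a) * (\<integral>\<^sup>+w. ennreal (r ^ trues w * c ^ Suc M) * g (False # w) \<partial>?W)"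
  proof -
    have "ennreal a' * (\<integral>\<^sup>+w. ennreal (r ^ trues w * c ^ M) * g (True # w) \<partial>?W)
      = ennreal a * (\<integral>\<^sup>+w. ennreal (r * c) * (ennreal (r ^ trues w * c ^ M) * g (True # w)) \<partial>?W)"
      using assms by (subst nn_integral_cmult)
        (auto simp: ennreal_mult mult.assoc intro!: mult_nonneg_nonneg)
    moreover have "ennreal (1 - a') * (\<integral>\<^sup>+w. ennreal (r ^ trues w * c ^ M) * g (False # w) \<partial>?W)
      = ennreal (1 - a) * (\<integral>\<^sup>+w. ennreal c * (ennreal (r ^ trues w * c ^ M) * g (False # w)) \<partial>?W)"
      using assms by (subst nn_integral_cmult) (auto simp: ennreal_mult mult.assoc)
    ultimately show ?thesis
      using assms by (simp add: ennreal_mult mult_ac)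
  qed
  also have "\<dots> = (\<integral>\<^sup>+w. ennreal (r ^ trues w * c ^ Suc M) * g w \<partial>replicate_pmf (Suc M) (bernoulli_pmf a))"
    using assms(1,2) by (simp add: nn_integral_bernoulli mult.commute)
  finally show ?case .
qed

text \<open>Geometric weights proportional to \<open>exp (- v * k)\<close>, parametrised so that
  shifts of v are exponential tilts.\<close>

definition geo :: "real \<Rightarrow> nat pmf" where
  "geo v = geometric_pmf (1 - exp (- v))"

text \<open>The odds are those of p multiplied by \<open>exp (- u)\<close>. This is the arrival
  probability that is in balance with geometric weights of ratio \<open>exp (- u)\<close>, as stated
  in \<open>arr_balance\<close>.\<close>

definition arr :: "real \<Rightarrow> real \<Rightarrow> real" where
  "arr p u = p * exp (- u) / (1 - p + p * exp (- u))"

lemma arr_bounds: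
  assumes "0 < p" "p < 1"
  shows "0 < arr p u" "arr p u < 1"
proof -
  have "0 < p * exp (- u)" "0 < 1 - p" using assms by auto
  then show "0 < arr p u" "arr p u < 1"
    unfolding arr_def by (auto simp: field_simps)
qed

lemma arr_balance:
  assumes "0 < p" "p < 1"
  shows "exp (- u) * (1 - arr p u) * p = arr p u * (1 - p)"
proof -
  have "0 < p * exp (- u)" "0 < 1 - p" using assms by auto
  then have "1 - p + p * exp (- u) \<noteq> 0" by linarith
  then show ?thesis
    unfolding arr_def by (simp add: field_simps)
qed

lemma nn_integral_geo_unfold:
  assumes "0 < v"
  shows "(\<integral>\<^sup>+q. f q \<partial>geo v) =
    ennreal (1 - exp (- v)) * f 0 + ennreal (exp (- v)) * (\<integral>\<^sup>+q. f (Suc q) \<partial>geo v)"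
proof -
  have "1 - exp (- v) \<in> {0<..1}" using assms by auto
  then have "geo v = bind_pmf (bernoulli_pmf (1 - exp (- v)))
      (\<lambda>b. if b then return_pmf 0 else map_pmf Suc (geo v))"
    unfolding geo_def by (rule geometric_bind_pmf_unfold)
  then have "(\<integral>\<^sup>+q. f q \<partial>geo v) = (\<integral>\<^sup>+q. f q \<partial>bind_pmf (bernoulli_pmf (1 - exp (- v)))
      (\<lambda>b. if b then return_pmf 0 else map_pmf Suc (geo v)))"
    by simp
  also have "\<dots> = ennreal (1 - exp (- v)) * f 0 + ennreal (exp (- v)) * (\<integral>\<^sup>+q. f (Suc q) \<partial>geo v)"
    using assms by (simp only: nn_integral_bind_pmf) (simp add: nn_integral_bernoulli mult.commute)
  finally show ?thesis .
qed

lemma nn_integral_geo_exp: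
  assumes "t < v" "0 < v"
  shows "(\<integral>\<^sup>+q. ennreal (exp (t * real q)) \<partial>geo v) =
    ennreal ((1 - exp (- v)) / (1 - exp (t - v)))"
proof -
  have lt: "exp (t - v) < 1" using assms by simp
  have "(\<integral>\<^sup>+q. ennreal (exp (t * real q)) \<partial>geo v) =
    (\<Sum>q. ennreal ((1 - exp (- v)) * exp (t - v) ^ q))"
    unfolding geo_def nn_integral_measure_pmf nn_integral_count_space_nat using assms
    by (intro suminf_cong)
      (auto simp flip: ennreal_mult' simp: exp_of_nat_mult[symmetric] mult_exp_exp algebra_simps)
  also have "\<dots> = ennreal (\<Sum>q. (1 - exp (- v)) * exp (t - v) ^ q)"
    using assms lt by (intro suminf_ennreal2 summable_mult summable_geometric) auto
  also have "(\<Sum>q. (1 - exp (- v)) * exp (t - v) ^ q) = (1 - exp (- v)) * (1 / (1 - exp (t - v)))"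
    using lt by (subst suminf_mult) (auto simp: suminf_geometric summable_geometric)
  finally show ?thesis by simp
qed

lemma nn_integral_geo_list_exp:
  assumes "t < v" "0 < v"
  shows "(\<integral>\<^sup>+qs. ennreal (exp (t * real (sum_list qs))) \<partial>replicate_pmf x (geo v)) =
    ennreal (((1 - exp (- v)) / (1 - exp (t - v))) ^ x)"
proof (induction x)
  case (Suc x)
  have "(\<integral>\<^sup>+qs. ennreal (exp (t * real (sum_list qs))) \<partial>replicate_pmf (Suc x) (geo v)) =
    (\<integral>\<^sup>+q. ennreal (exp (t * real q)) *
      (\<integral>\<^sup>+qs. ennreal (exp (t * real (sum_list qs))) \<partial>replicate_pmf x (geo v)) \<partial>geo v)"
    by (simp add: distrib_left exp_add ennreal_mult nn_integral_cmult)
  also have "\<dots> = ennreal ((1 - exp (- v)) / (1 - exp (t - v))) *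
      ennreal (((1 - exp (- v)) / (1 - exp (t - v))) ^ x)"
    by (simp add: Suc nn_integral_multc nn_integral_geo_exp assms)
  also have "\<dots> = ennreal (((1 - exp (- v)) / (1 - exp (t - v))) ^ Suc x)"
    using assms by (subst ennreal_mult[symmetric]) auto
  finally show ?case .
qed simp

text \<open>
  Clocks, initial occupations and arrivals. The fugacity \<open>u\<close> of the arrivals may differ from the
  fugacity \<open>v\<close> of the sites, the stationary case being \<open>u = v\<close>.
\<close>

definition model :: "nat \<Rightarrow> nat \<Rightarrow> real \<Rightarrow> real \<Rightarrow> real \<Rightarrow> (bool list list \<times> nat list \<times> bool list) pmf" where
  "model x M p u v = pair_pmf (replicate_pmf x (replicate_pmf M (bernoulli_pmf p)))
     (pair_pmf (replicate_pmf x (geo v)) (replicate_pmf M (bernoulli_pmf (arr p u))))"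

lemma model_stationary:
  assumes "0 < p" "p < 1" "0 < u"
  shows "map_pmf (\<lambda>(bs, qs, w). tandem qs bs w) (model x M p u u) =
    pair_pmf (replicate_pmf x (geo u)) (replicate_pmf M (bernoulli_pmf (arr p u)))"
proof -
  have "map_pmf (\<lambda>(bs, qs, w). tandem qs bs w) (model x M p u u) =
    do {bs \<leftarrow> replicate_pmf x (replicate_pmf M (bernoulli_pmf p));
      qs \<leftarrow> replicate_pmf x (geometric_pmf (1 - exp (- u)));
      w \<leftarrow> replicate_pmf M (bernoulli_pmf (arr p u)); return_pmf (tandem qs bs w)}"
    by (simp add: model_def pair_pmf_def map_bind_pmf bind_assoc_pmf bind_return_pmf geo_def)
  also have "\<dots> = pair_pmf (replicate_pmf x (geometric_pmf (1 - exp (- u))))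
      (replicate_pmf M (bernoulli_pmf (arr p u)))"
    using assms arr_bounds[of p u] arr_balance[of p u] by (intro tandem_stationary) auto
  finally show ?thesis by (simp add: geo_def)
qed

lemma set_pmf_model:
  assumes "(bs, qs, w) \<in> set_pmf (model x M p u v)"
  shows "length bs = x" "\<forall>b\<in>set bs. length b = M" "length qs = x" "length w = M"
  using assms by (auto simp: model_def set_replicate_pmf in_lists_conv_set)

lemma nn_integral_model:
  "(\<integral>\<^sup>+z. f z \<partial>model x M p u v) =
   (\<integral>\<^sup>+bs. \<integral>\<^sup>+qs. \<integral>\<^sup>+w. f (bs, qs, w) \<partial>replicate_pmf M (bernoulli_pmf (arr p u))
     \<partial>replicate_pmf x (geo v) \<partial>replicate_pmf x (replicate_pmf M (bernoulli_pmf p)))"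
  by (simp add: model_def nn_integral_pair_pmf')

text \<open>The logarithm of the partition function of the arrivals minus that of the sites. Its
  derivative in u is minus the stationary mean of the flux.\<close>

definition log_partition :: "nat \<Rightarrow> nat \<Rightarrow> real \<Rightarrow> real \<Rightarrow> real" where
  "log_partition x M p u = real x * ln (1 - exp (- u)) + real M * ln (1 - p + p * exp (- u))"

abbreviation fl :: "bool list list \<times> nat list \<times> bool list \<Rightarrow> real" where
  "fl z \<equiv> (case z of (bs, qs, w) \<Rightarrow> real_of_int (flux bs w qs))"

text \<open>The tilt changes the fugacity of the arrivals from u to v: with the flux written as
  arrivals minus final particles, the density cancels the arrivals. What is left is an exponential
  of the final particles under the stationary law of fugacity v, where they are again independent
  and geometric.\<close>

lemma nn_integral_exp_flux:
  assumes p: "0 < p" "p < 1" and uv: "0 < u" "0 < v"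
  shows "(\<integral>\<^sup>+z. ennreal (exp ((u - v) * fl z)) \<partial>model x M p u v) =
    ennreal (exp (log_partition x M p v - log_partition x M p u))"
proof -
  define r where "r = exp (v - u)"
  define c where "c = (1 - p + p * exp (- v)) / (1 - p + p * exp (- u))"
  have pos: "0 < 1 - p + p * exp (- u)" "0 < 1 - p + p * exp (- v)"
    using p by (auto intro!: add_pos_pos)
  have rc: "0 < r" "0 < c" using pos by (auto simp: r_def c_def)
  have ru: "exp (- v) * r = exp (- u)"
    by (simp add: r_def mult_exp_exp)
  have "arr p u = p * (exp (- v) * r) / (1 - p + p * exp (- u))"
    by (simp add: ru arr_def)
  also have "\<dots> = arr p v * r * c"
    using pos by (simp add: arr_def c_def)
  finally have arr1: "arr p u = arr p v * r * c" .
  have 1: "1 - arr p w = (1 - p) / (1 - p + p * exp (- w))" if "0 < 1 - p + p * exp (- w)" for w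
    using that by (simp add: arr_def field_simps)
  have arr2: "1 - arr p u = (1 - arr p v) * c"
    unfolding 1[OF pos(1)] 1[OF pos(2)] using pos by (simp add: c_def)
  have "(\<integral>\<^sup>+z. ennreal (exp ((u - v) * fl z)) \<partial>model x M p u v) =
    (\<integral>\<^sup>+z. ennreal (case z of (bs, qs, w) \<Rightarrow> r ^ trues w * c ^ M) * ennreal (exp ((u - v) * fl z)) \<partial>model x M p v v)"
    unfolding nn_integral_model using p uv rc
    by (subst nn_integral_bernoulli_list_density[OF _ _ _ _ rc arr1 arr2]) (auto simp: arr_bounds)
  also have "\<dots> = (\<integral>\<^sup>+z. ennreal (c ^ M) *
      ennreal (exp ((v - u) * real (sum_list (fst (case z of (bs, qs, w) \<Rightarrow> tandem qs bs w)))))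
      \<partial>model x M p v v)"
  proof (rule nn_integral_pmf_cong)
    fix z assume z: "z \<in> set_pmf (model x M p v v)"
    obtain bs qs w where zz: "z = (bs, qs, w)" by (cases z)
    have l: "length qs = length bs" "\<forall>b\<in>set bs. length b = length w"
      using set_pmf_model[OF z[unfolded zz]] by auto
    have "r ^ trues w * exp ((u - v) * real_of_int (flux bs w qs)) =
      exp ((v - u) * real (sum_list (fst (tandem qs bs w))))"
      unfolding flux_eq[OF l] r_def
      by (simp add: exp_of_nat_mult[symmetric] mult_exp_exp algebra_simps)
    then have e: "r ^ trues w * c ^ M * exp ((u - v) * real_of_int (flux bs w qs)) =
      c ^ M * exp ((v - u) * real (sum_list (fst (tandem qs bs w))))"
      by (simp add: algebra_simps)
    show "ennreal (case z of (bs, qs, w) \<Rightarrow> r ^ trues w * c ^ M) * ennreal (exp ((u - v) * fl z))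
      = ennreal (c ^ M) *
        ennreal (exp ((v - u) * real (sum_list (fst (case z of (bs, qs, w) \<Rightarrow> tandem qs bs w)))))"
      using rc e by (simp add: zz ennreal_mult'[symmetric])
  qed
  also have "\<dots> = ennreal (c ^ M) * (\<integral>\<^sup>+r. ennreal (exp ((v - u) * real (sum_list (fst r))))
      \<partial>map_pmf (\<lambda>(bs, qs, w). tandem qs bs w) (model x M p v v))"
    by (simp add: nn_integral_cmult)
  also have "\<dots> = ennreal (c ^ M) * (\<integral>\<^sup>+qs. ennreal (exp ((v - u) * real (sum_list qs)))
      \<partial>replicate_pmf x (geo v))"
    unfolding model_stationary[OF p uv(2)] by (simp add: nn_integral_pair_pmf')
  also have "\<dots> = ennreal (c ^ M * ((1 - exp (- v)) / (1 - exp (- u))) ^ x)"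
    using nn_integral_geo_list_exp[of "v - u" v x] uv rc by (simp add: ennreal_mult')
  also have "c ^ M * ((1 - exp (- v)) / (1 - exp (- u))) ^ x =
    exp (log_partition x M p v - log_partition x M p u)"
  proof -
    have "exp (log_partition x M p w) = (1 - exp (- w)) ^ x * (1 - p + p * exp (- w)) ^ M"
      if "0 < w" "0 < 1 - p + p * exp (- w)" for w
      using that by (simp add: log_partition_def exp_add exp_of_nat_mult)
    then show ?thesis
      using pos uv by (simp add: exp_diff c_def power_divide mult.commute)
  qed
  finally show ?thesis .
qed

text \<open>\<open>flux_ge_min\<close> is integrated against independent copies of both boundaries;
  the decreasing exponential of a minimum is at most the sum of the two exponentials.\<close>

lemma nn_integral_exp_neg_flux_le:
  assumes "0 \<le> s"
  shows "(\<integral>\<^sup>+z. ennreal (exp (- s * fl z)) \<partial>model x M p u v) \<le>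
    (\<integral>\<^sup>+z. ennreal (exp (- s * fl z)) \<partial>model x M p u v') +
    (\<integral>\<^sup>+z. ennreal (exp (- s * fl z)) \<partial>model x M p u' v)"
proof -
  let ?B = "replicate_pmf x (replicate_pmf M (bernoulli_pmf p))"
  let ?Q = "replicate_pmf x (geo v)" and ?Q' = "replicate_pmf x (geo v')"
  let ?W = "replicate_pmf M (bernoulli_pmf (arr p u))" and ?W' = "replicate_pmf M (bernoulli_pmf (arr p u'))"
  let ?e = "\<lambda>bs qs w. ennreal (exp (- s * fl (bs, qs, w)))"
  have "(\<integral>\<^sup>+z. ennreal (exp (- s * fl z)) \<partial>model x M p u v) =
    (\<integral>\<^sup>+bs. \<integral>\<^sup>+qs. \<integral>\<^sup>+w. \<integral>\<^sup>+qs'. \<integral>\<^sup>+w'. ?e bs qs w \<partial>?W' \<partial>?Q' \<partial>?W \<partial>?Q \<partial>?B)"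
    by (simp add: nn_integral_model)
  also have "\<dots> \<le> (\<integral>\<^sup>+bs. \<integral>\<^sup>+qs. \<integral>\<^sup>+w. \<integral>\<^sup>+qs'. \<integral>\<^sup>+w'. ?e bs qs' w + ?e bs qs w'
      \<partial>?W' \<partial>?Q' \<partial>?W \<partial>?Q \<partial>?B)"
  proof (intro nn_integral_pmf_mono)
    fix bs qs w qs' w'
    assume "bs \<in> set_pmf ?B" "qs \<in> set_pmf ?Q" "w \<in> set_pmf ?W" "qs' \<in> set_pmf ?Q'" "w' \<in> set_pmf ?W'"
    then have "min (flux bs w qs') (flux bs w' qs) \<le> flux bs w qs"
      by (intro flux_ge_min[of _ M]) (auto simp: set_replicate_pmf in_lists_conv_set)
    then have "exp (- s * fl (bs, qs, w)) \<le> exp (- s * fl (bs, qs', w)) \<or>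
        exp (- s * fl (bs, qs, w)) \<le> exp (- s * fl (bs, qs, w'))"
      using assms by (auto simp: min_le_iff_disj intro!: mult_left_mono)
    then have "exp (- s * fl (bs, qs, w)) \<le> exp (- s * fl (bs, qs', w)) + exp (- s * fl (bs, qs, w'))"
      by (smt (verit) exp_gt_zero)
    then show "?e bs qs w \<le> ?e bs qs' w + ?e bs qs w'"
      by (simp flip: ennreal_plus)
  qed
  also have "\<dots> = (\<integral>\<^sup>+bs. \<integral>\<^sup>+w. \<integral>\<^sup>+qs'. ?e bs qs' w \<partial>?Q' \<partial>?W \<partial>?B) +
      (\<integral>\<^sup>+bs. \<integral>\<^sup>+qs. \<integral>\<^sup>+w'. ?e bs qs w' \<partial>?W' \<partial>?Q \<partial>?B)"
    by (simp add: nn_integral_add)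
  also have "(\<integral>\<^sup>+bs. \<integral>\<^sup>+w. \<integral>\<^sup>+qs'. ?e bs qs' w \<partial>?Q' \<partial>?W \<partial>?B) =
      (\<integral>\<^sup>+bs. \<integral>\<^sup>+qs'. \<integral>\<^sup>+w. ?e bs qs' w \<partial>?W \<partial>?Q' \<partial>?B)"
    by (subst nn_integral_pmf_commute) simp
  finally show ?thesis by (simp add: nn_integral_model)
qed

text \<open>The replacements \<open>u + s\<close> for v and \<open>v - s\<close> for u are those for
  which the tilt s equals the difference of the two fugacities, so that
  \<open>nn_integral_exp_flux\<close> evaluates both terms.\<close>

lemma nn_integral_exp_neg_flux_bound:
  assumes p: "0 < p" "p < 1" and "0 < u" "0 < s" "s < v"
  shows "(\<integral>\<^sup>+z. ennreal (exp (- s * fl z)) \<partial>model x M p u v) \<le>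
    ennreal (exp (log_partition x M p (u + s) - log_partition x M p u) +
      exp (log_partition x M p v - log_partition x M p (v - s)))"
proof -
  have "(\<integral>\<^sup>+z. ennreal (exp (- s * fl z)) \<partial>model x M p u v) \<le>
    (\<integral>\<^sup>+z. ennreal (exp ((u - (u + s)) * fl z)) \<partial>model x M p u (u + s)) +
    (\<integral>\<^sup>+z. ennreal (exp ((v - s - v) * fl z)) \<partial>model x M p (v - s) v)"
    using nn_integral_exp_neg_flux_le[of s x M p u v "u + s" "v - s"] assms by simp
  also have "\<dots> = ennreal (exp (log_partition x M p (u + s) - log_partition x M p u) +
      exp (log_partition x M p v - log_partition x M p (v - s)))"
    using assms by (subst (1 2) nn_integral_exp_flux) auto
  finally show ?thesis .
qed

section \<open>Coupling different densities\<close>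

text \<open>In one coordinate this is the shift of the summation index from q to q + 1; the term q =
  0 carries the factor 0, and each weight drops by \<open>exp (- v)\<close>.\<close>

lemma geo_list_stein:
  fixes g :: "nat list \<Rightarrow> ennreal"
  assumes "0 < v"
  shows "(\<integral>\<^sup>+qs. of_nat (sum_list qs) * g qs \<partial>replicate_pmf x (geo v)) =
    ennreal (exp (- v)) *
    (\<integral>\<^sup>+qs. (\<Sum>i<x. of_nat (Suc (qs ! i)) * g (qs[i := Suc (qs ! i)])) \<partial>replicate_pmf x (geo v))"
proof (induction x arbitrary: g)
  case 0
  show ?case by simp
next
  case (Suc x)
  let ?Q = "replicate_pmf x (geo v)" and ?e = "ennreal (exp (- v))"
  have "(\<integral>\<^sup>+qs. of_nat (sum_list qs) * g qs \<partial>replicate_pmf (Suc x) (geo v)) =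
    (\<integral>\<^sup>+q. of_nat q * (\<integral>\<^sup>+qs. g (q # qs) \<partial>?Q) \<partial>geo v) +
    (\<integral>\<^sup>+q. (\<integral>\<^sup>+qs. of_nat (sum_list qs) * g (q # qs) \<partial>?Q) \<partial>geo v)"
    by (simp add: distrib_right nn_integral_add nn_integral_cmult)
  also have "(\<integral>\<^sup>+q. of_nat q * (\<integral>\<^sup>+qs. g (q # qs) \<partial>?Q) \<partial>geo v) =
    ?e * (\<integral>\<^sup>+q. of_nat (Suc q) * (\<integral>\<^sup>+qs. g (Suc q # qs) \<partial>?Q) \<partial>geo v)"
    by (subst nn_integral_geo_unfold[OF assms]) (simp del: of_nat_Suc)
  also have "(\<integral>\<^sup>+q. (\<integral>\<^sup>+qs. of_nat (sum_list qs) * g (q # qs) \<partial>?Q) \<partial>geo v) =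
    ?e * (\<integral>\<^sup>+q. (\<integral>\<^sup>+qs. (\<Sum>i<x. of_nat (Suc (qs ! i)) * g (q # qs[i := Suc (qs ! i)])) \<partial>?Q) \<partial>geo v)"
    by (subst Suc) (simp add: nn_integral_cmult)
  also have "?e * (\<integral>\<^sup>+q. of_nat (Suc q) * (\<integral>\<^sup>+qs. g (Suc q # qs) \<partial>?Q) \<partial>geo v) +
    ?e * (\<integral>\<^sup>+q. (\<integral>\<^sup>+qs. (\<Sum>i<x. of_nat (Suc (qs ! i)) * g (q # qs[i := Suc (qs ! i)])) \<partial>?Q) \<partial>geo v) =
    ?e * (\<integral>\<^sup>+qs. (\<Sum>i<Suc x. of_nat (Suc (qs ! i)) * g (qs[i := Suc (qs ! i)]))
      \<partial>replicate_pmf (Suc x) (geo v))"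
    by (simp add: sum.lessThan_Suc_shift nn_integral_add nn_integral_cmult distrib_left
        del: sum.lessThan_Suc of_nat_Suc)
  finally show ?case .
qed

text \<open>
  Adding a negative binomial number of particles to each site turns geometric variables into
  geometric variables with a larger mean, and the conditional mean of the addition is
  proportional to the factor \<open>q + 1\<close> of the Stein identity above.
\<close>

primrec increments :: "real \<Rightarrow> nat list \<Rightarrow> nat list pmf" where
  "increments z [] = return_pmf []"
| "increments z (q # qs) =
    do {k \<leftarrow> neg_binomial_pmf (Suc q) (1 - z); ks \<leftarrow> increments z qs; return_pmf (k # ks)}"

lemma increments_length: "ks \<in> set_pmf (increments z qs) \<Longrightarrow> length ks = length qs"
  by (induction qs arbitrary: ks) auto

text \<open>The joint weights of q and an increment n - q, summed over q, form the binomial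
  expansion of the n-th power of \<beta> (1 - z) + z.\<close>

lemma geometric_increment:
  assumes "0 \<le> \<beta>" "\<beta> < 1" "0 \<le> z" "z < 1"
  shows "bind_pmf (geometric_pmf (1 - \<beta>)) (\<lambda>q. map_pmf ((+) q) (neg_binomial_pmf (Suc q) (1 - z))) =
    geometric_pmf ((1 - \<beta>) * (1 - z))"
proof (rule pmf_eqI)
  fix n :: nat
  have r: "(1 - \<beta>) * (1 - z) \<in> {0<..1}"
    using assms mult_mono[of "1 - \<beta>" 1 "1 - z" 1] by auto
  have vim: "(+) q -` {n} = (if q \<le> n then {n - q} else {})" for q
    by auto
  have "pmf (bind_pmf (geometric_pmf (1 - \<beta>)) (\<lambda>q. map_pmf ((+) q) (neg_binomial_pmf (Suc q) (1 - z)))) n =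
    measure_pmf.expectation (geometric_pmf (1 - \<beta>))
      (\<lambda>q. if q \<le> n then pmf (neg_binomial_pmf (Suc q) (1 - z)) (n - q) else 0)"
    by (auto simp: pmf_bind pmf_map vim measure_pmf_single intro!: Bochner_Integration.integral_cong)
  also have "\<dots> = (\<Sum>q\<le>n. pmf (neg_binomial_pmf (Suc q) (1 - z)) (n - q) * pmf (geometric_pmf (1 - \<beta>)) q)"
    by (subst integral_measure_pmf_real[where A = "{..n}"]) (auto split: if_splits)
  also have "\<dots> = (\<Sum>q\<le>n. (1 - \<beta>) * (1 - z) * (real (n choose q) * (\<beta> * (1 - z)) ^ q * z ^ (n - q)))"
  proof (intro sum.cong refl)
    fix q assume "q \<in> {..n}"
    then have "n - q + Suc q - 1 = n" "n choose (n - q) = n choose q"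
      by (auto simp: binomial_symmetric[symmetric])
    then show "pmf (neg_binomial_pmf (Suc q) (1 - z)) (n - q) * pmf (geometric_pmf (1 - \<beta>)) q =
      (1 - \<beta>) * (1 - z) * (real (n choose q) * (\<beta> * (1 - z)) ^ q * z ^ (n - q))"
      using assms by (subst pmf_neg_binomial) (auto simp: power_mult_distrib)
  qed
  also have "\<dots> = (1 - \<beta>) * (1 - z) * (\<beta> * (1 - z) + z) ^ n"
    by (simp add: binomial_ring sum_distrib_left)
  also have "\<dots> = pmf (geometric_pmf ((1 - \<beta>) * (1 - z))) n"
  proof -
    have "\<beta> * (1 - z) + z = 1 - (1 - \<beta>) * (1 - z)" by (simp add: algebra_simps)
    then show ?thesis using r by simp
  qed
  finally show "pmf (bind_pmf (geometric_pmf (1 - \<beta>))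
      (\<lambda>q. map_pmf ((+) q) (neg_binomial_pmf (Suc q) (1 - z)))) n =
    pmf (geometric_pmf ((1 - \<beta>) * (1 - z))) n" .
qed

lemma increment_parameter_bounds:
  fixes v :: real
  assumes "0 < v'" "v' < v" "z = 1 - (1 - exp (- v')) / (1 - exp (- v))"
  shows "0 < z" "z < 1"
proof -
  have "0 < 1 - exp (- v')" "1 - exp (- v') < 1 - exp (- v)"
    using assms by auto
  then show "0 < z" "z < 1"
    unfolding assms(3) by (auto simp: divide_less_eq)
qed

lemma geo_list_increment:
  assumes "0 < v'" "v' < v" "z = 1 - (1 - exp (- v')) / (1 - exp (- v))"
  shows "bind_pmf (replicate_pmf x (geo v)) (\<lambda>qs. map_pmf (map2 (+) qs) (increments z qs)) =
    replicate_pmf x (geo v')"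
proof -
  have z: "0 \<le> z" "z < 1"
    using increment_parameter_bounds[OF assms] by auto
  have vz: "(1 - exp (- v)) * (1 - z) = 1 - exp (- v')"
    using assms by simp
  have one: "bind_pmf (geo v) (\<lambda>q. map_pmf ((+) q) (neg_binomial_pmf (Suc q) (1 - z))) = geo v'"
    using geometric_increment[of "exp (- v)" z] z assms(1,2) unfolding geo_def vz by simp
  show ?thesis
  proof (induction x)
    case 0
    show ?case by (simp add: bind_return_pmf)
  next
    case (Suc x)
    let ?N = "\<lambda>q. neg_binomial_pmf (Suc q) (1 - z)"
    have "bind_pmf (replicate_pmf (Suc x) (geo v)) (\<lambda>qs. map_pmf (map2 (+) qs) (increments z qs)) =
      do {q \<leftarrow> geo v; qs \<leftarrow> replicate_pmf x (geo v); k \<leftarrow> ?N q; ks \<leftarrow> increments z qs;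
        return_pmf ((q + k) # map2 (+) qs ks)}"
      by (simp add: bind_assoc_pmf bind_return_pmf map_bind_pmf)
    also have "\<dots> = do {q \<leftarrow> geo v; k \<leftarrow> ?N q; qs \<leftarrow> replicate_pmf x (geo v); ks \<leftarrow> increments z qs;
        return_pmf ((q + k) # map2 (+) qs ks)}"
      by (subst bind_commute_pmf[of "replicate_pmf x (geo v)"]) simp
    also have "\<dots> = do {q' \<leftarrow> bind_pmf (geo v) (\<lambda>q. map_pmf ((+) q) (?N q));
        qs' \<leftarrow> bind_pmf (replicate_pmf x (geo v)) (\<lambda>qs. map_pmf (map2 (+) qs) (increments z qs));
        return_pmf (q' # qs')}"
      by (simp add: bind_assoc_pmf bind_map_pmf)
    also have "\<dots> = replicate_pmf (Suc x) (geo v')"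
      by (simp add: one Suc)
    finally show ?case .
  qed
qed

lemma increments_mean:
  assumes "0 \<le> z" "z < 1"
  shows "(\<integral>\<^sup>+ks. of_nat (sum_list (take Z ks)) \<partial>increments z qs) =
    ennreal (z / (1 - z)) * of_nat (\<Sum>i<length qs. if i < Z then Suc (qs ! i) else 0)"
proof (induction qs arbitrary: Z)
  case (Cons q qs)
  show ?case
  proof (cases Z)
    case (Suc Z')
    have nb: "(\<integral>\<^sup>+k. of_nat k \<partial>neg_binomial_pmf (Suc q) (1 - z)) = ennreal (z / (1 - z)) * of_nat (Suc q)"
    proof -
      have "ennreal (real (Suc q) * (1 - (1 - z)) / (1 - z)) = ennreal (z / (1 - z)) * of_nat (Suc q)"
        using assms by (simp add: ennreal_of_nat_eq_real_of_nat ennreal_mult[symmetric] mult.commute del: of_nat_Suc)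
      then show ?thesis
        using nn_integral_neg_binomial_pmf_real[of "1 - z" "Suc q"] assms by simp
    qed
    have "(\<integral>\<^sup>+ks. of_nat (sum_list (take Z ks)) \<partial>increments z (q # qs)) =
      (\<integral>\<^sup>+k. of_nat k \<partial>neg_binomial_pmf (Suc q) (1 - z)) +
      (\<integral>\<^sup>+ks. of_nat (sum_list (take Z' ks)) \<partial>increments z qs)"
      by (simp add: Suc nn_integral_add)
    also have "\<dots> = ennreal (z / (1 - z)) * (of_nat (Suc q) +
        of_nat (\<Sum>i<length qs. if i < Z' then Suc (qs ! i) else 0))"
      unfolding nb Cons by (simp add: distrib_left)
    also have "\<dots> = ennreal (z / (1 - z)) *
        of_nat (\<Sum>i<length (q # qs). if i < Z then Suc ((q # qs) ! i) else 0)"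
      by (simp add: sum.lessThan_Suc_shift Suc add.assoc del: sum.lessThan_Suc cong: if_cong)
    finally show ?thesis .
  qed simp
qed simp

lemma flux_le:
  assumes "(bs, qs, w) \<in> set_pmf (model x M p u v)"
  shows "flux bs w qs \<le> int M" "flux bs w qs \<ge> - int (sum_list qs)"
proof -
  note l = set_pmf_model[OF assms]
  have "length (snd (tandem qs bs w)) = M"
    using tandem_length(2)[of qs bs w] l by simp
  then show "flux bs w qs \<le> int M"
    using trues_le_length[of "snd (tandem qs bs w)"] by (simp add: flux_def)
qed (simp add: flux_def)

text \<open>\<open>R\<close> is the mean of the sum of q + 1 over the sites before the exit
  \<open>Z\<close>. In the Stein identity it is the response of the flux to one extra particle; in
  the coupling it is, up to the factor \<open>z / (1 - z)\<close>, the mean number of particles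
  added before the exit. Only the number \<open>R\<close> leaves the lemma, never the exit. The
  integrand is M minus the flux to keep it nonnegative.\<close>

lemma flux_site_comparison:
  assumes v: "0 < v'" "v' < v" and z: "z = 1 - (1 - exp (- v')) / (1 - exp (- v))"
  shows "\<exists>R. (\<integral>\<^sup>+y. of_nat (sum_list (fst (snd y))) * ennreal (real M - fl y) \<partial>model x M p u v) =
      ennreal (exp (- v)) *
        ((\<integral>\<^sup>+y. of_nat (sum_list (fst (snd y))) * ennreal (real M - fl y) \<partial>model x M p u v) +
         of_nat x * (\<integral>\<^sup>+y. ennreal (real M - fl y) \<partial>model x M p u v) + R) \<and>
    (\<integral>\<^sup>+y. ennreal (real M - fl y) \<partial>model x M p u v) + ennreal (z / (1 - z)) * R
      \<le> (\<integral>\<^sup>+y. ennreal (real M - fl y) \<partial>model x M p u v')"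
proof -
  have z01: "0 \<le> z" "z < 1"
    using increment_parameter_bounds[OF v z] by auto
  let ?B = "replicate_pmf x (replicate_pmf M (bernoulli_pmf p))"
  let ?W = "replicate_pmf M (bernoulli_pmf (arr p u))"
  let ?Q = "replicate_pmf x (geo v)" and ?Q' = "replicate_pmf x (geo v')"
  define g where "g bs w qs = ennreal (real M - real_of_int (flux bs w qs))" for bs w qs
  have ok: "\<exists>Z. (\<forall>zs. length zs = x \<longrightarrow> flux bs w (map2 (+) qs zs) \<le> flux bs w qs - int (sum_list (take Z zs))) \<and>
      (\<forall>i<x. flux bs w (qs[i := Suc (qs ! i)]) = flux bs w qs - of_bool (i < Z))"
    if "bs \<in> set_pmf ?B" "w \<in> set_pmf ?W" "qs \<in> set_pmf ?Q" for bs w qs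
    using that flux_exit_site[of bs M w qs] by (auto simp: set_replicate_pmf in_lists_conv_set)
  define Z where "Z bs w qs = (SOME Z. (\<forall>zs. length zs = x \<longrightarrow>
        flux bs w (map2 (+) qs zs) \<le> flux bs w qs - int (sum_list (take Z zs))) \<and>
      (\<forall>i<x. flux bs w (qs[i := Suc (qs ! i)]) = flux bs w qs - of_bool (i < Z)))" for bs w qs
  have Z: "\<And>zs. length zs = x \<Longrightarrow>
        flux bs w (map2 (+) qs zs) \<le> flux bs w qs - int (sum_list (take (Z bs w qs) zs))"
      "\<And>i. i < x \<Longrightarrow> flux bs w (qs[i := Suc (qs ! i)]) = flux bs w qs - of_bool (i < Z bs w qs)"
    if "bs \<in> set_pmf ?B" "w \<in> set_pmf ?W" "qs \<in> set_pmf ?Q" for bs w qs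
    using someI_ex[OF ok[OF that]] unfolding Z_def[symmetric] by auto
  have fM: "flux bs w qs \<le> int M"
    if "bs \<in> set_pmf ?B" "w \<in> set_pmf ?W" "qs \<in> set_pmf ?Q" for bs w qs
    using that by (intro flux_le[of bs qs w x M p u v]) (simp add: model_def)
  define r where "r bs w qs = (of_nat (\<Sum>i<x. if i < Z bs w qs then Suc (qs ! i) else 0) :: ennreal)" for bs w qs
  define R where "R = (\<integral>\<^sup>+bs. \<integral>\<^sup>+w. \<integral>\<^sup>+qs. r bs w qs \<partial>?Q \<partial>?W \<partial>?B)"
  have swap: "(\<integral>\<^sup>+y. f y \<partial>model x M p u v) =
      (\<integral>\<^sup>+bs. \<integral>\<^sup>+w. \<integral>\<^sup>+qs. f (bs, qs, w) \<partial>replicate_pmf x (geo v) \<partial>?W \<partial>?B)" for f v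
    unfolding nn_integral_model by (subst (2) nn_integral_pmf_commute) simp
  have stein: "(\<integral>\<^sup>+qs. of_nat (sum_list qs) * g bs w qs \<partial>?Q) = ennreal (exp (- v)) *
      ((\<integral>\<^sup>+qs. of_nat (sum_list qs) * g bs w qs \<partial>?Q) + of_nat x * (\<integral>\<^sup>+qs. g bs w qs \<partial>?Q) +
       (\<integral>\<^sup>+qs. r bs w qs \<partial>?Q))"
    if bw: "bs \<in> set_pmf ?B" "w \<in> set_pmf ?W" for bs w
  proof -
    have "(\<integral>\<^sup>+qs. of_nat (sum_list qs) * g bs w qs \<partial>?Q) = ennreal (exp (- v)) *
      (\<integral>\<^sup>+qs. (\<Sum>i<x. of_nat (Suc (qs ! i)) * g bs w (qs[i := Suc (qs ! i)])) \<partial>?Q)"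
      using v by (intro geo_list_stein) auto
    also have "(\<integral>\<^sup>+qs. (\<Sum>i<x. of_nat (Suc (qs ! i)) * g bs w (qs[i := Suc (qs ! i)])) \<partial>?Q) =
      (\<integral>\<^sup>+qs. of_nat (sum_list qs) * g bs w qs + of_nat x * g bs w qs + r bs w qs \<partial>?Q)"
    proof (rule nn_integral_pmf_cong)
      fix qs assume q: "qs \<in> set_pmf ?Q"
      then have lq: "length qs = x" by (rule set_pmf_replicate_length)
      have "g bs w (qs[i := Suc (qs ! i)]) = g bs w qs + of_bool (i < Z bs w qs)" if "i < x" for i
        unfolding g_def using Z(2)[OF bw q that] fM[OF bw q]
        by (auto simp flip: ennreal_plus ennreal_1 simp: algebra_simps)
      then have "(\<Sum>i<x. of_nat (Suc (qs ! i)) * g bs w (qs[i := Suc (qs ! i)])) =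
          (\<Sum>i<x. of_nat (qs ! i) * g bs w qs + g bs w qs + (if i < Z bs w qs then of_nat (Suc (qs ! i)) else 0))"
        by (intro sum.cong) (auto simp: algebra_simps)
      also have "\<dots> = of_nat (\<Sum>i<x. qs ! i) * g bs w qs + of_nat x * g bs w qs + r bs w qs"
        unfolding sum.distrib
        by (simp add: sum_distrib_right r_def of_nat_sum if_distrib cong: if_cong)
      also have "(\<Sum>i<x. qs ! i) = sum_list qs"
        using lq by (simp add: sum_list_sum_nth atLeast0LessThan)
      finally show "(\<Sum>i<x. of_nat (Suc (qs ! i)) * g bs w (qs[i := Suc (qs ! i)])) =
        of_nat (sum_list qs) * g bs w qs + of_nat x * g bs w qs + r bs w qs" .
    qed
    finally show ?thesis by (simp add: nn_integral_add nn_integral_cmult)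
  qed
  have mono: "(\<integral>\<^sup>+qs. g bs w qs \<partial>?Q) + ennreal (z / (1 - z)) * (\<integral>\<^sup>+qs. r bs w qs \<partial>?Q) \<le>
      (\<integral>\<^sup>+qs. g bs w qs \<partial>?Q')" if bw: "bs \<in> set_pmf ?B" "w \<in> set_pmf ?W" for bs w
  proof -
    have "(\<integral>\<^sup>+qs. g bs w qs \<partial>?Q) + ennreal (z / (1 - z)) * (\<integral>\<^sup>+qs. r bs w qs \<partial>?Q) =
      (\<integral>\<^sup>+qs. g bs w qs + ennreal (z / (1 - z)) * r bs w qs \<partial>?Q)"
      by (simp add: nn_integral_add nn_integral_cmult)
    also have "\<dots> = (\<integral>\<^sup>+qs. \<integral>\<^sup>+ks. g bs w qs + of_nat (sum_list (take (Z bs w qs) ks)) \<partial>increments z qs \<partial>?Q)"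
    proof (rule nn_integral_pmf_cong)
      fix qs assume "qs \<in> set_pmf ?Q"
      then have "length qs = x" by (rule set_pmf_replicate_length)
      then show "g bs w qs + ennreal (z / (1 - z)) * r bs w qs =
        (\<integral>\<^sup>+ks. g bs w qs + of_nat (sum_list (take (Z bs w qs) ks)) \<partial>increments z qs)"
        using increments_mean[OF z01, where Z = "Z bs w qs" and qs = qs] by (simp add: nn_integral_add r_def)
    qed
    also have "\<dots> \<le> (\<integral>\<^sup>+qs. \<integral>\<^sup>+ks. g bs w (map2 (+) qs ks) \<partial>increments z qs \<partial>?Q)"
    proof (intro nn_integral_pmf_mono)
      fix qs ks assume q: "qs \<in> set_pmf ?Q" and k: "ks \<in> set_pmf (increments z qs)"
      have "length ks = x"
        using increments_length[OF k] set_pmf_replicate_length[OF q] by simp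
      from Z(1)[OF bw q this] fM[OF bw q]
      show "g bs w qs + of_nat (sum_list (take (Z bs w qs) ks)) \<le> g bs w (map2 (+) qs ks)"
        unfolding g_def
        by (auto simp: ennreal_of_nat_eq_real_of_nat simp flip: ennreal_plus intro!: ennreal_leI)
    qed
    also have "\<dots> = (\<integral>\<^sup>+qs. g bs w qs \<partial>bind_pmf ?Q (\<lambda>qs. map_pmf (map2 (+) qs) (increments z qs)))"
      by simp
    also have "\<dots> = (\<integral>\<^sup>+qs. g bs w qs \<partial>?Q')"
      by (subst geo_list_increment[OF v z]) simp
    finally show ?thesis .
  qed
  show ?thesis
  proof (intro exI[of _ R] conjI)
    have "(\<integral>\<^sup>+bs. \<integral>\<^sup>+w. \<integral>\<^sup>+qs. of_nat (sum_list qs) * g bs w qs \<partial>?Q \<partial>?W \<partial>?B) =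
      (\<integral>\<^sup>+bs. \<integral>\<^sup>+w. ennreal (exp (- v)) *
      ((\<integral>\<^sup>+qs. of_nat (sum_list qs) * g bs w qs \<partial>?Q) + of_nat x * (\<integral>\<^sup>+qs. g bs w qs \<partial>?Q) +
       (\<integral>\<^sup>+qs. r bs w qs \<partial>?Q)) \<partial>?W \<partial>?B)"
      by (intro nn_integral_pmf_cong stein)
    then show "(\<integral>\<^sup>+y. of_nat (sum_list (fst (snd y))) * ennreal (real M - fl y) \<partial>model x M p u v) =
      ennreal (exp (- v)) *
        ((\<integral>\<^sup>+y. of_nat (sum_list (fst (snd y))) * ennreal (real M - fl y) \<partial>model x M p u v) +
         of_nat x * (\<integral>\<^sup>+y. ennreal (real M - fl y) \<partial>model x M p u v) + R)"
      unfolding swap by (simp add: g_def R_def nn_integral_add nn_integral_cmult)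
    have "(\<integral>\<^sup>+bs. \<integral>\<^sup>+w. (\<integral>\<^sup>+qs. g bs w qs \<partial>?Q) + ennreal (z / (1 - z)) * (\<integral>\<^sup>+qs. r bs w qs \<partial>?Q) \<partial>?W \<partial>?B) \<le>
      (\<integral>\<^sup>+bs. \<integral>\<^sup>+w. \<integral>\<^sup>+qs. g bs w qs \<partial>?Q' \<partial>?W \<partial>?B)"
      by (intro nn_integral_pmf_mono mono)
    then show "(\<integral>\<^sup>+y. ennreal (real M - fl y) \<partial>model x M p u v) + ennreal (z / (1 - z)) * R
      \<le> (\<integral>\<^sup>+y. ennreal (real M - fl y) \<partial>model x M p u v')"
      unfolding swap by (simp add: g_def R_def nn_integral_add nn_integral_cmult)
  qed
qed

text \<open>With \<open>v < v'\<close> exchanged, the same coupling shows that the flux is monotone in the density.\<close>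

lemma nn_integral_exp_neg_flux_mono:
  assumes v: "0 < v'" "v' < v" and "0 \<le> s"
  shows "(\<integral>\<^sup>+y. ennreal (exp (- s * fl y)) \<partial>model x M p u v) \<le>
    (\<integral>\<^sup>+y. ennreal (exp (- s * fl y)) \<partial>model x M p u v')"
proof -
  define z where "z = 1 - (1 - exp (- v')) / (1 - exp (- v))"
  let ?B = "replicate_pmf x (replicate_pmf M (bernoulli_pmf p))"
  let ?W = "replicate_pmf M (bernoulli_pmf (arr p u))"
  let ?Q = "replicate_pmf x (geo v)"
  let ?g = "\<lambda>bs w qs. ennreal (exp (- s * real_of_int (flux bs w qs)))"
  have swap: "(\<integral>\<^sup>+y. f y \<partial>model x M p u v) =
      (\<integral>\<^sup>+bs. \<integral>\<^sup>+w. \<integral>\<^sup>+qs. f (bs, qs, w) \<partial>replicate_pmf x (geo v) \<partial>?W \<partial>?B)" for f v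
    unfolding nn_integral_model by (subst (2) nn_integral_pmf_commute) simp
  have "(\<integral>\<^sup>+bs. \<integral>\<^sup>+w. \<integral>\<^sup>+qs. ?g bs w qs \<partial>?Q \<partial>?W \<partial>?B) =
      (\<integral>\<^sup>+bs. \<integral>\<^sup>+w. \<integral>\<^sup>+qs. \<integral>\<^sup>+ks. ?g bs w qs \<partial>increments z qs \<partial>?Q \<partial>?W \<partial>?B)"
    by simp
  also have "\<dots> \<le> (\<integral>\<^sup>+bs. \<integral>\<^sup>+w. \<integral>\<^sup>+qs. \<integral>\<^sup>+ks. ?g bs w (map2 (+) qs ks) \<partial>increments z qs \<partial>?Q \<partial>?W \<partial>?B)"
  proof (intro nn_integral_pmf_mono ennreal_leI)
    fix bs w qs ks
    assume a: "bs \<in> set_pmf ?B" "w \<in> set_pmf ?W" "qs \<in> set_pmf ?Q" "ks \<in> set_pmf (increments z qs)"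
    then have l: "\<forall>b\<in>set bs. length b = M" "length w = M" "length qs = length bs" "length ks = length bs"
      using increments_length[OF a(4)] by (auto simp: set_replicate_pmf in_lists_conv_set)
    have "flux bs w (map2 (+) qs ks) \<le> flux bs w qs"
      using flux_exit_site[OF l(1,2,3)] l(4) by force
    then show "exp (- s * real_of_int (flux bs w qs)) \<le> exp (- s * real_of_int (flux bs w (map2 (+) qs ks)))"
      using assms by (simp add: mult_left_mono)
  qed
  also have "\<dots> = (\<integral>\<^sup>+bs. \<integral>\<^sup>+w. \<integral>\<^sup>+qs. ?g bs w qs
      \<partial>bind_pmf ?Q (\<lambda>qs. map_pmf (map2 (+) qs) (increments z qs)) \<partial>?W \<partial>?B)"
    by simp
  also have "\<dots> = (\<integral>\<^sup>+bs. \<integral>\<^sup>+w. \<integral>\<^sup>+qs. ?g bs w qs \<partial>replicate_pmf x (geo v') \<partial>?W \<partial>?B)"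
    by (subst geo_list_increment[OF v z_def]) simp
  finally show ?thesis unfolding swap by simp
qed

section \<open>Stein identity and thinning for the arrivals\<close>

lemma bernoulli_list_stein_step:
  fixes a b :: "'a :: comm_semiring_1"
  assumes "m * a * A = a * B + b * C" "m * a * A' = a * B' + b * C'"
  shows "(1 + m) * a * (a * A + b * A') = a * (a * (A + B) + b * B') + b * (a * (A' + C) + b * C')"
proof -
  have "(1 + m) * a * (a * A + b * A') = a * (a * A + b * A') + a * (m * a * A) + b * (m * a * A')"
    by (simp add: algebra_simps)
  also have "\<dots> = a * (a * (A + B) + b * B') + b * (a * (A' + C) + b * C')"
    unfolding assms by (simp add: algebra_simps)
  finally show ?thesis .
qed

text \<open>For one coordinate, switching a success off exchanges the weights a and 1 - a: the
  failures weighted by a give 1 - a times the successes evaluated after the removal. The identity is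
  the sum over all coordinates.\<close>

lemma bernoulli_list_stein:
  fixes g :: "bool list \<Rightarrow> ennreal"
  assumes "0 \<le> a" "a \<le> 1"
  shows "of_nat M * ennreal a * (\<integral>\<^sup>+w. g w \<partial>replicate_pmf M (bernoulli_pmf a)) =
    ennreal a * (\<integral>\<^sup>+w. of_nat (trues w) * g w \<partial>replicate_pmf M (bernoulli_pmf a)) +
    ennreal (1 - a) * (\<integral>\<^sup>+w. (\<Sum>i<M. if w ! i then g (w[i := False]) else 0)
      \<partial>replicate_pmf M (bernoulli_pmf a))"
proof (induction M arbitrary: g)
  case 0
  show ?case by simp
next
  case (Suc M)
  let ?W = "replicate_pmf M (bernoulli_pmf a)"
  show ?case
    using bernoulli_list_stein_step[OF Suc[of "\<lambda>w. g (True # w)"] Suc[of "\<lambda>w. g (False # w)"]]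
    by (simp add: nn_integral_bernoulli assms sum.lessThan_Suc_shift nn_integral_add distrib_right
        distrib_left add_ac del: sum.lessThan_Suc nn_integral_bernoulli_pmf cong: if_cong)
qed

primrec thinning :: "real \<Rightarrow> bool list \<Rightarrow> bool list pmf" where
  "thinning \<theta> [] = return_pmf []"
| "thinning \<theta> (y # w) =
    do {b \<leftarrow> bernoulli_pmf \<theta>; w' \<leftarrow> thinning \<theta> w; return_pmf ((y \<and> \<not> b) # w')}"

lemma thinning_length: "w' \<in> set_pmf (thinning \<theta> w) \<Longrightarrow> length w' = length w"
  by (induction w arbitrary: w') auto

lemma bernoulli_list_thinning:
  assumes "0 \<le> a" "a \<le> 1" "0 \<le> \<theta>" "\<theta> \<le> 1"
  shows "bind_pmf (replicate_pmf M (bernoulli_pmf a)) (thinning \<theta>) =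
    replicate_pmf M (bernoulli_pmf (a * (1 - \<theta>)))"
proof (induction M)
  case 0
  show ?case by (simp add: bind_return_pmf)
next
  case (Suc M)
  let ?W = "replicate_pmf M (bernoulli_pmf a)"
  have a': "0 \<le> a * (1 - \<theta>)" "a * (1 - \<theta>) \<le> 1"
    using assms by (auto intro: mult_le_one)
  have one: "do {y \<leftarrow> bernoulli_pmf a; b \<leftarrow> bernoulli_pmf \<theta>; return_pmf (y \<and> \<not> b)} =
    bernoulli_pmf (a * (1 - \<theta>))"
  proof (rule pmf_eqI)
    fix i
    show "pmf (do {y \<leftarrow> bernoulli_pmf a; b \<leftarrow> bernoulli_pmf \<theta>; return_pmf (y \<and> \<not> b)}) i =
        pmf (bernoulli_pmf (a * (1 - \<theta>))) i"
      by (cases i) (use assms a' in \<open>auto simp: pmf_bind_bernoulli algebra_simps\<close>)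
  qed
  have "bind_pmf (replicate_pmf (Suc M) (bernoulli_pmf a)) (thinning \<theta>) =
    do {y \<leftarrow> bernoulli_pmf a; w \<leftarrow> ?W; b \<leftarrow> bernoulli_pmf \<theta>; w' \<leftarrow> thinning \<theta> w;
      return_pmf ((y \<and> \<not> b) # w')}"
    by (simp add: bind_assoc_pmf bind_return_pmf)
  also have "\<dots> = do {y \<leftarrow> bernoulli_pmf a; b \<leftarrow> bernoulli_pmf \<theta>; w \<leftarrow> ?W; w' \<leftarrow> thinning \<theta> w;
      return_pmf ((y \<and> \<not> b) # w')}"
    by (subst bind_commute_pmf[of ?W]) simp
  also have "\<dots> = do {y' \<leftarrow> do {y \<leftarrow> bernoulli_pmf a; b \<leftarrow> bernoulli_pmf \<theta>; return_pmf (y \<and> \<not> b)};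
      w' \<leftarrow> bind_pmf ?W (thinning \<theta>); return_pmf (y' # w')}"
    by (simp add: bind_assoc_pmf bind_return_pmf)
  also have "\<dots> = replicate_pmf (Suc M) (bernoulli_pmf (a * (1 - \<theta>)))"
    unfolding one Suc by simp
  finally show ?case .
qed

lemma thinning_mean:
  assumes "0 \<le> \<theta>" "\<theta> \<le> 1"
  shows "(\<integral>\<^sup>+w'. of_nat (trues (take Z w')) \<partial>thinning \<theta> w) = ennreal (1 - \<theta>) * of_nat (trues (take Z w))"
proof (induction w arbitrary: Z)
  case (Cons y w)
  show ?case
  proof (cases Z)
    case (Suc Z')
    have "ennreal \<theta> + ennreal (1 - \<theta>) = 1"
      using assms by (simp flip: ennreal_plus)
    then have "ennreal \<theta> * A + ennreal (1 - \<theta>) * A = A" for A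
      by (metis distrib_right mult_1)
    then show ?thesis
      using Cons[of Z'] assms
      by (cases y) (auto simp: Suc nn_integral_bernoulli nn_integral_add distrib_left add_ac
        simp del: nn_integral_bernoulli_pmf)
  qed simp
qed simp

text \<open>\<open>R\<close> is the mean number of arrivals before the exit \<open>Z\<close>. Flux
  plus initial particles is the number of departures, hence a nonnegative integrand. The bound
  \<open>R \<le> of_nat M\<close> supplies the finiteness that permits cancelling \<open>R\<close>
  when the inequality is read over the reals.\<close>

lemma flux_time_comparison:
  assumes p: "0 < p" "p < 1" and \<theta>: "0 < \<theta>" "\<theta> < 1" "arr p u' = arr p u * (1 - \<theta>)"
  shows "\<exists>R. (\<integral>\<^sup>+y. of_nat (trues (snd (snd y))) *
        ennreal (fl y + real (sum_list (fst (snd y)))) \<partial>model x M p u v) =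
      of_nat M * ennreal (arr p u) * (\<integral>\<^sup>+y. ennreal (fl y + real (sum_list (fst (snd y)))) \<partial>model x M p u v)
      + ennreal (1 - arr p u) * R \<and>
    (\<integral>\<^sup>+y. ennreal (fl y + real (sum_list (fst (snd y)))) \<partial>model x M p u' v) + R \<le>
    (\<integral>\<^sup>+y. ennreal (fl y + real (sum_list (fst (snd y)))) \<partial>model x M p u v) + ennreal (1 - \<theta>) * R \<and>
    R \<le> of_nat M"
proof -
  define a where "a = arr p u"
  have a: "0 < a" "a < 1" using arr_bounds[OF p] by (auto simp: a_def)
  let ?B = "replicate_pmf x (replicate_pmf M (bernoulli_pmf p))"
  let ?W = "replicate_pmf M (bernoulli_pmf a)" and ?W' = "replicate_pmf M (bernoulli_pmf (a * (1 - \<theta>)))"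
  let ?Q = "replicate_pmf x (geo v)"
  define g where "g bs qs w = ennreal (real_of_int (flux bs w qs) + real (sum_list qs))" for bs qs w
  have ok: "\<exists>Z. (\<forall>w'. length w' = M \<longrightarrow>
        flux bs w' qs \<le> flux bs w qs - (int (trues (take Z w)) - int (trues (take Z w')))) \<and>
      (\<forall>i<M. w ! i \<longrightarrow> flux bs (w[i := False]) qs = flux bs w qs - of_bool (i < Z))"
    if "bs \<in> set_pmf ?B" "w \<in> set_pmf ?W" "qs \<in> set_pmf ?Q" for bs w qs
    using that flux_exit_time[of bs M w qs] by (auto simp: set_replicate_pmf in_lists_conv_set)
  define Z where "Z bs w qs = (SOME Z. (\<forall>w'. length w' = M \<longrightarrow>
        flux bs w' qs \<le> flux bs w qs - (int (trues (take Z w)) - int (trues (take Z w')))) \<and>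
      (\<forall>i<M. w ! i \<longrightarrow> flux bs (w[i := False]) qs = flux bs w qs - of_bool (i < Z)))" for bs w qs
  have Z: "\<And>w'. length w' = M \<Longrightarrow>
        flux bs w' qs \<le> flux bs w qs - (int (trues (take (Z bs w qs) w)) - int (trues (take (Z bs w qs) w')))"
      "\<And>i. i < M \<Longrightarrow> w ! i \<Longrightarrow> flux bs (w[i := False]) qs = flux bs w qs - of_bool (i < Z bs w qs)"
    if "bs \<in> set_pmf ?B" "w \<in> set_pmf ?W" "qs \<in> set_pmf ?Q" for bs w qs
    using someI_ex[OF ok[OF that]] unfolding Z_def[symmetric] by auto
  have fM: "0 \<le> real_of_int (flux bs w qs) + real (sum_list qs)" for bs w qs
    by (simp add: flux_def)
  define r where "r bs qs w = (of_nat (trues (take (Z bs w qs) w)) :: ennreal)" for bs w qs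
  define R where "R = (\<integral>\<^sup>+bs. \<integral>\<^sup>+qs. \<integral>\<^sup>+w. r bs qs w \<partial>?W \<partial>?Q \<partial>?B)"
  have sumtr: "trues (take k w) = (\<Sum>i<length w. if w ! i \<and> i < k then 1 else 0)" for k w
  proof (induction w arbitrary: k)
    case (Cons y w)
    then show ?case
      by (cases k) (auto simp: sum.lessThan_Suc_shift simp del: sum.lessThan_Suc cong: if_cong)
  qed simp
  have stein: "(\<integral>\<^sup>+w. of_nat (trues w) * g bs qs w \<partial>?W) =
      of_nat M * ennreal a * (\<integral>\<^sup>+w. g bs qs w \<partial>?W) + ennreal (1 - a) * (\<integral>\<^sup>+w. r bs qs w \<partial>?W)"
    if bq: "bs \<in> set_pmf ?B" "qs \<in> set_pmf ?Q" for bs qs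
  proof -
    let ?T = "\<integral>\<^sup>+w. of_nat (trues w) * g bs qs w \<partial>?W"
    have "?T = (\<integral>\<^sup>+w. (\<Sum>i<M. if w ! i then g bs qs (w[i := False]) else 0) + r bs qs w \<partial>?W)"
    proof (rule nn_integral_pmf_cong)
      fix w assume w: "w \<in> set_pmf ?W"
      then have lw: "length w = M" by (rule set_pmf_replicate_length)
      have "g bs qs w = g bs qs (w[i := False]) + of_bool (i < Z bs w qs)" if "i < M" "w ! i" for i
        unfolding g_def using Z(2)[OF bq(1) w bq(2) that] fM[of bs w qs] fM[of bs "w[i := False]" qs]
        by (auto simp flip: ennreal_plus ennreal_1 simp: algebra_simps)
      then have "(\<Sum>i<M. if w ! i then g bs qs (w[i := False]) else 0) +
          (\<Sum>i<M. if w ! i \<and> i < Z bs w qs then 1 else 0) = (\<Sum>i<M. if w ! i then g bs qs w else 0)"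
        unfolding sum.distrib[symmetric] by (intro sum.cong) auto
      moreover have "r bs qs w = (\<Sum>i<M. if w ! i \<and> i < Z bs w qs then 1 else 0)"
        unfolding r_def sumtr lw by (simp add: of_nat_sum if_distrib cong: if_cong)
      moreover have "of_nat (trues w) * g bs qs w = (\<Sum>i<M. if w ! i then g bs qs w else 0)"
        using sumtr[of "length w" w]
        by (simp add: lw of_nat_sum if_distrib sum_distrib_right cong: if_cong)
          (auto intro!: sum.cong)
      ultimately show "of_nat (trues w) * g bs qs w =
          (\<Sum>i<M. if w ! i then g bs qs (w[i := False]) else 0) + r bs qs w"
        by simp
    qed
    then have T: "?T = (\<integral>\<^sup>+w. (\<Sum>i<M. if w ! i then g bs qs (w[i := False]) else 0) \<partial>?W) +
        (\<integral>\<^sup>+w. r bs qs w \<partial>?W)"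
      by (simp add: nn_integral_add)
    \<comment> \<open>Splitting the integral with the weights a and 1 - a and rewriting only the
      second part matches the Stein identity without a subtraction in
      \<open>ennreal\<close>.\<close>
    have "ennreal a + ennreal (1 - a) = 1" using a by (simp flip: ennreal_plus)
    then have "A = ennreal a * A + ennreal (1 - a) * A" for A
      by (metis distrib_right mult_1)
    then have "?T = ennreal a * ?T + ennreal (1 - a) * ?T" .
    also have "ennreal (1 - a) * ?T = ennreal (1 - a) *
        (\<integral>\<^sup>+w. (\<Sum>i<M. if w ! i then g bs qs (w[i := False]) else 0) \<partial>?W) +
        ennreal (1 - a) * (\<integral>\<^sup>+w. r bs qs w \<partial>?W)"
      by (subst T) (simp add: distrib_left)
    finally show ?thesis
      using bernoulli_list_stein[of a M "g bs qs"] a by (simp add: add.assoc)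
  qed
  have mono: "(\<integral>\<^sup>+w. g bs qs w \<partial>?W') + (\<integral>\<^sup>+w. r bs qs w \<partial>?W) \<le>
      (\<integral>\<^sup>+w. g bs qs w \<partial>?W) + ennreal (1 - \<theta>) * (\<integral>\<^sup>+w. r bs qs w \<partial>?W)"
    if bq: "bs \<in> set_pmf ?B" "qs \<in> set_pmf ?Q" for bs qs
  proof -
    have "(\<integral>\<^sup>+w. g bs qs w \<partial>?W') + (\<integral>\<^sup>+w. r bs qs w \<partial>?W) =
      (\<integral>\<^sup>+w. g bs qs w \<partial>bind_pmf ?W (thinning \<theta>)) + (\<integral>\<^sup>+w. r bs qs w \<partial>?W)"
      by (subst bernoulli_list_thinning) (use a \<theta> in auto)
    also have "\<dots> = (\<integral>\<^sup>+w. \<integral>\<^sup>+w'. g bs qs w' + r bs qs w \<partial>thinning \<theta> w \<partial>?W)"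
      by (simp add: nn_integral_add)
    also have "\<dots> \<le> (\<integral>\<^sup>+w. \<integral>\<^sup>+w'. g bs qs w + of_nat (trues (take (Z bs w qs) w')) \<partial>thinning \<theta> w \<partial>?W)"
    proof (intro nn_integral_pmf_mono)
      fix w w' assume w: "w \<in> set_pmf ?W" and w': "w' \<in> set_pmf (thinning \<theta> w)"
      have l: "length w' = M"
        using thinning_length[OF w'] set_pmf_replicate_length[OF w] by simp
      from Z(1)[OF bq(1) w bq(2) l] fM[of bs w qs] fM[of bs w' qs]
      show "g bs qs w' + r bs qs w \<le> g bs qs w + of_nat (trues (take (Z bs w qs) w'))"
        unfolding g_def r_def
        by (auto simp: ennreal_of_nat_eq_real_of_nat simp flip: ennreal_plus intro!: ennreal_leI)
    qed
    also have "\<dots> = (\<integral>\<^sup>+w. g bs qs w + ennreal (1 - \<theta>) * r bs qs w \<partial>?W)"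
      using thinning_mean[of \<theta>] \<theta> by (simp add: nn_integral_add r_def)
    finally show ?thesis by (simp add: nn_integral_add nn_integral_cmult)
  qed
  show ?thesis
  proof (intro exI[of _ R] conjI)
    have "(\<integral>\<^sup>+bs. \<integral>\<^sup>+qs. \<integral>\<^sup>+w. of_nat (trues w) * g bs qs w \<partial>?W \<partial>?Q \<partial>?B) =
      (\<integral>\<^sup>+bs. \<integral>\<^sup>+qs. of_nat M * ennreal a * (\<integral>\<^sup>+w. g bs qs w \<partial>?W) +
        ennreal (1 - a) * (\<integral>\<^sup>+w. r bs qs w \<partial>?W) \<partial>?Q \<partial>?B)"
      by (intro nn_integral_pmf_cong stein)
    then show "(\<integral>\<^sup>+y. of_nat (trues (snd (snd y))) *
        ennreal (fl y + real (sum_list (fst (snd y)))) \<partial>model x M p u v) =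
      of_nat M * ennreal (arr p u) * (\<integral>\<^sup>+y. ennreal (fl y + real (sum_list (fst (snd y)))) \<partial>model x M p u v)
      + ennreal (1 - arr p u) * R"
      unfolding nn_integral_model by (simp add: g_def R_def nn_integral_add nn_integral_cmult flip: a_def)
    have "(\<integral>\<^sup>+bs. \<integral>\<^sup>+qs. (\<integral>\<^sup>+w. g bs qs w \<partial>?W') + (\<integral>\<^sup>+w. r bs qs w \<partial>?W) \<partial>?Q \<partial>?B) \<le>
      (\<integral>\<^sup>+bs. \<integral>\<^sup>+qs. (\<integral>\<^sup>+w. g bs qs w \<partial>?W) + ennreal (1 - \<theta>) * (\<integral>\<^sup>+w. r bs qs w \<partial>?W) \<partial>?Q \<partial>?B)"
      by (intro nn_integral_pmf_mono mono)
    then show "(\<integral>\<^sup>+y. ennreal (fl y + real (sum_list (fst (snd y)))) \<partial>model x M p u' v) + R \<le>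
    (\<integral>\<^sup>+y. ennreal (fl y + real (sum_list (fst (snd y)))) \<partial>model x M p u v) + ennreal (1 - \<theta>) * R"
      unfolding nn_integral_model \<theta>(3)
      by (simp add: g_def R_def nn_integral_add nn_integral_cmult flip: a_def)
    have "R \<le> (\<integral>\<^sup>+bs. \<integral>\<^sup>+qs. \<integral>\<^sup>+w. of_nat M \<partial>?W \<partial>?Q \<partial>?B)"
      unfolding R_def
    proof (intro nn_integral_pmf_mono)
      fix bs qs w assume "w \<in> set_pmf ?W"
      then have "length w = M" by (rule set_pmf_replicate_length)
      then have "trues (take (Z bs w qs) w) \<le> M"
        using trues_le_length[of "take (Z bs w qs) w"] by auto
      then show "r bs qs w \<le> of_nat M" unfolding r_def by (rule of_nat_mono)
    qed
    then show "R \<le> of_nat M" by simp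
  qed
qed

section \<open>First and second moments of the boundary laws\<close>

abbreviation mean_occ :: "real \<Rightarrow> real" where
  "mean_occ u \<equiv> exp (- u) / (1 - exp (- u))"

lemma integrable_pmf_nonneg:
  assumes "\<And>x. 0 \<le> f x" "(\<integral>\<^sup>+x. ennreal (f x) \<partial>measure_pmf p) < \<infinity>"
  shows "integrable (measure_pmf p) f"
  using assms by (intro integrableI_nonneg) auto

lemma integrable_pmf_bound:
  fixes f g :: "'a \<Rightarrow> real"
  assumes "integrable (measure_pmf p) g" "\<And>x. x \<in> set_pmf p \<Longrightarrow> \<bar>f x\<bar> \<le> g x"
  shows "integrable (measure_pmf p) f"
  by (rule Bochner_Integration.integrable_bound[OF assms(1)])
    (use assms(2) in \<open>force simp: AE_measure_pmf_iff\<close>)+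

lemma power_le_exp:
  fixes y :: real
  assumes "0 \<le> y" "0 < t"
  shows "y ^ k \<le> fact k / t ^ k * exp (t * y)"
proof -
  have "(t * y) ^ k / fact k \<le> exp (t * y)"
    using sum_le_suminf[OF summable_exp_generic[of "t * y"], of "{k}"] assms
    by (simp add: exp_def divide_inverse mult.commute)
  then show ?thesis
    using assms by (simp add: field_simps power_mult_distrib)
qed

lemma integrable_geo_list_power:
  assumes "0 < v"
  shows "integrable (measure_pmf (replicate_pmf x (geo v))) (\<lambda>qs. real (sum_list qs) ^ k)"
proof (rule integrable_pmf_bound)
  have "integrable (measure_pmf (replicate_pmf x (geo v))) (\<lambda>qs. exp (v / 2 * real (sum_list qs)))"
    using assms nn_integral_geo_list_exp[of "v / 2" v x] by (intro integrable_pmf_nonneg) auto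
  then show "integrable (measure_pmf (replicate_pmf x (geo v)))
      (\<lambda>qs. fact k / (v / 2) ^ k * exp (v / 2 * real (sum_list qs)))"
    by simp
qed (use assms power_le_exp[of "real (sum_list _)" "v / 2" k] in auto)

text \<open>The Stein identity for the constant 1 and for \<open>sum_list\<close> gives one linear
  equation for each of the two moments.\<close>

lemma geo_list_moments:
  assumes "0 < v"
  shows "(\<integral>qs. real (sum_list qs) \<partial>replicate_pmf x (geo v)) = real x * mean_occ v"
    "(\<integral>qs. real (sum_list qs) ^ 2 \<partial>replicate_pmf x (geo v)) =
      (real x * mean_occ v)\<^sup>2 + real x * (mean_occ v * (1 + mean_occ v))"
proof -
  let ?Q = "replicate_pmf x (geo v)" and ?b = "exp (- v)"
  define m1 where "m1 = (\<integral>qs. real (sum_list qs) \<partial>?Q)"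
  define m2 where "m2 = (\<integral>qs. real (sum_list qs) ^ 2 \<partial>?Q)"
  have i1: "integrable (measure_pmf ?Q) (\<lambda>qs. real (sum_list qs))"
    and i2: "integrable (measure_pmf ?Q) (\<lambda>qs. real (sum_list qs) ^ 2)"
    using integrable_geo_list_power[OF assms, of x 1] integrable_geo_list_power[OF assms, of x 2] by auto
  have n0: "0 \<le> m1" "0 \<le> m2" by (simp_all add: m1_def m2_def)
  have n1: "(\<integral>\<^sup>+qs. of_nat (sum_list qs) \<partial>?Q) = ennreal m1"
    using nn_integral_eq_integral[OF i1] by (simp add: m1_def ennreal_of_nat_eq_real_of_nat)
  have n2: "(\<integral>\<^sup>+qs. of_nat (sum_list qs) * of_nat (sum_list qs) \<partial>?Q) = ennreal m2"
    using nn_integral_eq_integral[OF i2]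
    by (simp add: m2_def ennreal_of_nat_eq_real_of_nat power2_eq_square flip: ennreal_mult)
  have b: "0 < ?b" "?b < 1" using assms by auto
  have sum: "(\<Sum>i<x. of_nat (Suc (qs ! i))) = (of_nat (sum_list qs + x) :: ennreal)"
    if "qs \<in> set_pmf ?Q" for qs
    using set_pmf_replicate_length[OF that]
    by (simp add: sum_list_sum_nth atLeast0LessThan sum.distrib)
  have "ennreal m1 = ennreal ?b * (\<integral>\<^sup>+qs. of_nat (sum_list qs + x) \<partial>?Q)"
    using geo_list_stein[OF assms, where g = "\<lambda>_. 1" and x = x] by (simp add: n1 nn_integral_pmf_cong[OF sum] del: of_nat_Suc of_nat_add)
  also have "\<dots> = ennreal (?b * (m1 + real x))"
    using n0 b by (simp add: nn_integral_add n1) (simp add: ennreal_of_nat_eq_real_of_nat ennreal_mult)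
  finally have "m1 = ?b * (m1 + real x)"
    using n0 b by (subst (asm) ennreal_inj) auto
  then show m1: "m1 = real x * mean_occ v"
    using b by (simp add: field_simps)
  have "ennreal m2 = ennreal ?b * (\<integral>\<^sup>+qs. of_nat ((sum_list qs + x) * (sum_list qs + 1)) \<partial>?Q)"
  proof -
    have sum2: "(\<Sum>i<x. of_nat (Suc (qs ! i)) * of_nat (sum_list (qs[i := Suc (qs ! i)]))) =
        (of_nat ((sum_list qs + x) * (sum_list qs + 1)) :: ennreal)"
      if q: "qs \<in> set_pmf ?Q" for qs
    proof -
      have l: "length qs = x" by (rule set_pmf_replicate_length[OF q])
      have "sum_list (qs[i := Suc (qs ! i)]) = sum_list qs + 1" if "i < x" for i
        using sum_list_take_increment[of i qs x] that l by simp
      then have "(\<Sum>i<x. of_nat (Suc (qs ! i)) * of_nat (sum_list (qs[i := Suc (qs ! i)]))) =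
          (\<Sum>i<x. of_nat (Suc (qs ! i)) * (of_nat (sum_list qs + 1) :: ennreal))"
        by (intro sum.cong) simp_all
      also have "\<dots> = of_nat ((sum_list qs + x) * (sum_list qs + 1))"
        unfolding sum_distrib_right[symmetric] sum[OF q] of_nat_mult ..
      finally show ?thesis .
    qed
    then show ?thesis
      using geo_list_stein[OF assms, where g = "\<lambda>qs. of_nat (sum_list qs)" and x = x]
      by (simp add: n2 nn_integral_pmf_cong[OF sum2] del: of_nat_Suc of_nat_add of_nat_mult)
  qed
  also have "(\<integral>\<^sup>+qs. of_nat ((sum_list qs + x) * (sum_list qs + 1)) \<partial>?Q) =
      (\<integral>\<^sup>+qs. of_nat (sum_list qs) * of_nat (sum_list qs) + of_nat (x + 1) * of_nat (sum_list qs) + of_nat x \<partial>?Q)"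
    by (simp add: algebra_simps)
  also have "\<dots> = ennreal m2 + of_nat (x + 1) * ennreal m1 + of_nat x"
    by (simp add: nn_integral_add nn_integral_cmult n1 n2 del: of_nat_add)
  also have "ennreal ?b * \<dots> = ennreal (?b * (m2 + (real x + 1) * m1 + real x))"
    using n0 b by (simp add: ennreal_of_nat_eq_real_of_nat ennreal_mult add_ac)
  finally have "m2 = ?b * (m2 + (real x + 1) * m1 + real x)"
    using n0 b by (subst (asm) ennreal_inj) auto
  then have "m2 * (1 - ?b) = ?b * ((real x + 1) * m1 + real x)"
    by (simp add: algebra_simps)
  then have "m2 = mean_occ v * ((real x + 1) * m1 + real x)"
    using b by (simp add: field_simps)
  moreover define r where "r = mean_occ v"
  ultimately have "m2 = r * ((real x + 1) * (real x * r) + real x)"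
    unfolding m1 by simp
  then show "m2 = (real x * mean_occ v)\<^sup>2 + real x * (mean_occ v * (1 + mean_occ v))"
    unfolding r_def[symmetric] by (simp add: power2_eq_square algebra_simps)
qed

lemma integrable_bernoulli_list:
  "integrable (measure_pmf (replicate_pmf M (bernoulli_pmf a))) (f :: bool list \<Rightarrow> real)"
proof (rule integrable_measure_pmf_finite)
  have "set_pmf (replicate_pmf M (bernoulli_pmf a)) \<subseteq> {xs. set xs \<subseteq> UNIV \<and> length xs = M}"
    by (auto simp: set_replicate_pmf)
  then show "finite (set_pmf (replicate_pmf M (bernoulli_pmf a)))"
    by (rule finite_subset) (rule finite_lists_length_eq, simp)
qed

lemma bernoulli_list_moments:
  assumes "0 < a" "a < 1"
  shows "(\<integral>w. real (trues w) \<partial>replicate_pmf M (bernoulli_pmf a)) = real M * a"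
    "(\<integral>w. real (trues w) ^ 2 \<partial>replicate_pmf M (bernoulli_pmf a)) = (real M * a)\<^sup>2 + real M * a * (1 - a)"
proof -
  let ?W = "replicate_pmf M (bernoulli_pmf a)"
  define m1 where "m1 = (\<integral>w. real (trues w) \<partial>?W)"
  define m2 where "m2 = (\<integral>w. real (trues w) ^ 2 \<partial>?W)"
  have n0: "0 \<le> m1" "0 \<le> m2" by (simp_all add: m1_def m2_def)
  have n1: "(\<integral>\<^sup>+w. of_nat (trues w) \<partial>?W) = ennreal m1"
    using nn_integral_eq_integral[OF integrable_bernoulli_list[of M a "\<lambda>w. real (trues w)"]]
    by (simp add: m1_def ennreal_of_nat_eq_real_of_nat)
  have n2: "(\<integral>\<^sup>+w. of_nat (trues w) * of_nat (trues w) \<partial>?W) = ennreal m2"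
    using nn_integral_eq_integral[OF integrable_bernoulli_list[of M a "\<lambda>w. real (trues w) ^ 2"]]
    by (simp add: m2_def ennreal_of_nat_eq_real_of_nat power2_eq_square flip: ennreal_mult)
  have tr: "trues w = (\<Sum>i<M. if w ! i then 1 else 0)" if "w \<in> set_pmf ?W" for w
    using set_pmf_replicate_length[OF that]
    by (simp add: sum_list_sum_nth atLeast0LessThan of_bool_def)
  have s1: "(\<Sum>i<M. if w ! i then 1 else 0) = (of_nat (trues w) :: ennreal)" if "w \<in> set_pmf ?W" for w
    unfolding tr[OF that] by (simp add: of_nat_sum if_distrib cong: if_cong)
  have "ennreal (real M * a) = ennreal a * ennreal m1 + ennreal (1 - a) * ennreal m1"
    using bernoulli_list_stein[where a = a and M = M and g = "\<lambda>_. 1"] assms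
    by (simp add: n1 nn_integral_pmf_cong[OF s1]) (simp add: ennreal_mult ennreal_of_nat_eq_real_of_nat)
  also have "\<dots> = ennreal m1"
  proof -
    have "ennreal a + ennreal (1 - a) = 1" using assms by (simp flip: ennreal_plus)
    then show ?thesis by (metis distrib_right mult_1)
  qed
  finally show m1: "m1 = real M * a"
    using n0 assms by (subst (asm) ennreal_inj) auto
  have s2: "(\<Sum>i<M. if w ! i then of_nat (trues (w[i := False])) else 0) + of_nat (trues w) =
      (of_nat (trues w) * of_nat (trues w) :: ennreal)" if w: "w \<in> set_pmf ?W" for w
  proof -
    have l: "length w = M" by (rule set_pmf_replicate_length[OF w])
    have "of_nat (trues (w[i := False])) + 1 = (of_nat (trues w) :: ennreal)" if "i < M" "w ! i" for i
    proof -
      have "trues (w[i := False]) + 1 = trues w"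
        using trues_take_remove[of i w "length w"] that l by simp
      then have "of_nat (trues (w[i := False]) + 1) = (of_nat (trues w) :: ennreal)" by simp
      then show ?thesis by (simp add: add.commute)
    qed
    then have "(\<Sum>i<M. if w ! i then of_nat (trues (w[i := False])) else 0) + (\<Sum>i<M. if w ! i then 1 else 0) =
      (\<Sum>i<M. (if w ! i then 1 else 0) * (of_nat (trues w) :: ennreal))"
      unfolding sum.distrib[symmetric] by (intro sum.cong) auto
    then show ?thesis unfolding sum_distrib_right[symmetric] s1[OF w] .
  qed
  let ?K = "\<integral>\<^sup>+w. (\<Sum>i<M. if w ! i then of_nat (trues (w[i := False])) else 0) \<partial>?W"
  have K: "?K + ennreal m1 = ennreal m2"
    unfolding n1[symmetric] n2[symmetric] by (subst nn_integral_add[symmetric]) (auto intro!: nn_integral_pmf_cong s2)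
  have "ennreal (real M * a * m1) + ennreal (1 - a) * ennreal m1 =
      ennreal a * ennreal m2 + ennreal (1 - a) * (?K + ennreal m1)"
    using bernoulli_list_stein[where a = a and M = M and g = "\<lambda>w. of_nat (trues w)"] assms n0
    by (simp add: n1 n2) (simp add: ennreal_mult ennreal_of_nat_eq_real_of_nat distrib_left add.assoc)
  then have "ennreal (real M * a * m1 + (1 - a) * m1) = ennreal (a * m2 + (1 - a) * m2)"
    unfolding K using assms n0 by (simp add: ennreal_mult)
  then have "real M * a * m1 + (1 - a) * m1 = m2"
  proof (subst (asm) ennreal_inj)
    show "0 \<le> real M * a * m1 + (1 - a) * m1" "0 \<le> a * m2 + (1 - a) * m2"
      using n0 assms by (auto intro!: add_nonneg_nonneg mult_nonneg_nonneg)
  qed (simp add: algebra_simps)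
  then show "m2 = (real M * a)\<^sup>2 + real M * a * (1 - a)"
    unfolding m1 by (simp add: power2_eq_square algebra_simps)
qed

section \<open>Covariances of the flux\<close>

type_synonym sample = "bool list list \<times> nat list \<times> bool list"

definition outcome :: "sample \<Rightarrow> nat list \<times> bool list" where
  "outcome y = (case y of (bs, qs, w) \<Rightarrow> tandem qs bs w)"

definition arrived :: "sample \<Rightarrow> real" where
  "arrived y = real (trues (snd (snd y)))"

definition initial :: "sample \<Rightarrow> real" where
  "initial y = real (sum_list (fst (snd y)))"

definition final :: "sample \<Rightarrow> real" where
  "final y = real (sum_list (fst (outcome y)))"

definition departed :: "sample \<Rightarrow> real" where
  "departed y = real (trues (snd (outcome y)))"

lemma sample_bounds:
  assumes "y \<in> set_pmf (model x M p u v)"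
  shows "fl y = departed y - initial y" "fl y = arrived y - final y"
    "0 \<le> arrived y" "arrived y \<le> M" "0 \<le> departed y" "departed y \<le> M" "0 \<le> initial y"
    "0 \<le> final y" "final y \<le> initial y + M"
proof -
  obtain bs qs w where y: "y = (bs, qs, w)" by (cases y)
  note l = set_pmf_model[OF assms[unfolded y]]
  have l': "length qs = length bs" "\<forall>b\<in>set bs. length b = length w" using l by auto
  show fl1: "fl y = departed y - initial y"
    by (simp add: y flux_def departed_def initial_def outcome_def)
  show fl2: "fl y = arrived y - final y"
    by (simp add: y flux_eq[OF l'] arrived_def final_def outcome_def)
  show "0 \<le> arrived y" "0 \<le> departed y" "0 \<le> initial y" "0 \<le> final y"
    by (simp_all add: arrived_def departed_def initial_def final_def)
  show a: "arrived y \<le> M"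
    using trues_le_length[of w] l by (simp add: y arrived_def)
  show "departed y \<le> M"
    using trues_le_length[of "snd (tandem qs bs w)"] tandem_length[OF l'] l
    by (simp add: y departed_def outcome_def)
  have "0 \<le> departed y" by (simp add: departed_def)
  with fl1 fl2 a show "final y \<le> initial y + M" by linarith
qed

lemma map_pmf_model:
  "map_pmf (\<lambda>y. fst (snd y)) (model x M p u v) = replicate_pmf x (geo v)"
  "map_pmf (\<lambda>y. snd (snd y)) (model x M p u v) = replicate_pmf M (bernoulli_pmf (arr p u))"
  "map_pmf snd (model x M p u v) =
    pair_pmf (replicate_pmf x (geo v)) (replicate_pmf M (bernoulli_pmf (arr p u)))"
proof -
  have "map_pmf (\<lambda>y. fst (snd y)) (model x M p u v) = map_pmf fst (map_pmf snd (model x M p u v))"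
    "map_pmf (\<lambda>y. snd (snd y)) (model x M p u v) = map_pmf snd (map_pmf snd (model x M p u v))"
    by (simp_all add: map_pmf_comp)
  moreover show "map_pmf snd (model x M p u v) =
    pair_pmf (replicate_pmf x (geo v)) (replicate_pmf M (bernoulli_pmf (arr p u)))"
    by (simp add: model_def map_snd_pair_pmf)
  ultimately show "map_pmf (\<lambda>y. fst (snd y)) (model x M p u v) = replicate_pmf x (geo v)"
    "map_pmf (\<lambda>y. snd (snd y)) (model x M p u v) = replicate_pmf M (bernoulli_pmf (arr p u))"
    by (simp_all add: map_fst_pair_pmf map_snd_pair_pmf)
qed

lemma map_pmf_outcome:
  assumes "0 < p" "p < 1" "0 < u"
  shows "map_pmf outcome (model x M p u u) =
    pair_pmf (replicate_pmf x (geo u)) (replicate_pmf M (bernoulli_pmf (arr p u)))"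
  using model_stationary[OF assms] by (simp add: outcome_def[abs_def])

lemma integrable_model:
  assumes v: "0 < v"
    and le: "\<And>y. y \<in> set_pmf (model x M p u v) \<Longrightarrow> \<bar>f y\<bar> \<le> C * (1 + initial y)\<^sup>2"
  shows "integrable (measure_pmf (model x M p u v)) f"
proof (rule integrable_pmf_bound[OF _ le])
  have "integrable (measure_pmf (replicate_pmf x (geo v))) (\<lambda>qs. C * (1 + real (sum_list qs))\<^sup>2)"
    using integrable_geo_list_power[OF v, of x 1] integrable_geo_list_power[OF v, of x 2]
    by (auto simp: power2_sum)
  then have "integrable (measure_pmf (map_pmf (\<lambda>y. fst (snd y)) (model x M p u v)))
      (\<lambda>qs. C * (1 + real (sum_list qs))\<^sup>2)"
    by (simp add: map_pmf_model)
  then show "integrable (measure_pmf (model x M p u v)) (\<lambda>y. C * (1 + initial y)\<^sup>2)"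
    by (simp add: integrable_map_pmf_eq initial_def)
qed

lemma integrable_model_product:
  assumes v: "0 < v"
    and f: "\<And>y. y \<in> set_pmf (model x M p u v) \<Longrightarrow> \<bar>f y\<bar> \<le> C * (1 + initial y)"
    and g: "\<And>y. y \<in> set_pmf (model x M p u v) \<Longrightarrow> \<bar>g y\<bar> \<le> D * (1 + initial y)"
  shows "integrable (measure_pmf (model x M p u v)) (\<lambda>y. f y * g y)"
proof (rule integrable_model[OF v])
  fix y assume y: "y \<in> set_pmf (model x M p u v)"
  have "\<bar>f y\<bar> * \<bar>g y\<bar> \<le> (C * (1 + initial y)) * (D * (1 + initial y))"
    using f[OF y] g[OF y] order_trans[OF abs_ge_zero f[OF y]] by (intro mult_mono) auto
  then show "\<bar>f y * g y\<bar> \<le> (C * D) * (1 + initial y)\<^sup>2"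
    by (simp add: abs_mult power2_eq_square mult_ac)
qed

lemma sample_linear_bounds:
  assumes "y \<in> set_pmf (model x M p u v)"
  shows "\<bar>arrived y\<bar> \<le> (1 + real M) * (1 + initial y)" "\<bar>departed y\<bar> \<le> (1 + real M) * (1 + initial y)"
    "\<bar>initial y\<bar> \<le> (1 + real M) * (1 + initial y)" "\<bar>final y\<bar> \<le> (1 + real M) * (1 + initial y)"
    "\<bar>fl y\<bar> \<le> (1 + real M) * (1 + initial y)" "\<bar>1\<bar> \<le> (1 + real M) * (1 + initial y)"
    "0 \<le> real M - fl y" "\<bar>real M - fl y\<bar> \<le> (1 + real M) * (1 + initial y)"
proof -
  note b = sample_bounds[OF assms]
  have "0 \<le> real M * initial y" using b by auto
  then have "initial y + real M + 1 \<le> (1 + real M) * (1 + initial y)"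
    by (simp add: algebra_simps)
  with b show "\<bar>arrived y\<bar> \<le> (1 + real M) * (1 + initial y)" "\<bar>departed y\<bar> \<le> (1 + real M) * (1 + initial y)"
    "\<bar>initial y\<bar> \<le> (1 + real M) * (1 + initial y)" "\<bar>final y\<bar> \<le> (1 + real M) * (1 + initial y)"
    "\<bar>fl y\<bar> \<le> (1 + real M) * (1 + initial y)" "\<bar>1\<bar> \<le> (1 + real M) * (1 + initial y)"
    "0 \<le> real M - fl y" "\<bar>real M - fl y\<bar> \<le> (1 + real M) * (1 + initial y)"
    by (simp_all only: abs_le_iff, linarith+)
qed

lemma integrable_sample:
  assumes v: "0 < v"
  shows "integrable (measure_pmf (model x M p u v)) arrived"
    "integrable (measure_pmf (model x M p u v)) departed"
    "integrable (measure_pmf (model x M p u v)) initial"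
    "integrable (measure_pmf (model x M p u v)) final"
    "integrable (measure_pmf (model x M p u v)) fl"
    "integrable (measure_pmf (model x M p u v)) (\<lambda>y. arrived y * initial y)"
    "integrable (measure_pmf (model x M p u v)) (\<lambda>y. arrived y * departed y)"
    "integrable (measure_pmf (model x M p u v)) (\<lambda>y. arrived y * final y)"
    "integrable (measure_pmf (model x M p u v)) (\<lambda>y. initial y * final y)"
    "integrable (measure_pmf (model x M p u v)) (\<lambda>y. initial y * departed y)"
    "integrable (measure_pmf (model x M p u v)) (\<lambda>y. final y * departed y)"
    "integrable (measure_pmf (model x M p u v)) (\<lambda>y. initial y * initial y)"
    "integrable (measure_pmf (model x M p u v)) (\<lambda>y. arrived y * arrived y)"
    "integrable (measure_pmf (model x M p u v)) (\<lambda>y. departed y * departed y)"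
    "integrable (measure_pmf (model x M p u v)) (\<lambda>y. final y * final y)"
    "integrable (measure_pmf (model x M p u v)) (\<lambda>y. fl y * fl y)"
    "integrable (measure_pmf (model x M p u v)) (\<lambda>y. initial y * (real M - fl y))"
proof -
  note I = integrable_model_product[OF v, where C = "1 + real M" and D = "1 + real M"]
  have I1: "integrable (measure_pmf (model x M p u v)) f"
    if "\<And>y. y \<in> set_pmf (model x M p u v) \<Longrightarrow> \<bar>f y\<bar> \<le> (1 + real M) * (1 + initial y)" for f
    using I[of x M p u f "\<lambda>_. 1"] that sample_linear_bounds(6) by simp
  show "integrable (measure_pmf (model x M p u v)) arrived"
    "integrable (measure_pmf (model x M p u v)) departed"
    "integrable (measure_pmf (model x M p u v)) initial"
    "integrable (measure_pmf (model x M p u v)) final"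
    "integrable (measure_pmf (model x M p u v)) fl"
    by (rule I1, erule sample_linear_bounds)+
  show "integrable (measure_pmf (model x M p u v)) (\<lambda>y. arrived y * initial y)"
    "integrable (measure_pmf (model x M p u v)) (\<lambda>y. arrived y * departed y)"
    "integrable (measure_pmf (model x M p u v)) (\<lambda>y. arrived y * final y)"
    "integrable (measure_pmf (model x M p u v)) (\<lambda>y. initial y * final y)"
    "integrable (measure_pmf (model x M p u v)) (\<lambda>y. initial y * departed y)"
    "integrable (measure_pmf (model x M p u v)) (\<lambda>y. final y * departed y)"
    "integrable (measure_pmf (model x M p u v)) (\<lambda>y. initial y * initial y)"
    "integrable (measure_pmf (model x M p u v)) (\<lambda>y. arrived y * arrived y)"
    "integrable (measure_pmf (model x M p u v)) (\<lambda>y. departed y * departed y)"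
    "integrable (measure_pmf (model x M p u v)) (\<lambda>y. final y * final y)"
    "integrable (measure_pmf (model x M p u v)) (\<lambda>y. fl y * fl y)"
    "integrable (measure_pmf (model x M p u v)) (\<lambda>y. initial y * (real M - fl y))"
    by (rule I; erule sample_linear_bounds)+
qed

lemma expectation_pair_pmf_mult:
  fixes f :: "'a \<Rightarrow> real" and g :: "'b \<Rightarrow> real"
  assumes "\<And>x. 0 \<le> f x" "\<And>y. 0 \<le> g y" "integrable (measure_pmf A) f" "integrable (measure_pmf B) g"
  shows "(\<integral>z. f (fst z) * g (snd z) \<partial>pair_pmf A B) = (\<integral>x. f x \<partial>A) * (\<integral>y. g y \<partial>B)"
proof -
  have "(\<integral>\<^sup>+z. ennreal (f (fst z) * g (snd z)) \<partial>pair_pmf A B) =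
    (\<integral>\<^sup>+x. ennreal (f x) \<partial>A) * (\<integral>\<^sup>+y. ennreal (g y) \<partial>B)"
    using assms by (simp add: nn_integral_pair_pmf' ennreal_mult nn_integral_cmult nn_integral_multc)
  also have "\<dots> = ennreal ((\<integral>x. f x \<partial>A) * (\<integral>y. g y \<partial>B))"
    using assms by (simp add: nn_integral_eq_integral ennreal_mult integral_nonneg)
  finally show ?thesis
    using assms by (simp add: integral_eq_nn_integral enn2real_ennreal integral_nonneg)
qed

lemma model_moments:
  assumes p: "0 < p" "p < 1" and v: "0 < v"
  shows "(\<integral>y. arrived y \<partial>model x M p u v) = real M * arr p u"
    "(\<integral>y. initial y \<partial>model x M p u v) = real x * mean_occ v"
    "(\<integral>y. arrived y * initial y \<partial>model x M p u v) = real M * arr p u * (real x * mean_occ v)"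
    "(\<integral>y. arrived y * arrived y \<partial>model x M p u v) = (real M * arr p u)\<^sup>2 + real M * arr p u * (1 - arr p u)"
    "(\<integral>y. initial y * initial y \<partial>model x M p u v) =
      (real x * mean_occ v)\<^sup>2 + real x * (mean_occ v * (1 + mean_occ v))"
proof -
  note a = arr_bounds[OF p, of u]
  have q: "(\<integral>y. f (fst (snd y)) \<partial>model x M p u v) = (\<integral>qs. f qs \<partial>replicate_pmf x (geo v))" for f :: "nat list \<Rightarrow> real"
    unfolding map_pmf_model(1)[of x M p u v, symmetric] by simp
  have w: "(\<integral>y. f (snd (snd y)) \<partial>model x M p u v) = (\<integral>w. f w \<partial>replicate_pmf M (bernoulli_pmf (arr p u)))"
    for f :: "bool list \<Rightarrow> real"
    unfolding map_pmf_model(2)[of x M p u v, symmetric] by simp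
  show "(\<integral>y. arrived y \<partial>model x M p u v) = real M * arr p u"
    unfolding arrived_def using w[of "\<lambda>w. real (trues w)"] bernoulli_list_moments(1)[OF a, of M] by simp
  show "(\<integral>y. initial y \<partial>model x M p u v) = real x * mean_occ v"
    unfolding initial_def using q[of "\<lambda>w. real (sum_list w)"] geo_list_moments(1)[OF v, of x] by simp
  show "(\<integral>y. arrived y * arrived y \<partial>model x M p u v) = (real M * arr p u)\<^sup>2 + real M * arr p u * (1 - arr p u)"
    unfolding arrived_def w[of "\<lambda>w. real (trues w) * real (trues w)"]
    using bernoulli_list_moments(2)[OF a, of M] by (simp add: power2_eq_square)
  show "(\<integral>y. initial y * initial y \<partial>model x M p u v) =
      (real x * mean_occ v)\<^sup>2 + real x * (mean_occ v * (1 + mean_occ v))"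
    unfolding initial_def q[of "\<lambda>w. real (sum_list w) * real (sum_list w)"]
    using geo_list_moments(2)[OF v, of x] by (simp add: power2_eq_square)
  have "(\<integral>y. arrived y * initial y \<partial>model x M p u v) =
      (\<integral>z. real (sum_list (fst z)) * real (trues (snd z)) \<partial>map_pmf snd (model x M p u v))"
    by (simp add: arrived_def initial_def mult.commute)
  also have "\<dots> = real x * mean_occ v * (real M * arr p u)"
    unfolding map_pmf_model
    by (subst expectation_pair_pmf_mult[where f = "\<lambda>qs. real (sum_list qs)" and g = "\<lambda>w. real (trues w)"])
      (use integrable_geo_list_power[OF v, of x 1] in
        \<open>simp_all add: integrable_bernoulli_list geo_list_moments[OF v] bernoulli_list_moments[OF a]\<close>)
  finally show "(\<integral>y. arrived y * initial y \<partial>model x M p u v) = real M * arr p u * (real x * mean_occ v)"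
    by simp
qed

text \<open>By stationarity the final and departed particles have the joint law of the initial and
  arrived ones, so the moments are copied from \<open>model_moments\<close>.\<close>

lemma outcome_moments:
  assumes p: "0 < p" "p < 1" and u: "0 < u"
  shows "(\<integral>y. departed y \<partial>model x M p u u) = real M * arr p u"
    "(\<integral>y. final y \<partial>model x M p u u) = real x * mean_occ u"
    "(\<integral>y. final y * departed y \<partial>model x M p u u) = real M * arr p u * (real x * mean_occ u)"
    "(\<integral>y. departed y * departed y \<partial>model x M p u u) = (real M * arr p u)\<^sup>2 + real M * arr p u * (1 - arr p u)"
    "(\<integral>y. final y * final y \<partial>model x M p u u) =
      (real x * mean_occ u)\<^sup>2 + real x * (mean_occ u * (1 + mean_occ u))"
proof -
  have eq: "(\<integral>y. f (outcome y) \<partial>model x M p u u) = (\<integral>y. f (snd y) \<partial>model x M p u u)"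
    for f :: "nat list \<times> bool list \<Rightarrow> real"
  proof -
    have "(\<integral>y. f y \<partial>map_pmf outcome (model x M p u u)) = (\<integral>y. f y \<partial>map_pmf snd (model x M p u u))"
      unfolding map_pmf_outcome[OF p u] map_pmf_model ..
    then show ?thesis by simp
  qed
  note m = model_moments[OF p u, of x M u]
  show "(\<integral>y. departed y \<partial>model x M p u u) = real M * arr p u"
    using m(1) eq[of "\<lambda>z. real (trues (snd z))"] by (simp add: departed_def arrived_def)
  show "(\<integral>y. final y \<partial>model x M p u u) = real x * mean_occ u"
    using m(2) eq[of "\<lambda>z. real (sum_list (fst z))"] by (simp add: final_def initial_def)
  show "(\<integral>y. final y * departed y \<partial>model x M p u u) = real M * arr p u * (real x * mean_occ u)"
    using m(3) eq[of "\<lambda>z. real (sum_list (fst z)) * real (trues (snd z))"]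
    by (simp add: final_def initial_def departed_def arrived_def mult.commute)
  show "(\<integral>y. departed y * departed y \<partial>model x M p u u) = (real M * arr p u)\<^sup>2 + real M * arr p u * (1 - arr p u)"
    using m(4) eq[of "\<lambda>z. real (trues (snd z)) * real (trues (snd z))"]
    by (simp add: departed_def arrived_def)
  show "(\<integral>y. final y * final y \<partial>model x M p u u) =
      (real x * mean_occ u)\<^sup>2 + real x * (mean_occ u * (1 + mean_occ u))"
    using m(5) eq[of "\<lambda>z. real (sum_list (fst z)) * real (sum_list (fst z))"]
    by (simp add: final_def initial_def)
qed

text \<open>In the stationary case initial and final particles have the same mean, so the subtracted
  square is the product of the two means.\<close>

definition covariance :: "nat \<Rightarrow> nat \<Rightarrow> real \<Rightarrow> real \<Rightarrow> real" where
  "covariance x M p u = (\<integral>y. initial y * final y \<partial>model x M p u u) - (real x * mean_occ u)\<^sup>2"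

lemma expectation_cong_pmf:
  fixes f g :: "'a \<Rightarrow> real"
  assumes "\<And>x. x \<in> set_pmf p \<Longrightarrow> f x = g x"
  shows "(\<integral>x. f x \<partial>measure_pmf p) = (\<integral>x. g x \<partial>measure_pmf p)"
  using assms by (intro integral_cong_AE) (simp_all add: AE_measure_pmf_iff)

text \<open>Arrived and initial particles are independent, so are final and departed ones, and
  arrived minus final equals departed minus initial. These facts leave a single unknown second
  moment, the one in \<open>covariance\<close>.\<close>

lemma stationary_identities:
  assumes p: "0 < p" "p < 1" and u: "0 < u"
  defines "a \<equiv> arr p u" and "\<rho> \<equiv> mean_occ u"
  shows "(\<integral>y. fl y \<partial>model x M p u u) = real M * a - real x * \<rho>"
    "(\<integral>y. initial y * (real M - fl y) \<partial>model x M p u u) =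
      real x * \<rho> * (real M - (real M * a - real x * \<rho>)) + covariance x M p u"
    "(\<integral>y. arrived y * departed y \<partial>model x M p u u) =
      (real M * a)\<^sup>2 + (real M * a * (1 - a) - real x * (\<rho> * (1 + \<rho>)) + covariance x M p u)"
    "(\<integral>y. fl y * fl y \<partial>model x M p u u) =
      (real M * a - real x * \<rho>)\<^sup>2 + (real M * a * (1 - a) - real x * (\<rho> * (1 + \<rho>)) + 2 * covariance x M p u)"
proof -
  let ?m = "measure_pmf (model x M p u u)"
  note m = model_moments[OF p u, of x M u, folded a_def \<rho>_def]
    and o = outcome_moments[OF p u, of x M, folded a_def \<rho>_def] and i = integrable_sample[OF u, of x M p u]
  define st where "st = (\<integral>y. initial y * final y \<partial>?m)"
  have cov: "covariance x M p u = st - (real x * \<rho>)\<^sup>2"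
    by (simp add: covariance_def st_def \<rho>_def)
  show "(\<integral>y. fl y \<partial>?m) = real M * a - real x * \<rho>"
  proof -
    have "(\<integral>y. fl y \<partial>?m) = (\<integral>y. departed y - initial y \<partial>?m)"
      by (intro expectation_cong_pmf sample_bounds)
    then show ?thesis using i m o by simp
  qed
  have ws: "(\<integral>y. arrived y * initial y \<partial>?m) = real M * a * (real x * \<rho>)" by (rule m)
  show "(\<integral>y. initial y * (real M - fl y) \<partial>?m) =
      real x * \<rho> * (real M - (real M * a - real x * \<rho>)) + covariance x M p u"
  proof -
    have "(\<integral>y. initial y * (real M - fl y) \<partial>?m) =
        (\<integral>y. real M * initial y - arrived y * initial y + initial y * final y \<partial>?m)"
      by (intro expectation_cong_pmf) (simp add: sample_bounds(2) algebra_simps)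
    also have "\<dots> = real M * (real x * \<rho>) - real M * a * (real x * \<rho>) + st"
      using i m by (simp add: st_def)
    finally show ?thesis by (simp add: cov power2_eq_square algebra_simps)
  qed
  have se: "(\<integral>y. initial y * departed y \<partial>?m) =
      real M * a * (real x * \<rho>) - st + ((real x * \<rho>)\<^sup>2 + real x * (\<rho> * (1 + \<rho>)))"
  proof -
    have "(\<integral>y. initial y * departed y \<partial>?m) =
        (\<integral>y. arrived y * initial y - initial y * final y + initial y * initial y \<partial>?m)"
    proof (intro expectation_cong_pmf)
      fix y assume y: "y \<in> set_pmf (model x M p u u)"
      have eq: "departed y = arrived y - final y + initial y"
        using sample_bounds(1,2)[OF y] by simp
      show "initial y * departed y = arrived y * initial y - initial y * final y + initial y * initial y"
        unfolding eq by (simp add: algebra_simps)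
    qed
    also have "\<dots> = real M * a * (real x * \<rho>) - st + ((real x * \<rho>)\<^sup>2 + real x * (\<rho> * (1 + \<rho>)))"
      using i m by (simp add: st_def)
    finally show ?thesis .
  qed
  show we: "(\<integral>y. arrived y * departed y \<partial>?m) =
      (real M * a)\<^sup>2 + (real M * a * (1 - a) - real x * (\<rho> * (1 + \<rho>)) + covariance x M p u)"
  proof -
    have "(\<integral>y. arrived y * departed y \<partial>?m) =
        (\<integral>y. final y * departed y + departed y * departed y - initial y * departed y \<partial>?m)"
    proof (intro expectation_cong_pmf)
      fix y assume y: "y \<in> set_pmf (model x M p u u)"
      have eq: "arrived y = departed y + final y - initial y"
        using sample_bounds(1,2)[OF y] by simp
      show "arrived y * departed y = final y * departed y + departed y * departed y - initial y * departed y"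
        unfolding eq by (simp add: algebra_simps)
    qed
    also have "\<dots> = real M * a * (real x * \<rho>) + ((real M * a)\<^sup>2 + real M * a * (1 - a)) -
        (\<integral>y. initial y * departed y \<partial>?m)"
      using i o by simp
    finally show ?thesis unfolding se cov by simp
  qed
  show "(\<integral>y. fl y * fl y \<partial>?m) =
      (real M * a - real x * \<rho>)\<^sup>2 + (real M * a * (1 - a) - real x * (\<rho> * (1 + \<rho>)) + 2 * covariance x M p u)"
  proof -
    have "(\<integral>y. fl y * fl y \<partial>?m) =
      (\<integral>y. arrived y * departed y - arrived y * initial y - final y * departed y + initial y * final y \<partial>?m)"
    proof (intro expectation_cong_pmf)
      fix y assume y: "y \<in> set_pmf (model x M p u u)"
      \<comment> \<open>One factor is taken in each of the two forms of the flux, so that every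
        product that occurs is known or has just been reduced to \<open>covariance\<close>.\<close>
      have eq: "fl y * fl y = (arrived y - final y) * (departed y - initial y)"
        using sample_bounds(1,2)[OF y] by simp
      show "fl y * fl y = arrived y * departed y - arrived y * initial y - final y * departed y + initial y * final y"
        unfolding eq by (simp add: algebra_simps)
    qed
    also have "\<dots> = (\<integral>y. arrived y * departed y \<partial>?m) - 2 * (real M * a * (real x * \<rho>)) + st"
      using i m o by (simp add: st_def)
    finally show ?thesis unfolding we cov by (simp add: power2_eq_square algebra_simps)
  qed
qed

lemma exp_neg_flux_bound:
  assumes p: "0 < p" "p < 1" and "0 < u" "0 < s" "s < v"
  shows "integrable (measure_pmf (model x M p u v)) (\<lambda>y. exp (- s * fl y))"
    "(\<integral>y. exp (- s * fl y) \<partial>model x M p u v) \<le>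
      exp (log_partition x M p (u + s) - log_partition x M p u) +
      exp (log_partition x M p v - log_partition x M p (v - s))"
proof -
  note b = nn_integral_exp_neg_flux_bound[OF assms, of x M]
  show i: "integrable (measure_pmf (model x M p u v)) (\<lambda>y. exp (- s * fl y))"
    using b by (intro integrable_pmf_nonneg) (auto intro: order.strict_trans1)
  have eq: "(\<integral>\<^sup>+y. ennreal (exp (- s * fl y)) \<partial>model x M p u v) =
      ennreal (\<integral>y. exp (- s * fl y) \<partial>model x M p u v)"
    by (intro nn_integral_eq_integral i) simp
  show "(\<integral>y. exp (- s * fl y) \<partial>model x M p u v) \<le>
      exp (log_partition x M p (u + s) - log_partition x M p u) +
      exp (log_partition x M p v - log_partition x M p (v - s))"
    using b unfolding eq by (subst (asm) ennreal_le_iff) (auto intro: add_nonneg_nonneg)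
qed

text \<open>Jensen's inequality in the form \<open>y \<le> (exp (s y) - 1) / s\<close>.\<close>

lemma mean_flux_bound:
  assumes p: "0 < p" "p < 1" and "0 < u" "0 < s" "s < v"
  shows "(\<integral>y. - fl y \<partial>model x M p u v) - k \<le>
    (exp (log_partition x M p (u + s) - log_partition x M p u - s * k) +
     exp (log_partition x M p v - log_partition x M p (v - s) - s * k) - 1) / s"
proof -
  let ?m = "measure_pmf (model x M p u v)"
  have v: "0 < v" using assms by simp
  note e = exp_neg_flux_bound[OF assms, of x M]
  have i: "integrable ?m (\<lambda>y. (exp (- s * k) * exp (- s * fl y) - 1) / s)"
    using e(1) by simp
  have "(\<integral>y. - fl y \<partial>?m) - k = (\<integral>y. - fl y - k \<partial>?m)"
    using integrable_sample(5)[OF v, of x M p u] by simp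
  also have "\<dots> \<le> (\<integral>y. (exp (- s * k) * exp (- s * fl y) - 1) / s \<partial>?m)"
  proof (rule integral_mono)
    show "integrable ?m (\<lambda>y. - fl y - k)"
      using integrable_sample(5)[OF v, of x M p u] by simp
    fix y
    have "1 + s * (- fl y - k) \<le> exp (s * (- fl y - k))" by simp
    also have "\<dots> = exp (- s * k) * exp (- s * fl y)"
      by (simp add: mult_exp_exp algebra_simps)
    finally show "- fl y - k \<le> (exp (- s * k) * exp (- s * fl y) - 1) / s"
      using assms by (simp add: field_simps)
  qed (rule i)
  also have "\<dots> = (exp (- s * k) * (\<integral>y. exp (- s * fl y) \<partial>?m) - 1) / s"
    using e(1) by simp
  also have "\<dots> \<le> (exp (- s * k) * (exp (log_partition x M p (u + s) - log_partition x M p u) +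
      exp (log_partition x M p v - log_partition x M p (v - s))) - 1) / s"
    using e(2) assms by (intro divide_right_mono diff_right_mono mult_left_mono) auto
  finally show ?thesis
    by (simp add: distrib_left mult_exp_exp algebra_simps)
qed

section \<open>Covariance and excess against differences of mean fluxes\<close>

definition mean_flux :: "nat \<Rightarrow> nat \<Rightarrow> real \<Rightarrow> real \<Rightarrow> real" where
  "mean_flux x M p u = real M * arr p u - real x * mean_occ u"

text \<open>The Stein identity turns the covariance into \<open>mean_occ u * r\<close> with r the
  weight of the sites before the exit, and the coupling with the smaller fugacity \<open>v'\<close>
  bounds r by a difference of mean fluxes.\<close>

lemma covariance_comparison:
  assumes p: "0 < p" "p < 1" and v: "0 < v'" "v' < u"
  shows "0 \<le> covariance x M p u"
    "covariance x M p u \<le> (mean_flux x M p u + (\<integral>y. - fl y \<partial>model x M p u v')) / (u - v')"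
proof -
  have u: "0 < u" using v by simp
  define z where "z = 1 - (1 - exp (- v')) / (1 - exp (- u))"
  note z = increment_parameter_bounds[OF v z_def]
  let ?m = "measure_pmf (model x M p u u)" and ?m' = "measure_pmf (model x M p u v')"
  define m0 where "m0 = (\<integral>y. real M - fl y \<partial>?m)"
  define m0' where "m0' = (\<integral>y. real M - fl y \<partial>?m')"
  define m1 where "m1 = (\<integral>y. initial y * (real M - fl y) \<partial>?m)"
  have ae: "AE y in measure_pmf (model x M p u w). 0 \<le> real M - fl y" for w
    unfolding AE_measure_pmf_iff by (intro ballI sample_linear_bounds(7))
  have ae1: "AE y in ?m. 0 \<le> initial y * (real M - fl y)"
    unfolding AE_measure_pmf_iff
    by (intro ballI mult_nonneg_nonneg sample_linear_bounds(7)) (auto simp: initial_def)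
  have int: "integrable (measure_pmf (model x M p u w)) (\<lambda>y. real M - fl y)" if "0 < w" for w
    using integrable_sample(5)[OF that, of x M p u] by simp
  have nn: "(\<integral>\<^sup>+y. ennreal (real M - fl y) \<partial>model x M p u w) = ennreal (\<integral>y. real M - fl y \<partial>model x M p u w)"
    if "0 < w" for w
    by (rule nn_integral_eq_integral[OF int[OF that] ae])
  have nn1: "(\<integral>\<^sup>+y. of_nat (sum_list (fst (snd y))) * ennreal (real M - fl y) \<partial>?m) = ennreal m1"
  proof -
    have "(\<integral>\<^sup>+y. of_nat (sum_list (fst (snd y))) * ennreal (real M - fl y) \<partial>?m) =
      (\<integral>\<^sup>+y. ennreal (initial y * (real M - fl y)) \<partial>?m)"
      by (simp add: initial_def ennreal_of_nat_eq_real_of_nat ennreal_mult')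
    also have "\<dots> = ennreal m1"
      unfolding m1_def
      by (rule nn_integral_eq_integral[OF integrable_sample(17)[OF u] ae1])
    finally show ?thesis .
  qed
  have n: "0 \<le> m0" "0 \<le> m0'" "0 \<le> m1"
    unfolding m0_def m0'_def m1_def
    by (rule integral_nonneg_AE, rule ae ae1)+
  obtain R where R1: "ennreal m1 = ennreal (exp (- u)) * (ennreal m1 + of_nat x * ennreal m0 + R)"
    and R2: "ennreal m0 + ennreal (z / (1 - z)) * R \<le> ennreal m0'"
    using flux_site_comparison[OF v z_def, of x M p u] unfolding nn1 nn[OF u] nn[OF v(1)]
    by (auto simp: m0_def m0'_def)
  have "R \<noteq> \<top>"
    using R1 by (auto simp: ennreal_mult_eq_top_iff ennreal_mult_top)
  then obtain r where r: "0 \<le> r" "R = ennreal r"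
    by (cases R) auto
  have "ennreal m1 = ennreal (exp (- u) * (m1 + real x * m0 + r))"
    using R1 n r by (simp add: ennreal_of_nat_eq_real_of_nat ennreal_mult)
  then have "m1 = exp (- u) * (m1 + real x * m0 + r)"
    using n r by (subst (asm) ennreal_inj) auto
  then have "m1 * (1 - exp (- u)) = exp (- u) * (real x * m0 + r)"
    by (simp add: algebra_simps)
  then have "m1 = mean_occ u * (real x * m0 + r)"
    using u by (simp add: eq_divide_eq)
  then have m1: "m1 = real x * mean_occ u * m0 + mean_occ u * r"
    by (simp only: distrib_left) (simp only: mult_ac)
  have m0: "m0 = real M - mean_flux x M p u"
    unfolding m0_def mean_flux_def using stationary_identities(1)[OF p u, of x M]
      integrable_sample(5)[OF u, of x M p u] by simp
  have cov: "covariance x M p u = mean_occ u * r"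
    using stationary_identities(2)[OF p u, of x M] m1 unfolding m1_def[symmetric] m0 mean_flux_def by simp
  show "0 \<le> covariance x M p u"
    unfolding cov using r u by simp
  have "ennreal (m0 + z / (1 - z) * r) \<le> ennreal m0'"
  proof -
    have "ennreal (z / (1 - z) * r) = ennreal (z / (1 - z)) * ennreal r"
      using z r by (intro ennreal_mult) auto
    then show ?thesis
      using R2 n r z by (subst ennreal_plus) auto
  qed
  then have "z / (1 - z) * r \<le> m0' - m0"
    using n by (simp add: ennreal_le_iff)
  also have "m0' - m0 = mean_flux x M p u + (\<integral>y. - fl y \<partial>?m')"
    unfolding m0 m0'_def using integrable_sample(5)[OF v(1), of x M p u] by simp
  finally have zr: "z / (1 - z) * r \<le> mean_flux x M p u + (\<integral>y. - fl y \<partial>?m')" .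
  \<comment> \<open>By convexity of the exponential the rate of added particles is at least the mean
    occupation times the distance of the fugacities. The factor \<open>mean_occ u\<close> then
    cancels against the one in the covariance.\<close>
  have "mean_occ u * (u - v') \<le> z / (1 - z)"
  proof -
    have 1: "1 - exp (- u) > 0" "1 - exp (- v') > 0" "1 - exp (- v') < 1" using v by auto
    have "z / (1 - z) = (exp (- v') - exp (- u)) / (1 - exp (- v'))"
    proof -
      have "z = ((1 - exp (- u)) - (1 - exp (- v'))) / (1 - exp (- u))"
        using 1 unfolding z_def diff_divide_distrib[of "1 - exp (- u)"] by (subst divide_self) auto
      moreover have "1 - z = (1 - exp (- v')) / (1 - exp (- u))" by (simp add: z_def)
      ultimately show ?thesis using 1 by simp
    qed
    also have "exp (- v') - exp (- u) = exp (- u) * (exp (u - v') - 1)"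
      by (simp add: algebra_simps mult_exp_exp)
    also have "exp (- u) * (exp (u - v') - 1) / (1 - exp (- v')) \<ge>
        exp (- u) * (u - v') / (1 - exp (- u))"
    proof (intro frac_le mult_left_mono)
      show "u - v' \<le> exp (u - v') - 1"
        using exp_ge_add_one_self[of "u - v'"] by linarith
    qed (use v 1 in auto)
    finally show ?thesis by simp
  qed
  then have "mean_occ u * (u - v') * r \<le> z / (1 - z) * r"
    using r by (intro mult_right_mono) auto
  also note zr
  finally have "mean_occ u * r * (u - v') \<le> mean_flux x M p u + (\<integral>y. - fl y \<partial>?m')"
    by (simp only: mult_ac)
  then show "covariance x M p u \<le> (mean_flux x M p u + (\<integral>y. - fl y \<partial>?m')) / (u - v')"
    unfolding cov using v by (subst pos_le_divide_eq) auto
qed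

text \<open>Since k is the derivative of F at u, the first exponent is of second order in s, while
  the second is to leading order - s \<delta> times the second derivative of F at u, which is
  negative below the characteristic.\<close>

lemma covariance_upper_bound:
  fixes x M :: nat and p s \<delta> u :: real
  assumes p: "0 < p" "p < 1" and "0 < s" "0 < \<delta>" "s + \<delta> < u"
  defines "F \<equiv> log_partition x M p" and "k \<equiv> - mean_flux x M p u"
  shows "covariance x M p u \<le>
    (exp (F (u + s) - F u - s * k) + exp (F (u - \<delta>) - F (u - \<delta> - s) - s * k) - 1) / (\<delta> * s)"
proof -
  have "covariance x M p u \<le> ((\<integral>y. - fl y \<partial>model x M p u (u - \<delta>)) - k) / \<delta>"
    using covariance_comparison(2)[OF p, of "u - \<delta>" u x M] assms by (simp add: k_def)
  also have "\<dots> \<le> ((exp (F (u + s) - F u - s * k) + exp (F (u - \<delta>) - F (u - \<delta> - s) - s * k) - 1) / s) / \<delta>"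
    using assms unfolding F_def by (intro divide_right_mono mean_flux_bound) auto
  finally show ?thesis by (simp add: mult.commute)
qed

text \<open>
  By the stationary identities this is the covariance of the flux with the number of arrivals, as
  \<open>covariance\<close> is the one of the negative flux with the initial number of particles.
\<close>

definition excess :: "nat \<Rightarrow> nat \<Rightarrow> real \<Rightarrow> real \<Rightarrow> real" where
  "excess x M p u = covariance x M p u - real x * (mean_occ u * (1 + mean_occ u)) + real M * arr p u * (1 - arr p u)"

lemma arr_strict_antimono:
  assumes "0 < p" "p < 1" "u < u'"
  shows "arr p u' < arr p u"
proof -
  have "0 < p * exp (- u')" "0 < p * exp (- u)" using assms by auto
  then have pos: "0 < 1 - p + p * exp (- u')" "0 < 1 - p + p * exp (- u)" using assms by linarith+
  have "p * (1 - p) * exp (- u') < p * (1 - p) * exp (- u)"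
    using assms by auto
  then show ?thesis
    unfolding arr_def using pos by (simp add: divide_less_eq less_divide_eq) (simp add: algebra_simps)
qed

text \<open>The argument of \<open>covariance_comparison\<close> in the direction of time: the
  excess is \<open>(1 - arr p u) * r\<close> with r the mean number of arrivals before the exit, and
  thinning the arrivals by \<theta> lowers the mean flux by at least \<theta> r.\<close>

lemma excess_comparison:
  assumes p: "0 < p" "p < 1" and u: "0 < u" "u < u'"
  defines "\<theta> \<equiv> 1 - arr p u' / arr p u"
  shows "0 \<le> excess x M p u"
    "excess x M p u \<le> (mean_flux x M p u - (\<integral>y. fl y \<partial>model x M p u' u)) / \<theta>"
    "0 < \<theta>"
proof -
  note a = arr_bounds[OF p]
  have \<theta>: "0 < \<theta>" "\<theta> < 1" and \<theta>a: "arr p u' = arr p u * (1 - \<theta>)"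
    using a[of u] a[of u'] arr_strict_antimono[OF p u(2)] by (simp_all add: \<theta>_def)
  let ?m = "measure_pmf (model x M p u u)" and ?m' = "measure_pmf (model x M p u' u)"
  have g: "fl y + real (sum_list (fst (snd y))) = departed y" if "y \<in> set_pmf (model x M p w u)" for w y
    using sample_bounds(1)[OF that] by (simp add: initial_def)
  have nn: "(\<integral>\<^sup>+y. ennreal (fl y + real (sum_list (fst (snd y)))) \<partial>model x M p w u) =
      ennreal (\<integral>y. departed y \<partial>model x M p w u)" for w
  proof -
    have "(\<integral>\<^sup>+y. ennreal (fl y + real (sum_list (fst (snd y)))) \<partial>model x M p w u) =
      (\<integral>\<^sup>+y. ennreal (departed y) \<partial>model x M p w u)"
      by (intro nn_integral_pmf_cong) (simp only: g)
    also have "\<dots> = ennreal (\<integral>y. departed y \<partial>model x M p w u)"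
      by (intro nn_integral_eq_integral integrable_sample u) (simp add: departed_def)
    finally show ?thesis .
  qed
  define t0 where "t0 = (\<integral>y. departed y \<partial>?m)"
  define t0' where "t0' = (\<integral>y. departed y \<partial>?m')"
  define t1 where "t1 = (\<integral>y. arrived y * departed y \<partial>?m)"
  have nn1: "(\<integral>\<^sup>+y. of_nat (trues (snd (snd y))) * ennreal (fl y + real (sum_list (fst (snd y)))) \<partial>?m) = ennreal t1"
  proof -
    have "(\<integral>\<^sup>+y. of_nat (trues (snd (snd y))) * ennreal (fl y + real (sum_list (fst (snd y)))) \<partial>?m) =
      (\<integral>\<^sup>+y. ennreal (arrived y * departed y) \<partial>?m)"
    proof (intro nn_integral_pmf_cong)
      fix y assume "y \<in> set_pmf (model x M p u u)"
      then show "of_nat (trues (snd (snd y))) * ennreal (fl y + real (sum_list (fst (snd y)))) =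
          ennreal (arrived y * departed y)"
        unfolding g[OF \<open>y \<in> set_pmf (model x M p u u)\<close>] arrived_def ennreal_of_nat_eq_real_of_nat
        by (intro ennreal_mult'[symmetric]) simp
    qed
    also have "\<dots> = ennreal t1"
      unfolding t1_def
      by (intro nn_integral_eq_integral integrable_sample u) (simp add: departed_def arrived_def)
    finally show ?thesis .
  qed
  have n: "0 \<le> t0" "0 \<le> t0'" "0 \<le> t1"
    by (auto simp: t0_def t0'_def t1_def departed_def arrived_def intro!: integral_nonneg)
  obtain R where R1: "ennreal t1 = of_nat M * ennreal (arr p u) * ennreal t0 + ennreal (1 - arr p u) * R"
    and R2: "ennreal t0' + R \<le> ennreal t0 + ennreal (1 - \<theta>) * R" and RM: "R \<le> of_nat M"
    using flux_time_comparison[OF p \<theta> \<theta>a, of x M u] unfolding nn1 nn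
    by (auto simp: t0_def t0'_def)
  have "R \<noteq> \<top>"
    using RM by (auto simp: top_unique)
  then obtain r where r: "0 \<le> r" "R = ennreal r"
    by (cases R) auto
  have "ennreal t1 = ennreal (real M * arr p u * t0 + (1 - arr p u) * r)"
    using R1 n r a[of u] by (simp add: ennreal_of_nat_eq_real_of_nat ennreal_mult)
  then have t1: "t1 = real M * arr p u * t0 + (1 - arr p u) * r"
    using n r a[of u] by (subst (asm) ennreal_inj) (auto intro!: add_nonneg_nonneg mult_nonneg_nonneg)
  have t0: "t0 = real M * arr p u"
    unfolding t0_def by (rule outcome_moments[OF p u(1)])
  have ex: "excess x M p u = (1 - arr p u) * r"
    using t1 stationary_identities(3)[OF p u(1), of x M]
    unfolding t1_def[symmetric] t0 excess_def by (simp add: power2_eq_square)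
  show "0 \<le> excess x M p u" unfolding ex using r a[of u] by simp
  have "ennreal (t0' + r) \<le> ennreal (t0 + (1 - \<theta>) * r)"
    using R2 n r \<theta> by (simp add: ennreal_mult)
  then have "t0' + r \<le> t0 + (1 - \<theta>) * r"
    using n r \<theta> by (subst (asm) ennreal_le_iff) (auto intro!: add_nonneg_nonneg mult_nonneg_nonneg)
  then have "\<theta> * r \<le> t0 - t0'" by (simp add: algebra_simps)
  also have "t0 - t0' = mean_flux x M p u - (\<integral>y. fl y \<partial>?m')"
  proof -
    have "(\<integral>y. fl y \<partial>?m') = (\<integral>y. departed y - initial y \<partial>?m')"
      by (intro expectation_cong_pmf sample_bounds)
    then show ?thesis
      using integrable_sample(2,3)[OF u(1), of x M p u'] model_moments(2)[OF p u(1), of x M u']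
      by (simp add: t0 t0'_def mean_flux_def)
  qed
  finally have "r \<le> (mean_flux x M p u - (\<integral>y. fl y \<partial>?m')) / \<theta>"
    using \<theta> by (simp add: field_simps)
  moreover have "(1 - arr p u) * r \<le> r"
    using r a[of u] by (simp add: algebra_simps)
  ultimately show "excess x M p u \<le> (mean_flux x M p u - (\<integral>y. fl y \<partial>?m')) / \<theta>"
    unfolding ex by linarith
  show "0 < \<theta>" by (rule \<theta>)
qed

lemma excess_upper_bound:
  fixes x M :: nat and p s \<delta> u :: real
  assumes p: "0 < p" "p < 1" and "0 < s" "0 < \<delta>" "s < u"
  defines "F \<equiv> log_partition x M p" and "k \<equiv> - mean_flux x M p u"
    and "\<theta> \<equiv> 1 - arr p (u + \<delta>) / arr p u"
  shows "excess x M p u \<le>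
    (exp (F (u + \<delta> + s) - F (u + \<delta>) - s * k) + exp (F u - F (u - s) - s * k) - 1) / (\<theta> * s)"
proof -
  have u: "0 < u" "u < u + \<delta>" using assms by auto
  have "excess x M p u \<le> ((\<integral>y. - fl y \<partial>model x M p (u + \<delta>) u) - k) / \<theta>"
    using excess_comparison(2)[OF p u, of x M] by (simp add: k_def \<theta>_def)
  also have "\<dots> \<le> ((exp (F (u + \<delta> + s) - F (u + \<delta>) - s * k) + exp (F u - F (u - s) - s * k) - 1) / s) / \<theta>"
    using assms excess_comparison(3)[OF p u]
    unfolding F_def \<theta>_def[symmetric] by (intro divide_right_mono mean_flux_bound) auto
  finally show ?thesis by (simp add: mult.commute)
qed

text \<open>Separates two dependent exponentials whose means are explicit only one at a time; the
  weight w is left free so that both terms can be made equally small.\<close>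

lemma exp_flux_weighted:
  fixes a b w :: real
  assumes "0 < w"
  shows "exp a * exp b \<le> (w * exp (2 * a) + exp (2 * b) / w) / 2"
proof -
  have "0 \<le> (sqrt w * exp a - exp b / sqrt w)\<^sup>2" by simp
  also have "\<dots> = w * exp (2 * a) + exp (2 * b) / w - 2 * (exp a * exp b)"
  proof -
    have "sqrt w * exp a * (exp b / sqrt w) = exp a * exp b" using assms by simp
    then show ?thesis
      using assms by (simp add: power2_diff power_mult_distrib power_divide exp_double mult.assoc)
  qed
  finally show ?thesis by simp
qed

text \<open>
  Far to the right of the characteristic the fluxes with and without additional arrivals differ
  only if the arrivals win against the initial particles of all sites, which is exponentially
  unlikely in the number of sites.
\<close>

lemma mean_flux_difference_far:
  assumes p: "0 < p" "p < 1" and u: "0 < u" "0 < u'" "0 < v'" and s: "0 < s" and l: "0 < l"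
    and i1: "integrable (measure_pmf (model x M p u u)) (\<lambda>y. exp (2 * s * fl y))"
    and i2: "integrable (measure_pmf (model x M p u' v')) (\<lambda>y. exp (- (2 * s) * fl y))"
  shows "(\<integral>y. fl y \<partial>model x M p u u) - (\<integral>y. fl y \<partial>model x M p u' u) \<le>
    (l * (\<integral>y. exp (2 * s * fl y) \<partial>model x M p u u) +
      (\<integral>y. exp (- (2 * s) * fl y) \<partial>model x M p u' v') / l) / (2 * s)"
proof -
  let ?B = "replicate_pmf x (replicate_pmf M (bernoulli_pmf p))"
  let ?Q = "replicate_pmf x (geo u)" and ?Q' = "replicate_pmf x (geo v')"
  let ?W = "replicate_pmf M (bernoulli_pmf (arr p u))" and ?W' = "replicate_pmf M (bernoulli_pmf (arr p u'))"
  let ?h = "\<lambda>bs qs w. real_of_int (flux bs w qs)"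
  let ?g = "\<lambda>bs qs w. ennreal (?h bs qs w + real (sum_list qs))"
  let ?e1 = "\<lambda>bs qs w. ennreal (l / (2 * s) * exp (2 * s * ?h bs qs w))"
  let ?e2 = "\<lambda>bs qs w. ennreal (1 / (2 * s * l) * exp (- (2 * s) * ?h bs qs w))"
  have gpos: "0 \<le> ?h bs qs w + real (sum_list qs)" for bs qs w
    by (simp add: flux_def)
  have "(\<integral>\<^sup>+bs. \<integral>\<^sup>+qs. \<integral>\<^sup>+w. \<integral>\<^sup>+qs'. \<integral>\<^sup>+w'. ?g bs qs w \<partial>?W' \<partial>?Q' \<partial>?W \<partial>?Q \<partial>?B) \<le>
    (\<integral>\<^sup>+bs. \<integral>\<^sup>+qs. \<integral>\<^sup>+w. \<integral>\<^sup>+qs'. \<integral>\<^sup>+w'. ?g bs qs w' + (?e1 bs qs w + ?e2 bs qs' w')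
      \<partial>?W' \<partial>?Q' \<partial>?W \<partial>?Q \<partial>?B)"
  proof (intro nn_integral_pmf_mono)
    fix bs qs w qs' w'
    assume "bs \<in> set_pmf ?B" "qs \<in> set_pmf ?Q" "w \<in> set_pmf ?W" "qs' \<in> set_pmf ?Q'" "w' \<in> set_pmf ?W'"
    \<comment> \<open>If passing from the arrivals \<open>w\<close> to \<open>w'\<close> lowers the
      flux at all, the first term of the minimum is the smaller one: the flux with \<open>w'\<close>
      and the fresh sites \<open>qs'\<close> is then a lower bound, and its law can be tilted
      explicitly.\<close>
    then have "min (flux bs w' qs') (flux bs w qs) \<le> flux bs w' qs"
      by (intro flux_ge_min[of _ M]) (auto simp: set_replicate_pmf in_lists_conv_set)
    then have min: "min (?h bs qs' w') (?h bs qs w) \<le> ?h bs qs w'"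
      by (simp add: min_le_iff_disj)
    have "1 + s * (?h bs qs w - ?h bs qs' w') \<le> exp (s * (?h bs qs w - ?h bs qs' w'))" by simp
    then have 1: "s * (?h bs qs w - ?h bs qs' w') \<le> exp (s * ?h bs qs w) * exp (- s * ?h bs qs' w')"
      by (simp add: mult_exp_exp algebra_simps)
    have "s * (?h bs qs w - ?h bs qs w') \<le> exp (s * ?h bs qs w) * exp (- s * ?h bs qs' w')"
    proof (cases "?h bs qs w \<le> ?h bs qs w'")
      case True
      then have "s * (?h bs qs w - ?h bs qs w') \<le> 0" using s by (simp add: mult_le_0_iff)
      also have "0 \<le> exp (s * ?h bs qs w) * exp (- s * ?h bs qs' w')" by simp
      finally show ?thesis .
    next
      case False
      then have "s * (?h bs qs w - ?h bs qs w') \<le> s * (?h bs qs w - ?h bs qs' w')"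
        using min s by (intro mult_left_mono) auto
      with 1 show ?thesis by linarith
    qed
    \<comment> \<open>Both fluxes use the same clocks, so the product of their exponentials has no
      explicit mean; the weighted squares are integrated separately.\<close>
    also have "\<dots> \<le> (l * exp (2 * (s * ?h bs qs w)) + exp (2 * (- s * ?h bs qs' w')) / l) / 2"
      by (rule exp_flux_weighted[OF l])
    finally have "?h bs qs w - ?h bs qs w' \<le>
        l / (2 * s) * exp (2 * s * ?h bs qs w) + 1 / (2 * s * l) * exp (- (2 * s) * ?h bs qs' w')"
      using s by (simp add: field_simps)
    then have "ennreal (?h bs qs w + real (sum_list qs)) \<le> ennreal (?h bs qs w' + real (sum_list qs) +
        (l / (2 * s) * exp (2 * s * ?h bs qs w) + 1 / (2 * s * l) * exp (- (2 * s) * ?h bs qs' w')))"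
      by (intro ennreal_leI) linarith
    also have "\<dots> = ?g bs qs w' + (?e1 bs qs w + ?e2 bs qs' w')"
      using gpos[of bs w' qs] s l by (subst ennreal_plus) (auto intro!: add_nonneg_nonneg)
    finally show "?g bs qs w \<le> ?g bs qs w' + (?e1 bs qs w + ?e2 bs qs' w')" .
  qed
  also have "\<dots> = (\<integral>\<^sup>+bs. \<integral>\<^sup>+qs. \<integral>\<^sup>+w'. ?g bs qs w' \<partial>?W' \<partial>?Q \<partial>?B) +
      ((\<integral>\<^sup>+bs. \<integral>\<^sup>+qs. \<integral>\<^sup>+w. ?e1 bs qs w \<partial>?W \<partial>?Q \<partial>?B) +
       (\<integral>\<^sup>+bs. \<integral>\<^sup>+qs'. \<integral>\<^sup>+w'. ?e2 bs qs' w' \<partial>?W' \<partial>?Q' \<partial>?B))"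
    by (simp add: nn_integral_add)
  finally have main: "(\<integral>\<^sup>+y. ennreal (fl y + real (sum_list (fst (snd y)))) \<partial>model x M p u u) \<le>
      (\<integral>\<^sup>+y. ennreal (fl y + real (sum_list (fst (snd y)))) \<partial>model x M p u' u) +
      ((\<integral>\<^sup>+y. ennreal (l / (2 * s) * exp (2 * s * fl y)) \<partial>model x M p u u) +
       (\<integral>\<^sup>+y. ennreal (1 / (2 * s * l) * exp (- (2 * s) * fl y)) \<partial>model x M p u' v'))"
    unfolding nn_integral_model by simp
  have E1: "(\<integral>\<^sup>+y. ennreal (l / (2 * s) * exp (2 * s * fl y)) \<partial>model x M p u u) =
      ennreal (l / (2 * s) * (\<integral>y. exp (2 * s * fl y) \<partial>model x M p u u))"
    using i1 s l by (subst nn_integral_eq_integral) auto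
  have E2: "(\<integral>\<^sup>+y. ennreal (1 / (2 * s * l) * exp (- (2 * s) * fl y)) \<partial>model x M p u' v') =
      ennreal (1 / (2 * s * l) * (\<integral>y. exp (- (2 * s) * fl y) \<partial>model x M p u' v'))"
    using i2 s l by (subst nn_integral_eq_integral) auto
  have i0: "integrable (measure_pmf (model x M p w u)) (\<lambda>y. fl y + initial y)" for w
    using integrable_sample(3,5)[OF u(1), of x M p w] by simp
  have pos0: "0 \<le> fl y + initial y" for y
    using gpos by (cases y) (simp add: initial_def)
  have E0: "(\<integral>\<^sup>+y. ennreal (fl y + real (sum_list (fst (snd y)))) \<partial>model x M p w u) =
      ennreal (\<integral>y. fl y + initial y \<partial>model x M p w u)" for w
    using nn_integral_eq_integral[OF i0[of w]] pos0 by (simp add: initial_def)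
  have "(\<integral>y. fl y + initial y \<partial>model x M p u u) \<le> (\<integral>y. fl y + initial y \<partial>model x M p u' u) +
      (l / (2 * s) * (\<integral>y. exp (2 * s * fl y) \<partial>model x M p u u) +
       1 / (2 * s * l) * (\<integral>y. exp (- (2 * s) * fl y) \<partial>model x M p u' v'))" (is "?L \<le> ?a + (?b + ?c)")
  proof -
    have nn: "0 \<le> ?a" "0 \<le> ?b" "0 \<le> ?c"
      using s l pos0 by (auto intro!: integral_nonneg mult_nonneg_nonneg)
    have "ennreal ?L \<le> ennreal (?a + (?b + ?c))"
      using main nn unfolding E0 E1 E2 by simp
    then show ?thesis using nn by (subst (asm) ennreal_le_iff) auto
  qed
  moreover have "(\<integral>y. fl y + initial y \<partial>model x M p w u) =
      (\<integral>y. fl y \<partial>model x M p w u) + real x * mean_occ u" for w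
    using integrable_sample(3,5)[OF u(1), of x M p w] model_moments(2)[OF p u(1), of x M w] by simp
  ultimately show ?thesis
    using s l by (simp add: field_simps)
qed

lemma nn_integral_bernoulli_list_exp:
  assumes "0 \<le> a" "a \<le> 1"
  shows "(\<integral>\<^sup>+w. ennreal (exp (t * real (trues w))) \<partial>replicate_pmf M (bernoulli_pmf a)) =
    ennreal ((1 - a + a * exp t) ^ M)"
proof (induction M)
  case (Suc M)
  have "(\<integral>\<^sup>+w. ennreal (exp (t * real (trues w))) \<partial>replicate_pmf (Suc M) (bernoulli_pmf a)) =
    ennreal a * (ennreal (exp t) * ennreal ((1 - a + a * exp t) ^ M)) +
    ennreal (1 - a) * ennreal ((1 - a + a * exp t) ^ M)"
    using Suc assms by (simp add: nn_integral_bernoulli distrib_left exp_add ennreal_mult nn_integral_cmult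
        del: nn_integral_bernoulli_pmf)
  also have "\<dots> = ennreal (a * (exp t * (1 - a + a * exp t) ^ M) + (1 - a) * (1 - a + a * exp t) ^ M)"
    using assms by (simp add: ennreal_mult)
  also have "\<dots> = ennreal ((1 - a + a * exp t) ^ Suc M)"
    by (simp add: algebra_simps)
  finally show ?case .
qed simp

text \<open>A positive exponential of the stationary flux is the product of one of the arrivals and
  one of the final particles. Each factor has an explicit law, but they are dependent, hence the
  weight \<open>l\<close>.\<close>

lemma exp_flux_stationary_bound:
  assumes p: "0 < p" "p < 1" and u: "0 < u" and s: "0 < s" and l: "0 < l"
  shows "integrable (measure_pmf (model x M p u u)) (\<lambda>y. exp (2 * s * fl y))"
    "(\<integral>y. exp (2 * s * fl y) \<partial>model x M p u u) \<le>
      (l * (1 - arr p u + arr p u * exp (4 * s)) ^ M +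
       ((1 - exp (- u)) / (1 - exp (- u - 4 * s))) ^ x / l) / 2"
proof -
  let ?m = "measure_pmf (model x M p u u)"
  note a = arr_bounds[OF p, of u]
  let ?A = "(1 - arr p u + arr p u * exp (4 * s)) ^ M"
  let ?B = "((1 - exp (- u)) / (1 - exp (- u - 4 * s))) ^ x"
  have AB: "0 \<le> ?A" "0 \<le> ?B"
    using a u s by auto
  have A: "(\<integral>\<^sup>+y. ennreal (exp (4 * s * arrived y)) \<partial>?m) = ennreal ?A"
  proof -
    have "(\<integral>\<^sup>+y. ennreal (exp (4 * s * arrived y)) \<partial>?m) =
      (\<integral>\<^sup>+w. ennreal (exp (4 * s * real (trues w))) \<partial>map_pmf (\<lambda>y. snd (snd y)) (model x M p u u))"
      by (simp add: arrived_def)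
    then show ?thesis
      unfolding map_pmf_model using nn_integral_bernoulli_list_exp[where a = "arr p u" and t = "4 * s" and M = M] a by simp
  qed
  have B: "(\<integral>\<^sup>+y. ennreal (exp (- (4 * s) * final y)) \<partial>?m) = ennreal ?B"
  proof -
    have "(\<integral>\<^sup>+y. ennreal (exp (- (4 * s) * final y)) \<partial>?m) =
      (\<integral>\<^sup>+r. ennreal (exp (- (4 * s) * real (sum_list (fst r)))) \<partial>map_pmf outcome (model x M p u u))"
      by (simp add: final_def)
    also have "\<dots> = (\<integral>\<^sup>+qs. ennreal (exp (- (4 * s) * real (sum_list qs))) \<partial>replicate_pmf x (geo u))"
      unfolding map_pmf_outcome[OF p u] by (simp add: nn_integral_pair_pmf')
    also have "\<dots> = ennreal ?B"
    proof -
      have eq: "- (4 * s) - u = - u - 4 * s" by simp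
      show ?thesis
        using nn_integral_geo_list_exp[of "- (4 * s)" u x, unfolded eq] s u by simp
    qed
    finally show ?thesis .
  qed
  have "(\<integral>\<^sup>+y. ennreal (exp (2 * s * fl y)) \<partial>?m) \<le>
    (\<integral>\<^sup>+y. ennreal (l / 2) * ennreal (exp (4 * s * arrived y)) +
      ennreal (1 / (2 * l)) * ennreal (exp (- (4 * s) * final y)) \<partial>?m)"
  proof (intro nn_integral_pmf_mono)
    fix y assume y: "y \<in> set_pmf (model x M p u u)"
    have "exp (2 * s * fl y) = exp (2 * s * arrived y) * exp (- (2 * s) * final y)"
      unfolding sample_bounds(2)[OF y] by (simp add: mult_exp_exp algebra_simps)
    also have "\<dots> \<le> (l * exp (2 * (2 * s * arrived y)) + exp (2 * (- (2 * s) * final y)) / l) / 2"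
      by (rule exp_flux_weighted[OF l])
    also have "\<dots> = l / 2 * exp (4 * s * arrived y) + 1 / (2 * l) * exp (- (4 * s) * final y)"
      by (simp add: field_simps)
    finally have "ennreal (exp (2 * s * fl y)) \<le>
      ennreal (l / 2 * exp (4 * s * arrived y) + 1 / (2 * l) * exp (- (4 * s) * final y))"
      by (rule ennreal_leI)
    also have "\<dots> = ennreal (l / 2) * ennreal (exp (4 * s * arrived y)) +
      ennreal (1 / (2 * l)) * ennreal (exp (- (4 * s) * final y))"
    proof -
      have "ennreal (l / 2 * exp (4 * s * arrived y)) = ennreal (l / 2) * ennreal (exp (4 * s * arrived y))"
        "ennreal (1 / (2 * l) * exp (- (4 * s) * final y)) =
          ennreal (1 / (2 * l)) * ennreal (exp (- (4 * s) * final y))"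
        by (rule ennreal_mult', use l in simp)+
      then show ?thesis
        using l by (subst ennreal_plus) simp_all
    qed
    finally show "ennreal (exp (2 * s * fl y)) \<le> ennreal (l / 2) * ennreal (exp (4 * s * arrived y)) +
      ennreal (1 / (2 * l)) * ennreal (exp (- (4 * s) * final y))" .
  qed
  also have "\<dots> = ennreal (l / 2) * ennreal ?A + ennreal (1 / (2 * l)) * ennreal ?B"
    unfolding A[symmetric] B[symmetric] by (subst nn_integral_add) (simp_all add: nn_integral_cmult)
  also have "\<dots> = ennreal ((l * ?A + ?B / l) / 2)"
    using AB l by (simp add: ennreal_mult'[symmetric] ennreal_plus[symmetric] add_divide_distrib del: ennreal_plus)
  finally have le: "(\<integral>\<^sup>+y. ennreal (exp (2 * s * fl y)) \<partial>?m) \<le> ennreal ((l * ?A + ?B / l) / 2)" .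
  show i: "integrable ?m (\<lambda>y. exp (2 * s * fl y))"
    using le by (intro integrable_pmf_nonneg) (auto intro: order.strict_trans1)
  have "ennreal (\<integral>y. exp (2 * s * fl y) \<partial>?m) = (\<integral>\<^sup>+y. ennreal (exp (2 * s * fl y)) \<partial>?m)"
    by (intro nn_integral_eq_integral[symmetric] i) simp
  then have "ennreal (\<integral>y. exp (2 * s * fl y) \<partial>?m) \<le> ennreal ((l * ?A + ?B / l) / 2)"
    using le by simp
  then show "(\<integral>y. exp (2 * s * fl y) \<partial>?m) \<le> (l * ?A + ?B / l) / 2"
    using AB l by (subst (asm) ennreal_le_iff) auto
qed

text \<open>The second pair of boundary laws has the fugacities u + \<delta> and u + \<delta> + 2 s,
  for which the exponential moment with the tilt 2 s is given by
  \<open>nn_integral_exp_flux\<close>.\<close>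

lemma excess_far_bound:
  fixes x M :: nat and p s \<delta> u l l' :: real
  assumes p: "0 < p" "p < 1" and u: "0 < u" and s: "0 < s" and \<delta>: "0 < \<delta>"
    and l: "0 < l" and l': "0 < l'"
  defines "F \<equiv> log_partition x M p" and "\<theta> \<equiv> 1 - arr p (u + \<delta>) / arr p u"
  shows "excess x M p u \<le>
    (l * ((l' * (1 - arr p u + arr p u * exp (4 * s)) ^ M +
       ((1 - exp (- u)) / (1 - exp (- u - 4 * s))) ^ x / l') / 2) +
     exp (F (u + \<delta> + 2 * s) - F (u + \<delta>)) / l) / (2 * s * \<theta>)"
proof -
  let ?u' = "u + \<delta>" and ?v' = "u + \<delta> + 2 * s"
  have eq: "(\<integral>\<^sup>+y. ennreal (exp (- (2 * s) * fl y)) \<partial>model x M p ?u' ?v') = ennreal (exp (F ?v' - F ?u'))"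
    using nn_integral_exp_flux[OF p, of ?u' ?v' x M] u s \<delta> by (simp add: F_def)
  have i2: "integrable (measure_pmf (model x M p ?u' ?v')) (\<lambda>y. exp (- (2 * s) * fl y))"
    using eq by (intro integrable_pmf_nonneg) auto
  have e2: "(\<integral>y. exp (- (2 * s) * fl y) \<partial>model x M p ?u' ?v') = exp (F ?v' - F ?u')"
    using eq nn_integral_eq_integral[OF i2] by simp
  note e1 = exp_flux_stationary_bound[OF p u s l', of x M]
  let ?E1 = "(l' * (1 - arr p u + arr p u * exp (4 * s)) ^ M +
       ((1 - exp (- u)) / (1 - exp (- u - 4 * s))) ^ x / l') / 2"
  note ex = excess_comparison(2)[OF p u, where u' = "u + \<delta>" and x = x and M = M, folded \<theta>_def]
  have \<theta>: "0 < \<theta>"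
    using excess_comparison(3)[OF p u, of ?u'] \<delta> by (simp add: \<theta>_def)
  have "mean_flux x M p u = (\<integral>y. fl y \<partial>model x M p u u)"
    using stationary_identities(1)[OF p u, of x M] by (simp add: mean_flux_def)
  then have "mean_flux x M p u - (\<integral>y. fl y \<partial>model x M p ?u' u) \<le>
    (l * (\<integral>y. exp (2 * s * fl y) \<partial>model x M p u u) + exp (F ?v' - F ?u') / l) / (2 * s)"
    using mean_flux_difference_far[OF p u _ _ s l e1(1) i2] u s \<delta> e2 by simp
  also have "\<dots> \<le> (l * ?E1 + exp (F ?v' - F ?u') / l) / (2 * s)"
    using e1(2) s l by (intro divide_right_mono add_right_mono mult_left_mono) auto
  finally have "(mean_flux x M p u - (\<integral>y. fl y \<partial>model x M p ?u' u)) / \<theta> \<le>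
      ((l * ?E1 + exp (F ?v' - F ?u') / l) / (2 * s)) / \<theta>"
    using \<theta> by (intro divide_right_mono) auto
  then show ?thesis using ex \<delta> by simp
qed

text \<open>
  Paley and Zygmund: a lower bound for the mean and an upper bound for the mean square of
  \<open>exp (- s (fl y + k))\<close> force fluctuations of the flux of order \<open>1 / s\<close>.
\<close>

lemma covariance_lower_bound:
  fixes x M :: nat and p s u B :: real
  assumes p: "0 < p" "p < 1" and s: "0 < s" "2 * s < u"
  defines "F \<equiv> log_partition x M p" and "k \<equiv> - mean_flux x M p u"
  assumes large: "4 \<le> exp (F (u + s) - F u - s * k)"
    and B: "exp (F (u + 2 * s) - F u - 2 * s * k) + exp (F u - F (u - 2 * s) - 2 * s * k) \<le> B"
  shows "4 * (ln 2 / s)\<^sup>2 / B \<le>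
    real M * arr p u * (1 - arr p u) - real x * (mean_occ u * (1 + mean_occ u)) + 2 * covariance x M p u"
proof -
  have u: "0 < u" using s by simp
  let ?m = "measure_pmf (model x M p u u)"
  have B0: "0 < B" using B by (smt (verit) exp_gt_zero)
  define X where "X y = - fl y - k" for y
  have e1: "integrable ?m (\<lambda>y. exp (s * X y))" "4 \<le> (\<integral>y. exp (s * X y) \<partial>?m)"
  proof -
    have eq: "exp (s * X y) = exp (- s * k) * exp (- s * fl y)" for y
      by (simp add: X_def mult_exp_exp algebra_simps)
    have i: "integrable ?m (\<lambda>y. exp (- s * fl y))"
      using exp_neg_flux_bound(1)[OF p u s(1), of u x M] s by simp
    show "integrable ?m (\<lambda>y. exp (s * X y))" unfolding eq using i by simp
    \<comment> \<open>The stationary moment has no closed form. Thinning out the sites, from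
      fugacity u to u + s, makes it explicit and can only decrease it.\<close>
    have "ennreal (exp (F (u + s) - F u)) = (\<integral>\<^sup>+y. ennreal (exp (- s * fl y)) \<partial>model x M p u (u + s))"
      using nn_integral_exp_flux[OF p u, of "u + s" x M] s u by (simp add: F_def)
    also have "\<dots> \<le> (\<integral>\<^sup>+y. ennreal (exp (- s * fl y)) \<partial>?m)"
      using s u by (intro nn_integral_exp_neg_flux_mono) auto
    also have "\<dots> = ennreal (\<integral>y. exp (- s * fl y) \<partial>?m)"
      by (intro nn_integral_eq_integral i) simp
    finally have "exp (F (u + s) - F u) \<le> (\<integral>y. exp (- s * fl y) \<partial>?m)"
      by (subst (asm) ennreal_le_iff) (auto intro!: integral_nonneg)
    then have "exp (- s * k) * exp (F (u + s) - F u) \<le> exp (- s * k) * (\<integral>y. exp (- s * fl y) \<partial>?m)"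
      by (intro mult_left_mono) auto
    moreover have "exp (- s * k) * exp (F (u + s) - F u) = exp (F (u + s) - F u - s * k)"
      by (simp add: mult_exp_exp algebra_simps)
    ultimately show "4 \<le> (\<integral>y. exp (s * X y) \<partial>?m)"
      unfolding eq using large by (simp only: integral_mult_right_zero)
  qed
  have e2: "integrable ?m (\<lambda>y. exp (2 * s * X y))" "(\<integral>y. exp (2 * s * X y) \<partial>?m) \<le> B"
  proof -
    have eq: "exp (2 * s * X y) = exp (- (2 * s) * k) * exp (- (2 * s) * fl y)" for y
      by (simp add: X_def mult_exp_exp algebra_simps)
    note b = exp_neg_flux_bound[OF p u, of "2 * s" u x M]
    show "integrable ?m (\<lambda>y. exp (2 * s * X y))" unfolding eq using b s by simp
    have "exp (- (2 * s) * k) * (\<integral>y. exp (- (2 * s) * fl y) \<partial>?m) \<le>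
      exp (- (2 * s) * k) * (exp (F (u + 2 * s) - F u) + exp (F u - F (u - 2 * s)))"
      using b(2) s unfolding F_def by (intro mult_left_mono) auto
    also have "\<dots> \<le> B" using B by (simp add: distrib_left mult_exp_exp algebra_simps)
    finally show "(\<integral>y. exp (2 * s * X y) \<partial>?m) \<le> B" unfolding eq by simp
  qed
  define L where "L = ln 2 / s"
  have L: "0 < L" using s by (simp add: L_def)
  note i5 = integrable_sample(5,16)[OF u, of x M p u]
  have iX: "integrable ?m (\<lambda>y. (X y)\<^sup>2)"
  proof -
    have "(X y)\<^sup>2 = fl y * fl y + 2 * k * fl y + k\<^sup>2" for y
      unfolding X_def power2_eq_square by (simp add: algebra_simps)
    then show ?thesis using i5 by simp
  qed
  have EX: "(\<integral>y. (X y)\<^sup>2 \<partial>?m) =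
    real M * arr p u * (1 - arr p u) - real x * (mean_occ u * (1 + mean_occ u)) + 2 * covariance x M p u"
  proof -
    have "(X y)\<^sup>2 = fl y * fl y + 2 * k * fl y + k\<^sup>2" for y
      unfolding X_def power2_eq_square by (simp add: algebra_simps)
    then have "(\<integral>y. (X y)\<^sup>2 \<partial>?m) = (\<integral>y. fl y * fl y \<partial>?m) + 2 * k * (\<integral>y. fl y \<partial>?m) + k\<^sup>2"
      using i5 by simp
    then show ?thesis
      unfolding stationary_identities(1,4)[OF p u, of x M] k_def mean_flux_def
      by (simp add: power2_eq_square algebra_simps)
  qed
  \<comment> \<open>On the left the mean is at least 4; on the right the first two terms have mean
    at most 3, so the variance term has mean at least 1. Where X exceeds L, the bound is y \<le> y^2
    / B + B / 4 with y = exp (s X).\<close>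
  have pw: "exp (s * X y) \<le> 2 + exp (2 * s * X y) / B + B / 4 * ((X y)\<^sup>2 / L\<^sup>2)" for y
  proof (cases "X y \<le> L")
    case True
    then have "s * X y \<le> ln 2" using s by (simp add: L_def field_simps)
    then have "exp (s * X y) \<le> 2" by (metis exp_le_cancel_iff exp_ln zero_less_numeral)
    moreover have "0 \<le> exp (2 * s * X y) / B + B / 4 * ((X y)\<^sup>2 / L\<^sup>2)"
      using B0 by auto
    ultimately show ?thesis by linarith
  next
    case False
    then have "1 \<le> (X y)\<^sup>2 / L\<^sup>2"
      using L by (simp add: power_mono)
    then have 1: "B / 4 * 1 \<le> B / 4 * ((X y)\<^sup>2 / L\<^sup>2)"
      using B0 by (intro mult_left_mono) auto
    have "0 \<le> (exp (s * X y) - B / 2)\<^sup>2 / B" using B0 by simp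
    also have "\<dots> = (exp (s * X y))\<^sup>2 / B + B / 4 - exp (s * X y)"
      using B0 by (simp add: power2_diff field_simps power2_eq_square)
    also have "(exp (s * X y))\<^sup>2 = exp (2 * s * X y)"
      using exp_double[of "s * X y"] by (simp add: mult.assoc)
    finally show ?thesis using 1 by simp
  qed
  have "4 \<le> (\<integral>y. exp (s * X y) \<partial>?m)" by (rule e1)
  also have "\<dots> \<le> (\<integral>y. 2 + exp (2 * s * X y) / B + B / 4 * ((X y)\<^sup>2 / L\<^sup>2) \<partial>?m)"
    by (rule integral_mono[OF _ _ pw]) (use e1 e2 iX in auto)
  also have "\<dots> = 2 + (\<integral>y. exp (2 * s * X y) \<partial>?m) / B + B / 4 * ((\<integral>y. (X y)\<^sup>2 \<partial>?m) / L\<^sup>2)"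
    using e2 iX by simp
  also have "(\<integral>y. exp (2 * s * X y) \<partial>?m) / B \<le> 1"
    using e2 B0 by simp
  finally have "1 \<le> B / 4 * ((\<integral>y. (X y)\<^sup>2 \<partial>?m) / L\<^sup>2)" by simp
  then show ?thesis
    unfolding EX[symmetric] L_def[symmetric] using B0 L by (simp add: field_simps)
qed

section \<open>Two-point correlations\<close>

lemma nn_integral_column:
  assumes "0 < p" "p < 1" "0 < u"
  shows "(\<integral>\<^sup>+b. \<integral>\<^sup>+q. \<integral>\<^sup>+w. F (column q w b) \<partial>replicate_pmf M (bernoulli_pmf (arr p u)) \<partial>geo u
      \<partial>replicate_pmf M (bernoulli_pmf p)) =
    (\<integral>\<^sup>+q. \<integral>\<^sup>+w. F (q, w) \<partial>replicate_pmf M (bernoulli_pmf (arr p u)) \<partial>geo u)"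
proof -
  have "(\<integral>\<^sup>+r. F r \<partial>(bind_pmf (replicate_pmf M (bernoulli_pmf p)) (\<lambda>b.
      bind_pmf (geometric_pmf (1 - exp (- u))) (\<lambda>q.
      bind_pmf (replicate_pmf M (bernoulli_pmf (arr p u))) (\<lambda>w. return_pmf (column q w b)))))) =
    (\<integral>\<^sup>+r. F r \<partial>pair_pmf (geometric_pmf (1 - exp (- u))) (replicate_pmf M (bernoulli_pmf (arr p u))))"
    using assms arr_bounds[of p u] arr_balance[of p u] by (subst column_stationary) auto
  then show ?thesis by (simp add: geo_def nn_integral_pair_pmf')
qed

definition occ0 :: "sample \<Rightarrow> nat list" where
  "occ0 y = fst (snd y)"

definition occ1 :: "sample \<Rightarrow> nat list" where
  "occ1 y = fst (outcome y)"

lemma occ_length: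
  assumes "y \<in> set_pmf (model x M p u v)"
  shows "length (occ0 y) = x" "length (occ1 y) = x"
proof -
  obtain bs qs w where y: "y = (bs, qs, w)" by (cases y)
  note l = set_pmf_model[OF assms[unfolded y]]
  show "length (occ0 y) = x" using l by (simp add: y occ0_def)
  show "length (occ1 y) = x"
    using l tandem_length(1)[of qs bs w] by (simp add: y occ1_def outcome_def)
qed

text \<open>By Burke's theorem the first queue hands on fresh Bernoulli arrivals that are
  independent of its final content, so the sites behind it form a stationary system of their
  own.\<close>

lemma nn_integral_model_Suc:
  assumes "0 < p" "p < 1" "0 < u"
  shows "(\<integral>\<^sup>+y. f (hd (occ1 y)) (tl (occ0 y)) (tl (occ1 y)) \<partial>model (Suc x) M p u u) =
    (\<integral>\<^sup>+q. \<integral>\<^sup>+y. f q (occ0 y) (occ1 y) \<partial>model x M p u u \<partial>geo u)"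
proof -
  let ?B = "replicate_pmf M (bernoulli_pmf p)" and ?W = "replicate_pmf M (bernoulli_pmf (arr p u))"
  let ?Bs = "replicate_pmf x ?B" and ?Qs = "replicate_pmf x (geo u)"
  define F where "F bs qs r = f (fst r) qs (fst (tandem qs bs (snd r)))" for bs qs and r :: "nat \<times> bool list"
  have "(\<integral>\<^sup>+y. f (hd (occ1 y)) (tl (occ0 y)) (tl (occ1 y)) \<partial>model (Suc x) M p u u) =
    (\<integral>\<^sup>+b. \<integral>\<^sup>+bs. \<integral>\<^sup>+q. \<integral>\<^sup>+qs. \<integral>\<^sup>+w. F bs qs (column q w b) \<partial>?W \<partial>?Qs \<partial>geo u \<partial>?Bs \<partial>?B)"
    by (simp add: nn_integral_model F_def occ0_def occ1_def outcome_def Let_def)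
  also have "\<dots> = (\<integral>\<^sup>+bs. \<integral>\<^sup>+b. \<integral>\<^sup>+q. \<integral>\<^sup>+qs. \<integral>\<^sup>+w. F bs qs (column q w b) \<partial>?W \<partial>?Qs \<partial>geo u \<partial>?B \<partial>?Bs)"
    by (rule nn_integral_pmf_commute)
  also have "\<dots> = (\<integral>\<^sup>+bs. \<integral>\<^sup>+b. \<integral>\<^sup>+qs. \<integral>\<^sup>+q. \<integral>\<^sup>+w. F bs qs (column q w b) \<partial>?W \<partial>geo u \<partial>?Qs \<partial>?B \<partial>?Bs)"
    by (intro nn_integral_cong nn_integral_pmf_commute)
  also have "\<dots> = (\<integral>\<^sup>+bs. \<integral>\<^sup>+qs. \<integral>\<^sup>+b. \<integral>\<^sup>+q. \<integral>\<^sup>+w. F bs qs (column q w b) \<partial>?W \<partial>geo u \<partial>?B \<partial>?Qs \<partial>?Bs)"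
    by (intro nn_integral_cong nn_integral_pmf_commute)
  also have "\<dots> = (\<integral>\<^sup>+bs. \<integral>\<^sup>+qs. \<integral>\<^sup>+q. \<integral>\<^sup>+w. F bs qs (q, w) \<partial>?W \<partial>geo u \<partial>?Qs \<partial>?Bs)"
    by (subst nn_integral_column[OF assms]) (rule refl)
  also have "\<dots> = (\<integral>\<^sup>+bs. \<integral>\<^sup>+q. \<integral>\<^sup>+qs. \<integral>\<^sup>+w. F bs qs (q, w) \<partial>?W \<partial>?Qs \<partial>geo u \<partial>?Bs)"
    by (intro nn_integral_cong nn_integral_pmf_commute)
  also have "\<dots> = (\<integral>\<^sup>+q. \<integral>\<^sup>+bs. \<integral>\<^sup>+qs. \<integral>\<^sup>+w. F bs qs (q, w) \<partial>?W \<partial>?Qs \<partial>?Bs \<partial>geo u)"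
    by (rule nn_integral_pmf_commute)
  also have "\<dots> = (\<integral>\<^sup>+q. \<integral>\<^sup>+y. f q (occ0 y) (occ1 y) \<partial>model x M p u u \<partial>geo u)"
    by (simp add: nn_integral_model F_def occ0_def occ1_def outcome_def)
  finally show ?thesis .
qed

lemma take_tandem:
  "fst (tandem (take n qs) (take n bs) w) = take n (fst (tandem qs bs w))"
proof (induction qs bs w arbitrary: n rule: tandem.induct)
  case (1 q qs b bs w)
  then show ?case by (cases n) (auto simp: Let_def)
next
  case (3 q qs w)
  then show ?case by (cases n) auto
qed auto

lemma map_take_replicate_pmf:
  assumes "n \<le> x"
  shows "map_pmf (take n) (replicate_pmf x p) = replicate_pmf n p"
proof -
  have "map_pmf (take n) (replicate_pmf (n + (x - n)) p) =
    bind_pmf (replicate_pmf n p) (\<lambda>xs. bind_pmf (replicate_pmf (x - n) p) (\<lambda>ys. return_pmf (take n (xs @ ys))))"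
    by (simp only: replicate_pmf_distrib map_bind_pmf map_return_pmf)
  also have "\<dots> = bind_pmf (replicate_pmf n p) (\<lambda>xs. bind_pmf (replicate_pmf (x - n) p) (\<lambda>ys. return_pmf xs))"
    by (intro bind_pmf_cong refl) (simp add: set_pmf_replicate_length)
  also have "\<dots> = replicate_pmf n p"
    by (simp add: bind_return_pmf')
  finally show ?thesis using assms by simp
qed

lemma nn_integral_model_take:
  assumes "n \<le> x"
  shows "(\<integral>\<^sup>+y. f (take n (occ0 y)) (take n (occ1 y)) \<partial>model x M p u v) =
    (\<integral>\<^sup>+y. f (occ0 y) (occ1 y) \<partial>model n M p u v)"
proof -
  have "(\<integral>\<^sup>+y. f (take n (occ0 y)) (take n (occ1 y)) \<partial>model x M p u v) =
    (\<integral>\<^sup>+bs. \<integral>\<^sup>+qs. \<integral>\<^sup>+w. f qs (fst (tandem qs bs w)) \<partial>replicate_pmf M (bernoulli_pmf (arr p u))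
     \<partial>map_pmf (take n) (replicate_pmf x (geo v))
     \<partial>map_pmf (take n) (replicate_pmf x (replicate_pmf M (bernoulli_pmf p))))"
    by (simp add: nn_integral_model occ0_def occ1_def outcome_def take_tandem)
  then show ?thesis
    by (simp add: nn_integral_model occ0_def occ1_def outcome_def map_take_replicate_pmf[OF assms])
qed

lemma map_nth_replicate_pmf:
  assumes "i < x"
  shows "map_pmf (\<lambda>xs. xs ! i) (replicate_pmf x p) = p"
  using assms
proof (induction x arbitrary: i)
  case (Suc x)
  show ?case
  proof (cases i)
    case 0
    then show ?thesis by (simp add: map_bind_pmf bind_return_pmf')
  next
    case (Suc j)
    then have "map_pmf (\<lambda>xs. xs ! i) (replicate_pmf (Suc x) p) =
      map_pmf (\<lambda>xs. xs ! j) (replicate_pmf x p)"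
      by (simp add: map_bind_pmf) (simp add: map_pmf_def)
    then show ?thesis using Suc Suc.IH Suc.prems by simp
  qed
qed simp

text \<open>Removing the sites before j one by one leaves the final content of a first site, which
  is independent of the initial contents of all later sites. So nothing is correlated against the
  direction of the jumps.\<close>

lemma joint_law_left:
  assumes "0 < p" "p < 1" "0 < u" "j < k" "k < x"
  shows "(\<integral>\<^sup>+y. f (occ0 y ! k) (occ1 y ! j) \<partial>model x M p u u) = (\<integral>\<^sup>+b. \<integral>\<^sup>+a. f a b \<partial>geo u \<partial>geo u)"
  using assms(4,5)
proof (induction j arbitrary: k x)
  case 0
  obtain k' x' where kx: "k = Suc k'" "x = Suc x'" "k' < x'"
    using 0 by (cases k; cases x) auto
  have "(\<integral>\<^sup>+y. f (occ0 y ! k) (occ1 y ! 0) \<partial>model x M p u u) =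
    (\<integral>\<^sup>+y. f (tl (occ0 y) ! k') (hd (occ1 y)) \<partial>model x M p u u)"
  proof (rule nn_integral_pmf_cong)
    fix y assume "y \<in> set_pmf (model x M p u u)"
    note l = occ_length[OF this]
    then have "occ1 y \<noteq> []" "k' < length (tl (occ0 y))" using kx by auto
    then show "f (occ0 y ! k) (occ1 y ! 0) = f (tl (occ0 y) ! k') (hd (occ1 y))"
      by (simp add: hd_conv_nth nth_tl kx)
  qed
  also have "\<dots> = (\<integral>\<^sup>+b. \<integral>\<^sup>+y. f (occ0 y ! k') b \<partial>model x' M p u u \<partial>geo u)"
    unfolding kx using nn_integral_model_Suc[OF assms(1-3), where f = "\<lambda>b l m. f (l ! k') b"] by simp
  also have "\<dots> = (\<integral>\<^sup>+b. \<integral>\<^sup>+a. f a b \<partial>geo u \<partial>geo u)"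
  proof (rule nn_integral_cong)
    fix b
    have "(\<integral>\<^sup>+y. f (occ0 y ! k') b \<partial>model x' M p u u) =
      (\<integral>\<^sup>+a. f a b \<partial>map_pmf (\<lambda>qs. qs ! k') (map_pmf (\<lambda>y. fst (snd y)) (model x' M p u u)))"
      by (simp add: occ0_def)
    then show "(\<integral>\<^sup>+y. f (occ0 y ! k') b \<partial>model x' M p u u) = (\<integral>\<^sup>+a. f a b \<partial>geo u)"
      unfolding map_pmf_model map_nth_replicate_pmf[OF kx(3)] .
  qed
  finally show ?case .
next
  case (Suc j)
  obtain k' x' where kx: "k = Suc k'" "x = Suc x'" "j < k'" "k' < x'"
    using Suc.prems by (cases k; cases x) auto
  have "(\<integral>\<^sup>+y. f (occ0 y ! k) (occ1 y ! Suc j) \<partial>model x M p u u) =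
    (\<integral>\<^sup>+y. f (tl (occ0 y) ! k') (tl (occ1 y) ! j) \<partial>model x M p u u)"
  proof (rule nn_integral_pmf_cong)
    fix y assume "y \<in> set_pmf (model x M p u u)"
    note l = occ_length[OF this]
    then have "j < length (tl (occ1 y))" "k' < length (tl (occ0 y))" using kx by auto
    then show "f (occ0 y ! k) (occ1 y ! Suc j) = f (tl (occ0 y) ! k') (tl (occ1 y) ! j)"
      by (simp add: nth_tl kx)
  qed
  also have "\<dots> = (\<integral>\<^sup>+y. f (occ0 y ! k') (occ1 y ! j) \<partial>model x' M p u u)"
    unfolding kx using nn_integral_model_Suc[OF assms(1-3), where f = "\<lambda>b l m. f (l ! k') (m ! j)"] by simp
  also have "\<dots> = (\<integral>\<^sup>+b. \<integral>\<^sup>+a. f a b \<partial>geo u \<partial>geo u)"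
    by (rule Suc.IH[OF kx(3,4)])
  finally show ?case .
qed

text \<open>Translation invariance: the sites to the left of k are removed by
  \<open>nn_integral_model_Suc\<close>, those to the right of j by
  \<open>nn_integral_model_take\<close>.\<close>

lemma joint_law_right:
  assumes "0 < p" "p < 1" "0 < u" "k \<le> j" "j < x"
  shows "(\<integral>\<^sup>+y. f (occ0 y ! k) (occ1 y ! j) \<partial>model x M p u u) =
    (\<integral>\<^sup>+y. f (occ0 y ! 0) (occ1 y ! (j - k)) \<partial>model (Suc (j - k)) M p u u)"
  using assms(4,5)
proof (induction k arbitrary: j x)
  case 0
  have "(\<integral>\<^sup>+y. f (occ0 y ! 0) (occ1 y ! j) \<partial>model x M p u u) =
    (\<integral>\<^sup>+y. f (take (Suc j) (occ0 y) ! 0) (take (Suc j) (occ1 y) ! j) \<partial>model x M p u u)"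
    by simp
  also have "\<dots> = (\<integral>\<^sup>+y. f (occ0 y ! 0) (occ1 y ! j) \<partial>model (Suc j) M p u u)"
    using nn_integral_model_take[of "Suc j" x, where f = "\<lambda>l m. f (l ! 0) (m ! j)"] 0 by simp
  finally show ?case by simp
next
  case (Suc k)
  obtain j' x' where jx: "j = Suc j'" "x = Suc x'" "k \<le> j'" "j' < x'"
    using Suc.prems by (cases j; cases x) auto
  have "(\<integral>\<^sup>+y. f (occ0 y ! Suc k) (occ1 y ! j) \<partial>model x M p u u) =
    (\<integral>\<^sup>+y. f (tl (occ0 y) ! k) (tl (occ1 y) ! j') \<partial>model x M p u u)"
  proof (rule nn_integral_pmf_cong)
    fix y assume "y \<in> set_pmf (model x M p u u)"
    note l = occ_length[OF this]
    then have "j' < length (tl (occ1 y))" "k < length (tl (occ0 y))" using jx by auto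
    then show "f (occ0 y ! Suc k) (occ1 y ! j) = f (tl (occ0 y) ! k) (tl (occ1 y) ! j')"
      by (simp add: nth_tl jx)
  qed
  also have "\<dots> = (\<integral>\<^sup>+y. f (occ0 y ! k) (occ1 y ! j') \<partial>model x' M p u u)"
    unfolding jx using nn_integral_model_Suc[OF assms(1-3), where f = "\<lambda>b l m. f (l ! k) (m ! j')"] by simp
  also have "\<dots> = (\<integral>\<^sup>+y. f (occ0 y ! 0) (occ1 y ! (j' - k)) \<partial>model (Suc (j' - k)) M p u u)"
    by (rule Suc.IH[OF jx(3,4)])
  finally show ?case by (simp add: jx)
qed

text \<open>Taken on the shortest chain that contains both sites; by \<open>joint_law_right\<close>
  longer chains and other positions give the same value.\<close>

definition correlation :: "nat \<Rightarrow> nat \<Rightarrow> real \<Rightarrow> real \<Rightarrow> real" where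
  "correlation i M p u = (\<integral>y. real (occ0 y ! 0 * occ1 y ! i) \<partial>model (Suc i) M p u u) - (mean_occ u)\<^sup>2"

lemma sum_list_eq_sum: "length xs = x \<Longrightarrow> sum_list xs = (\<Sum>i<x. xs ! i)"
  by (simp add: sum_list_sum_nth atLeast0LessThan)

lemma sum_toeplitz:
  fixes c :: "nat \<Rightarrow> real"
  shows "(\<Sum>k<x. \<Sum>j<x. if k \<le> j then c (j - k) else 0) = (\<Sum>i<x. real (x - i) * c i)"
proof (induction x)
  case (Suc x)
  have "(\<Sum>k<Suc x. \<Sum>j<Suc x. if k \<le> j then c (j - k) else 0) =
    (\<Sum>i<x. real (x - i) * c i) + (\<Sum>k<Suc x. c (x - k))"
    by (simp add: sum.distrib Suc)
  also have "(\<Sum>k<Suc x. c (x - k)) = (\<Sum>i<Suc x. c i)"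
    by (rule sum.reindex_bij_witness[of _ "\<lambda>i. x - i" "\<lambda>i. x - i"]) auto
  also have "(\<Sum>i<x. real (x - i) * c i) + (\<Sum>i<Suc x. c i) = (\<Sum>i<Suc x. real (Suc x - i) * c i)"
    by (simp add: sum.distrib[symmetric]) (auto intro!: sum.cong simp: Suc_diff_le algebra_simps of_nat_diff)
  finally show ?case .
qed simp

lemma geo_moment:
  assumes "0 < v"
  shows "integrable (measure_pmf (geo v)) (\<lambda>q. real q ^ k)" "(\<integral>q. real q \<partial>geo v) = mean_occ v"
proof -
  have eq: "map_pmf sum_list (replicate_pmf 1 (geo v)) = geo v"
    by (simp only: replicate_pmf_1) (simp add: map_pmf_comp)
  have "integrable (measure_pmf (map_pmf sum_list (replicate_pmf 1 (geo v)))) (\<lambda>q. real q ^ k)"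
    using integrable_geo_list_power[OF assms, of 1 k] by (simp only: integrable_map_pmf_eq)
  then show "integrable (measure_pmf (geo v)) (\<lambda>q. real q ^ k)" by (simp only: eq)
  have "(\<integral>q. real q \<partial>map_pmf sum_list (replicate_pmf 1 (geo v))) = mean_occ v"
    using geo_list_moments(1)[OF assms, of 1] by (simp only: integral_map_pmf)
  then show "(\<integral>q. real q \<partial>geo v) = mean_occ v" by (simp only: eq)
qed

text \<open>Pairs whose final site lies left of the initial one contribute nothing; otherwise only
  the distance i counts, and there are x - i pairs at distance i.\<close>

lemma covariance_eq_sum_correlation:
  assumes p: "0 < p" "p < 1" and u: "0 < u"
  shows "covariance x M p u = (\<Sum>i<x. real (x - i) * correlation i M p u)"
proof -
  let ?m = "\<lambda>x. measure_pmf (model x M p u u)"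
  have "(\<integral>y. initial y * final y \<partial>?m x) = (\<integral>y. (\<Sum>k<x. \<Sum>j<x. real (occ0 y ! k * occ1 y ! j)) \<partial>?m x)"
  proof (rule expectation_cong_pmf)
    fix y assume "y \<in> set_pmf (model x M p u u)"
    note l = occ_length[OF this]
    have "initial y = real (\<Sum>k<x. occ0 y ! k)" "final y = real (\<Sum>k<x. occ1 y ! k)"
      using l[THEN sum_list_eq_sum] by (simp_all add: initial_def final_def occ0_def occ1_def)
    then show "initial y * final y = (\<Sum>k<x. \<Sum>j<x. real (occ0 y ! k * occ1 y ! j))"
      by (simp add: sum_product)
  qed
  also have "\<dots> = (\<Sum>k<x. \<Sum>j<x. (\<integral>y. real (occ0 y ! k * occ1 y ! j) \<partial>?m x))"
  proof -
    have "integrable (?m x) (\<lambda>y. real (occ0 y ! k * occ1 y ! j))" if "k < x" "j < x" for k j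
    proof (rule integrable_pmf_bound[OF integrable_sample(9)[OF u, of x M p u]])
      fix y assume "y \<in> set_pmf (model x M p u u)"
      note l = occ_length[OF this]
      have "occ0 y ! k \<le> sum_list (occ0 y)" "occ1 y ! j \<le> sum_list (occ1 y)"
        using that l by (auto intro!: member_le_sum_list)
      then have "occ0 y ! k * occ1 y ! j \<le> sum_list (occ0 y) * sum_list (occ1 y)"
        by (rule mult_le_mono)
      then show "\<bar>real (occ0 y ! k * occ1 y ! j)\<bar> \<le> initial y * final y"
        unfolding initial_def final_def occ0_def[symmetric] occ1_def[symmetric] of_nat_mult[symmetric]
        by (simp del: of_nat_mult)
    qed
    then show ?thesis
      by (subst Bochner_Integration.integral_sum | auto intro!: Bochner_Integration.integrable_sum sum.cong)+
  qed
  also have "\<dots> = (\<Sum>k<x. \<Sum>j<x. (mean_occ u)\<^sup>2 + (if k \<le> j then correlation (j - k) M p u else 0))"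
  proof (intro sum.cong refl)
    fix k j assume kj: "k \<in> {..<x}" "j \<in> {..<x}"
    have e: "(\<integral>y. real (f y) \<partial>measure_pmf q) = enn2real (\<integral>\<^sup>+y. of_nat (f y) \<partial>measure_pmf q)"
      for f :: "sample \<Rightarrow> nat" and q
      by (subst integral_eq_nn_integral) (auto simp: ennreal_of_nat_eq_real_of_nat)
    show "(\<integral>y. real (occ0 y ! k * occ1 y ! j) \<partial>?m x) =
      (mean_occ u)\<^sup>2 + (if k \<le> j then correlation (j - k) M p u else 0)"
    proof (cases "k \<le> j")
      case True
      have "(\<integral>y. real (occ0 y ! k * occ1 y ! j) \<partial>?m x) =
          (\<integral>y. real (occ0 y ! 0 * occ1 y ! (j - k)) \<partial>?m (Suc (j - k)))"
        unfolding e using joint_law_right[OF p u True, where x = x and f = "\<lambda>a b. of_nat (a * b)"] kj by simp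
      then show ?thesis using True by (simp add: correlation_def)
    next
      case False
      have "(\<integral>\<^sup>+b. \<integral>\<^sup>+a. of_nat (a * b) \<partial>geo u \<partial>geo u) = (\<integral>\<^sup>+b. ennreal (mean_occ u) * ennreal (real b) \<partial>geo u)"
      proof (intro nn_integral_cong)
        fix b
        have "(\<integral>\<^sup>+a. of_nat (a * b) \<partial>geo u) = (\<integral>\<^sup>+a. ennreal (real a) \<partial>geo u) * ennreal (real b)"
          by (subst nn_integral_multc[symmetric]) (simp_all add: ennreal_of_nat_eq_real_of_nat ennreal_mult)
        also have "(\<integral>\<^sup>+a. ennreal (real a) \<partial>geo u) = ennreal (mean_occ u)"
          using nn_integral_eq_integral[OF geo_moment(1)[OF u, of 1]] geo_moment(2)[OF u] by simp
        finally show "(\<integral>\<^sup>+a. of_nat (a * b) \<partial>geo u) = ennreal (mean_occ u) * ennreal (real b)" .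
      qed
      also have "\<dots> = ennreal (mean_occ u) * ennreal (mean_occ u)"
        using nn_integral_eq_integral[OF geo_moment(1)[OF u, of 1]] geo_moment(2)[OF u]
        by (simp add: nn_integral_cmult)
      also have "\<dots> = ennreal ((mean_occ u)\<^sup>2)"
        using u by (simp add: ennreal_mult[symmetric] power2_eq_square)
      finally show ?thesis
        unfolding e using joint_law_left[OF p u, where j = j and k = k and x = x and f = "\<lambda>a b. of_nat (a * b)"] kj False
        by (simp del: of_nat_mult)
    qed
  qed
  also have "\<dots> = (real x * mean_occ u)\<^sup>2 + (\<Sum>i<x. real (x - i) * correlation i M p u)"
    unfolding sum.distrib sum_toeplitz[where c = "\<lambda>i. correlation i M p u"] by (simp add: power2_eq_square mult_ac)
  finally show ?thesis by (simp add: covariance_def)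
qed

section \<open>The graphical construction\<close>

lemma initial_segment:
  fixes S :: "nat set"
  assumes "finite S" "\<And>k l. k \<in> S \<Longrightarrow> l < k \<Longrightarrow> l \<in> S"
  shows "S = {..<card S}"
proof (cases "S = {}")
  case False
  define m where "m = Max S"
  have m: "m \<in> S" "\<And>k. k \<in> S \<Longrightarrow> k \<le> m"
    using assms(1) False by (auto simp: m_def)
  have "S = {..<Suc m}"
    using m assms(2)[OF m(1)] by (auto simp: less_Suc_eq_le le_less)
  then show ?thesis by simp
qed simp

lemma strict_mono_le_count:
  fixes f :: "nat \<Rightarrow> 'a :: linorder"
  assumes "strict_mono f" "t < f m"
  shows "{k. f k \<le> t} = {..<card {k. f k \<le> t}}" "{k. f k < t} = {..<card {k. f k < t}}"
proof -
  have lt: "k < m" if "f k \<le> t" for k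
    using assms that strict_mono_less[OF assms(1), of k m] by auto
  have mono: "f l < f k" if "l < k" for k l
    using strict_monoD[OF assms(1) that] .
  show "{k. f k \<le> t} = {..<card {k. f k \<le> t}}"
  proof (rule initial_segment)
    have "{k. f k \<le> t} \<subseteq> {..<m}" using lt by blast
    then show "finite {k. f k \<le> t}" by (rule finite_subset) simp
    show "l \<in> {k. f k \<le> t}" if "k \<in> {k. f k \<le> t}" "l < k" for k l
      using order.strict_trans2[OF mono[OF that(2)], of t] that(1) by simp
  qed
  show "{k. f k < t} = {..<card {k. f k < t}}"
  proof (rule initial_segment)
    have "{k. f k < t} \<subseteq> {..<m}" using lt less_imp_le by blast
    then show "finite {k. f k < t}" by (rule finite_subset) simp
    show "l \<in> {k. f k < t}" if "k \<in> {k. f k < t}" "l < k" for k l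
      using order.strict_trans[OF mono[OF that(2)], of t] that(1) by simp
  qed
qed

lemma strict_mono_card_le_eq:
  fixes f :: "nat \<Rightarrow> 'a :: linorder"
  assumes "strict_mono f" "a < f m" "m = 0 \<or> f (m - 1) \<le> a"
  shows "card {k. f k \<le> a} = m"
proof -
  have "f k \<le> a \<longleftrightarrow> k < m" for k
  proof
    show "k < m" if "f k \<le> a"
      using that assms(2) strict_mono_less[OF assms(1), of k m] by auto
    show "f k \<le> a" if "k < m"
    proof -
      have "f k \<le> f (m - 1)"
        using that strict_mono_mono[OF assms(1)] by (auto simp: mono_def)
      then show ?thesis using assms(3) that by auto
    qed
  qed
  then show ?thesis by simp
qed

text \<open>
  \<open>served q c k\<close> is the number of departures among the first \<open>k\<close> rings of the clock of a queue
  with \<open>q\<close> initial customers when \<open>c l\<close> customers have arrived before the ring number \<open>l\<close>.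
\<close>

primrec served :: "nat \<Rightarrow> (nat \<Rightarrow> nat) \<Rightarrow> nat \<Rightarrow> nat" where
  "served q c 0 = 0"
| "served q c (Suc k) = served q c k + (if served q c k < q + c k then 1 else 0)"

lemma served_cong: "(\<And>l. l < k \<Longrightarrow> c l = c' l) \<Longrightarrow> served q c k = served q c' k"
  by (induction k) auto

lemma served_mono: "k \<le> l \<Longrightarrow> served q c k \<le> served q c l"
  by (rule lift_Suc_mono_le) auto

lemma served_le: "(\<And>l. l < k \<Longrightarrow> c l \<le> a) \<Longrightarrow> served q c k \<le> q + a"
proof (induction k)
  case (Suc k)
  then have "served q c k \<le> q + a" "c k \<le> a" by auto
  then show ?case by auto
qed simp

lemma card_served: "card {l. l < k \<and> served q c l < q + c l} = served q c k"
proof (induction k)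
  case (Suc k)
  have "{l. l < Suc k \<and> served q c l < q + c l} =
    {l. l < k \<and> served q c l < q + c l} \<union> (if served q c k < q + c k then {k} else {})"
    by (auto simp: less_Suc_eq)
  then show ?case using Suc by (auto simp: card_insert_if)
qed simp

definition count_le :: "waiting \<Rightarrow> int \<Rightarrow> real \<Rightarrow> nat" where
  "count_le \<xi> i t = card {k. ring_time \<xi> i k \<le> t}"

definition count_less :: "waiting \<Rightarrow> int \<Rightarrow> real \<Rightarrow> nat" where
  "count_less \<xi> i t = card {k. ring_time \<xi> i k < t}"

text \<open>
  The departures from site \<open>i\<close> among its first \<open>k\<close> rings, when the first \<open>L\<close> sites up to \<open>i\<close> are
  taken into account and nothing departs from the site before them.
\<close>

primrec departures :: "config \<Rightarrow> waiting \<Rightarrow> nat \<Rightarrow> int \<Rightarrow> nat \<Rightarrow> nat" where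
  "departures \<eta> \<xi> 0 i = (\<lambda>k. 0)"
| "departures \<eta> \<xi> (Suc L) i =
    served (\<eta> i) (\<lambda>k. departures \<eta> \<xi> L (i - 1) (count_less \<xi> (i - 1) (ring_time \<xi> i k)))"

lemma departures_0: "departures \<eta> \<xi> L i 0 = 0"
  by (cases L) auto

lemma departures_mono: "k \<le> l \<Longrightarrow> departures \<eta> \<xi> L i k \<le> departures \<eta> \<xi> L i l"
  by (cases L) (auto intro: served_mono)

text \<open>Almost sure properties of the clocks, after which the construction is deterministic. A
  site as in \<open>quiet\<close> lets no particle pass up to time T and thus cuts the line;
  \<open>distinct\<close> settles the order of rings at neighbouring sites.\<close>

locale regular_clocks =
  fixes \<eta> :: config and \<xi> :: waiting
  assumes waiting_pos: "\<And>p. 0 < \<xi> p"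
    and unbounded: "\<And>i T. \<exists>n. T < ring_time \<xi> i n"
    and quiet: "\<And>j T. \<exists>i\<le>j. T < \<xi> (i, 0)"
    and distinct: "\<And>i k l. ring_time \<xi> i k \<noteq> ring_time \<xi> (i - 1) l"
begin

lemma strict_mono_ring_time: "strict_mono (ring_time \<xi> i)"
  by (rule strict_monoI_Suc) (simp add: ring_time_def waiting_pos)

lemma count_le: "ring_time \<xi> i k \<le> t \<longleftrightarrow> k < count_le \<xi> i t"
proof -
  obtain m where "t < ring_time \<xi> i m" using unbounded by blast
  from strict_mono_le_count(1)[OF strict_mono_ring_time this] show ?thesis
    unfolding count_le_def by blast
qed

lemma count_less: "ring_time \<xi> i k < t \<longleftrightarrow> k < count_less \<xi> i t"
proof -
  obtain m where "t < ring_time \<xi> i m" using unbounded by blast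
  from strict_mono_le_count(2)[OF strict_mono_ring_time this] show ?thesis
    unfolding count_less_def by blast
qed

lemma count_le_eqI: "(\<And>k. ring_time \<xi> i k \<le> t \<longleftrightarrow> k < m) \<Longrightarrow> count_le \<xi> i t = m"
  by (simp add: count_le_def)

lemma count_less_le: "a \<le> t \<Longrightarrow> count_less \<xi> i a \<le> count_le \<xi> i t"
  by (meson count_le count_less le_less_linear less_le_trans less_imp_le order.trans not_less)

text \<open>The left limit of the counting function counts strictly earlier rings only. This is how
  the filter \<open>at_left\<close> in \<open>jump_count\<close> is evaluated.\<close>

lemma eventually_count: "\<forall>\<^sub>F v in at_left \<tau>. count_le \<xi> i v = count_less \<xi> i \<tau>"
proof -
  define n where "n = count_less \<xi> i \<tau>"
  define b where "b = (if n = 0 then \<tau> - 1 else ring_time \<xi> i (n - 1))"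
  have "b < \<tau>"
    using count_less[of i "n - 1" \<tau>] by (auto simp: b_def n_def)
  moreover have "count_le \<xi> i v = n" if v: "b < v" "v < \<tau>" for v
  proof (rule count_le_eqI)
    fix k
    show "ring_time \<xi> i k \<le> v \<longleftrightarrow> k < n"
    proof
      show "k < n" if "ring_time \<xi> i k \<le> v"
        using that v count_less[of i k \<tau>] by (simp add: n_def)
      show "ring_time \<xi> i k \<le> v" if k: "k < n"
      proof -
        have "ring_time \<xi> i k \<le> ring_time \<xi> i (n - 1)"
          using k strict_mono_mono[OF strict_mono_ring_time] by (auto simp: mono_def)
        then show ?thesis using k v by (auto simp: b_def)
      qed
    qed
  qed
  ultimately show ?thesis
    unfolding n_def by (auto simp: eventually_at_left[of b \<tau>] intro!: exI[of _ b])
qed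

lemma count_less_ring_time: "count_less \<xi> i (ring_time \<xi> i n) = n"
  using strict_mono_less[OF strict_mono_ring_time, of i _ n] by (simp add: count_less_def)

lemma eventually_at_left_less_iff:
  fixes f A :: "real \<Rightarrow> nat"
  assumes "\<forall>\<^sub>F v in at_left \<tau>. f v = d" "\<forall>\<^sub>F v in at_left \<tau>. A v = c"
  shows "(\<forall>\<^sub>F v in at_left \<tau>. f v < q + A v) \<longleftrightarrow> d < q + c"
proof
  assume "\<forall>\<^sub>F v in at_left \<tau>. f v < q + A v"
  with assms have "\<forall>\<^sub>F v in at_left \<tau>. d < q + c" by eventually_elim simp
  then show "d < q + c" by (simp add: eventually_const_iff trivial_limit_at_left_real)
next
  assume "d < q + c"
  with assms show "\<forall>\<^sub>F v in at_left \<tau>. f v < q + A v" by (auto elim: eventually_elim2)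
qed

text \<open>Just before ring n the path has made the departures of the first n rings and has seen c
  n arrivals, so the test in \<open>served\<close> is the test of occupancy in
  \<open>jump_count\<close>.\<close>

lemma queue_solution:
  assumes f: "\<And>v. v \<le> t \<Longrightarrow> f v = served q c (count_le \<xi> i v)"
    and A: "\<And>n. ring_time \<xi> i n \<le> t \<Longrightarrow> \<forall>\<^sub>F v in at_left (ring_time \<xi> i n). A v = c n"
  shows "f t = card {n. ring_time \<xi> i n \<le> t \<and> (\<forall>\<^sub>F v in at_left (ring_time \<xi> i n). f v < q + A v)}"
proof -
  have "(\<forall>\<^sub>F v in at_left (ring_time \<xi> i n). f v < q + A v) \<longleftrightarrow> served q c n < q + c n"
    if n: "ring_time \<xi> i n \<le> t" for n
  proof (rule eventually_at_left_less_iff[OF _ A[OF n]])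
    have "\<forall>\<^sub>F v in at_left (ring_time \<xi> i n). v < ring_time \<xi> i n"
      by (auto simp: eventually_at_filter)
    with eventually_count[of i "ring_time \<xi> i n"]
    show "\<forall>\<^sub>F v in at_left (ring_time \<xi> i n). f v = served q c n"
      by eventually_elim (use n in \<open>simp add: f count_less_ring_time\<close>)
  qed
  then have "{n. ring_time \<xi> i n \<le> t \<and> (\<forall>\<^sub>F v in at_left (ring_time \<xi> i n). f v < q + A v)} =
      {n. n < count_le \<xi> i t \<and> served q c n < q + c n}"
    by (auto simp: count_le)
  then show ?thesis by (simp add: card_served f)
qed

text \<open>The implicit equation determines f by induction over the rings, because occupancy just
  before a ring depends on earlier rings and on the arrivals only.\<close>

lemma queue_unique:
  assumes f: "\<And>v. v \<le> t \<Longrightarrow>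
      f v = card {n. ring_time \<xi> i n \<le> v \<and> (\<forall>\<^sub>F v in at_left (ring_time \<xi> i n). f v < q + A v)}"
    and A: "\<And>n. ring_time \<xi> i n \<le> t \<Longrightarrow> \<forall>\<^sub>F v in at_left (ring_time \<xi> i n). A v = c n"
  shows "f t = served q c (count_le \<xi> i t)"
proof -
  define flag where "flag n \<longleftrightarrow> (\<forall>\<^sub>F v in at_left (ring_time \<xi> i n). f v < q + A v)" for n
  have f': "f v = card {n. n < count_le \<xi> i v \<and> flag n}" if "v \<le> t" for v
    using f[OF that] by (simp add: flag_def count_le)
  have "card {l. l < n \<and> flag l} = served q c n" if "n \<le> count_le \<xi> i t" for n
    using that
  proof (induction n)
    case (Suc n)
    have n: "ring_time \<xi> i n \<le> t" using Suc by (simp add: count_le)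
    have "flag n \<longleftrightarrow> served q c n < q + c n"
      unfolding flag_def
    proof (rule eventually_at_left_less_iff[OF _ A[OF n]])
      have "\<forall>\<^sub>F v in at_left (ring_time \<xi> i n). v < ring_time \<xi> i n"
        by (auto simp: eventually_at_filter)
      with eventually_count[of i "ring_time \<xi> i n"]
      show "\<forall>\<^sub>F v in at_left (ring_time \<xi> i n). f v = served q c n"
        by eventually_elim (use n Suc in \<open>simp add: f' count_less_ring_time\<close>)
    qed
    moreover have "{l. l < Suc n \<and> flag l} = {l. l < n \<and> flag l} \<union> (if flag n then {n} else {})"
      by (auto simp: less_Suc_eq)
    ultimately show ?case using Suc by (auto simp: card_insert_if)
  qed simp
  then show ?thesis using f'[of t] by simp
qed

text \<open>Nothing leaves a site whose first ring is later than t, so starting the recursion at it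
  or further to the left makes no difference up to time t. \<open>K\<close> is the distance to such
  a site.\<close>

lemma departures_agree:
  assumes "t < \<xi> (i - int K, 0)" "K < L" "K < L'" "k \<le> count_le \<xi> i t"
  shows "departures \<eta> \<xi> L i k = departures \<eta> \<xi> L' i k"
  using assms
proof (induction K arbitrary: i L L' k)
  case 0
  then have "t < ring_time \<xi> i 0" by (simp add: ring_time_def)
  then have "count_le \<xi> i t = 0"
    using count_le[of i 0 t] by auto
  then show ?case using 0 by (simp add: departures_0)
next
  case (Suc K)
  obtain L1 L1' where L: "L = Suc L1" "L' = Suc L1'" using Suc.prems by (cases L; cases L') auto
  show ?case
    unfolding L departures.simps
  proof (rule served_cong, rule Suc.IH)
    fix l assume "l < k"
    then have "ring_time \<xi> i l \<le> t" using Suc by (simp add: count_le)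
    then show "count_less \<xi> (i - 1) (ring_time \<xi> i l) \<le> count_le \<xi> (i - 1) t"
      by (rule count_less_le)
  qed (use Suc L in \<open>auto simp: algebra_simps\<close>)
qed

text \<open>The recursion starts at the nearest site at or to the left of i that has not rung by
  time t; the \<open>Suc\<close> makes the recursion include that site.\<close>

definition flow :: "int \<Rightarrow> real \<Rightarrow> nat" where
  "flow i t = departures \<eta> \<xi> (Suc (LEAST K. t < \<xi> (i - int K, 0))) i (count_le \<xi> i t)"

lemma flow_eq:
  assumes "t < \<xi> (i - int K, 0)" "K < L"
  shows "flow i t = departures \<eta> \<xi> L i (count_le \<xi> i t)"
  unfolding flow_def
proof (rule departures_agree)
  show "t < \<xi> (i - int (LEAST K. t < \<xi> (i - int K, 0)), 0)"
    by (rule LeastI[of "\<lambda>K. t < \<xi> (i - int K, 0)", OF assms(1)])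
  have "(LEAST K. t < \<xi> (i - int K, 0)) \<le> K"
    by (rule Least_le[of "\<lambda>K. t < \<xi> (i - int K, 0)", OF assms(1)])
  then show "(LEAST K. t < \<xi> (i - int K, 0)) < L" using assms(2) by simp
qed simp_all

lemma eventually_flow:
  assumes "t < \<xi> (i - int K, 0)" "K < L" "\<tau> \<le> t"
  shows "\<forall>\<^sub>F v in at_left \<tau>. flow i v = departures \<eta> \<xi> L i (count_less \<xi> i \<tau>)"
proof -
  have "\<forall>\<^sub>F v in at_left \<tau>. v < \<tau>"
    by (auto simp: eventually_at_filter)
  with eventually_count[of i \<tau>] show ?thesis
  proof eventually_elim
    case (elim v)
    then have "flow i v = departures \<eta> \<xi> L i (count_le \<xi> i v)"
      using assms by (intro flow_eq[of _ _ K]) auto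
    then show ?case using elim by simp
  qed
qed

lemma quiet_before: "\<exists>K. t < \<xi> (i - int K, 0)"
proof -
  obtain j where "j \<le> i" "t < \<xi> (j, 0)" using quiet by blast
  then show ?thesis by (intro exI[of _ "nat (i - j)"]) simp
qed

text \<open>A recursion depth that suffices at time t suffices at all earlier times, so one fixed
  depth describes the whole path up to t and \<open>queue_solution\<close> applies.\<close>

lemma flow_solution:
  "flow i t = card {n. ring_time \<xi> i n \<le> t \<and>
    (\<forall>\<^sub>F v in at_left (ring_time \<xi> i n). flow i v < \<eta> i + flow (i - 1) v)}"
  and flow_le: "flow i t \<le> \<eta> i + flow (i - 1) t"
proof -
  obtain K where K: "t < \<xi> (i - 1 - int K, 0)" using quiet_before by blast
  have K': "t < \<xi> (i - int (Suc K), 0)" using K by (simp add: algebra_simps)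
  define c where "c k = departures \<eta> \<xi> (Suc K) (i - 1) (count_less \<xi> (i - 1) (ring_time \<xi> i k))" for k
  have f: "flow i v = served (\<eta> i) c (count_le \<xi> i v)" if "v \<le> t" for v
  proof -
    have "flow i v = departures \<eta> \<xi> (Suc (Suc K)) i (count_le \<xi> i v)"
      using K' that by (intro flow_eq[of v i "Suc K"]) auto
    then show ?thesis unfolding c_def by (simp only: departures.simps)
  qed
  show "flow i t = card {n. ring_time \<xi> i n \<le> t \<and>
    (\<forall>\<^sub>F v in at_left (ring_time \<xi> i n). flow i v < \<eta> i + flow (i - 1) v)}"
    unfolding c_def by (rule queue_solution[OF f[unfolded c_def]], assumption)
      (rule eventually_flow[OF K lessI])
  show "flow i t \<le> \<eta> i + flow (i - 1) t"
    unfolding f[OF order_refl]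
  proof (rule served_le)
    fix l assume "l < count_le \<xi> i t"
    then have "ring_time \<xi> i l \<le> t" by (simp add: count_le)
    then have "c l \<le> departures \<eta> \<xi> (Suc K) (i - 1) (count_le \<xi> (i - 1) t)"
      unfolding c_def by (intro departures_mono count_less_le)
    also have "\<dots> = flow (i - 1) t" using flow_eq[OF K, of "Suc K"] by simp
    finally show "c l \<le> flow (i - 1) t" .
  qed
qed

definition trajectory :: "real \<Rightarrow> config" where
  "trajectory t i = \<eta> i + flow (i - 1) t - flow i t"

lemma trajectory_path: "tazrp_path (\<eta>, \<xi>) trajectory"
proof -
  have pos: "0 < trajectory u i \<longleftrightarrow> flow i u < \<eta> i + flow (i - 1) u" for u i
    unfolding trajectory_def by auto
  have "jump_count \<xi> trajectory i t = flow i t" for i t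
    unfolding jump_count_def pos by (rule flow_solution[symmetric])
  then show ?thesis
    unfolding tazrp_path_def using flow_le by (auto simp: trajectory_def of_nat_diff)
qed

text \<open>Induction over the distance to a site that has not rung by time t: there the number of
  jumps is zero, and \<open>queue_unique\<close> carries the identity one site to the right.\<close>

lemma path_unique:
  assumes "tazrp_path (\<eta>, \<xi>) x"
  shows "x = trajectory"
proof -
  define f where "f i t = jump_count \<xi> x i t" for i t
  have x: "int (x t i) = int (\<eta> i) + int (f (i - 1) t) - int (f i t)" for t i
    using assms by (simp add: tazrp_path_def f_def)
  have pos: "0 < x u i \<longleftrightarrow> f i u < \<eta> i + f (i - 1) u" for u i
    using x[of u i] by linarith
  have f: "f i t = card {n. ring_time \<xi> i n \<le> t \<and>
      (\<forall>\<^sub>F v in at_left (ring_time \<xi> i n). f i v < \<eta> i + f (i - 1) v)}" for i t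
    using jump_count_def[of \<xi> x i t] unfolding pos f_def[symmetric] .
  have claim: "f i t = departures \<eta> \<xi> L i (count_le \<xi> i t)" if "t < \<xi> (i - int K, 0)" "K < L" for i t K L
    using that
  proof (induction K arbitrary: i t L)
    case 0
    then have "t < ring_time \<xi> i 0" by (simp add: ring_time_def)
    then have "count_le \<xi> i t = 0"
      using count_le[of i 0 t] by auto
    then show ?case using f[of i t] by (simp add: departures_0 count_le)
  next
    case (Suc K)
    obtain L1 where L: "L = Suc L1" using Suc.prems by (cases L) auto
    have K: "t < \<xi> (i - 1 - int K, 0)" using Suc.prems by (simp add: algebra_simps)
    have IH: "f (i - 1) v = departures \<eta> \<xi> L1 (i - 1) (count_le \<xi> (i - 1) v)" if "v \<le> t" for v
      using Suc.IH[of v "i - 1" L1] K that Suc.prems L by simp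
    show ?case
      unfolding L departures.simps
    proof (rule queue_unique[OF f])
      fix n assume n: "ring_time \<xi> i n \<le> t"
      have "\<forall>\<^sub>F v in at_left (ring_time \<xi> i n). v < ring_time \<xi> i n"
        by (auto simp: eventually_at_filter)
      with eventually_count[of "i - 1" "ring_time \<xi> i n"]
      show "\<forall>\<^sub>F v in at_left (ring_time \<xi> i n). f (i - 1) v =
          departures \<eta> \<xi> L1 (i - 1) (count_less \<xi> (i - 1) (ring_time \<xi> i n))"
        by eventually_elim (use n in \<open>simp add: IH\<close>)
    qed
  qed
  have "f i t = flow i t" for i t
    using quiet_before[of t i] claim flow_eq by (metis lessI)
  then have "x t i = trajectory t i" for t i
    using x[of t i] unfolding trajectory_def by simp
  then show ?thesis by (intro ext)
qed

lemma tazrp_eq: "tazrp (\<eta>, \<xi>) = trajectory"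
  unfolding tazrp_def using trajectory_path path_unique by (intro the_equality)

end

section \<open>Clocks on a lattice of time steps\<close>

definition rings :: "(nat \<Rightarrow> nat) \<Rightarrow> nat \<Rightarrow> nat" where
  "rings g k = (\<Sum>l\<le>k. Suc (g l))"

text \<open>Entry m belongs to the time step m + 1, because the gaps in \<open>rings\<close> are at
  least one and no ring happens at time 0.\<close>

definition ring_bits :: "(nat \<Rightarrow> nat) \<Rightarrow> nat \<Rightarrow> bool list" where
  "ring_bits g M = map (\<lambda>m. Suc m \<in> range (rings g)) [0..<M]"

lemma strict_mono_rings: "strict_mono (rings g)"
  by (rule strict_monoI_Suc) (simp add: rings_def)

lemma rings_pos: "0 < rings g k"
  unfolding rings_def by (rule sum_pos) auto

lemma rings_count: "rings g k \<le> m \<longleftrightarrow> k < card {k. rings g k \<le> m}"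
proof -
  have "m < rings g (Suc m)"
    using strict_mono_imp_increasing[OF strict_mono_rings, of "Suc m" g] by simp
  from strict_mono_le_count(1)[OF strict_mono_rings this] show ?thesis by blast
qed

lemma rings_count_Suc:
  "card {k. rings g k \<le> Suc m} = card {k. rings g k \<le> m} + of_bool (Suc m \<in> range (rings g))"
proof (cases "Suc m \<in> range (rings g)")
  case True
  then obtain k where k: "Suc m = rings g k" by auto
  have "rings g l \<le> Suc m \<longleftrightarrow> l = k \<or> rings g l \<le> m" for l
    using strict_mono_eq[OF strict_mono_rings, of g l k] k by (auto simp: le_Suc_eq)
  then have "{l. rings g l \<le> Suc m} = insert k {l. rings g l \<le> m}" by auto
  moreover have "finite {l. rings g l \<le> m}"
    by (subst rings_count) simp
  moreover have "k \<notin> {l. rings g l \<le> m}" using k by auto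
  ultimately show ?thesis using True by simp
next
  case False
  then have "rings g l \<noteq> Suc m" for l by (metis rangeI)
  then have "{l. rings g l \<le> Suc m} = {l. rings g l \<le> m}"
    by (auto simp: le_Suc_eq)
  then show ?thesis using False by simp
qed

lemma rings_eq_Suc:
  assumes "Suc m \<in> range (rings g)"
  shows "rings g (card {k. rings g k \<le> m}) = Suc m"
proof -
  obtain k where k: "Suc m = rings g k" using assms by auto
  have "rings g l \<le> m \<longleftrightarrow> l < k" for l
    using strict_mono_less[OF strict_mono_rings, of g l k] k by auto
  then show ?thesis using k by simp
qed

lemma column_step:
  assumes "length as = length bs" "m < length bs"
  shows "trues (take (Suc m) (snd (column q as bs))) = trues (take m (snd (column q as bs))) +
    of_bool (bs ! m \<and> trues (take m (snd (column q as bs))) < q + trues (take (Suc m) as))"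
  using assms
proof (induction as bs arbitrary: q m rule: list_induct2)
  case (Cons a as b bs)
  define d where "d = (b \<and> (a \<or> 0 < q))"
  define q' where "q' = q + of_bool a - of_bool d"
  have q': "q' + of_bool d = q + of_bool a"
    by (auto simp: q'_def d_def)
  have eq: "snd (column q (a # as) (b # bs)) = d # snd (column q' as bs)"
    by (simp add: Let_def d_def q'_def)
  show ?case
  proof (cases m)
    case 0
    then show ?thesis unfolding eq by (auto simp: d_def)
  next
    case (Suc j)
    then have "trues (take (Suc j) (snd (column q' as bs))) = trues (take j (snd (column q' as bs))) +
      of_bool (bs ! j \<and> trues (take j (snd (column q' as bs))) < q' + trues (take (Suc j) as))"
      using Cons by auto
    moreover have "of_bool d + trues (take j (snd (column q' as bs))) < q + (of_bool a + trues (take (Suc j) as)) \<longleftrightarrow>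
      trues (take j (snd (column q' as bs))) < q' + trues (take (Suc j) as)"
      using q' by linarith
    ultimately show ?thesis
      unfolding eq Suc by (simp add: add.assoc)
  qed
qed simp

text \<open>Connects the queue on lists of bits with the recursion of the graphical construction. A
  customer may be served in the step of its arrival, so the arrivals up to and including the step
  \<open>rings g k\<close> are present at ring k.\<close>

lemma column_served:
  assumes "length as = M" "m \<le> M"
  shows "trues (take m (snd (column q as (ring_bits g M)))) =
    served q (\<lambda>k. trues (take (rings g k) as)) (card {k. rings g k \<le> m})"
  using assms(2)
proof (induction m)
  case 0
  have "\<not> rings g k \<le> 0" for k using rings_pos[of g k] by simp
  then have "card {k. rings g k \<le> 0} = 0" by (simp only: Collect_empty_eq[THEN iffD2] card.empty) simp
  then show ?case by (simp only: take_0 list.map served.simps) simp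
next
  case (Suc m)
  let ?s = "served q (\<lambda>k. trues (take (rings g k) as))"
  have len: "length (ring_bits g M) = M" by (simp add: ring_bits_def)
  have b: "ring_bits g M ! m \<longleftrightarrow> Suc m \<in> range (rings g)"
    using Suc by (simp add: ring_bits_def)
  have "trues (take (Suc m) (snd (column q as (ring_bits g M)))) = ?s (card {k. rings g k \<le> m}) +
    of_bool (Suc m \<in> range (rings g) \<and> ?s (card {k. rings g k \<le> m}) < q + trues (take (Suc m) as))"
    using column_step[of as "ring_bits g M" m q] Suc assms by (simp add: len b)
  also have "\<dots> = ?s (card {k. rings g k \<le> Suc m})"
    using rings_eq_Suc[of m g] by (auto simp: rings_count_Suc)
  finally show ?case .
qed

text \<open>For positive x, \<open>Suc (cell n x)\<close> is the number of the cell of length 1 / n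
  that contains x. When x is exponential, lack of memory makes \<open>cell n x\<close>
  geometric.\<close>

definition cell :: "nat \<Rightarrow> real \<Rightarrow> nat" where
  "cell n x = nat (\<lceil>real n * x\<rceil> - 1)"

lemma cell_bounds:
  assumes "0 < n" "0 < x"
  shows "real n * x \<le> real (Suc (cell n x))" "real (Suc (cell n x)) \<le> real n * x + 1"
proof -
  have "0 < real n * x" using assms by simp
  then have "1 \<le> \<lceil>real n * x\<rceil>" by linarith
  then have "real (Suc (cell n x)) = real_of_int \<lceil>real n * x\<rceil>"
    by (simp add: cell_def)
  then show "real n * x \<le> real (Suc (cell n x))" "real (Suc (cell n x)) \<le> real n * x + 1"
    by linarith+
qed

definition site_cells :: "waiting \<Rightarrow> nat \<Rightarrow> int \<Rightarrow> nat \<Rightarrow> nat" where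
  "site_cells \<xi> n i k = cell n (\<xi> (i, k))"

context regular_clocks
begin

text \<open>Every waiting time is rounded up separately, which keeps the lattice clock exactly
  Bernoulli. The price is an error of up to k + 1 cells at ring k, negligible in real time for fixed
  k.\<close>

lemma rings_bounds:
  assumes "0 < n"
  shows "real n * ring_time \<xi> i k \<le> real (rings (site_cells \<xi> n i) k)"
    "real (rings (site_cells \<xi> n i) k) \<le> real n * ring_time \<xi> i k + real (Suc k)"
proof -
  have r: "real (rings (site_cells \<xi> n i) k) = (\<Sum>l\<le>k. real (Suc (cell n (\<xi> (i, l)))))"
    by (simp add: rings_def site_cells_def del: of_nat_Suc)
  show "real n * ring_time \<xi> i k \<le> real (rings (site_cells \<xi> n i) k)"
    unfolding r ring_time_def sum_distrib_left
    by (intro sum_mono cell_bounds assms waiting_pos)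
  have "real (rings (site_cells \<xi> n i) k) \<le> (\<Sum>l\<le>k. real n * \<xi> (i, l) + 1)"
    unfolding r by (intro sum_mono cell_bounds assms waiting_pos)
  then show "real (rings (site_cells \<xi> n i) k) \<le> real n * ring_time \<xi> i k + real (Suc k)"
    by (simp add: sum.distrib ring_time_def sum_distrib_left)
qed

lemma eventually_mult_ge:
  fixes a b :: real
  assumes "a < b"
  shows "\<forall>\<^sub>F n in sequentially. real n * a + c \<le> real n * b"
proof -
  have "\<forall>\<^sub>F n in sequentially. c / (b - a) \<le> real n"
    using eventually_ge_at_top[of "nat \<lceil>c / (b - a)\<rceil>"]
    by eventually_elim linarith
  then show ?thesis
  proof eventually_elim
    case (elim n)
    then have "c \<le> real n * (b - a)" using assms by (simp add: pos_divide_le_eq)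
    then show ?case by (simp add: right_diff_distrib)
  qed
qed

text \<open>Because t is not a ring time, its distance to the adjacent rings eventually exceeds the
  rounding error.\<close>

lemma eventually_count_rings_time:
  assumes "0 < t" "\<And>k. ring_time \<xi> i k \<noteq> t"
  shows "\<forall>\<^sub>F n in sequentially. card {k. rings (site_cells \<xi> n i) k \<le> nat \<lfloor>real n * t\<rfloor>} = count_le \<xi> i t"
proof -
  define m where "m = count_le \<xi> i t"
  have up: "t < ring_time \<xi> i m"
    using count_le[of i m t] by (simp add: m_def)
  have low: "m = 0 \<or> ring_time \<xi> i (m - 1) < t"
  proof (cases "m = 0")
    case False
    then have "ring_time \<xi> i (m - 1) \<le> t" unfolding count_le m_def by linarith
    then show ?thesis using assms(2)[of "m - 1"] by linarith
  qed simp
  have ev: "\<forall>\<^sub>F n in sequentially. m = 0 \<or> real n * ring_time \<xi> i (m - 1) + (real m + 1) \<le> real n * t"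
    using low eventually_mult_ge[of "ring_time \<xi> i (m - 1)" t "real m + 1"] by (cases "m = 0") auto
  show ?thesis
    using ev eventually_gt_at_top[of 0]
  proof eventually_elim
    case (elim n)
    show ?case
      unfolding m_def[symmetric]
    proof (rule strict_mono_card_le_eq[OF strict_mono_rings])
      have "real (nat \<lfloor>real n * t\<rfloor>) \<le> real n * t" using assms(1) by simp
      also have "\<dots> < real n * ring_time \<xi> i m" using up elim by simp
      also have "\<dots> \<le> real (rings (site_cells \<xi> n i) m)" by (rule rings_bounds) fact
      finally show "nat \<lfloor>real n * t\<rfloor> < rings (site_cells \<xi> n i) m" by simp
      show "m = 0 \<or> rings (site_cells \<xi> n i) (m - 1) \<le> nat \<lfloor>real n * t\<rfloor>"
      proof (cases "m = 0")
        case False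
        have "real (rings (site_cells \<xi> n i) (m - 1)) \<le> real n * ring_time \<xi> i (m - 1) + real m"
          using rings_bounds(2)[of n i "m - 1"] elim False by simp
        also have "\<dots> \<le> real n * t - 1" using elim False by simp
        finally have "real (rings (site_cells \<xi> n i) (m - 1)) \<le> real n * t - 1" .
        then show ?thesis by linarith
      qed simp
    qed
  qed
qed

text \<open>The lattice lets a tie count as an earlier ring and the process does not. By
  \<open>distinct\<close> the true ring times differ, so for large n rounding neither creates a tie
  nor changes the order.\<close>

lemma eventually_count_rings_ring:
  "\<forall>\<^sub>F n in sequentially. card {l. rings (site_cells \<xi> n (i - 1)) l \<le> rings (site_cells \<xi> n i) k} =
    count_less \<xi> (i - 1) (ring_time \<xi> i k)"
proof -
  define \<tau> where "\<tau> = ring_time \<xi> i k"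
  define m where "m = count_less \<xi> (i - 1) \<tau>"
  have up: "\<tau> < ring_time \<xi> (i - 1) m"
    using count_less[of "i - 1" m \<tau>] distinct[of i k m] unfolding m_def \<tau>_def by linarith
  have low: "m = 0 \<or> ring_time \<xi> (i - 1) (m - 1) < \<tau>"
    unfolding count_less m_def by linarith
  have ev: "\<forall>\<^sub>F n in sequentially. m = 0 \<or> real n * ring_time \<xi> (i - 1) (m - 1) + real m \<le> real n * \<tau>"
    using low eventually_mult_ge[of "ring_time \<xi> (i - 1) (m - 1)" \<tau> "real m"] by (cases "m = 0") auto
  show ?thesis
    using ev eventually_mult_ge[OF up, of "real k + 2"] eventually_gt_at_top[of 0]
  proof eventually_elim
    case (elim n)
    show ?case
      unfolding m_def[unfolded \<tau>_def, symmetric]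
    proof (rule strict_mono_card_le_eq[OF strict_mono_rings])
      have "real (rings (site_cells \<xi> n i) k) \<le> real n * \<tau> + real (Suc k)"
        unfolding \<tau>_def by (rule rings_bounds) fact
      also have "\<dots> < real n * ring_time \<xi> (i - 1) m" using elim by simp
      also have "\<dots> \<le> real (rings (site_cells \<xi> n (i - 1)) m)" by (rule rings_bounds) fact
      finally show "rings (site_cells \<xi> n i) k < rings (site_cells \<xi> n (i - 1)) m" by simp
      show "m = 0 \<or> rings (site_cells \<xi> n (i - 1)) (m - 1) \<le> rings (site_cells \<xi> n i) k"
      proof (cases "m = 0")
        case False
        have "real (rings (site_cells \<xi> n (i - 1)) (m - 1)) \<le> real n * ring_time \<xi> (i - 1) (m - 1) + real m"
          using rings_bounds(2)[of n "i - 1" "m - 1"] elim False by simp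
        also have "\<dots> \<le> real n * \<tau>" using elim False by simp
        also have "\<dots> \<le> real (rings (site_cells \<xi> n i) k)"
          unfolding \<tau>_def by (rule rings_bounds) fact
        finally show ?thesis by simp
      qed simp
    qed
  qed
qed

end

section \<open>Discretisation of time\<close>

lemma tandem_nth:
  assumes "l < length qs" "length qs = length bs"
  shows "fst (tandem qs bs w) ! l =
      fst (column (qs ! l) (snd (tandem (take l qs) (take l bs) w)) (bs ! l))"
    "snd (tandem (take (Suc l) qs) (take (Suc l) bs) w) =
      snd (column (qs ! l) (snd (tandem (take l qs) (take l bs) w)) (bs ! l))"
  using assms
proof (induction qs bs w arbitrary: l rule: tandem.induct)
  case (1 q qs b bs w)
  {
    case 1
    then show ?case using "1.IH" by (cases l) (auto simp: Let_def)
  next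
    case 2
    then show ?case using "1.IH" by (cases l) (auto simp: Let_def)
  }
qed auto

text \<open>The grid begins at the site - n, so that site i has the index n + i and the origin the
  index n.\<close>

definition grid_occupations :: "config \<Rightarrow> nat \<Rightarrow> nat \<Rightarrow> nat list" where
  "grid_occupations \<eta> n X = map (\<lambda>l. \<eta> (int l - int n)) [0..<X]"

definition grid_clocks :: "waiting \<Rightarrow> nat \<Rightarrow> nat \<Rightarrow> nat \<Rightarrow> bool list list" where
  "grid_clocks \<xi> n X M = map (\<lambda>l. ring_bits (site_cells \<xi> n (int l - int n)) M) [0..<X]"

context regular_clocks
begin

text \<open>No clock rings at the index \<open>l0\<close> up to time t, so neither the arrivals
  \<open>w\<close> nor the sites before it influence anything beyond; from there on the lattice
  recursion and \<open>departures\<close> agree site by site. The inequality \<open>l0 < l\<close>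
  is strict since the site at \<open>l0\<close> may itself receive artificial particles.\<close>

lemma grid_match:
  fixes n X M l0 :: nat and w :: "bool list"
  defines "site \<equiv> (\<lambda>l. int l - int n)"
  assumes quiet0: "t < \<xi> (site l0, 0)"
    and cnt: "\<And>l. l0 \<le> l \<Longrightarrow> l < X \<Longrightarrow>
      card {k. rings (site_cells \<xi> n (site l)) k \<le> M} = count_le \<xi> (site l) t"
    and cmp: "\<And>l k. l0 \<le> l \<Longrightarrow> Suc l < X \<Longrightarrow> k < count_le \<xi> (site (Suc l)) t \<Longrightarrow>
      card {k'. rings (site_cells \<xi> n (site l)) k' \<le> rings (site_cells \<xi> n (site (Suc l))) k} =
      count_less \<xi> (site l) (ring_time \<xi> (site (Suc l)) k)"
    and w: "length w = M" and l: "l0 < l" "l < X"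
  shows "fst (tandem (grid_occupations \<eta> n X) (grid_clocks \<xi> n X M) w) ! l = trajectory t (site l)"
proof -
  define qs where "qs = grid_occupations \<eta> n X"
  define bs where "bs = grid_clocks \<xi> n X M"
  define e where "e l = snd (tandem (take l qs) (take l bs) w)" for l
  define g where "g l = site_cells \<xi> n (site l)" for l
  have len: "length qs = X" "length bs = X"
    by (simp_all add: qs_def bs_def grid_occupations_def grid_clocks_def)
  have nth: "qs ! l = \<eta> (site l)" "bs ! l = ring_bits (g l) M" if "l < X" for l
    using that by (simp_all add: qs_def bs_def grid_occupations_def grid_clocks_def g_def site_def)
  have bsM: "\<forall>b\<in>set bs. length b = M"
    by (auto simp: bs_def grid_clocks_def ring_bits_def)
  have e_len: "length (e l) = M" for l
  proof -
    have "length (e l) = length w"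
      unfolding e_def using len bsM w by (intro tandem_length(2)) (auto dest: in_set_takeD)
    then show ?thesis using w by simp
  qed
  have e_Suc: "e (Suc l) = snd (column (\<eta> (site l)) (e l) (ring_bits (g l) M))" if "l < X" for l
    using tandem_nth(2)[of l qs bs w] that len by (simp add: e_def nth)
  have ser: "trues (take m (e (Suc l))) =
      served (\<eta> (site l)) (\<lambda>k. trues (take (rings (g l) k) (e l))) (card {k. rings (g l) k \<le> m})"
    if "l < X" "m \<le> M" for l m
    unfolding e_Suc[OF that(1)] by (rule column_served[OF e_len that(2)])
  have claim: "served (\<eta> (site l)) (\<lambda>k. trues (take (rings (g l) k) (e l))) k =
      departures \<eta> \<xi> (Suc (l - l0)) (site l) k"
    if "l0 \<le> l" "l < X" "k \<le> count_le \<xi> (site l) t" for l k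
    using that
  proof (induction l arbitrary: k rule: dec_induct)
    case base
    then have "t < ring_time \<xi> (site l0) 0" using quiet0 by (simp add: ring_time_def)
    then have "count_le \<xi> (site l0) t = 0"
      using count_le[of "site l0" 0 t] by auto
    then show ?case using base by simp
  next
    case (step l)
    have s: "site (Suc l) - 1 = site l" by (simp add: site_def)
    have d: "Suc l - l0 = Suc (l - l0)" using step by simp
    show ?case
      unfolding d departures.simps(2)[of _ _ "Suc (l - l0)"] s
    proof (rule served_cong)
      fix k' assume "k' < k"
      then have k': "k' < count_le \<xi> (site (Suc l)) t" using step.prems by simp
      then have "k' < card {k. rings (g (Suc l)) k \<le> M}"
        using cnt[of "Suc l"] step.hyps step.prems by (simp add: g_def)
      then have le: "rings (g (Suc l)) k' \<le> M" by (subst rings_count)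
      have "trues (take (rings (g (Suc l)) k') (e (Suc l))) =
        served (\<eta> (site l)) (\<lambda>k. trues (take (rings (g l) k) (e l)))
          (card {k. rings (g l) k \<le> rings (g (Suc l)) k'})"
        using step.prems by (intro ser le) simp
      also have "card {k. rings (g l) k \<le> rings (g (Suc l)) k'} =
          count_less \<xi> (site l) (ring_time \<xi> (site (Suc l)) k')"
        unfolding g_def using step.hyps step.prems k' by (intro cmp) auto
      also have "served (\<eta> (site l)) (\<lambda>k. trues (take (rings (g l) k) (e l))) \<dots> =
          departures \<eta> \<xi> (Suc (l - l0)) (site l) (count_less \<xi> (site l) (ring_time \<xi> (site (Suc l)) k'))"
      proof (rule step.IH)
        have "ring_time \<xi> (site (Suc l)) k' \<le> t" using k' by (simp add: count_le)
        then show "count_less \<xi> (site l) (ring_time \<xi> (site (Suc l)) k') \<le> count_le \<xi> (site l) t"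
          by (rule count_less_le)
      qed (use step.prems in simp)
      finally show "trues (take (rings (g (Suc l)) k') (e (Suc l))) =
          departures \<eta> \<xi> (Suc (l - l0)) (site l) (count_less \<xi> (site l) (ring_time \<xi> (site (Suc l)) k'))" .
    qed
  qed
  have out: "trues (e (Suc l)) = flow (site l) t" if "l0 \<le> l" "l < X" for l
  proof -
    have "trues (e (Suc l)) = trues (take M (e (Suc l)))"
      using e_len[of "Suc l"] by simp
    also have "\<dots> = departures \<eta> \<xi> (Suc (l - l0)) (site l) (count_le \<xi> (site l) t)"
      using ser[OF that(2) order_refl] claim[OF that] cnt[OF that] by (simp add: g_def)
    also have "\<dots> = flow (site l) t"
    proof (rule flow_eq[symmetric])
      have "site l - int (l - l0) = site l0" using that by (simp add: site_def)
      then show "t < \<xi> (site l - int (l - l0), 0)" using quiet0 by simp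
    qed simp
    finally show ?thesis .
  qed
  obtain l' where l': "l = Suc l'" "l0 \<le> l'" using l by (cases l) auto
  have "site l - 1 = site l'" by (simp add: site_def l')
  then have "trues (e l) = flow (site l - 1) t"
    using out[of l'] l l' by simp
  moreover have "fst (column (\<eta> (site l)) (e l) (ring_bits (g l) M)) + trues (e (Suc l)) = \<eta> (site l) + trues (e l)"
    using column_conservation[of "e l" "ring_bits (g l) M" "\<eta> (site l)"] e_len[of l]
    by (simp add: e_Suc[OF l(2)] ring_bits_def)
  moreover have "fst (tandem qs bs w) ! l = fst (column (\<eta> (site l)) (e l) (ring_bits (g l) M))"
    using tandem_nth(1)[of l qs bs w] l len by (simp add: e_def nth)
  ultimately show ?thesis
    using out[of l] l unfolding trajectory_def qs_def bs_def by simp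
qed

text \<open>Between a quiet site and I only finitely many clocks, each with finitely many rings up
  to t, matter, so the finitely many eventual statements hold simultaneously.\<close>

lemma eventually_grid_match:
  assumes t: "0 < t" "\<And>i k. ring_time \<xi> i k \<noteq> t" and i: "i \<le> int I"
  shows "\<forall>\<^sub>F n in sequentially. \<forall>w. length w = nat \<lfloor>real n * t\<rfloor> \<longrightarrow>
    fst (tandem (grid_occupations \<eta> n (n + Suc I)) (grid_clocks \<xi> n (n + Suc I) (nat \<lfloor>real n * t\<rfloor>)) w) !
      nat (int n + i) = trajectory t i"
proof -
  obtain j where j: "j \<le> i - 1" "t < \<xi> (j, 0)" using quiet by blast
  have ev1: "\<forall>\<^sub>F n in sequentially. \<forall>s\<in>{j..int I}.
      card {k. rings (site_cells \<xi> n s) k \<le> nat \<lfloor>real n * t\<rfloor>} = count_le \<xi> s t"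
    by (intro eventually_ball_finite ballI eventually_count_rings_time t) simp
  have ev2: "\<forall>\<^sub>F n in sequentially. \<forall>s\<in>{j..int I}. \<forall>k\<in>{..<count_le \<xi> s t}.
      card {l. rings (site_cells \<xi> n (s - 1)) l \<le> rings (site_cells \<xi> n s) k} =
      count_less \<xi> (s - 1) (ring_time \<xi> s k)"
    by (intro eventually_ball_finite ballI eventually_count_rings_ring) simp_all
  show ?thesis
    using ev1 ev2 eventually_ge_at_top[of "nat (- j)"]
  proof eventually_elim
    case (elim n)
    have nj: "0 \<le> int n + j" using elim by simp
    define l0 where "l0 = nat (int n + j)"
    define l where "l = nat (int n + i)"
    have s0: "int l0 - int n = j" and s: "int l - int n = i" using nj j by (auto simp: l0_def l_def)
    show ?case
    proof (intro allI impI)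
      fix w :: "bool list" assume w: "length w = nat \<lfloor>real n * t\<rfloor>"
      have "fst (tandem (grid_occupations \<eta> n (n + Suc I)) (grid_clocks \<xi> n (n + Suc I) (nat \<lfloor>real n * t\<rfloor>)) w) ! l =
        trajectory t (int l - int n)"
      proof (rule grid_match[where ?l0.0 = l0, OF _ _ _ w])
        show "t < \<xi> (int l0 - int n, 0)" using s0 j by simp
        fix m assume m: "l0 \<le> m" "m < n + Suc I"
        then have "int m - int n \<in> {j..int I}" using s0 by auto
        then show "card {k. rings (site_cells \<xi> n (int m - int n)) k \<le> nat \<lfloor>real n * t\<rfloor>} =
            count_le \<xi> (int m - int n) t"
          using elim by blast
      next
        fix m k assume m: "l0 \<le> m" "Suc m < n + Suc I" "k < count_le \<xi> (int (Suc m) - int n) t"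
        have "int (Suc m) - int n \<in> {j..int I}" "int (Suc m) - int n - 1 = int m - int n"
          using s0 m by auto
        then show "card {k'. rings (site_cells \<xi> n (int m - int n)) k' \<le>
            rings (site_cells \<xi> n (int (Suc m) - int n)) k} =
          count_less \<xi> (int m - int n) (ring_time \<xi> (int (Suc m) - int n) k)"
          using elim m(3) by (metis lessThan_iff)
      next
        show "l0 < l" using j nj by (simp add: l0_def l_def)
        show "l < n + Suc I" using i by (simp add: l_def)
      qed
      then show "fst (tandem (grid_occupations \<eta> n (n + Suc I)) (grid_clocks \<xi> n (n + Suc I) (nat \<lfloor>real n * t\<rfloor>)) w) !
          nat (int n + i) = trajectory t i"
        by (simp add: s flip: l_def)
    qed
  qed
qed

lemma trajectory_0: "trajectory 0 i = \<eta> i"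
proof -
  have "flow j 0 = 0" for j
  proof -
    have "ring_time \<xi> j 0 > 0" using waiting_pos by (simp add: ring_time_def)
    then have "count_le \<xi> j 0 = 0" using count_le[of j 0 0] by auto
    then show ?thesis by (simp add: flow_def departures_0 del: departures.simps)
  qed
  then show ?thesis by (simp add: trajectory_def)
qed

end

section \<open>The law of the discretised clocks\<close>

abbreviation unit_exp :: "real measure" where
  "unit_exp \<equiv> density lborel (exponential_density 1)"

lemma prob_space_unit_exp: "prob_space unit_exp"
  by (rule prob_space_exponential_density) simp

lemma emeasure_unit_exp_gt:
  assumes "0 \<le> a"
  shows "emeasure unit_exp {x. a < x} = ennreal (exp (- a))"
proof -
  interpret prob_space unit_exp by (rule prob_space_unit_exp)
  have "distributed unit_exp lborel (\<lambda>x. x) (exponential_density 1)"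
    unfolding distributed_def by (auto simp: distr_id2)
  from exponential_distributedD_gt[OF this assms] show ?thesis
    by (simp add: emeasure_eq_measure)
qed

lemma cell_ge_iff: "0 < n \<Longrightarrow> d \<noteq> 0 \<Longrightarrow> d \<le> cell n x \<longleftrightarrow> real d / real n < x"
proof -
  assume n: "0 < n" "d \<noteq> 0"
  have "d \<le> cell n x \<longleftrightarrow> int d < \<lceil>real n * x\<rceil>"
    using n unfolding cell_def by linarith
  also have "\<dots> \<longleftrightarrow> real d < real n * x" by (simp add: less_ceiling_iff)
  also have "\<dots> \<longleftrightarrow> real d / real n < x" using n by (simp add: divide_less_eq mult.commute)
  finally show ?thesis .
qed

lemma measurable_cell [measurable]: "cell n \<in> borel \<rightarrow>\<^sub>M count_space UNIV"
  unfolding cell_def[abs_def] by measurable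

lemma emeasure_cell_ge:
  assumes "0 < n"
  shows "emeasure unit_exp {x. d \<le> cell n x} = ennreal (exp (- 1 / real n) ^ d)"
proof (cases "d = 0")
  case True
  then show ?thesis
    using prob_space.emeasure_space_1[OF prob_space_unit_exp] by simp
next
  case False
  then show ?thesis
    using assms emeasure_unit_exp_gt[of "real d / real n"]
    by (simp add: cell_ge_iff exp_of_nat_mult[symmetric])
qed

lemma emeasure_cell_eq:
  assumes "0 < n"
  shows "emeasure unit_exp {x. cell n x = d} =
    ennreal (exp (- 1 / real n) ^ d * (1 - exp (- 1 / real n)))"
proof -
  let ?q = "exp (- 1 / real n)"
  have q: "0 < ?q" "?q \<le> 1" using assms by auto
  interpret prob_space unit_exp by (rule prob_space_unit_exp)
  have "{x. cell n x = d} = {x. d \<le> cell n x} - {x. Suc d \<le> cell n x}" by auto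
  also have "emeasure unit_exp \<dots> = emeasure unit_exp {x. d \<le> cell n x} - emeasure unit_exp {x. Suc d \<le> cell n x}"
  proof (rule emeasure_Diff)
    show "{x. Suc d \<le> cell n x} \<in> sets unit_exp"
      by (simp, measurable)
  qed auto
  also have "\<dots> = ennreal (?q ^ d - ?q ^ Suc d)"
    unfolding emeasure_cell_ge[OF assms] by (rule ennreal_minus) (use q in auto)
  finally show ?thesis by (simp add: algebra_simps)
qed

text \<open>The bits of a clock fix its gaps one after the other, with d the number of steps since
  the last ring. When the list ends, the current gap is only known to be at least d.\<close>

fun gap_conditions :: "nat \<Rightarrow> bool list \<Rightarrow> (nat \<Rightarrow> bool) list" where
  "gap_conditions d [] = [\<lambda>c. d \<le> c]"
| "gap_conditions d (True # bs) = (\<lambda>c. c = d) # gap_conditions 0 bs"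
| "gap_conditions d (False # bs) = gap_conditions (Suc d) bs"

lemma rings_shift: "rings g (Suc k) = Suc (g 0) + rings (\<lambda>k. g (Suc k)) k"
  unfolding rings_def by (subst sum.atMost_Suc_shift) simp

lemma range_rings_split: "range (rings g) = insert (Suc (g 0)) ((+) (Suc (g 0)) ` range (rings (\<lambda>k. g (Suc k))))"
proof -
  have "range (rings g) = insert (rings g 0) (range (\<lambda>k. rings g (Suc k)))"
    by (metis (no_types) UNIV_nat_eq image_insert image_image)
  moreover have "rings g 0 = Suc (g 0)" by (simp add: rings_def)
  ultimately show ?thesis by (simp only: rings_shift image_image)
qed

lemma gap_conditions_iff:
  "d \<le> g 0 \<and> map (\<lambda>m. Suc (d + m) \<in> range (rings g)) [0..<length bs] = bs \<longleftrightarrow>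
    (\<forall>k<length (gap_conditions d bs). (gap_conditions d bs ! k) (g k))"
proof (induction d bs arbitrary: g rule: gap_conditions.induct)
  case (1 d)
  then show ?case by simp
next
  case (2 d bs)
  have first: "Suc d \<in> range (rings g) \<longleftrightarrow> g 0 = d" if "d \<le> g 0"
    using that unfolding range_rings_split[of g] by auto
  have rest: "Suc (d + Suc m) \<in> range (rings g) \<longleftrightarrow> Suc m \<in> range (rings (\<lambda>k. g (Suc k)))" if "g 0 = d" for m
    unfolding range_rings_split[of g] that by auto
  have "d \<le> g 0 \<and> map (\<lambda>m. Suc (d + m) \<in> range (rings g)) [0..<length (True # bs)] = True # bs \<longleftrightarrow>
    g 0 = d \<and> map (\<lambda>m. Suc (d + Suc m) \<in> range (rings g)) [0..<length bs] = bs"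
    using first by (auto simp: map_upt_Suc simp del: upt_Suc)
  also have "\<dots> \<longleftrightarrow> g 0 = d \<and> map (\<lambda>m. Suc (0 + m) \<in> range (rings (\<lambda>k. g (Suc k)))) [0..<length bs] = bs"
    using rest by (auto simp del: upt_Suc)
  also have "\<dots> \<longleftrightarrow> g 0 = d \<and> (\<forall>k<length (gap_conditions 0 bs). (gap_conditions 0 bs ! k) (g (Suc k)))"
    using 2[of "\<lambda>k. g (Suc k)"] by simp
  also have "\<dots> \<longleftrightarrow> (\<forall>k<length (gap_conditions d (True # bs)). (gap_conditions d (True # bs) ! k) (g k))"
    by (auto simp: nth_Cons less_Suc_eq_0_disj split: nat.splits)
  finally show ?case .
next
  case (3 d bs)
  have first: "Suc d \<in> range (rings g) \<longleftrightarrow> g 0 = d" if "d \<le> g 0"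
    using that unfolding range_rings_split[of g] by auto
  have "d \<le> g 0 \<and> map (\<lambda>m. Suc (d + m) \<in> range (rings g)) [0..<length (False # bs)] = False # bs \<longleftrightarrow>
    Suc d \<le> g 0 \<and> map (\<lambda>m. Suc (Suc d + m) \<in> range (rings g)) [0..<length bs] = bs"
    using first by (auto simp: map_upt_Suc simp del: upt_Suc)
  then show ?case using 3[of g] by simp
qed

text \<open>With q = exp (- 1 / n), a closed gap d has probability q^d (1 - q) and the open last one
  q^d, so every bit contributes exactly one factor.\<close>

lemma prod_emeasure_gap_conditions:
  assumes "0 < n"
  shows "(\<Prod>k<length (gap_conditions d bs). emeasure unit_exp {x. (gap_conditions d bs ! k) (cell n x)}) =
    ennreal (exp (- 1 / real n) ^ d *
      (\<Prod>b\<leftarrow>bs. if b then 1 - exp (- 1 / real n) else exp (- 1 / real n)))"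
proof (induction d bs rule: gap_conditions.induct)
  case (1 d)
  then show ?case using emeasure_cell_ge[OF assms] by simp
next
  case (2 d bs)
  have pos: "0 \<le> (\<Prod>b\<leftarrow>bs. if b then 1 - exp (- 1 / real n) else exp (- 1 / real n))"
    using assms by (induction bs) auto
  show ?case
    using emeasure_cell_eq[OF assms, of d] 2 pos assms
    by (simp add: prod.lessThan_Suc_shift ennreal_mult'[symmetric] mult_ac del: prod.lessThan_Suc)
next
  case (3 d bs)
  then show ?case by (simp add: mult_ac)
qed

lemma pmf_replicate_pmf:
  "pmf (replicate_pmf n p) xs = (if length xs = n then (\<Prod>x\<leftarrow>xs. pmf p x) else 0)"
proof (cases "length xs = n")
  case False
  then have "xs \<notin> set_pmf (replicate_pmf n p)" using set_pmf_replicate_length by blast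
  then show ?thesis using False by (simp add: set_pmf_iff)
next
  case True
  then show ?thesis
  proof (induction n arbitrary: xs)
    case (Suc n)
    then obtain y ys where xs: "xs = y # ys" "length ys = n" by (cases xs) auto
    have "replicate_pmf (Suc n) p = map_pmf (\<lambda>(y, ys). y # ys) (pair_pmf p (replicate_pmf n p))"
      by (simp add: pair_pmf_def map_bind_pmf)
    moreover have "pmf (map_pmf (\<lambda>(y, ys). y # ys) (pair_pmf p (replicate_pmf n p))) ((\<lambda>(y, ys). y # ys) (y, ys)) =
      pmf (pair_pmf p (replicate_pmf n p)) (y, ys)"
      by (rule pmf_map_inj') (auto simp: inj_on_def)
    ultimately show ?case
      using Suc.IH[of ys] xs by (simp add: pmf_pair)
  qed simp
qed

abbreviation config_measure :: "real \<Rightarrow> config measure" where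
  "config_measure \<rho> \<equiv> \<Pi>\<^sub>M i\<in>UNIV. measure_pmf (site_law \<rho>)"

abbreviation waiting_measure :: "waiting measure" where
  "waiting_measure \<equiv> \<Pi>\<^sub>M p\<in>UNIV. unit_exp"

abbreviation sample_measure :: "real \<Rightarrow> (config \<times> waiting) measure" where
  "sample_measure \<rho> \<equiv> config_measure \<rho> \<Otimes>\<^sub>M waiting_measure"

lemma tazrp_space_eq: "tazrp_space \<rho> = completion (sample_measure \<rho>)"
  by (simp add: tazrp_space_def)

lemma prob_space_waiting: "prob_space waiting_measure"
  by (intro prob_space_PiM prob_space_unit_exp)

lemma prob_space_config: "prob_space (config_measure \<rho>)"
  by (intro prob_space_PiM prob_space_measure_pmf)

lemma prob_space_sample: "prob_space (sample_measure \<rho>)"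
proof -
  interpret A: prob_space "config_measure \<rho>" by (rule prob_space_config)
  interpret B: prob_space waiting_measure by (rule prob_space_waiting)
  interpret pair_prob_space "config_measure \<rho>" waiting_measure ..
  show ?thesis by unfold_locales
qed

lemma product_prob_space_waiting: "product_prob_space (\<lambda>p :: int \<times> nat. unit_exp)"
  using prob_space_unit_exp
  by (auto simp: product_prob_space_def product_prob_space_axioms_def product_sigma_finite_def
      intro: prob_space_imp_sigma_finite)

lemma product_prob_space_config: "product_prob_space (\<lambda>i :: int. measure_pmf (site_law \<rho>))"
  by (auto simp: product_prob_space_def product_prob_space_axioms_def product_sigma_finite_def
      intro: prob_space_imp_sigma_finite prob_space_measure_pmf)

lemma space_waiting [simp]: "space waiting_measure = UNIV"
  by (simp add: space_PiM PiE_UNIV_domain)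

lemma space_config [simp]: "space (config_measure \<rho>) = UNIV"
  by (simp add: space_PiM PiE_UNIV_domain)

lemma waiting_rectangle:
  assumes "finite J" "\<And>p. p \<in> J \<Longrightarrow> A p \<in> sets borel"
  shows "{\<xi>. \<forall>p\<in>J. \<xi> p \<in> A p} \<in> sets waiting_measure"
    "emeasure waiting_measure {\<xi>. \<forall>p\<in>J. \<xi> p \<in> A p} = (\<Prod>p\<in>J. emeasure unit_exp (A p))"
proof -
  interpret product_prob_space "\<lambda>p :: int \<times> nat. unit_exp" UNIV by (rule product_prob_space_waiting)
  have A: "\<And>p. p \<in> J \<Longrightarrow> A p \<in> sets unit_exp" using assms by simp
  have "{\<xi> \<in> space waiting_measure. \<xi> p \<in> A p} \<in> sets waiting_measure" if "p \<in> J" for p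
    using measurable_sets[OF measurable_component_singleton[of p UNIV "\<lambda>_. unit_exp"] A[OF that]]
    by (simp add: vimage_def)
  then have "{\<xi> \<in> space waiting_measure. \<forall>p\<in>J. \<xi> p \<in> A p} \<in> sets waiting_measure"
    using assms(1) by (intro sets.sets_Collect_finite_All) auto
  then show "{\<xi>. \<forall>p\<in>J. \<xi> p \<in> A p} \<in> sets waiting_measure" by simp
  show "emeasure waiting_measure {\<xi>. \<forall>p\<in>J. \<xi> p \<in> A p} = (\<Prod>p\<in>J. emeasure unit_exp (A p))"
    using emeasure_PiM_Collect[OF _ assms(1) A] by simp
qed

lemma config_rectangle:
  assumes "finite J"
  shows "{\<eta>. \<forall>i\<in>J. \<eta> i = c i} \<in> sets (config_measure \<rho>)"
    "emeasure (config_measure \<rho>) {\<eta>. \<forall>i\<in>J. \<eta> i = c i} = (\<Prod>i\<in>J. ennreal (pmf (site_law \<rho>) (c i)))"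
proof -
  interpret product_prob_space "\<lambda>i :: int. measure_pmf (site_law \<rho>)" UNIV by (rule product_prob_space_config)
  have "{\<eta> \<in> space (config_measure \<rho>). \<eta> i \<in> {c i}} \<in> sets (config_measure \<rho>)" for i
    using measurable_sets[OF measurable_component_singleton[of i UNIV "\<lambda>_. measure_pmf (site_law \<rho>)"], of "{c i}"]
    by (simp add: vimage_def)
  then have "{\<eta> \<in> space (config_measure \<rho>). \<forall>i\<in>J. \<eta> i \<in> {c i}} \<in> sets (config_measure \<rho>)"
    using assms(1) by (intro sets.sets_Collect_finite_All) auto
  then show "{\<eta>. \<forall>i\<in>J. \<eta> i = c i} \<in> sets (config_measure \<rho>)" by simp
  show "emeasure (config_measure \<rho>) {\<eta>. \<forall>i\<in>J. \<eta> i = c i} = (\<Prod>i\<in>J. ennreal (pmf (site_law \<rho>) (c i)))"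
    using emeasure_PiM_Collect[OF _ assms(1), of "\<lambda>i. {c i}"] by (simp add: emeasure_pmf_single)
qed

text \<open>
  The arrivals at the leftmost site of the grid are produced by the clock of the site before it,
  which is not used otherwise.
\<close>

definition grid_arrivals :: "waiting \<Rightarrow> real \<Rightarrow> nat \<Rightarrow> nat \<Rightarrow> bool list" where
  "grid_arrivals \<xi> a n M = map (\<lambda>m. - ln a < \<xi> (- int n - 1, m)) [0..<M]"

definition grid_sample :: "real \<Rightarrow> nat \<Rightarrow> nat \<Rightarrow> nat \<Rightarrow> config \<times> waiting \<Rightarrow> sample" where
  "grid_sample a n X M s =
    (grid_clocks (snd s) n X M, grid_occupations (fst s) n X, grid_arrivals (snd s) a n M)"

lemma prod_list_eq_prod: "length xs = n \<Longrightarrow> (\<Prod>x\<leftarrow>xs. f x) = (\<Prod>i<n. f (xs ! i))"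
  by (simp add: prod.list_conv_set_nth atLeast0LessThan)

lemma emeasure_grid_clocks:
  assumes n: "0 < n" and a: "0 < a" "a < 1" and l: "length bs = X" "\<forall>b\<in>set bs. length b = M" "length w = M"
  shows "{\<xi>. grid_clocks \<xi> n X M = bs \<and> grid_arrivals \<xi> a n M = w} \<in> sets waiting_measure"
    "emeasure waiting_measure {\<xi>. grid_clocks \<xi> n X M = bs \<and> grid_arrivals \<xi> a n M = w} =
      ennreal (pmf (replicate_pmf X (replicate_pmf M (bernoulli_pmf (1 - exp (- 1 / real n))))) bs *
        pmf (replicate_pmf M (bernoulli_pmf a)) w)"
proof -
  define q where "q = exp (- 1 / real n)"
  have q: "0 < q" "q < 1" using n by (auto simp: q_def)
  define J1 where "J1 = (\<lambda>m. (- int n - 1, m)) ` {..<M}"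
  define J2 where "J2 = (SIGMA i:(\<lambda>l. int l - int n) ` {..<X}. {..<length (gap_conditions 0 (bs ! nat (i + int n)))})"
  \<comment> \<open>The event is a finite rectangle: \<open>J1\<close> holds the waiting times that
    produce the arrivals, \<open>J2\<close> the gaps that the prescribed bits constrain.\<close>
  define A where "A p = (if fst p = - int n - 1 then {x. (- ln a < x) = w ! snd p}
    else {x. (gap_conditions 0 (bs ! nat (fst p + int n)) ! snd p) (cell n x)})" for p :: "int \<times> nat"
  have fin: "finite (J1 \<union> J2)" by (auto simp: J1_def J2_def)
  have disj: "J1 \<inter> J2 = {}" by (auto simp: J1_def J2_def)
  have A1: "A (- int n - 1, m) = {x. (- ln a < x) = w ! m}" for m
    by (simp add: A_def)
  have A2: "A (int l - int n, k) = {x. (gap_conditions 0 (bs ! l) ! k) (cell n x)}" for l k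
    by (simp add: A_def)
  have A: "A p \<in> sets borel" for p
  proof -
    have "Measurable.pred borel (\<lambda>x. (gap_conditions 0 (bs ! nat (fst p + int n)) ! snd p) (cell n x))"
      by (rule measurable_compose[OF measurable_cell]) simp
    moreover have "Measurable.pred borel (\<lambda>x. (- ln a < x) = w ! snd p)" by measurable
    ultimately show ?thesis by (auto simp: A_def pred_def)
  qed
  have bits: "ring_bits g M = bs ! l \<longleftrightarrow> (\<forall>k<length (gap_conditions 0 (bs ! l)). (gap_conditions 0 (bs ! l) ! k) (g k))"
    if "l < X" for l g
  proof -
    have "length (bs ! l) = M" using l that by auto
    then show ?thesis using gap_conditions_iff[of 0 g "bs ! l"] by (simp add: ring_bits_def)
  qed
  have set_eq: "{\<xi>. grid_clocks \<xi> n X M = bs \<and> grid_arrivals \<xi> a n M = w} = {\<xi>. \<forall>p\<in>J1 \<union> J2. \<xi> p \<in> A p}"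
  proof (rule Collect_cong)
    fix \<xi> :: waiting
    have "grid_clocks \<xi> n X M = bs \<longleftrightarrow> (\<forall>l<X. ring_bits (site_cells \<xi> n (int l - int n)) M = bs ! l)"
      using l(1) by (auto simp: grid_clocks_def list_eq_iff_nth_eq)
    also have "\<dots> \<longleftrightarrow> (\<forall>l<X. \<forall>k<length (gap_conditions 0 (bs ! l)). \<xi> (int l - int n, k) \<in> A (int l - int n, k))"
      using bits by (simp add: A2 site_cells_def)
    also have "\<dots> \<longleftrightarrow> (\<forall>p\<in>J2. \<xi> p \<in> A p)"
      by (force simp: J2_def)
    finally have 1: "grid_clocks \<xi> n X M = bs \<longleftrightarrow> (\<forall>p\<in>J2. \<xi> p \<in> A p)" .
    have "grid_arrivals \<xi> a n M = w \<longleftrightarrow> (\<forall>m<M. (- ln a < \<xi> (- int n - 1, m)) = w ! m)"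
      using l(3) by (auto simp: grid_arrivals_def list_eq_iff_nth_eq)
    also have "\<dots> \<longleftrightarrow> (\<forall>p\<in>J1. \<xi> p \<in> A p)"
      by (auto simp: J1_def A1)
    finally show "grid_clocks \<xi> n X M = bs \<and> grid_arrivals \<xi> a n M = w \<longleftrightarrow> (\<forall>p\<in>J1 \<union> J2. \<xi> p \<in> A p)"
      using 1 by blast
  qed
  note rect = waiting_rectangle[OF fin A]
  show "{\<xi>. grid_clocks \<xi> n X M = bs \<and> grid_arrivals \<xi> a n M = w} \<in> sets waiting_measure"
    unfolding set_eq by (rule rect)
  have P1: "(\<Prod>p\<in>J1. emeasure unit_exp (A p)) = ennreal (pmf (replicate_pmf M (bernoulli_pmf a)) w)"
  proof -
    have e1: "emeasure unit_exp {x. (- ln a < x) = b} = ennreal (pmf (bernoulli_pmf a) b)" for b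
    proof -
      \<comment> \<open>The threshold - ln a in \<open>grid_arrivals\<close> is chosen such that an
        exponential variable exceeds it with probability a.\<close>
      have gt: "emeasure unit_exp {x. - ln a < x} = ennreal a"
        using emeasure_unit_exp_gt[of "- ln a"] a by simp
      show ?thesis
      proof (cases b)
        case True
        then show ?thesis using gt a by simp
      next
        case False
        interpret prob_space unit_exp by (rule prob_space_unit_exp)
        have "{x. (- ln a < x) = b} = space unit_exp - {x. - ln a < x}" using False by auto
        also have "emeasure unit_exp \<dots> = emeasure unit_exp (space unit_exp) - emeasure unit_exp {x. - ln a < x}"
          by (rule emeasure_compl) auto
        also have "\<dots> = ennreal (1 - a)"
          unfolding gt emeasure_space_1 using a by (simp add: ennreal_minus flip: ennreal_1)
        finally show ?thesis using False a by simp
      qed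
    qed
    have "(\<Prod>p\<in>J1. emeasure unit_exp (A p)) = (\<Prod>m<M. ennreal (pmf (bernoulli_pmf a) (w ! m)))"
      unfolding J1_def by (subst prod.reindex) (auto simp: inj_on_def A1 e1)
    also have "\<dots> = ennreal (\<Prod>m<M. pmf (bernoulli_pmf a) (w ! m))"
      by (rule prod_ennreal) simp
    finally show ?thesis
      using l(3) prod_list_eq_prod[of w M "pmf (bernoulli_pmf a)"] by (simp add: pmf_replicate_pmf)
  qed
  have P2: "(\<Prod>p\<in>J2. emeasure unit_exp (A p)) =
      ennreal (pmf (replicate_pmf X (replicate_pmf M (bernoulli_pmf (1 - q)))) bs)"
  proof -
    have "(\<Prod>p\<in>J2. emeasure unit_exp (A p)) = (\<Prod>i\<in>(\<lambda>l. int l - int n) ` {..<X}.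
        \<Prod>k<length (gap_conditions 0 (bs ! nat (i + int n))). emeasure unit_exp (A (i, k)))"
      unfolding J2_def by (subst prod.Sigma) auto
    also have "\<dots> = (\<Prod>l<X. \<Prod>k<length (gap_conditions 0 (bs ! l)). emeasure unit_exp (A (int l - int n, k)))"
      by (subst prod.reindex) (auto simp: inj_on_def)
    also have "\<dots> = (\<Prod>l<X. ennreal (pmf (replicate_pmf M (bernoulli_pmf (1 - q))) (bs ! l)))"
    proof (rule prod.cong[OF refl])
      fix l assume "l \<in> {..<X}"
      then have "length (bs ! l) = M" using l by auto
      moreover have "pmf (bernoulli_pmf (1 - q)) = (\<lambda>b. if b then 1 - q else q)"
      proof
        show "pmf (bernoulli_pmf (1 - q)) b = (if b then 1 - q else q)" for b
          using q by (cases b) auto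
      qed
      ultimately show "(\<Prod>k<length (gap_conditions 0 (bs ! l)). emeasure unit_exp (A (int l - int n, k))) =
        ennreal (pmf (replicate_pmf M (bernoulli_pmf (1 - q))) (bs ! l))"
        unfolding A2 prod_emeasure_gap_conditions[OF n, folded q_def] by (simp add: pmf_replicate_pmf)
    qed
    also have "\<dots> = ennreal (\<Prod>l<X. pmf (replicate_pmf M (bernoulli_pmf (1 - q))) (bs ! l))"
      by (rule prod_ennreal) simp
    finally show ?thesis
      using l(1) prod_list_eq_prod[of bs X "pmf (replicate_pmf M (bernoulli_pmf (1 - q)))"]
      by (simp add: pmf_replicate_pmf[of X])
  qed
  have "(\<Prod>p\<in>J1 \<union> J2. emeasure unit_exp (A p)) =
      (\<Prod>p\<in>J1. emeasure unit_exp (A p)) * (\<Prod>p\<in>J2. emeasure unit_exp (A p))"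
    using fin disj by (intro prod.union_disjoint) auto
  then show "emeasure waiting_measure {\<xi>. grid_clocks \<xi> n X M = bs \<and> grid_arrivals \<xi> a n M = w} =
      ennreal (pmf (replicate_pmf X (replicate_pmf M (bernoulli_pmf (1 - exp (- 1 / real n))))) bs *
        pmf (replicate_pmf M (bernoulli_pmf a)) w)"
    unfolding set_eq rect(2) P1 P2 q_def by (simp add: ennreal_mult' mult.commute)
qed

lemma emeasure_grid_occupations:
  assumes "length qs = X"
  shows "{\<eta>. grid_occupations \<eta> n X = qs} \<in> sets (config_measure \<rho>)"
    "emeasure (config_measure \<rho>) {\<eta>. grid_occupations \<eta> n X = qs} = ennreal (pmf (replicate_pmf X (site_law \<rho>)) qs)"
proof -
  define J where "J = (\<lambda>l. int l - int n) ` {..<X}"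
  have set_eq: "{\<eta>. grid_occupations \<eta> n X = qs} = {\<eta>. \<forall>i\<in>J. \<eta> i = qs ! nat (i + int n)}"
    using assms by (auto simp: J_def grid_occupations_def list_eq_iff_nth_eq)
  have fin: "finite J" by (simp add: J_def)
  show "{\<eta>. grid_occupations \<eta> n X = qs} \<in> sets (config_measure \<rho>)"
    unfolding set_eq by (rule config_rectangle[OF fin])
  have "(\<Prod>i\<in>J. ennreal (pmf (site_law \<rho>) (qs ! nat (i + int n)))) = (\<Prod>l<X. ennreal (pmf (site_law \<rho>) (qs ! l)))"
    unfolding J_def by (subst prod.reindex) (auto simp: inj_on_def)
  also have "\<dots> = ennreal (\<Prod>l<X. pmf (site_law \<rho>) (qs ! l))"
    by (rule prod_ennreal) simp
  finally show "emeasure (config_measure \<rho>) {\<eta>. grid_occupations \<eta> n X = qs} =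
      ennreal (pmf (replicate_pmf X (site_law \<rho>)) qs)"
    unfolding set_eq config_rectangle(2)[OF fin]
    using assms prod_list_eq_prod[of qs X "pmf (site_law \<rho>)"] by (simp add: pmf_replicate_pmf)
qed

lemma grid_sample_vimage:
  assumes n: "0 < n" and a: "0 < a" "a < 1" and u: "geo u = site_law \<rho>" "arr (1 - exp (- 1 / real n)) u = a"
  shows "grid_sample a n X M -` {y} \<inter> space (sample_measure \<rho>) \<in> sets (sample_measure \<rho>)"
    "emeasure (sample_measure \<rho>) (grid_sample a n X M -` {y} \<inter> space (sample_measure \<rho>)) =
      ennreal (pmf (model X M (1 - exp (- 1 / real n)) u u) y)"
proof -
  interpret A: prob_space "config_measure \<rho>" by (rule prob_space_config)
  interpret B: prob_space waiting_measure by (rule prob_space_waiting)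
  obtain bs qs w where y: "y = (bs, qs, w)" by (cases y)
  define p where "p = 1 - exp (- 1 / real n)"
  have "(grid_sample a n X M -` {y} \<inter> space (sample_measure \<rho>) \<in> sets (sample_measure \<rho>)) \<and>
    emeasure (sample_measure \<rho>) (grid_sample a n X M -` {y} \<inter> space (sample_measure \<rho>)) =
      ennreal (pmf (model X M p u u) y)"
  proof (cases "length bs = X \<and> (\<forall>b\<in>set bs. length b = M) \<and> length qs = X \<and> length w = M")
    case True
    then have l: "length bs = X" "\<forall>b\<in>set bs. length b = M" "length qs = X" "length w = M" by auto
    have eq: "grid_sample a n X M -` {y} \<inter> space (sample_measure \<rho>) =
      {\<eta>. grid_occupations \<eta> n X = qs} \<times> {\<xi>. grid_clocks \<xi> n X M = bs \<and> grid_arrivals \<xi> a n M = w}"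
      by (auto simp: grid_sample_def y space_pair_measure)
    note w = emeasure_grid_clocks[OF n a l(1,2,4)] and c = emeasure_grid_occupations[OF l(3), where n = n and \<rho> = \<rho>]
    show ?thesis
      unfolding eq B.emeasure_pair_measure_Times[OF c(1) w(1)] c(2) w(2)[folded p_def]
      using w(1) c(1) by (simp add: y model_def pmf_pair u(1) u(2)[folded p_def] ennreal_mult'[symmetric] mult_ac)
  next
    case False
    then have "y \<notin> set_pmf (model X M p u u)"
      using set_pmf_model[of bs qs w X M p u u] by (auto simp: y)
    moreover have "grid_sample a n X M -` {y} = {}"
      using False by (auto simp: grid_sample_def y grid_clocks_def grid_occupations_def grid_arrivals_def ring_bits_def)
    ultimately show ?thesis by (simp add: set_pmf_iff)
  qed
  then show "grid_sample a n X M -` {y} \<inter> space (sample_measure \<rho>) \<in> sets (sample_measure \<rho>)"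
    "emeasure (sample_measure \<rho>) (grid_sample a n X M -` {y} \<inter> space (sample_measure \<rho>)) =
      ennreal (pmf (model X M (1 - exp (- 1 / real n)) u u) y)"
    by (simp_all add: p_def)
qed

text \<open>For every n the sample with law \<open>model\<close> is a function on the probability
  space of the process itself, so that the limit of the lattices can be taken almost surely.\<close>

lemma grid_sample_law:
  assumes n: "0 < n" and a: "0 < a" "a < 1" and u: "geo u = site_law \<rho>" "arr (1 - exp (- 1 / real n)) u = a"
  shows "grid_sample a n X M \<in> sample_measure \<rho> \<rightarrow>\<^sub>M count_space UNIV"
    "distr (sample_measure \<rho>) (count_space UNIV) (grid_sample a n X M) =
      measure_pmf (model X M (1 - exp (- 1 / real n)) u u)"
proof -
  note v = grid_sample_vimage[OF n a u]
  show meas: "grid_sample a n X M \<in> sample_measure \<rho> \<rightarrow>\<^sub>M count_space UNIV"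
    using v(1) by (subst measurable_count_space_eq_countable) auto
  show "distr (sample_measure \<rho>) (count_space UNIV) (grid_sample a n X M) =
      measure_pmf (model X M (1 - exp (- 1 / real n)) u u)"
  proof (rule measure_eqI_countable)
    fix y :: sample
    show "emeasure (distr (sample_measure \<rho>) (count_space UNIV) (grid_sample a n X M)) {y} =
      emeasure (measure_pmf (model X M (1 - exp (- 1 / real n)) u u)) {y}"
      using meas by (simp add: emeasure_distr v(2) emeasure_pmf_single)
  qed auto
qed

section \<open>Almost sure regularity of the clocks\<close>

lemma AE_exceeds:
  fixes f :: "nat \<Rightarrow> int \<times> nat"
  assumes "inj f"
  shows "AE \<xi> in waiting_measure. \<exists>k. T < \<xi> (f k)"
proof -
  define c where "c = max T 0"
  define q where "q = 1 - exp (- c)"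
  have q: "0 \<le> q" "q < 1" by (auto simp: q_def c_def)
  interpret prob_space unit_exp by (rule prob_space_unit_exp)
  have le: "emeasure unit_exp {..c} = ennreal q"
  proof -
    have "{..c} = space unit_exp - {x. c < x}" by auto
    also have "emeasure unit_exp \<dots> = emeasure unit_exp (space unit_exp) - emeasure unit_exp {x. c < x}"
      by (rule emeasure_compl) auto
    also have "\<dots> = ennreal q"
      using emeasure_unit_exp_gt[of c] unfolding emeasure_space_1 q_def
      by (simp add: c_def ennreal_minus flip: ennreal_1)
    finally show ?thesis .
  qed
  \<comment> \<open>\<open>B N\<close> says that none of the first N waiting times exceeds c; its
    probability q^N tends to zero.\<close>
  define B where "B N = {\<xi> :: waiting. \<forall>p\<in>f ` {..<N}. \<xi> p \<in> {..c}}" for N :: nat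
  have B: "B N \<in> sets waiting_measure" "emeasure waiting_measure (B N) = ennreal (q ^ N)" for N
  proof -
    have "finite (f ` {..<N})" by simp
    note r = waiting_rectangle[OF this, of "\<lambda>_. {..c}"]
    show "B N \<in> sets waiting_measure" unfolding B_def by (rule r) simp
    have "(\<Prod>p\<in>f ` {..<N}. emeasure unit_exp {..c}) = ennreal (q ^ N)"
      using q assms by (simp add: le card_image inj_on_subset[OF assms] ennreal_power)
    then show "emeasure waiting_measure (B N) = ennreal (q ^ N)"
      unfolding B_def using r(2) by simp
  qed
  have sets: "(\<Inter>N. B N) \<in> sets waiting_measure" using B(1) by auto
  have "emeasure waiting_measure (\<Inter>N. B N) \<le> ennreal (q ^ N)" for N
    unfolding B(2)[symmetric] by (rule emeasure_mono[OF _ B(1)]) auto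
  moreover have "(\<lambda>N. ennreal (q ^ N)) \<longlonglongrightarrow> ennreal 0"
    using q by (intro tendsto_ennrealI LIMSEQ_realpow_zero) auto
  ultimately have "emeasure waiting_measure (\<Inter>N. B N) \<le> ennreal 0"
    by (intro LIMSEQ_le_const) auto
  then have "(\<Inter>N. B N) \<in> null_sets waiting_measure"
    using sets by (auto simp: null_sets_def)
  then show ?thesis
    by (rule AE_I') (auto simp: B_def c_def not_less le_max_iff_disj)
qed

lemma measurable_waiting [measurable]: "(\<lambda>\<xi>. \<xi> p) \<in> borel_measurable waiting_measure"
proof -
  have "(\<lambda>\<xi>. \<xi> p) \<in> waiting_measure \<rightarrow>\<^sub>M unit_exp"
    by (rule measurable_component_singleton) simp
  then show ?thesis by (simp cong: measurable_cong_sets)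
qed

lemma measurable_ring_time [measurable]: "(\<lambda>\<xi>. ring_time \<xi> i k) \<in> borel_measurable waiting_measure"
  unfolding ring_time_def by (intro borel_measurable_sum measurable_waiting)

text \<open>Resampling the coordinate p preserves the product law and does not change
  \<open>g\<close>, and a fresh exponential variable has no atom at the value of
  \<open>g\<close>.\<close>

lemma AE_coordinate_neq:
  assumes g: "g \<in> borel_measurable waiting_measure" and indep: "\<And>X x. g (X(p := x)) = g X"
  shows "AE \<xi> in waiting_measure. \<xi> p \<noteq> g \<xi>"
proof -
  interpret E: prob_space unit_exp by (rule prob_space_unit_exp)
  interpret W: prob_space waiting_measure by (rule prob_space_waiting)
  interpret P: pair_sigma_finite unit_exp waiting_measure ..
  note [measurable] = g
  have eq: "distr (unit_exp \<Otimes>\<^sub>M waiting_measure) waiting_measure (\<lambda>(x, X). X(p := x)) = waiting_measure"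
    using distr_pair_PiM_eq_PiM[of UNIV "\<lambda>_. unit_exp" p] prob_space_unit_exp by simp
  have upd: "(\<lambda>(x, X). X(p := x)) \<in> (unit_exp \<Otimes>\<^sub>M waiting_measure) \<rightarrow>\<^sub>M waiting_measure"
  proof (rule measurable_PiM_single')
    fix r :: "int \<times> nat"
    show "(\<lambda>z. (case z of (x, X) \<Rightarrow> X(p := x)) r) \<in> unit_exp \<Otimes>\<^sub>M waiting_measure \<rightarrow>\<^sub>M unit_exp"
    proof (cases "r = p")
      case True
      then have eq: "(\<lambda>z. (case z of (x, X) \<Rightarrow> X(p := x)) r) = (fst :: real \<times> waiting \<Rightarrow> real)"
        by (auto simp: fun_eq_iff)
      show ?thesis unfolding eq by (rule measurable_fst)
    next
      case False
      then have eq: "(\<lambda>z. (case z of (x, X) \<Rightarrow> X(p := x)) r) = (\<lambda>z :: real \<times> waiting. snd z r)"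
        by (auto simp: fun_eq_iff)
      show ?thesis
        unfolding eq by (rule measurable_compose[OF measurable_snd measurable_component_singleton]) simp
    qed
  qed (simp add: PiE_UNIV_domain)
  have cont: "AE x in unit_exp. x \<noteq> c" for c
    using AE_lborel_singleton[of c] by (subst AE_density) auto
  have "AE X in waiting_measure. AE x in unit_exp. x \<noteq> g X"
    using cont by simp
  moreover have ms: "{z \<in> space (unit_exp \<Otimes>\<^sub>M waiting_measure). fst z \<noteq> g (snd z)} \<in>
      sets (unit_exp \<Otimes>\<^sub>M waiting_measure)"
  proof -
    have "Measurable.pred (borel \<Otimes>\<^sub>M waiting_measure) (\<lambda>z. fst z \<noteq> g (snd z))"
      by measurable
    then have "{z \<in> space (borel \<Otimes>\<^sub>M waiting_measure). fst z \<noteq> g (snd z)} \<in> sets (borel \<Otimes>\<^sub>M waiting_measure)"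
      by (rule predE)
    moreover have "sets (unit_exp \<Otimes>\<^sub>M waiting_measure) = sets (borel \<Otimes>\<^sub>M waiting_measure)"
      by (rule sets_pair_measure_cong) simp_all
    ultimately show ?thesis by (simp add: space_pair_measure)
  qed
  ultimately have "AE x in unit_exp. AE X in waiting_measure. x \<noteq> g X"
    by (subst P.AE_commute) simp_all
  then have pair: "AE z in unit_exp \<Otimes>\<^sub>M waiting_measure. fst z \<noteq> g (snd z)"
    by (intro P.AE_pair_measure[OF ms]) simp
  have "AE \<xi> in distr (unit_exp \<Otimes>\<^sub>M waiting_measure) waiting_measure (\<lambda>(x, X). X(p := x)). \<xi> p \<noteq> g \<xi>"
  proof (subst AE_distr_iff[OF upd])
    show "{\<xi> \<in> space waiting_measure. \<xi> p \<noteq> g \<xi>} \<in> sets waiting_measure"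
      by (rule borel_measurable_neq[OF measurable_waiting g])
    show "AE z in unit_exp \<Otimes>\<^sub>M waiting_measure. (case z of (x, X) \<Rightarrow> X(p := x)) p \<noteq> g (case z of (x, X) \<Rightarrow> X(p := x))"
      using pair by eventually_elim (simp add: split_beta indep)
  qed
  then show ?thesis unfolding eq .
qed

lemma measurable_partial_sum:
  "(\<lambda>\<xi>. \<Sum>l\<in>L. \<xi> (i, l)) \<in> borel_measurable waiting_measure"
  by (intro borel_measurable_sum measurable_waiting)

text \<open>Isolates one waiting time on which nothing else in the comparison depends, the situation
  of \<open>AE_coordinate_neq\<close>.\<close>

lemma ring_time_split: "ring_time \<xi> i k = \<xi> (i, 0) + (\<Sum>l\<in>{1..k}. \<xi> (i, l))"
  unfolding ring_time_def by (simp add: atMost_atLeast0 sum.atLeast_Suc_atMost)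

lemma AE_ring_time_neq: "AE \<xi> in waiting_measure. ring_time \<xi> i k \<noteq> t"
proof -
  have "AE \<xi> in waiting_measure. \<xi> (i, 0) \<noteq> t - (\<Sum>l\<in>{1..k}. \<xi> (i, l))"
    by (rule AE_coordinate_neq)
      (intro borel_measurable_diff borel_measurable_const measurable_partial_sum, auto intro!: sum.cong)
  then show ?thesis by eventually_elim (simp add: ring_time_split)
qed

lemma AE_ring_times_distinct: "AE \<xi> in waiting_measure. ring_time \<xi> i k \<noteq> ring_time \<xi> (i - 1) l"
proof -
  have "AE \<xi> in waiting_measure. \<xi> (i, 0) \<noteq> ring_time \<xi> (i - 1) l - (\<Sum>l\<in>{1..k}. \<xi> (i, l))"
    by (rule AE_coordinate_neq)
      (intro borel_measurable_diff measurable_ring_time measurable_partial_sum,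
        auto simp: ring_time_def intro!: sum.cong arg_cong2[where f = "(-)"])
  then show ?thesis by eventually_elim (simp add: ring_time_split[of _ i k])
qed

lemma AE_waiting_pos: "AE \<xi> in waiting_measure. \<forall>p. 0 < \<xi> p"
proof -
  interpret E: prob_space unit_exp by (rule prob_space_unit_exp)
  have "E.prob {x. 0 < x} = 1"
    using emeasure_unit_exp_gt[of 0] by (simp add: E.emeasure_eq_measure)
  then have "AE x in unit_exp. x \<in> {x. 0 < x}"
    by (subst E.AE_in_set_eq_1) auto
  then have "AE \<xi> in waiting_measure. 0 < \<xi> p" for p
    using AE_PiM_component[of UNIV "\<lambda>_. unit_exp" p "\<lambda>x. 0 < x"] prob_space_unit_exp by simp
  then show ?thesis by (simp add: AE_all_countable)
qed

text \<open>Integer values of T suffice for the unbounded and the quiet clocks, which keeps all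
  quantifiers countable.\<close>

lemma AE_regular_clocks:
  "AE \<xi> in waiting_measure. regular_clocks \<xi> \<and> (\<forall>i k. ring_time \<xi> i k \<noteq> t)"
proof -
  have 1: "AE \<xi> in waiting_measure. \<forall>(i :: int) (T :: nat). \<exists>k. real T < \<xi> (i, k)"
    unfolding AE_all_countable by (intro allI AE_exceeds) (simp add: inj_on_def)
  have 2: "AE \<xi> in waiting_measure. \<forall>(j :: int) (T :: nat). \<exists>k. real T < \<xi> (j - int k, 0)"
    unfolding AE_all_countable by (intro allI AE_exceeds) (simp add: inj_on_def)
  have 3: "AE \<xi> in waiting_measure. \<forall>i k l. ring_time \<xi> i k \<noteq> ring_time \<xi> (i - 1) l"
    unfolding AE_all_countable by (intro allI AE_ring_times_distinct)
  have 4: "AE \<xi> in waiting_measure. \<forall>i k. ring_time \<xi> i k \<noteq> t"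
    unfolding AE_all_countable by (intro allI AE_ring_time_neq)
  show ?thesis
    using 1 2 3 4 AE_waiting_pos
  proof eventually_elim
    case (elim \<xi>)
    have "regular_clocks \<xi>"
    proof
      show "0 < \<xi> p" for p using elim by blast
      fix i and T :: real
      obtain N :: nat where N: "T \<le> real N" using real_arch_simple by blast
      obtain k where k: "real N < \<xi> (i, k)" using elim by blast
      have "\<xi> (i, k) \<le> ring_time \<xi> i k"
        unfolding ring_time_def using elim by (intro member_le_sum) (auto intro: less_imp_le)
      then show "\<exists>n. T < ring_time \<xi> i n" using N k by (intro exI[of _ k]) linarith
    next
      fix j and T :: real
      obtain N :: nat where N: "T \<le> real N" using real_arch_simple by blast
      obtain k where k: "real N < \<xi> (j - int k, 0)" using elim by blast
      then show "\<exists>i\<le>j. T < \<xi> (i, 0)" using N by (intro exI[of _ "j - int k"]) simp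
    next
      show "ring_time \<xi> i k \<noteq> ring_time \<xi> (i - 1) l" for i k l using elim by blast
    qed
    then show ?case using elim by blast
  qed
qed

lemma AE_sample_snd:
  assumes "AE \<xi> in waiting_measure. P \<xi>"
  shows "AE s in sample_measure \<rho>. P (snd s)"
proof -
  interpret B: prob_space waiting_measure by (rule prob_space_waiting)
  obtain N where N: "{\<xi> \<in> space waiting_measure. \<not> P \<xi>} \<subseteq> N" "emeasure waiting_measure N = 0" "N \<in> sets waiting_measure"
    using assms by (rule AE_E)
  have "UNIV \<in> sets (config_measure \<rho>)"
    using sets.top[of "config_measure \<rho>"] by simp
  then have "space (config_measure \<rho>) \<times> N \<in> null_sets (sample_measure \<rho>)"
    using N B.emeasure_pair_measure_Times[of "space (config_measure \<rho>)" "config_measure \<rho>" N]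
    by (auto simp: null_sets_def)
  then show ?thesis
    by (rule AE_I') (use N(1) in \<open>auto simp: space_pair_measure\<close>)
qed

text \<open>The process is identified only almost everywhere; in the completed measure every
  property of the exceptional points is measurable.\<close>

lemma borel_measurable_completion_AE:
  fixes f g :: "'a \<Rightarrow> real"
  assumes g: "g \<in> borel_measurable M" and eq: "AE x in M. f x = g x"
  shows "f \<in> borel_measurable (completion M)"
proof (rule measurableI)
  fix A :: "real set" assume A: "A \<in> sets borel"
  have 1: "Measurable.pred (completion M) (\<lambda>x. f x \<noteq> g x)"
    by (rule sets_completion_AE) (use eq in auto)
  have 2: "Measurable.pred (completion M) (\<lambda>x. f x \<in> A \<and> f x \<noteq> g x)"
    by (rule sets_completion_AE) (use eq in auto)
  have 3: "Measurable.pred (completion M) (\<lambda>x. g x \<in> A)"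
    using measurable_completion[OF g] A by measurable
  have "Measurable.pred (completion M) (\<lambda>x. (f x \<in> A \<and> f x \<noteq> g x) \<or> (g x \<in> A \<and> \<not> f x \<noteq> g x))"
    using 1 2 3 by measurable
  moreover have "(\<lambda>x. (f x \<in> A \<and> f x \<noteq> g x) \<or> (g x \<in> A \<and> \<not> f x \<noteq> g x)) = (\<lambda>x. f x \<in> A)"
    by auto
  ultimately have "Measurable.pred (completion M) (\<lambda>x. f x \<in> A)" by simp
  then have "{x \<in> space (completion M). f x \<in> A} \<in> sets (completion M)" by (rule predE)
  then show "f -` A \<inter> space (completion M) \<in> sets (completion M)"
    by (simp add: vimage_def Int_def conj_commute)
qed simp

text \<open>Bounded second moments make the sequence uniformly integrable.\<close>

lemma (in prob_space) expectation_limit: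
  fixes f :: "nat \<Rightarrow> 'a \<Rightarrow> real"
  assumes meas: "\<And>n. f n \<in> borel_measurable M" and nonneg: "\<And>n x. 0 \<le> f n x"
    and int: "\<And>n. integrable M (\<lambda>x. (f n x)\<^sup>2)" "\<And>n. expectation (\<lambda>x. (f n x)\<^sup>2) \<le> C"
    and lim: "AE x in M. (\<lambda>n. f n x) \<longlonglongrightarrow> g x"
  shows "(\<lambda>n. expectation (f n)) \<longlonglongrightarrow> integral\<^sup>L (completion M) g"
proof -
  note [measurable] = meas
  define h where "h x = lim (\<lambda>n. f n x)" for x
  have h [measurable]: "h \<in> borel_measurable M"
    unfolding h_def by (rule borel_measurable_lim_metric) (rule meas)
  have gh: "AE x in M. g x = h x"
    using lim by eventually_elim (simp add: h_def limI)
  have limh: "AE x in M. (\<lambda>n. f n x) \<longlonglongrightarrow> h x"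
    using lim gh by eventually_elim simp
  have h0: "AE x in M. 0 \<le> h x"
    using limh by eventually_elim (use nonneg in \<open>auto intro: LIMSEQ_le_const\<close>)
  have le: "f n x \<le> 1 + (f n x)\<^sup>2" for n x
  proof -
    have "0 \<le> (f n x - 1)\<^sup>2" by simp
    then show ?thesis using nonneg[of n x] by (simp add: power2_diff)
  qed
  have intf: "integrable M (f n)" for n
    by (rule Bochner_Integration.integrable_bound[of M "\<lambda>x. 1 + (f n x)\<^sup>2"])
      (use int(1)[of n] nonneg le in auto)
  have C0: "0 \<le> C" using int(2)[of 0] by (rule order_trans[rotated]) simp
  have Ef: "expectation (f n) \<le> 1 + C" for n
  proof -
    have "expectation (f n) \<le> expectation (\<lambda>x. 1 + (f n x)\<^sup>2)"
      using intf int le by (intro integral_mono) auto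
    also have "\<dots> = 1 + expectation (\<lambda>x. (f n x)\<^sup>2)"
      using int(1)[of n] by (simp add: prob_space)
    finally show ?thesis using int(2)[of n] by simp
  qed
  have inth: "integrable M h"
  proof (rule integrableI_nonneg[OF h h0])
    have "(\<integral>\<^sup>+x. ennreal (h x) \<partial>M) = (\<integral>\<^sup>+x. liminf (\<lambda>n. ennreal (f n x)) \<partial>M)"
    proof (rule nn_integral_cong_AE)
      show "AE x in M. ennreal (h x) = liminf (\<lambda>n. ennreal (f n x))"
        using limh by eventually_elim (rule lim_imp_Liminf[symmetric], auto intro: tendsto_ennrealI)
    qed
    also have "\<dots> \<le> liminf (\<lambda>n. \<integral>\<^sup>+x. ennreal (f n x) \<partial>M)"
      by (rule nn_integral_liminf) simp
    also have "\<dots> \<le> ennreal (1 + C)"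
    proof -
      have "(\<integral>\<^sup>+x. ennreal (f n x) \<partial>M) \<le> ennreal (1 + C)" for n
        using nn_integral_eq_integral[OF intf[of n]] nonneg Ef[of n] by (simp add: ennreal_leI)
      then show ?thesis
        using Liminf_mono[of "\<lambda>n. \<integral>\<^sup>+x. ennreal (f n x) \<partial>M" "\<lambda>_. ennreal (1 + C)" sequentially]
        by (simp add: Liminf_const)
    qed
    finally show "(\<integral>\<^sup>+x. ennreal (h x) \<partial>M) < \<infinity>"
      using ennreal_less_top le_less_trans by (metis infinity_ennreal_def)
  qed
  have "integral\<^sup>L (completion M) g = integral\<^sup>L (completion M) h"
    by (intro integral_cong_AE borel_measurable_completion_AE[OF h gh] measurable_completion h
        AE_completion gh)
  also have "\<dots> = expectation h" by (rule integral_completion[OF h])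
  finally have eq: "integral\<^sup>L (completion M) g = expectation h" .
  have conv_h: "(\<lambda>K. expectation (\<lambda>x. min (h x) (real K))) \<longlonglongrightarrow> expectation h"
  proof (rule integral_dominated_convergence[where w = h])
    show "AE x in M. (\<lambda>K. min (h x) (real K)) \<longlonglongrightarrow> h x"
    proof (rule AE_I2)
      fix x
      have "\<forall>\<^sub>F K in sequentially. h x \<le> real K"
        using eventually_ge_at_top[of "nat \<lceil>h x\<rceil>"] by eventually_elim linarith
      then have "\<forall>\<^sub>F K in sequentially. min (h x) (real K) = h x"
        by eventually_elim simp
      then show "(\<lambda>K. min (h x) (real K)) \<longlonglongrightarrow> h x" by (rule tendsto_eventually)
    qed
    show "AE x in M. norm (min (h x) (real K)) \<le> h x" for K
      using h0 by eventually_elim auto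
  qed (use inth in auto)
  have conv_f: "(\<lambda>n. expectation (\<lambda>x. min (f n x) (real K))) \<longlonglongrightarrow> expectation (\<lambda>x. min (h x) (real K))" for K
  proof (rule integral_dominated_convergence[where w = "\<lambda>_. real K"])
    show "AE x in M. (\<lambda>n. min (f n x) (real K)) \<longlonglongrightarrow> min (h x) (real K)"
      using limh by eventually_elim (intro tendsto_min tendsto_const)
    show "AE x in M. norm (min (f n x) (real K)) \<le> real K" for n
      using nonneg by auto
  qed auto
  \<comment> \<open>The part of f above the level K is at most f^2 / K, so truncation costs C / K
    uniformly in n, and truncated functions converge by domination.\<close>
  have diff: "\<bar>expectation (f n) - expectation (\<lambda>x. min (f n x) (real K))\<bar> \<le> C / real K" if "0 < K" for n K
  proof -
    have im: "integrable M (\<lambda>x. min (f n x) (real K))"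
      by (rule Bochner_Integration.integrable_bound[OF intf[of n]]) (use nonneg in auto)
    have pw: "0 \<le> f n x - min (f n x) (real K)" "f n x - min (f n x) (real K) \<le> (f n x)\<^sup>2 / real K" for x
    proof -
      show "f n x - min (f n x) (real K) \<le> (f n x)\<^sup>2 / real K"
      proof (cases "f n x \<le> real K")
        case False
        then have "f n x * real K \<le> f n x * f n x" using nonneg by (intro mult_left_mono) auto
        then have "f n x \<le> (f n x)\<^sup>2 / real K"
          using that by (simp add: power2_eq_square pos_le_divide_eq)
        then show ?thesis using False by simp
      qed (use that in auto)
    qed auto
    have "expectation (f n) - expectation (\<lambda>x. min (f n x) (real K)) = expectation (\<lambda>x. f n x - min (f n x) (real K))"
      using intf im by simp
    moreover have "0 \<le> expectation (\<lambda>x. f n x - min (f n x) (real K))"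
      by (rule Bochner_Integration.integral_nonneg) (rule pw)
    moreover have "expectation (\<lambda>x. f n x - min (f n x) (real K)) \<le> expectation (\<lambda>x. (f n x)\<^sup>2 / real K)"
      using pw intf im int(1) by (intro integral_mono) auto
    moreover have "expectation (\<lambda>x. (f n x)\<^sup>2 / real K) \<le> C / real K"
      using int(2)[of n] by (simp add: divide_right_mono)
    ultimately show ?thesis by linarith
  qed
  show ?thesis
    unfolding eq
  proof (rule LIMSEQ_I)
    fix r :: real assume r: "0 < r"
    obtain K0 where K0: "\<And>K. K0 \<le> K \<Longrightarrow> norm (expectation (\<lambda>x. min (h x) (real K)) - expectation h) < r / 3"
      using LIMSEQ_D[OF conv_h, of "r / 3"] r by auto
    define K where "K = max (max K0 1) (nat \<lceil>3 * C / r\<rceil> + 1)"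
    have K: "K0 \<le> K" "0 < K" "3 * C / r < real K" unfolding K_def by linarith+
    then have CK: "C / real K < r / 3"
      using r by (simp add: field_simps)
    obtain n0 where n0: "\<And>n. n0 \<le> n \<Longrightarrow> norm (expectation (\<lambda>x. min (f n x) (real K)) -
        expectation (\<lambda>x. min (h x) (real K))) < r / 3"
      using LIMSEQ_D[OF conv_f[of K], of "r / 3"] r by auto
    have "norm (expectation (f n) - expectation h) < r" if "n0 \<le> n" for n
      using n0[OF that] K0[OF K(1)] diff[OF K(2), of n] CK unfolding real_norm_def by linarith
    then show "\<exists>no. \<forall>n\<ge>no. norm (expectation (f n) - expectation h) < r" by blast
  qed
qed

section \<open>The two-point function as a limit of lattice correlations\<close>

definition fugacity :: "real \<Rightarrow> real" where
  "fugacity \<rho> = ln ((1 + \<rho>) / \<rho>)"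

lemma fugacity:
  assumes "0 < \<rho>"
  shows "0 < fugacity \<rho>" "exp (- fugacity \<rho>) = \<rho> / (1 + \<rho>)" "mean_occ (fugacity \<rho>) = \<rho>" "geo (fugacity \<rho>) = site_law \<rho>"
proof -
  show "0 < fugacity \<rho>" using assms by (simp add: fugacity_def)
  show e: "exp (- fugacity \<rho>) = \<rho> / (1 + \<rho>)"
    using assms by (simp add: fugacity_def exp_minus)
  have 1: "1 - \<rho> / (1 + \<rho>) = 1 / (1 + \<rho>)"
    using assms by (simp add: field_simps)
  show "mean_occ (fugacity \<rho>) = \<rho>" unfolding e 1 using assms by simp
  show "geo (fugacity \<rho>) = site_law \<rho>" unfolding geo_def site_law_def e 1 ..
qed

text \<open>The probability that a unit exponential waiting time ends within a cell of length 1 /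
  n.\<close>

definition step_prob :: "nat \<Rightarrow> real" where
  "step_prob n = 1 - exp (- 1 / real n)"

definition steps :: "real \<Rightarrow> nat \<Rightarrow> nat" where
  "steps t n = nat \<lfloor>real n * t\<rfloor>"

lemma step_prob: "0 < n \<Longrightarrow> 0 < step_prob n" "step_prob n < 1"
  by (auto simp: step_prob_def)

text \<open>By stationarity both occupations have the law \<open>geo u\<close>, so the bound by its
  fourth moment depends neither on the size of the grid nor on the clocks.\<close>

lemma pair_second_moment:
  assumes p: "0 < p" "p < 1" and u: "0 < u" and kj: "k < x" "j < x"
  shows "integrable (measure_pmf (model x M p u u)) (\<lambda>y. (real (occ0 y ! k * occ1 y ! j))\<^sup>2)"
    "(\<integral>y. (real (occ0 y ! k * occ1 y ! j))\<^sup>2 \<partial>model x M p u u) \<le> 2 * (\<integral>q. real q ^ 4 \<partial>geo u)"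
proof -
  let ?m = "measure_pmf (model x M p u u)"
  have m0: "map_pmf (\<lambda>y. occ0 y ! k) (model x M p u u) = geo u"
  proof -
    have "map_pmf (\<lambda>y. occ0 y ! k) (model x M p u u) =
        map_pmf (\<lambda>qs. qs ! k) (map_pmf (\<lambda>y. fst (snd y)) (model x M p u u))"
      by (simp add: map_pmf_comp occ0_def)
    then show ?thesis unfolding map_pmf_model map_nth_replicate_pmf[OF kj(1)] .
  qed
  have m1: "map_pmf (\<lambda>y. occ1 y ! j) (model x M p u u) = geo u"
  proof -
    have "map_pmf (\<lambda>y. occ1 y ! j) (model x M p u u) =
        map_pmf (\<lambda>qs. qs ! j) (map_pmf fst (map_pmf outcome (model x M p u u)))"
      by (simp add: map_pmf_comp occ1_def)
    then show ?thesis
      unfolding map_pmf_outcome[OF p u] map_fst_pair_pmf map_nth_replicate_pmf[OF kj(2)] .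
  qed
  have i0: "integrable ?m (\<lambda>y. real (occ0 y ! k) ^ 4)" and e0: "(\<integral>y. real (occ0 y ! k) ^ 4 \<partial>?m) = (\<integral>q. real q ^ 4 \<partial>geo u)"
    using geo_moment(1)[OF u, of 4] unfolding m0[symmetric] by (simp_all add: integrable_map_pmf_eq)
  have i1: "integrable ?m (\<lambda>y. real (occ1 y ! j) ^ 4)" and e1: "(\<integral>y. real (occ1 y ! j) ^ 4 \<partial>?m) = (\<integral>q. real q ^ 4 \<partial>geo u)"
    using geo_moment(1)[OF u, of 4] unfolding m1[symmetric] by (simp_all add: integrable_map_pmf_eq)
  have pw: "(real (a * b))\<^sup>2 \<le> real a ^ 4 + real b ^ 4" for a b :: nat
  proof -
    have "0 \<le> ((real a)\<^sup>2 - (real b)\<^sup>2)\<^sup>2" by simp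
    then have "2 * ((real a)\<^sup>2 * (real b)\<^sup>2) \<le> real a ^ 4 + real b ^ 4"
      by (simp add: power2_diff flip: power_mult)
    moreover have "0 \<le> (real a)\<^sup>2 * (real b)\<^sup>2" by simp
    ultimately show ?thesis unfolding of_nat_mult power_mult_distrib by linarith
  qed
  show i: "integrable ?m (\<lambda>y. (real (occ0 y ! k * occ1 y ! j))\<^sup>2)"
    by (rule integrable_pmf_bound[OF Bochner_Integration.integrable_add[OF i0 i1]]) (use pw in auto)
  have "(\<integral>y. (real (occ0 y ! k * occ1 y ! j))\<^sup>2 \<partial>?m) \<le> (\<integral>y. real (occ0 y ! k) ^ 4 + real (occ1 y ! j) ^ 4 \<partial>?m)"
    by (rule integral_mono[OF i]) (use i0 i1 pw in auto)
  also have "\<dots> = 2 * (\<integral>q. real q ^ 4 \<partial>geo u)"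
    using i0 i1 e0 e1 by simp
  finally show "(\<integral>y. (real (occ0 y ! k * occ1 y ! j))\<^sup>2 \<partial>?m) \<le> 2 * (\<integral>q. real q ^ 4 \<partial>geo u)" .
qed

text \<open>Almost surely the lattice occupations are eventually equal to those of the process, and
  the uniform second moments carry the convergence over to the means.\<close>

lemma grid_expectation_limit:
  assumes \<rho>: "0 < \<rho>" and t: "0 < t"
  shows "(\<lambda>n. \<integral>y. real (occ0 y ! n * occ1 y ! nat (int n + i))
      \<partial>model (n + Suc (nat i)) (steps t n) (step_prob n) (fugacity \<rho>) (fugacity \<rho>))
    \<longlonglongrightarrow> two_point \<rho> i t + \<rho>\<^sup>2"
proof -
  define u where "u = fugacity \<rho>"
  define a where "a n = arr (step_prob n) u" for n
  define X where "X n = n + Suc (nat i)" for n :: nat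
  \<comment> \<open>The index is shifted by one because the laws of the grid require a positive
    number of cells per unit of time.\<close>
  define y where "y n = grid_sample (a (Suc n)) (Suc n) (X (Suc n)) (steps t (Suc n))" for n
  define F where "F n z = real (occ0 z ! Suc n * occ1 z ! nat (int (Suc n) + i))" for n and z :: sample
  define f where "f n s = F n (y n s)" for n s
  note u = fugacity[OF \<rho>, folded u_def]
  interpret prob_space "sample_measure \<rho>" by (rule prob_space_sample)
  let ?m = "\<lambda>n. measure_pmf (model (X (Suc n)) (steps t (Suc n)) (step_prob (Suc n)) u u)"
  have law: "y n \<in> sample_measure \<rho> \<rightarrow>\<^sub>M count_space UNIV"
    "distr (sample_measure \<rho>) (count_space UNIV) (y n) = ?m n" for n
  proof -
    have b: "0 < a (Suc n)" "a (Suc n) < 1"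
      unfolding a_def by (intro arr_bounds step_prob; simp)+
    show "y n \<in> sample_measure \<rho> \<rightarrow>\<^sub>M count_space UNIV"
      unfolding y_def
      by (rule grid_sample_law(1)[OF _ b u(4)]) (simp_all add: a_def step_prob_def)
    show "distr (sample_measure \<rho>) (count_space UNIV) (y n) = ?m n"
      unfolding y_def step_prob_def
      by (rule grid_sample_law(2)[OF _ b u(4)]) (simp_all add: a_def step_prob_def)
  qed
  have meas: "f n \<in> borel_measurable (sample_measure \<rho>)" for n
    unfolding f_def using law(1) by (rule measurable_compose) simp
  have E: "expectation (\<lambda>s. G (f n s)) = (\<integral>z. G (F n z) \<partial>?m n)" for G :: "real \<Rightarrow> real" and n
    unfolding law(2)[symmetric] f_def by (subst integral_distr[OF law(1)]) simp_all
  have "nat (int (Suc n) + i) < X (Suc n)" "Suc n < X (Suc n)" for n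
    by (auto simp: X_def)
  note mom = pair_second_moment[OF step_prob u(1) this(2,1)]
  have int: "integrable (sample_measure \<rho>) (\<lambda>s. (f n s)\<^sup>2)" for n
  proof -
    have "integrable (distr (sample_measure \<rho>) (count_space UNIV) (y n)) (\<lambda>z. (F n z)\<^sup>2)"
      unfolding law(2) F_def by (rule mom) simp
    then show ?thesis unfolding f_def by (subst (asm) integrable_distr_eq[OF law(1)]) simp_all
  qed
  have bound: "expectation (\<lambda>s. (f n s)\<^sup>2) \<le> 2 * (\<integral>q. real q ^ 4 \<partial>geo u)" for n
    unfolding E[of "\<lambda>x. x\<^sup>2"] F_def by (rule mom) simp
  have lim: "AE s in sample_measure \<rho>. (\<lambda>n. f n s) \<longlonglongrightarrow> real (tazrp s t i) * real (tazrp s 0 0)"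
    using AE_sample_snd[OF AE_regular_clocks[of t], of \<rho>]
  proof eventually_elim
    case (elim s)
    obtain \<eta> \<xi> where s: "s = (\<eta>, \<xi>)" by (cases s)
    then interpret regular_clocks \<eta> \<xi> using elim by simp
    have "i \<le> int (nat i)" by simp
    then have ev: "\<forall>\<^sub>F n in sequentially. \<forall>w. length w = nat \<lfloor>real n * t\<rfloor> \<longrightarrow>
      fst (tandem (grid_occupations \<eta> n (n + Suc (nat i))) (grid_clocks \<xi> n (n + Suc (nat i)) (nat \<lfloor>real n * t\<rfloor>)) w) !
      nat (int n + i) = trajectory t i"
      using elim s by (intro eventually_grid_match t) auto
    then have "\<forall>\<^sub>F n in sequentially. \<forall>w. length w = nat \<lfloor>real (Suc n) * t\<rfloor> \<longrightarrow>
      fst (tandem (grid_occupations \<eta> (Suc n) (Suc n + Suc (nat i)))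
        (grid_clocks \<xi> (Suc n) (Suc n + Suc (nat i)) (nat \<lfloor>real (Suc n) * t\<rfloor>)) w) !
      nat (int (Suc n) + i) = trajectory t i"
      by (rule eventually_compose_filterlim[OF _ filterlim_Suc])
    then have "\<forall>\<^sub>F n in sequentially. f n s = real (tazrp s t i) * real (tazrp s 0 0)"
    proof eventually_elim
      case (elim n)
      have "occ0 (y n s) ! Suc n = \<eta> 0"
        by (simp add: y_def grid_sample_def occ0_def grid_occupations_def X_def s del: upt_Suc)
      moreover have "occ1 (y n s) ! nat (int (Suc n) + i) = trajectory t i"
        using elim by (simp add: y_def grid_sample_def occ1_def outcome_def X_def s steps_def grid_arrivals_def)
      ultimately show ?case
        by (simp add: f_def F_def s tazrp_eq trajectory_0)
    qed
    then show ?case by (rule tendsto_eventually)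
  qed
  have "(\<lambda>n. expectation (f n)) \<longlonglongrightarrow> integral\<^sup>L (completion (sample_measure \<rho>)) (\<lambda>s. real (tazrp s t i) * real (tazrp s 0 0))"
    by (rule expectation_limit[OF meas _ int bound lim]) (simp add: f_def F_def)
  then have "(\<lambda>n. \<integral>z. F n z \<partial>?m n) \<longlonglongrightarrow> two_point \<rho> i t + \<rho>\<^sup>2"
    using E[of "\<lambda>x. x"] by (simp add: two_point_def tazrp_space_eq)
  then show ?thesis
    unfolding F_def X_def u_def by (rule LIMSEQ_imp_Suc)
qed

text \<open>Translation invariance moves the origin from the index n of the grid to the first site
  of a chain of i + 1 sites.\<close>

lemma two_point_limit:
  assumes \<rho>: "0 < \<rho>" and t: "0 < t"
  shows "(\<lambda>n. correlation i (steps t n) (step_prob n) (fugacity \<rho>)) \<longlonglongrightarrow> two_point \<rho> (int i) t"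
proof -
  note u = fugacity[OF \<rho>]
  have lim: "(\<lambda>n. (\<integral>y. real (occ0 y ! n * occ1 y ! nat (int n + int i))
      \<partial>model (n + Suc (nat (int i))) (steps t n) (step_prob n) (fugacity \<rho>) (fugacity \<rho>)) - \<rho>\<^sup>2)
    \<longlonglongrightarrow> two_point \<rho> (int i) t + \<rho>\<^sup>2 - \<rho>\<^sup>2"
    by (intro tendsto_diff grid_expectation_limit \<rho> t tendsto_const)
  have "\<forall>\<^sub>F n in sequentially. (\<integral>y. real (occ0 y ! n * occ1 y ! nat (int n + int i))
      \<partial>model (n + Suc (nat (int i))) (steps t n) (step_prob n) (fugacity \<rho>) (fugacity \<rho>)) - \<rho>\<^sup>2 =
    correlation i (steps t n) (step_prob n) (fugacity \<rho>)"
    using eventually_gt_at_top[of 0]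
  proof eventually_elim
    case (elim n)
    have e: "(\<integral>y. real (f y) \<partial>measure_pmf q) = enn2real (\<integral>\<^sup>+y. of_nat (f y) \<partial>measure_pmf q)"
      for f :: "sample \<Rightarrow> nat" and q
      by (subst integral_eq_nn_integral) (auto simp: ennreal_of_nat_eq_real_of_nat)
    show ?case
      unfolding e correlation_def u(3)
      using joint_law_right[OF step_prob(1)[OF elim] step_prob(2) u(1), where k = n and j = "n + i"
          and x = "n + Suc i" and M = "steps t n" and f = "\<lambda>a b. of_nat (a * b)"]
      by (simp add: nat_int_add)
  qed
  from Lim_transform_eventually[OF lim this] show ?thesis by simp
qed

text \<open>By \<open>joint_law_left\<close> the two occupations are independent on every
  sufficiently fine grid, so the limit of the means is the constant \<rho>^2.\<close>

lemma two_point_left: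
  assumes \<rho>: "0 < \<rho>" and t: "0 < t" and i: "i < 0"
  shows "two_point \<rho> i t = 0"
proof -
  note u = fugacity[OF \<rho>]
  have "\<forall>\<^sub>F n in sequentially. (\<integral>y. real (occ0 y ! n * occ1 y ! nat (int n + i))
      \<partial>model (n + Suc (nat i)) (steps t n) (step_prob n) (fugacity \<rho>) (fugacity \<rho>)) = \<rho>\<^sup>2"
    using eventually_gt_at_top[of 0]
  proof eventually_elim
    case (elim n)
    let ?g = "geo (fugacity \<rho>)"
    have e: "(\<integral>y. real (f y) \<partial>measure_pmf q) = enn2real (\<integral>\<^sup>+y. of_nat (f y) \<partial>measure_pmf q)"
      for f :: "sample \<Rightarrow> nat" and q
      by (subst integral_eq_nn_integral) (auto simp: ennreal_of_nat_eq_real_of_nat)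
    have g1: "(\<integral>\<^sup>+a. ennreal (real a) \<partial>?g) = ennreal \<rho>"
      using nn_integral_eq_integral[OF geo_moment(1)[OF u(1), of 1]] geo_moment(2)[OF u(1)] u(3) by simp
    have "(\<integral>\<^sup>+b. \<integral>\<^sup>+a. of_nat (a * b) \<partial>?g \<partial>?g) = (\<integral>\<^sup>+b. ennreal \<rho> * ennreal (real b) \<partial>?g)"
    proof (intro nn_integral_cong)
      fix b
      have "(\<integral>\<^sup>+a. of_nat (a * b) \<partial>?g) = (\<integral>\<^sup>+a. ennreal (real a) \<partial>?g) * ennreal (real b)"
        by (subst nn_integral_multc[symmetric]) (simp_all add: ennreal_of_nat_eq_real_of_nat ennreal_mult)
      then show "(\<integral>\<^sup>+a. of_nat (a * b) \<partial>?g) = ennreal \<rho> * ennreal (real b)"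
        unfolding g1 .
    qed
    also have "\<dots> = ennreal (\<rho>\<^sup>2)"
      using \<rho> by (subst nn_integral_cmult) (simp_all add: g1 ennreal_mult[symmetric] power2_eq_square)
    finally have "(\<integral>\<^sup>+b. \<integral>\<^sup>+a. of_nat (a * b) \<partial>?g \<partial>?g) = ennreal (\<rho>\<^sup>2)" .
    moreover have "nat (int n + i) < n" using elim i by linarith
    ultimately show ?case
      unfolding e
      using joint_law_left[OF step_prob(1)[OF elim] step_prob(2) u(1), where k = n and j = "nat (int n + i)"
          and x = "n + Suc (nat i)" and M = "steps t n" and f = "\<lambda>a b. of_nat (a * b)"]
      by (simp del: of_nat_mult)
  qed
  then have "(\<lambda>n. \<integral>y. real (occ0 y ! n * occ1 y ! nat (int n + i))
      \<partial>model (n + Suc (nat i)) (steps t n) (step_prob n) (fugacity \<rho>) (fugacity \<rho>)) \<longlonglongrightarrow> \<rho>\<^sup>2"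
    by (rule tendsto_eventually)
  from LIMSEQ_unique[OF this grid_expectation_limit[OF \<rho> t]] show ?thesis by simp
qed

section \<open>The limit of the covariance bounds\<close>

lemma step_prob_limit: "step_prob \<longlonglongrightarrow> 0"
proof -
  have "(\<lambda>n. 1 - exp (- 1 * inverse (real n))) \<longlonglongrightarrow> 1 - exp (- 1 * 0)"
    by (intro tendsto_intros LIMSEQ_inverse_real_of_nat[THEN LIMSEQ_imp_Suc])
  then show ?thesis by (simp add: step_prob_def[abs_def] divide_inverse)
qed

lemma step_prob_at_0:
  assumes "c \<noteq> 0"
  shows "filterlim (\<lambda>n. c * step_prob n) (at 0) sequentially"
proof (rule filterlim_atI)
  show "(\<lambda>n. c * step_prob n) \<longlonglongrightarrow> 0"
    using tendsto_mult_right_zero[OF step_prob_limit] .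
  show "\<forall>\<^sub>F n in sequentially. c * step_prob n \<noteq> 0"
    using eventually_gt_at_top[of 0]
  proof eventually_elim
    case (elim n)
    then show ?case using step_prob(1)[OF elim] assms by simp
  qed
qed

lemma steps_step_prob_limit:
  assumes "0 < t"
  shows "(\<lambda>n. real (steps t n) * step_prob n) \<longlonglongrightarrow> t"
proof -
  have "((\<lambda>h. (exp (0 + h) - exp 0) / h) \<longlongrightarrow> exp (0 :: real)) (at 0)"
    using DERIV_exp[of "0 :: real"] by (simp only: DERIV_def)
  moreover have "filterlim (\<lambda>n. - 1 / real n) (at 0) sequentially"
  proof (rule filterlim_atI)
    show "(\<lambda>n. - 1 / real n) \<longlonglongrightarrow> 0"
      using tendsto_minus[OF lim_1_over_n] by simp
    show "\<forall>\<^sub>F n in sequentially. - 1 / real n \<noteq> 0"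
      using eventually_gt_at_top[of 0] by eventually_elim auto
  qed
  ultimately have "(\<lambda>n. (exp (0 + - 1 / real n) - exp 0) / (- 1 / real n)) \<longlonglongrightarrow> exp (0 :: real)"
    by (rule filterlim_compose)
  then have 1: "(\<lambda>n. real n * step_prob n) \<longlonglongrightarrow> 1"
    by (simp add: step_prob_def algebra_simps)
  have 2: "(\<lambda>n. (real (steps t n) - real n * t) * step_prob n) \<longlonglongrightarrow> 0"
  proof (rule Lim_null_comparison[OF _ step_prob_limit])
    show "\<forall>\<^sub>F n in sequentially. norm ((real (steps t n) - real n * t) * step_prob n) \<le> step_prob n"
      using eventually_gt_at_top[of 0]
    proof eventually_elim
      case (elim n)
      have "0 \<le> real n * t" using assms by simp
      then have "\<bar>real (steps t n) - real n * t\<bar> \<le> 1"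
        unfolding steps_def by linarith
      then show ?case
        using step_prob(1)[OF elim] by (simp add: abs_mult mult_left_le_one_le)
    qed
  qed
  have "(\<lambda>n. (real (steps t n) - real n * t) * step_prob n + t * (real n * step_prob n)) \<longlonglongrightarrow> 0 + t * 1"
    by (intro tendsto_add tendsto_mult tendsto_const 1 2)
  then show ?thesis by (simp add: algebra_simps)
qed

text \<open>The limit of \<open>log_partition\<close>: the Bernoulli arrivals become Poisson, and
  their partition function becomes an exponential.\<close>

definition limit_partition :: "real \<Rightarrow> real \<Rightarrow> real \<Rightarrow> real" where
  "limit_partition x t v = x * ln (1 - exp (- v)) - t * (1 - exp (- v))"

lemma log_partition_limit:
  assumes "0 < t" "0 < v"
  shows "(\<lambda>n. log_partition x (steps t n) (step_prob n) v) \<longlonglongrightarrow> limit_partition x t v"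
proof -
  define c where "c = 1 - exp (- v)"
  have c: "0 < c" using assms by (simp add: c_def)
  have "((\<lambda>h. (ln (1 + h) - ln 1) / h) \<longlongrightarrow> inverse (1 :: real)) (at 0)"
    using DERIV_ln[of "1 :: real"] by (simp only: DERIV_def)
  then have "((\<lambda>h. ln (1 + h) / h) \<longlongrightarrow> 1) (at (0 :: real))" by simp
  from filterlim_compose[OF this step_prob_at_0[of "- c"]] c
  have 1: "(\<lambda>n. ln (1 + - c * step_prob n) / (- c * step_prob n)) \<longlonglongrightarrow> 1" by simp
  have "(\<lambda>n. (real (steps t n) * step_prob n) * (- c) * (ln (1 + - c * step_prob n) / (- c * step_prob n)))
      \<longlonglongrightarrow> t * (- c) * 1"
    by (intro tendsto_mult steps_step_prob_limit assms 1 tendsto_const)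
  moreover have "\<forall>\<^sub>F n in sequentially.
      (real (steps t n) * step_prob n) * (- c) * (ln (1 + - c * step_prob n) / (- c * step_prob n)) =
      real (steps t n) * ln (1 - step_prob n + step_prob n * exp (- v))"
    using eventually_gt_at_top[of 0]
  proof eventually_elim
    case (elim n)
    have eq: "1 - step_prob n + step_prob n * exp (- v) = 1 + - c * step_prob n"
      by (simp add: c_def algebra_simps)
    have "(A * q) * (- c) * (L / (- c * q)) = A * L" if "q \<noteq> 0" for A q L :: real
      using that c by simp
    then show ?case unfolding eq using step_prob(1)[OF elim] by simp
  qed
  ultimately have "(\<lambda>n. real (steps t n) * ln (1 - step_prob n + step_prob n * exp (- v))) \<longlonglongrightarrow> t * (- c) * 1"
    by (rule Lim_transform_eventually)
  then have "(\<lambda>n. real x * ln (1 - exp (- v)) + real (steps t n) * ln (1 - step_prob n + step_prob n * exp (- v)))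
      \<longlonglongrightarrow> real x * ln (1 - exp (- v)) + t * (- c) * 1"
    by (intro tendsto_add tendsto_const)
  moreover have "real x * ln (1 - exp (- v)) + t * (- c) * 1 = limit_partition x t v"
    by (simp add: limit_partition_def c_def algebra_simps)
  ultimately show ?thesis unfolding log_partition_def by (simp only:)
qed

lemma arr_limit: "(\<lambda>n. arr (step_prob n) v) \<longlonglongrightarrow> 0"
proof -
  have "(\<lambda>n. step_prob n * exp (- v) / (1 - step_prob n + step_prob n * exp (- v))) \<longlonglongrightarrow>
    0 * exp (- v) / (1 - 0 + 0 * exp (- v))"
    by (intro tendsto_intros step_prob_limit) simp
  then show ?thesis by (simp add: arr_def)
qed

lemma steps_arr_limit:
  assumes "0 < t"
  shows "(\<lambda>n. real (steps t n) * arr (step_prob n) v) \<longlonglongrightarrow> t * exp (- v)"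
proof -
  have "(\<lambda>n. (real (steps t n) * step_prob n) * exp (- v) / (1 - step_prob n + step_prob n * exp (- v))) \<longlonglongrightarrow>
    t * exp (- v) / (1 - 0 + 0 * exp (- v))"
    by (intro tendsto_intros step_prob_limit steps_step_prob_limit assms) simp
  then show ?thesis by (simp add: arr_def mult.assoc)
qed

lemma arr_ratio_limit: "(\<lambda>n. arr (step_prob n) (u + \<delta>) / arr (step_prob n) u) \<longlonglongrightarrow> exp (- \<delta>)"
proof -
  have "(\<lambda>n. exp (- \<delta>) * (1 - step_prob n + step_prob n * exp (- u)) / (1 - step_prob n + step_prob n * exp (- (u + \<delta>))))
    \<longlonglongrightarrow> exp (- \<delta>) * (1 - 0 + 0 * exp (- u)) / (1 - 0 + 0 * exp (- (u + \<delta>)))"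
    by (intro tendsto_intros step_prob_limit) simp
  moreover have "\<forall>\<^sub>F n in sequentially.
      exp (- \<delta>) * (1 - step_prob n + step_prob n * exp (- u)) / (1 - step_prob n + step_prob n * exp (- (u + \<delta>))) =
      arr (step_prob n) (u + \<delta>) / arr (step_prob n) u"
    using eventually_gt_at_top[of 0]
  proof eventually_elim
    case (elim n)
    define p where "p = step_prob n"
    have p: "0 < p" "p < 1" using step_prob(1)[OF elim] step_prob(2) by (auto simp: p_def)
    define D where "D v = 1 - p + p * exp (- v)" for v
    have D: "0 < D v" for v
      unfolding D_def using p by (intro add_pos_pos) auto
    have "exp (- (u + \<delta>)) = exp (- \<delta>) * exp (- u)" by (simp add: mult_exp_exp)
    then have "arr p (u + \<delta>) / arr p u = (p * (exp (- \<delta>) * exp (- u)) / D (u + \<delta>)) / (p * exp (- u) / D u)"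
      by (simp only: arr_def D_def)
    also have "\<dots> = exp (- \<delta>) * D u / D (u + \<delta>)"
    proof -
      have "(p * (d * e) / D2) / (p * e / D1) = d * D1 / D2" if "p \<noteq> 0" "e \<noteq> 0" "D1 \<noteq> 0" "D2 \<noteq> 0"
        for p d e D1 D2 :: real
        using that by simp
      then show ?thesis using p D[of u] D[of "u + \<delta>"] by simp
    qed
    finally show ?case unfolding D_def p_def by (rule sym)
  qed
  ultimately have "(\<lambda>n. arr (step_prob n) (u + \<delta>) / arr (step_prob n) u)
      \<longlonglongrightarrow> exp (- \<delta>) * (1 - 0 + 0 * exp (- u)) / (1 - 0 + 0 * exp (- (u + \<delta>)))"
    by (rule Lim_transform_eventually)
  then show ?thesis by (simp only: mult_zero_left add_0_right diff_zero div_by_1 mult_1_right)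
qed

definition cov_limit :: "real \<Rightarrow> real \<Rightarrow> nat \<Rightarrow> real" where
  "cov_limit \<rho> t x = (\<Sum>i<x. real (x - i) * two_point \<rho> (int i) t)"

definition excess_limit :: "real \<Rightarrow> real \<Rightarrow> nat \<Rightarrow> real" where
  "excess_limit \<rho> t x = cov_limit \<rho> t x - real x * (\<rho> * (1 + \<rho>)) + t * (\<rho> / (1 + \<rho>))"

text \<open>Minus the mean flux in the limit, and the derivative of \<open>limit_partition\<close>
  at the fugacity of \<rho>.\<close>

definition drift :: "real \<Rightarrow> real \<Rightarrow> nat \<Rightarrow> real" where
  "drift \<rho> t x = real x * \<rho> - t * (\<rho> / (1 + \<rho>))"

lemma covariance_limit:
  assumes \<rho>: "0 < \<rho>" and t: "0 < t"
  shows "(\<lambda>n. covariance x (steps t n) (step_prob n) (fugacity \<rho>)) \<longlonglongrightarrow> cov_limit \<rho> t x"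
proof -
  have "(\<lambda>n. \<Sum>i<x. real (x - i) * correlation i (steps t n) (step_prob n) (fugacity \<rho>)) \<longlonglongrightarrow> cov_limit \<rho> t x"
    unfolding cov_limit_def by (intro tendsto_sum tendsto_mult tendsto_const two_point_limit assms)
  moreover have "\<forall>\<^sub>F n in sequentially.
      (\<Sum>i<x. real (x - i) * correlation i (steps t n) (step_prob n) (fugacity \<rho>)) =
      covariance x (steps t n) (step_prob n) (fugacity \<rho>)"
    using eventually_gt_at_top[of 0]
  proof eventually_elim
    case (elim n)
    show ?case
      by (rule covariance_eq_sum_correlation[symmetric, OF step_prob(1)[OF elim] step_prob(2) fugacity(1)[OF \<rho>]])
  qed
  ultimately show ?thesis by (rule Lim_transform_eventually)
qed

lemma excess_tendsto:
  assumes \<rho>: "0 < \<rho>" and t: "0 < t"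
  shows "(\<lambda>n. excess x (steps t n) (step_prob n) (fugacity \<rho>)) \<longlonglongrightarrow> excess_limit \<rho> t x"
proof -
  note u = fugacity[OF \<rho>]
  have "(\<lambda>n. covariance x (steps t n) (step_prob n) (fugacity \<rho>) - real x * (\<rho> * (1 + \<rho>)) +
      real (steps t n) * arr (step_prob n) (fugacity \<rho>) * (1 - arr (step_prob n) (fugacity \<rho>)))
    \<longlonglongrightarrow> cov_limit \<rho> t x - real x * (\<rho> * (1 + \<rho>)) + t * exp (- fugacity \<rho>) * (1 - 0)"
    by (intro tendsto_intros covariance_limit assms steps_arr_limit arr_limit)
  then show ?thesis unfolding excess_def excess_limit_def u(3) by (simp add: u(2))
qed

lemma mean_flux_limit:
  assumes \<rho>: "0 < \<rho>" and t: "0 < t"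
  shows "(\<lambda>n. - mean_flux x (steps t n) (step_prob n) (fugacity \<rho>)) \<longlonglongrightarrow> drift \<rho> t x"
proof -
  note u = fugacity[OF \<rho>]
  have "(\<lambda>n. - (real (steps t n) * arr (step_prob n) (fugacity \<rho>) - real x * \<rho>))
    \<longlonglongrightarrow> - (t * exp (- fugacity \<rho>) - real x * \<rho>)"
    by (intro tendsto_intros assms steps_arr_limit)
  then show ?thesis unfolding mean_flux_def drift_def u(3) by (simp add: u(2))
qed

lemma cov_limit_nonneg:
  assumes \<rho>: "0 < \<rho>" and t: "0 < t"
  shows "0 \<le> cov_limit \<rho> t x"
proof (rule LIMSEQ_le_const[OF covariance_limit[OF assms]])
  have "0 \<le> covariance x (steps t n) (step_prob n) (fugacity \<rho>)" if "0 < n" for n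
    using covariance_comparison(1)[OF step_prob(1)[OF that] step_prob(2), of "fugacity \<rho> / 2" "fugacity \<rho>"]
      fugacity(1)[OF \<rho>] by simp
  then show "\<exists>N. \<forall>n\<ge>N. 0 \<le> covariance x (steps t n) (step_prob n) (fugacity \<rho>)"
    by (intro exI[of _ 1]) simp
qed

lemma excess_limit_nonneg:
  assumes \<rho>: "0 < \<rho>" and t: "0 < t"
  shows "0 \<le> excess_limit \<rho> t x"
proof (rule LIMSEQ_le_const[OF excess_tendsto[OF assms]])
  have "0 \<le> excess x (steps t n) (step_prob n) (fugacity \<rho>)" if "0 < n" for n
    using excess_comparison(1)[OF step_prob(1)[OF that] step_prob(2), of "fugacity \<rho>" "fugacity \<rho> + 1"]
      fugacity(1)[OF \<rho>] by simp
  then show "\<exists>N. \<forall>n\<ge>N. 0 \<le> excess x (steps t n) (step_prob n) (fugacity \<rho>)"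
    by (intro exI[of _ 1]) simp
qed

lemma cov_limit_upper:
  fixes x :: nat and t \<rho> s \<delta> :: real
  assumes \<rho>: "0 < \<rho>" and t: "0 < t" and s: "0 < s" "0 < \<delta>" "s + \<delta> < fugacity \<rho>"
  defines "F \<equiv> limit_partition x t" and "u \<equiv> fugacity \<rho>" and "k \<equiv> drift \<rho> t x"
  shows "cov_limit \<rho> t x \<le>
    (exp (F (u + s) - F u - s * k) + exp (F (u - \<delta>) - F (u - \<delta> - s) - s * k) - 1) / (\<delta> * s)"
proof (rule LIMSEQ_le[OF covariance_limit[OF \<rho> t]])
  define Fn where "Fn n = log_partition x (steps t n) (step_prob n)" for n
  define kn where "kn n = - mean_flux x (steps t n) (step_prob n) u" for n
  have F: "(\<lambda>n. Fn n v) \<longlonglongrightarrow> F v" if "0 < v" for v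
    unfolding Fn_def F_def by (rule log_partition_limit[OF t that])
  have k: "kn \<longlonglongrightarrow> k"
    unfolding kn_def[abs_def] k_def u_def by (rule mean_flux_limit[OF \<rho> t])
  show "(\<lambda>n. (exp (Fn n (u + s) - Fn n u - s * kn n) + exp (Fn n (u - \<delta>) - Fn n (u - \<delta> - s) - s * kn n) - 1) / (\<delta> * s))
    \<longlonglongrightarrow> (exp (F (u + s) - F u - s * k) + exp (F (u - \<delta>) - F (u - \<delta> - s) - s * k) - 1) / (\<delta> * s)"
    by (intro tendsto_intros F k) (use s fugacity(1)[OF \<rho>] in \<open>auto simp: u_def\<close>)
  have "covariance x (steps t n) (step_prob n) (fugacity \<rho>) \<le>
      (exp (Fn n (u + s) - Fn n u - s * kn n) + exp (Fn n (u - \<delta>) - Fn n (u - \<delta> - s) - s * kn n) - 1) / (\<delta> * s)"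
    if "0 < n" for n
    unfolding Fn_def kn_def u_def
    by (rule covariance_upper_bound[OF step_prob(1)[OF that] step_prob(2) s])
  then show "\<exists>N. \<forall>n\<ge>N. covariance x (steps t n) (step_prob n) (fugacity \<rho>) \<le>
      (exp (Fn n (u + s) - Fn n u - s * kn n) + exp (Fn n (u - \<delta>) - Fn n (u - \<delta> - s) - s * kn n) - 1) / (\<delta> * s)"
    by (intro exI[of _ 1]) simp
qed

lemma excess_limit_upper:
  fixes x :: nat and t \<rho> s \<delta> :: real
  assumes \<rho>: "0 < \<rho>" and t: "0 < t" and s: "0 < s" "0 < \<delta>" "s < fugacity \<rho>"
  defines "F \<equiv> limit_partition x t" and "u \<equiv> fugacity \<rho>" and "k \<equiv> drift \<rho> t x"
  shows "excess_limit \<rho> t x \<le>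
    (exp (F (u + \<delta> + s) - F (u + \<delta>) - s * k) + exp (F u - F (u - s) - s * k) - 1) / ((1 - exp (- \<delta>)) * s)"
proof (rule LIMSEQ_le[OF excess_tendsto[OF \<rho> t]])
  define Fn where "Fn n = log_partition x (steps t n) (step_prob n)" for n
  define kn where "kn n = - mean_flux x (steps t n) (step_prob n) u" for n
  define \<theta> where "\<theta> n = 1 - arr (step_prob n) (u + \<delta>) / arr (step_prob n) u" for n
  have F: "(\<lambda>n. Fn n v) \<longlonglongrightarrow> F v" if "0 < v" for v
    unfolding Fn_def F_def by (rule log_partition_limit[OF t that])
  have k: "kn \<longlonglongrightarrow> k"
    unfolding kn_def[abs_def] k_def u_def by (rule mean_flux_limit[OF \<rho> t])
  have \<theta>: "\<theta> \<longlonglongrightarrow> 1 - exp (- \<delta>)"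
    unfolding \<theta>_def[abs_def] by (intro tendsto_intros arr_ratio_limit)
  show "(\<lambda>n. (exp (Fn n (u + \<delta> + s) - Fn n (u + \<delta>) - s * kn n) + exp (Fn n u - Fn n (u - s) - s * kn n) - 1) / (\<theta> n * s))
    \<longlonglongrightarrow> (exp (F (u + \<delta> + s) - F (u + \<delta>) - s * k) + exp (F u - F (u - s) - s * k) - 1) / ((1 - exp (- \<delta>)) * s)"
    by (intro tendsto_intros F k \<theta>) (use s fugacity(1)[OF \<rho>] in \<open>auto simp: u_def\<close>)
  have "excess x (steps t n) (step_prob n) (fugacity \<rho>) \<le>
      (exp (Fn n (u + \<delta> + s) - Fn n (u + \<delta>) - s * kn n) + exp (Fn n u - Fn n (u - s) - s * kn n) - 1) / (\<theta> n * s)"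
    if "0 < n" for n
    unfolding Fn_def kn_def \<theta>_def u_def
    by (rule excess_upper_bound[OF step_prob(1)[OF that] step_prob(2) s])
  then show "\<exists>N. \<forall>n\<ge>N. excess x (steps t n) (step_prob n) (fugacity \<rho>) \<le>
      (exp (Fn n (u + \<delta> + s) - Fn n (u + \<delta>) - s * kn n) + exp (Fn n u - Fn n (u - s) - s * kn n) - 1) / (\<theta> n * s)"
    by (intro exI[of _ 1]) simp
qed

text \<open>The inequality 1 + y \<le> exp y replaces the Bernoulli moment by a Poisson one, whose
  exponent has an evident limit.\<close>

lemma excess_limit_far:
  fixes x :: nat and t \<rho> s \<delta> l l' :: real
  assumes \<rho>: "0 < \<rho>" and t: "0 < t" and s: "0 < s" "0 < \<delta>" and l: "0 < l" "0 < l'"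
  defines "F \<equiv> limit_partition x t" and "u \<equiv> fugacity \<rho>"
  shows "excess_limit \<rho> t x \<le>
    (l * ((l' * exp (t * exp (- u) * (exp (4 * s) - 1)) +
       ((1 - exp (- u)) / (1 - exp (- u - 4 * s))) ^ x / l') / 2) +
     exp (F (u + \<delta> + 2 * s) - F (u + \<delta>)) / l) / (2 * s * (1 - exp (- \<delta>)))"
proof (rule LIMSEQ_le[OF excess_tendsto[OF \<rho> t]])
  define Fn where "Fn n = log_partition x (steps t n) (step_prob n)" for n
  define \<theta> where "\<theta> n = 1 - arr (step_prob n) (u + \<delta>) / arr (step_prob n) u" for n
  define a where "a n = arr (step_prob n) u" for n
  define B where "B = ((1 - exp (- u)) / (1 - exp (- u - 4 * s))) ^ x / l'"
  have F: "(\<lambda>n. Fn n v) \<longlonglongrightarrow> F v" if "0 < v" for v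
    unfolding Fn_def F_def by (rule log_partition_limit[OF t that])
  have \<theta>: "\<theta> \<longlonglongrightarrow> 1 - exp (- \<delta>)"
    unfolding \<theta>_def[abs_def] by (intro tendsto_intros arr_ratio_limit)
  have u: "0 < u" unfolding u_def by (rule fugacity(1)[OF \<rho>])
  have sa: "(\<lambda>n. real (steps t n) * a n) \<longlonglongrightarrow> t * exp (- u)"
    unfolding a_def by (rule steps_arr_limit[OF t])
  show "(\<lambda>n. (l * ((l' * exp (real (steps t n) * a n * (exp (4 * s) - 1)) + B) / 2) +
      exp (Fn n (u + \<delta> + 2 * s) - Fn n (u + \<delta>)) / l) / (2 * s * \<theta> n)) \<longlonglongrightarrow>
    (l * ((l' * exp (t * exp (- u) * (exp (4 * s) - 1)) +
       ((1 - exp (- u)) / (1 - exp (- u - 4 * s))) ^ x / l') / 2) +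
     exp (F (u + \<delta> + 2 * s) - F (u + \<delta>)) / l) / (2 * s * (1 - exp (- \<delta>)))"
    unfolding B_def[symmetric]
    by (intro tendsto_intros F \<theta> sa) (use s u l in auto)
  have "excess x (steps t n) (step_prob n) (fugacity \<rho>) \<le>
      (l * ((l' * exp (real (steps t n) * a n * (exp (4 * s) - 1)) + B) / 2) +
      exp (Fn n (u + \<delta> + 2 * s) - Fn n (u + \<delta>)) / l) / (2 * s * \<theta> n)"
    if n: "0 < n" for n
  proof -
    note p = step_prob(1)[OF n] step_prob(2)
    have "excess x (steps t n) (step_prob n) (fugacity \<rho>) \<le>
      (l * ((l' * (1 - a n + a n * exp (4 * s)) ^ steps t n + B) / 2) +
      exp (Fn n (u + \<delta> + 2 * s) - Fn n (u + \<delta>)) / l) / (2 * s * \<theta> n)"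
      using excess_far_bound[OF p u s(1,2) l, of x "steps t n"] unfolding Fn_def \<theta>_def a_def B_def u_def .
    also have "\<dots> \<le> (l * ((l' * exp (real (steps t n) * a n * (exp (4 * s) - 1)) + B) / 2) +
      exp (Fn n (u + \<delta> + 2 * s) - Fn n (u + \<delta>)) / l) / (2 * s * \<theta> n)"
    proof -
      have \<theta>0: "0 < \<theta> n"
        unfolding \<theta>_def using excess_comparison(3)[OF p u, of "u + \<delta>"] s by simp
      have "(1 - a n + a n * exp (4 * s)) ^ steps t n \<le> exp (a n * (exp (4 * s) - 1)) ^ steps t n"
      proof (rule power_mono)
        show "1 - a n + a n * exp (4 * s) \<le> exp (a n * (exp (4 * s) - 1))"
          using exp_ge_add_one_self[of "a n * (exp (4 * s) - 1)"] by (simp add: algebra_simps)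
        show "0 \<le> 1 - a n + a n * exp (4 * s)"
          using arr_bounds[OF p, of u] by (simp add: a_def)
      qed
      also have "\<dots> = exp (real (steps t n) * a n * (exp (4 * s) - 1))"
        by (simp add: exp_of_nat_mult[symmetric] mult.assoc)
      finally have "l' * (1 - a n + a n * exp (4 * s)) ^ steps t n \<le>
          l' * exp (real (steps t n) * a n * (exp (4 * s) - 1))"
        using l by (intro mult_left_mono) auto
      then show ?thesis
        using \<theta>0 s l by (intro divide_right_mono add_right_mono mult_left_mono) auto
    qed
    finally show ?thesis .
  qed
  then show "\<exists>N. \<forall>n\<ge>N. excess x (steps t n) (step_prob n) (fugacity \<rho>) \<le>
      (l * ((l' * exp (real (steps t n) * a n * (exp (4 * s) - 1)) + B) / 2) +
      exp (Fn n (u + \<delta> + 2 * s) - Fn n (u + \<delta>)) / l) / (2 * s * \<theta> n)"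
    by (intro exI[of _ 1]) simp
qed

text \<open>The strict hypotheses hold on all fine grids. There
  \<open>covariance_lower_bound\<close> estimates the variance of the flux, which is the sum of the
  covariance and the excess.\<close>

lemma cov_limit_lower:
  fixes x :: nat and t \<rho> s B :: real
  assumes \<rho>: "0 < \<rho>" and t: "0 < t" and s: "0 < s" "2 * s < fugacity \<rho>"
  defines "F \<equiv> limit_partition x t" and "u \<equiv> fugacity \<rho>" and "k \<equiv> drift \<rho> t x"
  assumes large: "4 < exp (F (u + s) - F u - s * k)"
    and B: "exp (F (u + 2 * s) - F u - 2 * s * k) + exp (F u - F (u - 2 * s) - 2 * s * k) < B"
  shows "4 * (ln 2 / s)\<^sup>2 / B \<le> cov_limit \<rho> t x + excess_limit \<rho> t x"
proof -
  define Fn where "Fn n = log_partition x (steps t n) (step_prob n)" for n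
  define kn where "kn n = - mean_flux x (steps t n) (step_prob n) u" for n
  have u: "0 < u" unfolding u_def by (rule fugacity(1)[OF \<rho>])
  have F: "(\<lambda>n. Fn n v) \<longlonglongrightarrow> F v" if "0 < v" for v
    unfolding Fn_def F_def by (rule log_partition_limit[OF t that])
  have k: "kn \<longlonglongrightarrow> k"
    unfolding kn_def[abs_def] k_def u_def by (rule mean_flux_limit[OF \<rho> t])
  have "(\<lambda>n. exp (Fn n (u + s) - Fn n u - s * kn n)) \<longlonglongrightarrow> exp (F (u + s) - F u - s * k)"
    by (intro tendsto_intros F k) (use s u in auto)
  from order_tendstoD(1)[OF this large]
  have ev1: "\<forall>\<^sub>F n in sequentially. 4 < exp (Fn n (u + s) - Fn n u - s * kn n)" .
  have "(\<lambda>n. exp (Fn n (u + 2 * s) - Fn n u - 2 * s * kn n) + exp (Fn n u - Fn n (u - 2 * s) - 2 * s * kn n))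
    \<longlonglongrightarrow> exp (F (u + 2 * s) - F u - 2 * s * k) + exp (F u - F (u - 2 * s) - 2 * s * k)"
    by (intro tendsto_intros F k) (use s u in \<open>auto simp: u_def\<close>)
  from order_tendstoD(2)[OF this B]
  have ev2: "\<forall>\<^sub>F n in sequentially. exp (Fn n (u + 2 * s) - Fn n u - 2 * s * kn n) +
      exp (Fn n u - Fn n (u - 2 * s) - 2 * s * kn n) < B" .
  have lim: "(\<lambda>n. covariance x (steps t n) (step_prob n) u + excess x (steps t n) (step_prob n) u) \<longlonglongrightarrow>
      cov_limit \<rho> t x + excess_limit \<rho> t x"
    unfolding u_def by (intro tendsto_add covariance_limit excess_tendsto \<rho> t)
  show ?thesis
  proof (rule tendsto_lowerbound[OF lim])
    show "\<forall>\<^sub>F n in sequentially. 4 * (ln 2 / s)\<^sup>2 / B \<le>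
        covariance x (steps t n) (step_prob n) u + excess x (steps t n) (step_prob n) u"
      using ev1 ev2 eventually_gt_at_top[of 0]
    proof eventually_elim
      case (elim n)
      have "4 * (ln 2 / s)\<^sup>2 / B \<le>
        real (steps t n) * arr (step_prob n) u * (1 - arr (step_prob n) u) -
          real x * (mean_occ u * (1 + mean_occ u)) + 2 * covariance x (steps t n) (step_prob n) u"
        using elim s step_prob[of n] unfolding Fn_def kn_def
        by (intro covariance_lower_bound) (auto simp: u_def)
      then show ?case by (simp add: excess_def)
    qed
  qed simp
qed

section \<open>Estimates on the scale of the characteristic\<close>

text \<open>The factorial in Lagrange's remainder is estimated away, as only the order in h
  matters.\<close>

lemma taylor_remainder_le:
  fixes D :: "nat \<Rightarrow> real \<Rightarrow> real" and u h r M :: real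
  assumes n: "0 < n"
    and deriv: "\<And>j v. j < n \<Longrightarrow> \<bar>v - u\<bar> \<le> r \<Longrightarrow> (D j has_real_derivative D (Suc j) v) (at v)"
    and bound: "\<And>v. \<bar>v - u\<bar> \<le> r \<Longrightarrow> \<bar>D n v\<bar> \<le> M"
    and h: "\<bar>h\<bar> \<le> r"
  shows "\<bar>D 0 (u + h) - (\<Sum>j<n. D j u / fact j * h ^ j)\<bar> \<le> M * \<bar>h\<bar> ^ n"
proof (cases "h = 0")
  case True
  have "(\<Sum>j<n. D j u / fact j * h ^ j) = (\<Sum>j<n. if j = 0 then D 0 u else 0)"
    by (rule sum.cong) (auto simp: True)
  also have "\<dots> = D 0 u" using n by simp
  finally show ?thesis using True n by (simp add: power_0_left)
next
  case False
  have "\<exists>v. (if u + h < u then u + h < v \<and> v < u else u < v \<and> v < u + h) \<and>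
      D 0 (u + h) = (\<Sum>j<n. D j u / fact j * (u + h - u) ^ j) + D n v / fact n * (u + h - u) ^ n"
    by (rule Taylor[where a = "u - r" and b = "u + r"])
      (use n h False in \<open>auto intro!: deriv simp: abs_le_iff\<close>)
  then obtain v where v: "if u + h < u then u + h < v \<and> v < u else u < v \<and> v < u + h"
    and eq: "D 0 (u + h) = (\<Sum>j<n. D j u / fact j * h ^ j) + D n v / fact n * h ^ n"
    by auto
  have "\<bar>v - u\<bar> \<le> r" using v h by (auto split: if_splits)
  then have b: "\<bar>D n v\<bar> \<le> M" by (rule bound)
  have "\<bar>D n v\<bar> / fact n \<le> M"
  proof -
    have "\<bar>D n v\<bar> / fact n \<le> \<bar>D n v\<bar> / 1" by (intro divide_left_mono) auto
    then show ?thesis using b by simp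
  qed
  then have "\<bar>D n v\<bar> / fact n * \<bar>h\<bar> ^ n \<le> M * \<bar>h\<bar> ^ n" by (intro mult_right_mono) auto
  then show ?thesis unfolding eq by (simp add: abs_mult power_abs)
qed

lemma DERIV_mean_occ:
  assumes "0 < v"
  shows "((\<lambda>v. mean_occ v) has_real_derivative - (mean_occ v + mean_occ v ^ 2)) (at v)"
proof -
  have e: "exp (- v) < 1" using assms by simp
  have "((\<lambda>v. exp (- v) / (1 - exp (- v))) has_real_derivative
      (- exp (- v) * (1 - exp (- v)) - exp (- v) * exp (- v)) / ((1 - exp (- v)) * (1 - exp (- v)))) (at v)"
    using e by (auto intro!: derivative_eq_intros)
  moreover have "(- e * d - e * e) / (d * d) = - (e / d + (e / d) ^ 2)" if "d \<noteq> 0" for d e :: real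
    using that by (simp add: field_simps power2_eq_square)
  ultimately show ?thesis using e by simp
qed

lemma DERIV_limit_partition:
  assumes "0 < v"
  shows "(limit_partition x t has_real_derivative x * mean_occ v - t * exp (- v)) (at v)"
proof -
  have e: "0 < 1 - exp (- v)" using assms by simp
  show ?thesis unfolding limit_partition_def[abs_def]
    by (rule derivative_eq_intros | use e in simp)+
qed

text \<open>The second derivative at u is
  \<open>\<rho> * (1 + \<rho>) * (char_speed \<rho> * t - x)\<close>, which vanishes on the
  characteristic, where the third derivative is positive and of order t. Restricting to x \<le> K t
  and to shifts of at most u / 2 makes \<open>L\<close> uniform.\<close>

lemma limit_partition_taylor:
  fixes \<rho> K :: real
  assumes \<rho>: "0 < \<rho>" and K: "0 \<le> K"
  defines "u \<equiv> fugacity \<rho>"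
  obtains L where "1 \<le> L"
    "\<And>x t h. 0 < t \<Longrightarrow> real x \<le> K * t \<Longrightarrow> \<bar>h\<bar> \<le> u / 2 \<Longrightarrow>
      \<bar>limit_partition x t (u + h) - limit_partition x t u - h * drift \<rho> t x -
        \<rho> * (1 + \<rho>) * (char_speed \<rho> * t - x) * h\<^sup>2 / 2\<bar> \<le> L * t * \<bar>h\<bar> ^ 3"
    "\<And>x t h. 0 < t \<Longrightarrow> real x \<le> K * t \<Longrightarrow> \<bar>h\<bar> \<le> u / 2 \<Longrightarrow>
      \<bar>x * mean_occ (u + h) - t * exp (- (u + h)) - drift \<rho> t x -
        \<rho> * (1 + \<rho>) * (char_speed \<rho> * t - x) * h\<bar> \<le> L * t * \<bar>h\<bar> ^ 2"
    "\<And>x t h. 0 < t \<Longrightarrow> real x \<le> K * t \<Longrightarrow> \<bar>h\<bar> \<le> u / 2 \<Longrightarrow>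
      \<bar>limit_partition x t (u + h) - limit_partition x t u - h * drift \<rho> t x -
        \<rho> * (1 + \<rho>) * (char_speed \<rho> * t - x) * h\<^sup>2 / 2 -
        (x * (1 + 2 * \<rho>) - char_speed \<rho> * t) * (\<rho> * (1 + \<rho>)) * h ^ 3 / 6\<bar> \<le> L * t * \<bar>h\<bar> ^ 4"
proof -
  define R where "R v = mean_occ v" for v
  define E :: "real \<Rightarrow> real" where "E v = exp (- v)" for v
  have R': "(R has_real_derivative - (R v + R v ^ 2)) (at v)" if "0 < v" for v
    unfolding R_def[abs_def] using DERIV_mean_occ[OF that] .
  have E': "(E has_real_derivative - E v) (at v)" for v
    unfolding E_def[abs_def] by (auto intro!: derivative_eq_intros)
  \<comment> \<open>The mean occupation R decreases in v, so its value at the left end u / 2 bounds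
    it on the whole interval.\<close>
  define b where "b = R (u / 2)"
  define L where "L = K * (b + 7 * b ^ 2 + 12 * b ^ 3 + 6 * b ^ 4) + 1"
  have u: "0 < u" unfolding u_def by (rule fugacity(1)[OF \<rho>])
  have b: "0 < b" unfolding b_def R_def using u by simp
  have L: "1 \<le> L" "K * (b + 3 * b ^ 2 + 2 * b ^ 3) + 1 \<le> L"
  proof -
    have "0 \<le> b ^ i" for i using b by simp
    from this[of 2] this[of 3] this[of 4] b
    have "0 \<le> b + 7 * b ^ 2 + 12 * b ^ 3 + 6 * b ^ 4"
      "b + 3 * b ^ 2 + 2 * b ^ 3 \<le> b + 7 * b ^ 2 + 12 * b ^ 3 + 6 * b ^ 4" by linarith+
    then show "1 \<le> L" "K * (b + 3 * b ^ 2 + 2 * b ^ 3) + 1 \<le> L"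
      unfolding L_def using K by (auto intro: mult_left_mono)
  qed
  have Rb: "0 < R v" "R v \<le> b" if "\<bar>v - u\<bar> \<le> u / 2" for v
  proof -
    have v: "u / 2 \<le> v" using that by linarith
    then show "0 < R v" using u by (simp add: R_def)
    have "exp (- v) \<le> exp (- (u / 2))" using v by simp
    moreover have "exp (- (u / 2)) < 1" using u by simp
    ultimately show "R v \<le> b" unfolding R_def b_def by (intro frac_le) auto
  qed
  have Eb: "0 < E v" "E v \<le> 1" if "\<bar>v - u\<bar> \<le> u / 2" for v
  proof -
    have "0 \<le> v" using that u by linarith
    then show "0 < E v" "E v \<le> 1" by (auto simp: E_def)
  qed
  have Ru: "R u = \<rho>" unfolding R_def u_def by (rule fugacity(3)[OF \<rho>])
  have Eu: "E u = \<rho> / (1 + \<rho>)" unfolding E_def u_def by (rule fugacity(2)[OF \<rho>])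
  \<comment> \<open>Since R' = - (R + R^2), all derivatives are polynomials in the mean occupation R
    plus multiples of exp (- v).\<close>
  define D :: "nat \<Rightarrow> real \<Rightarrow> nat \<Rightarrow> real \<Rightarrow> real" where
    "D x t j v = (if j = 0 then limit_partition x t v
      else if j = 1 then x * R v - t * E v
      else if j = 2 then - x * (R v + R v ^ 2) + t * E v
      else if j = 3 then x * (R v + 3 * R v ^ 2 + 2 * R v ^ 3) - t * E v
      else - x * (R v + 7 * R v ^ 2 + 12 * R v ^ 3 + 6 * R v ^ 4) + t * E v)"
    for x t j v
  have D: "(D x t j has_real_derivative D x t (Suc j) v) (at v)" if "j < 4" "\<bar>v - u\<bar> \<le> u / 2" for x t j v
  proof -
    have v: "0 < v" using that(2) u by linarith
    note intr = derivative_eq_intros R'[OF v] E'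
    consider "j = 0" | "j = 1" | "j = 2" | "j = 3" using \<open>j < 4\<close> by linarith
    then show ?thesis
    proof cases
      case 1
      then show ?thesis using DERIV_limit_partition[OF v, of x t] by (simp add: D_def[abs_def] R_def E_def)
    next
      case 2
      show ?thesis unfolding D_def[abs_def] 2
        by (simp, (rule intr refl)+, simp add: algebra_simps power2_eq_square)
    next
      case 3
      show ?thesis unfolding D_def[abs_def] 3
        by (simp, (rule intr refl)+, simp add: algebra_simps power2_eq_square power3_eq_cube)
    next
      case 4
      show ?thesis unfolding D_def[abs_def] 4
        by (simp, (rule intr refl)+, simp add: algebra_simps power2_eq_square power3_eq_cube power4_eq_xxxx)
    qed
  qed
  have Dle: "\<bar>D x t 3 v\<bar> \<le> L * t" "\<bar>D x t 4 v\<bar> \<le> L * t"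
    if t: "0 < t" and x: "real x \<le> K * t" and v: "\<bar>v - u\<bar> \<le> u / 2" for x t v
  proof -
    note r = Rb[OF v] and e = Eb[OF v]
    have pw: "0 \<le> R v ^ i" "R v ^ i \<le> b ^ i" for i
      using r by (auto intro!: power_mono)
    have te: "0 \<le> t * E v" "t * E v \<le> t" using t e by auto
    have main: "\<bar>real x * p - t * E v\<bar> \<le> (K * q + 1) * t" if "0 \<le> p" "p \<le> q" for p q
    proof -
      have "real x * p \<le> (K * t) * q" by (rule mult_mono) (use x that K t in auto)
      moreover have "0 \<le> real x * p" using that by simp
      ultimately show ?thesis using te by (simp add: algebra_simps abs_le_iff)
    qed
    have "\<bar>real x * (R v + 3 * R v ^ 2 + 2 * R v ^ 3) - t * E v\<bar> \<le> (K * (b + 3 * b ^ 2 + 2 * b ^ 3) + 1) * t"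
      using r pw[of 2] pw[of 3] by (intro main; linarith)
    also have "\<dots> \<le> L * t" using L t by (intro mult_right_mono) auto
    finally show "\<bar>D x t 3 v\<bar> \<le> L * t" by (simp add: D_def)
    have "\<bar>real x * (R v + 7 * R v ^ 2 + 12 * R v ^ 3 + 6 * R v ^ 4) - t * E v\<bar> \<le> L * t"
      unfolding L_def using r pw[of 2] pw[of 3] pw[of 4] by (intro main; linarith)
    moreover have "D x t 4 v = - (real x * (R v + 7 * R v ^ 2 + 12 * R v ^ 3 + 6 * R v ^ 4) - t * E v)"
      by (simp add: D_def)
    ultimately show "\<bar>D x t 4 v\<bar> \<le> L * t" by (simp only: abs_minus_cancel)
  qed
  have D1: "D x t 1 u = drift \<rho> t x" for x t by (simp add: D_def Ru Eu drift_def)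
  have Vt: "char_speed \<rho> * t * (\<rho> * (1 + \<rho>)) = t * (\<rho> / (1 + \<rho>))" for t
    using \<rho> by (simp add: char_speed_def power2_eq_square)
  have D2: "D x t 2 u = \<rho> * (1 + \<rho>) * (char_speed \<rho> * t - x)" for x t
  proof -
    have "D x t 2 u = - real x * (\<rho> * (1 + \<rho>)) + t * (\<rho> / (1 + \<rho>))"
      by (simp add: D_def Ru Eu power2_eq_square algebra_simps)
    then show ?thesis unfolding Vt[symmetric] by (simp add: algebra_simps)
  qed
  have D3: "D x t 3 u = (x * (1 + 2 * \<rho>) - char_speed \<rho> * t) * (\<rho> * (1 + \<rho>))" for x t
  proof -
    have "D x t 3 u = real x * (\<rho> * (1 + \<rho>) * (1 + 2 * \<rho>)) - t * (\<rho> / (1 + \<rho>))"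
      by (simp add: D_def Ru Eu power2_eq_square power3_eq_cube algebra_simps)
    then show ?thesis unfolding Vt[symmetric] by (simp add: algebra_simps)
  qed
  show ?thesis
  proof (rule that[of L])
    show "1 \<le> L" by (rule L)
    fix x :: nat and t h :: real
    assume t: "0 < t" and x: "real x \<le> K * t" and h: "\<bar>h\<bar> \<le> u / 2"
    have sums: "(\<Sum>j<2. g j) = g 0 + g 1" "(\<Sum>j<3. g j) = g 0 + g 1 + g 2"
      "(\<Sum>j<4. g j) = g 0 + g 1 + g 2 + g 3" for g :: "nat \<Rightarrow> real"
      by (simp_all add: eval_nat_numeral)
    have D0: "D x t 0 v = limit_partition x t v" for v by (simp add: D_def)
    have fact: "fact 2 = (2 :: real)" "fact 3 = (6 :: real)" by (simp_all add: eval_nat_numeral)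
    define A where "A = limit_partition x t (u + h)"
    define B where "B = limit_partition x t u"
    define k where "k = drift \<rho> t x"
    define c2 where "c2 = \<rho> * (1 + \<rho>) * (char_speed \<rho> * t - x)"
    define c3 where "c3 = (x * (1 + 2 * \<rho>) - char_speed \<rho> * t) * (\<rho> * (1 + \<rho>))"
    have "\<bar>D x t 0 (u + h) - (\<Sum>j<3. D x t j u / fact j * h ^ j)\<bar> \<le> L * t * \<bar>h\<bar> ^ 3"
      by (rule taylor_remainder_le[OF _ D Dle(1)[OF t x] h]) auto
    moreover have "D x t 0 (u + h) - (\<Sum>j<3. D x t j u / fact j * h ^ j) = A - B - h * k - c2 * h\<^sup>2 / 2"
      unfolding sums D0 D1 D2 fact A_def[symmetric] B_def[symmetric] k_def[symmetric] c2_def[symmetric] by simp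
    ultimately show "\<bar>limit_partition x t (u + h) - limit_partition x t u - h * drift \<rho> t x -
        \<rho> * (1 + \<rho>) * (char_speed \<rho> * t - x) * h\<^sup>2 / 2\<bar> \<le> L * t * \<bar>h\<bar> ^ 3"
      unfolding A_def B_def k_def c2_def by (simp only:)
    have "\<bar>D x t 0 (u + h) - (\<Sum>j<4. D x t j u / fact j * h ^ j)\<bar> \<le> L * t * \<bar>h\<bar> ^ 4"
      by (rule taylor_remainder_le[OF _ D Dle(2)[OF t x] h]) auto
    moreover have "D x t 0 (u + h) - (\<Sum>j<4. D x t j u / fact j * h ^ j) =
        A - B - h * k - c2 * h\<^sup>2 / 2 - c3 * h ^ 3 / 6"
      unfolding sums D0 D1 D2 D3 fact A_def[symmetric] B_def[symmetric] k_def[symmetric]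
        c2_def[symmetric] c3_def[symmetric] by simp
    ultimately show "\<bar>limit_partition x t (u + h) - limit_partition x t u - h * drift \<rho> t x -
        \<rho> * (1 + \<rho>) * (char_speed \<rho> * t - x) * h\<^sup>2 / 2 -
        (x * (1 + 2 * \<rho>) - char_speed \<rho> * t) * (\<rho> * (1 + \<rho>)) * h ^ 3 / 6\<bar> \<le> L * t * \<bar>h\<bar> ^ 4"
      unfolding A_def B_def k_def c2_def c3_def by (simp only:)
    have "\<bar>D x t (Suc 0) (u + h) - (\<Sum>j<2. D x t (Suc j) u / fact j * h ^ j)\<bar> \<le> L * t * \<bar>h\<bar> ^ 2"
      by (rule taylor_remainder_le[where D = "\<lambda>j. D x t (Suc j)", OF _ D _ h])
        (use Dle(1)[OF t x] in \<open>auto simp: numeral_3_eq_3 numeral_2_eq_2\<close>)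
    moreover have "D x t (Suc 0) (u + h) = x * mean_occ (u + h) - t * exp (- (u + h))"
      by (simp add: D_def R_def E_def)
    moreover have "(\<Sum>j<2. D x t (Suc j) u / fact j * h ^ j) = k + c2 * h"
      unfolding sums using D1[of x t] D2[of x t] by (simp add: k_def c2_def numeral_2_eq_2)
    ultimately show "\<bar>x * mean_occ (u + h) - t * exp (- (u + h)) - drift \<rho> t x -
        \<rho> * (1 + \<rho>) * (char_speed \<rho> * t - x) * h\<bar> \<le> L * t * \<bar>h\<bar> ^ 2"
      unfolding k_def c2_def by (simp only: diff_diff_add)
  qed
qed

text \<open>
  With \<open>Z = sqrt (1 + r / \<tau>\<^sup>2)\<close> the choice is \<open>\<delta> \<sim> Z\<^sup>2 / \<tau>\<close> and \<open>s \<sim> 1 / (Z\<^sup>3 \<tau>)\<close>: the shift \<open>\<delta>\<close> of the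
  fugacity is the largest one for which the quadratic term still dominates the Taylor remainder.
\<close>

lemma scale_choice:
  fixes \<kappa> L M u :: real
  assumes \<kappa>: "0 < \<kappa>" and L: "1 \<le> L" and M: "0 \<le> M" and u: "0 < u"
  obtains C where "0 < C"
    "\<And>\<tau> r. 1 \<le> \<tau> \<Longrightarrow> 0 \<le> r \<Longrightarrow> r \<le> M * \<tau> ^ 3 \<Longrightarrow> \<exists>\<delta> s. 0 < \<delta> \<and> 0 < s \<and> \<delta> + s \<le> u / 2 \<and>
      (exp (\<kappa> * r * s\<^sup>2 / 2 + L * \<tau> ^ 3 * s ^ 3) + exp (s * (L * \<tau> ^ 3 * (\<delta> + s)\<^sup>2 - \<kappa> * r * \<delta>)) - 1) / (\<delta> * s)
        \<le> C * \<tau>\<^sup>2 / sqrt (1 + r / \<tau>\<^sup>2) ^ 3"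
proof -
  \<comment> \<open>The bound 8 L a \<le> \<kappa> makes the Taylor remainder at most half of the
    leading part of the quadratic gain, and a (2 + M) \<le> u / 2 keeps both shifts inside the
    interval of the expansion.\<close>
  define a where "a = min 1 (min (\<kappa> / (8 * L)) (u / (2 * (2 + M))))"
  have a: "0 < a" "a \<le> 1" "8 * L * a \<le> \<kappa>" "a * (2 + M) \<le> u / 2"
  proof -
    show "0 < a" "a \<le> 1" unfolding a_def using \<kappa> L M u by auto
    have "a \<le> \<kappa> / (8 * L)" "a \<le> u / (2 * (2 + M))" by (auto simp: a_def)
    then show "8 * L * a \<le> \<kappa>" "a * (2 + M) \<le> u / 2" using L M by (simp_all add: field_simps)
  qed
  define b where "b = \<kappa> * a\<^sup>2 / 2"
  have b: "0 < b" using a \<kappa> by (simp add: b_def)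
  define c1 where "c1 = \<kappa> + L"
  define c2 where "c2 = c1 * exp c1 + exp (\<kappa> * a\<^sup>2) * (24 / b ^ 4)"
  have c1: "0 < c1" using \<kappa> L by (simp add: c1_def)
  have c2: "0 < c2" unfolding c2_def using c1 b by (intro add_pos_pos mult_pos_pos) auto
  show ?thesis
  proof (rule that[of "c2 / a\<^sup>2"])
    show "0 < c2 / a\<^sup>2" using c2 a by simp
    fix \<tau> r :: real
    assume \<tau>: "1 \<le> \<tau>" and r: "0 \<le> r" "r \<le> M * \<tau> ^ 3"
    define Z where "Z = sqrt (1 + r / \<tau>\<^sup>2)"
    have Z: "1 \<le> Z" unfolding Z_def using r by simp
    have Z2: "Z\<^sup>2 = 1 + r / \<tau>\<^sup>2" unfolding Z_def using r by (intro real_sqrt_pow2) (simp add: add_nonneg_nonneg)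
    have req: "r = (Z\<^sup>2 - 1) * \<tau>\<^sup>2" unfolding Z2 using \<tau> by simp
    define \<delta> where "\<delta> = a * Z\<^sup>2 / \<tau>"
    define s where "s = a / (Z ^ 3 * \<tau>)"
    have pos: "0 < \<delta>" "0 < s" unfolding \<delta>_def s_def using a Z \<tau> by auto
    have Z3: "1 \<le> Z ^ k" for k using Z by (rule one_le_power)
    have "s \<le> a / \<tau>"
      unfolding s_def using a \<tau> Z Z3[of 3] by (intro divide_left_mono) auto
    moreover have "a / \<tau> \<le> \<delta>"
      unfolding \<delta>_def using a \<tau> Z3[of 2] by (intro divide_right_mono) auto
    moreover have "a / \<tau> \<le> a" using a \<tau> by (simp add: divide_le_eq)
    moreover have "\<delta> \<le> a * (1 + M)"
    proof -
      have "r / \<tau>\<^sup>2 \<le> M * \<tau> ^ 3 / \<tau>\<^sup>2" using r by (intro divide_right_mono) auto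
      also have "\<dots> = M * \<tau>" using \<tau> by (simp add: power2_eq_square power3_eq_cube)
      finally have "Z\<^sup>2 \<le> (1 + M) * \<tau>" unfolding Z2 using \<tau> M by (simp add: algebra_simps)
      then have "Z\<^sup>2 / \<tau> \<le> 1 + M" using \<tau> by (simp add: divide_le_eq)
      then have "a * (Z\<^sup>2 / \<tau>) \<le> a * (1 + M)" using a by (intro mult_left_mono) auto
      then show ?thesis unfolding \<delta>_def by simp
    qed
    ultimately have s\<delta>: "s \<le> \<delta>" "\<delta> + s \<le> u / 2"
      using a by (auto simp: algebra_simps)
    define A where "A = \<kappa> * r * s\<^sup>2 / 2 + L * \<tau> ^ 3 * s ^ 3"
    define B where "B = s * (L * \<tau> ^ 3 * (\<delta> + s)\<^sup>2 - \<kappa> * r * \<delta>)"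
    have A0: "0 \<le> A" unfolding A_def using \<kappa> r pos L \<tau> by (intro add_nonneg_nonneg) auto
    have A1: "A \<le> c1 / Z ^ 4"
    proof -
      have "\<kappa> * r * s\<^sup>2 / 2 = \<kappa> * ((Z\<^sup>2 - 1) * (a\<^sup>2 / 2) / Z ^ 6)"
        unfolding req s_def using \<tau> Z by (simp add: field_simps power_numeral_reduce)
      also have "\<dots> \<le> \<kappa> * (Z\<^sup>2 * 1 / Z ^ 6)"
        using \<kappa> a Z Z3[of 2] power_le_one[of a 2]
        by (intro mult_left_mono divide_right_mono mult_mono) auto
      also have "\<dots> = \<kappa> / Z ^ 4" using Z by (simp add: field_simps power_numeral_reduce)
      finally have 1: "\<kappa> * r * s\<^sup>2 / 2 \<le> \<kappa> / Z ^ 4" .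
      have "L * \<tau> ^ 3 * s ^ 3 = L * (a ^ 3 / Z ^ 9)"
        unfolding s_def using \<tau> Z by (simp add: field_simps power_numeral_reduce)
      also have "\<dots> \<le> L * (1 / Z ^ 4)"
        using a L Z power_le_one[of a 3] power_increasing[of 4 9 Z] by (intro mult_left_mono frac_le) auto
      also have "\<dots> = L / Z ^ 4" by simp
      finally show ?thesis using 1 unfolding A_def c1_def add_divide_distrib by linarith
    qed
    have "c1 / Z ^ 4 \<le> c1 / 1"
      using c1 Z3[of 4] by (intro divide_left_mono) auto
    then have "A \<le> c1" using A1 by simp
    have eA: "exp A - 1 \<le> c1 * exp c1 / Z ^ 4"
    proof -
      have "1 - A \<le> exp (- A)" using exp_ge_add_one_self[of "- A"] by simp
      then have "exp A * (1 - A) \<le> exp A * exp (- A)" by (intro mult_left_mono) auto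
      then have "exp A - 1 \<le> A * exp A" by (simp add: mult_exp_exp algebra_simps)
      also have "\<dots> \<le> (c1 / Z ^ 4) * exp c1"
        using A0 A1 \<open>A \<le> c1\<close> by (intro mult_mono) auto
      finally show ?thesis by simp
    qed
    have B1: "B \<le> \<kappa> * a\<^sup>2 - b * Z"
    proof -
      have "(\<delta> + s)\<^sup>2 \<le> (2 * \<delta>)\<^sup>2" using s\<delta> pos by (intro power_mono) auto
      then have "L * \<tau> ^ 3 * (\<delta> + s)\<^sup>2 \<le> L * \<tau> ^ 3 * (2 * \<delta>)\<^sup>2" using L \<tau> by (intro mult_left_mono) auto
      also have "\<dots> = (8 * L * a) * (a * Z ^ 4 * \<tau> / 2)"
        unfolding \<delta>_def using \<tau> by (simp add: field_simps power_numeral_reduce)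
      also have "\<dots> \<le> \<kappa> * (a * Z ^ 4 * \<tau> / 2)" using a Z \<tau> by (intro mult_right_mono) auto
      finally have "L * \<tau> ^ 3 * (\<delta> + s)\<^sup>2 - \<kappa> * r * \<delta> \<le> \<kappa> * (a * Z ^ 4 * \<tau> / 2) - \<kappa> * r * \<delta>" by simp
      moreover have "\<kappa> * r * \<delta> = \<kappa> * a * (Z ^ 4 - Z\<^sup>2) * \<tau>"
        unfolding req \<delta>_def using \<tau> by (simp add: field_simps power_numeral_reduce)
      moreover have "\<kappa> * (a * Z ^ 4 * \<tau> / 2) - \<kappa> * a * (Z ^ 4 - Z\<^sup>2) * \<tau> = \<kappa> * a * \<tau> * (Z\<^sup>2 - Z ^ 4 / 2)"
        by (simp add: algebra_simps)
      ultimately have "L * \<tau> ^ 3 * (\<delta> + s)\<^sup>2 - \<kappa> * r * \<delta> \<le> \<kappa> * a * \<tau> * (Z\<^sup>2 - Z ^ 4 / 2)"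
        by (simp only:)
      then have "B \<le> s * (\<kappa> * a * \<tau> * (Z\<^sup>2 - Z ^ 4 / 2))"
        unfolding B_def using pos by (intro mult_left_mono) auto
      also have "\<dots> = \<kappa> * a\<^sup>2 * (1 / Z) - b * Z"
        unfolding s_def b_def using \<tau> Z by (simp add: field_simps power_numeral_reduce)
      also have "\<dots> \<le> \<kappa> * a\<^sup>2 * 1 - b * Z"
        using \<kappa> Z by (intro diff_right_mono mult_left_mono) auto
      finally show ?thesis by simp
    qed
    \<comment> \<open>Exponential decay in Z is weakened to Z^-4, the order of the other term; 24 is
      the factorial of 4. Division by \<delta> s = a^2 / (Z \<tau>^2) then leaves \<tau>^2 /
      Z^3.\<close>
    have eB: "exp B \<le> exp (\<kappa> * a\<^sup>2) * (24 / b ^ 4) / Z ^ 4"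
    proof -
      have "Z ^ 4 \<le> 24 / b ^ 4 * exp (b * Z)"
        using power_le_exp[of Z b 4] Z b by (simp add: eval_nat_numeral)
      then have "exp (- (b * Z)) \<le> 24 / b ^ 4 / Z ^ 4"
        using Z b by (simp add: exp_minus field_simps)
      then have "exp (\<kappa> * a\<^sup>2) * exp (- (b * Z)) \<le> exp (\<kappa> * a\<^sup>2) * (24 / b ^ 4 / Z ^ 4)"
        by (intro mult_left_mono) auto
      moreover have "exp B \<le> exp (\<kappa> * a\<^sup>2 - b * Z)" using B1 by simp
      moreover have "exp (\<kappa> * a\<^sup>2 - b * Z) = exp (\<kappa> * a\<^sup>2) * exp (- (b * Z))"
        by (simp add: mult_exp_exp)
      ultimately have "exp B \<le> exp (\<kappa> * a\<^sup>2) * (24 / b ^ 4 / Z ^ 4)" by linarith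
      then show ?thesis by simp
    qed
    have "(exp A + exp B - 1) / (\<delta> * s) \<le> (c2 / Z ^ 4) / (\<delta> * s)"
      using eA eB pos by (intro divide_right_mono) (auto simp: c2_def add_divide_distrib)
    also have "\<dots> = c2 / a\<^sup>2 * \<tau>\<^sup>2 / Z ^ 3"
      unfolding \<delta>_def s_def using Z \<tau> a by (simp add: field_simps power_numeral_reduce)
    finally have le: "(exp A + exp B - 1) / (\<delta> * s) \<le> c2 / a\<^sup>2 * \<tau>\<^sup>2 / Z ^ 3" .
    show "\<exists>\<delta> s. 0 < \<delta> \<and> 0 < s \<and> \<delta> + s \<le> u / 2 \<and>
      (exp (\<kappa> * r * s\<^sup>2 / 2 + L * \<tau> ^ 3 * s ^ 3) + exp (s * (L * \<tau> ^ 3 * (\<delta> + s)\<^sup>2 - \<kappa> * r * \<delta>)) - 1) / (\<delta> * s)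
        \<le> c2 / a\<^sup>2 * \<tau>\<^sup>2 / sqrt (1 + r / \<tau>\<^sup>2) ^ 3"
      using pos s\<delta>(2) le unfolding A_def B_def Z_def by (intro exI[of _ \<delta>] exI[of _ s] conjI)
  qed
qed

text \<open>Provides the summability of the diffusivity. The rate is the strict concavity of ln (1 -
  exp (- v)) at u, u + 1, u + 2, that is \<open>2 * h < g\<close>. The weights \<open>l\<close> and
  \<open>l'\<close> make the two terms that each of them balances decay in x at the same
  rate.\<close>

lemma excess_limit_exp_decay:
  assumes \<rho>: "0 < \<rho>"
  obtains c C where "0 < c" "0 < C"
    "\<And>t x. 0 < t \<Longrightarrow> excess_limit \<rho> t x \<le> C * exp (C * t - c * real x)"
proof -
  define u where "u = fugacity \<rho>"
  have u: "0 < u" unfolding u_def by (rule fugacity(1)[OF \<rho>])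
  define \<psi> :: "real \<Rightarrow> real" where "\<psi> v = ln (1 - exp (- v))" for v
  define g where "g = \<psi> (u + 2) - \<psi> u"
  define h where "h = \<psi> (u + 2) - \<psi> (u + 1)"
  have gh: "2 * h < g"
  proof -
    define p y where "p = exp (- u)" and "y = exp (- 1 :: real)"
    have p: "0 < p" "p < 1" and y: "0 < y" "y < 1" using u by (auto simp: p_def y_def)
    have e1: "exp (- (u + 1)) = p * y" and e2: "exp (- (u + 2)) = p * y * y"
      by (simp_all add: p_def y_def mult_exp_exp)
    have py: "p * y < 1" "p * y * y < 1" using p y
      by (smt (verit) mult_less_cancel_left2 mult_pos_pos)+
    have "ln ((1 - p * y * y) * (1 - p)) < ln ((1 - p * y) * (1 - p * y))"
    proof (subst ln_less_cancel_iff)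
      show "0 < (1 - p * y * y) * (1 - p)" "0 < (1 - p * y) * (1 - p * y)" using p py by auto
      have "0 < p * ((1 - y) * (1 - y))" using p y by (intro mult_pos_pos) auto
      then show "(1 - p * y * y) * (1 - p) < (1 - p * y) * (1 - p * y)" by (simp add: algebra_simps)
    qed
    then have "ln (1 - p * y * y) + ln (1 - p) < ln (1 - p * y) + ln (1 - p * y)"
      using p py by (simp add: ln_mult)
    then show ?thesis unfolding g_def h_def \<psi>_def e1 e2 p_def[symmetric] by simp
  qed
  define c where "c = g / 4 - h / 2"
  define c3 where "c3 = exp (- u) * (exp 2 - 1)"
  have c3: "0 < c3" unfolding c3_def by simp
  define C where "C = max c3 (2 / (1 - exp (- 1)))"
  have "(1 - exp (- u)) / (1 - exp (- u - 2)) = exp (- g)"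
  proof -
    have "0 < 1 - exp (- u)" "0 < 1 - exp (- u - 2)" using u by auto
    then show ?thesis unfolding g_def \<psi>_def by (simp add: exp_diff)
  qed
  note q = this
  show ?thesis
  proof (rule that[of c C])
    show "0 < c" using gh by (simp add: c_def)
    show "0 < C" using c3 by (simp add: C_def)
    fix t :: real and x :: nat
    assume t: "0 < t"
    define l' where "l' = exp (- g / 2 * real x)"
    define l where "l = exp ((h / 2 + g / 4) * real x)"
    define A where "A = exp (t * c3)"
    have A: "1 \<le> A" using t c3 by (simp add: A_def)
    define F where "F = limit_partition x t"
    have "excess_limit \<rho> t x \<le> (l * ((l' * A + exp (- g) ^ x / l') / 2) + exp (F (u + 1 + 1) - F (u + 1)) / l) /
      (1 * (1 - exp (- 1)))"
      using excess_limit_far[OF \<rho> t, of "1 / 2" 1 l l' x, folded u_def]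
      by (simp add: l_def l'_def A_def c3_def F_def q mult.assoc)
    also have "\<dots> \<le> (2 * A * exp (- (c * real x))) / (1 * (1 - exp (- 1)))"
    proof (intro divide_right_mono)
      have F: "F (u + 1 + 1) - F (u + 1) \<le> h * real x"
      proof -
        have "t * exp (- (u + 2)) \<le> t * exp (- (u + 1))" using t by simp
        then show ?thesis by (simp add: F_def limit_partition_def h_def \<psi>_def algebra_simps)
      qed
      have "exp (- g) ^ x = l' * l'"
        by (simp add: l'_def mult_exp_exp exp_of_nat_mult[symmetric] algebra_simps)
      then have "l' * A + exp (- g) ^ x / l' = l' * (A + 1)"
        by (simp add: l'_def distrib_left)
      moreover have "l * l' = exp (- (c * real x))"
        by (simp add: l_def l'_def c_def mult_exp_exp algebra_simps)
      moreover have "exp (F (u + 1 + 1) - F (u + 1)) / l \<le> exp (- (c * real x))"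
      proof -
        have "exp (F (u + 1 + 1) - F (u + 1)) / l \<le> exp (h * real x) / l"
          using F by (intro divide_right_mono) (auto simp: l_def)
        also have "\<dots> = exp (- (c * real x))"
          unfolding l_def exp_diff[symmetric] by (simp add: c_def algebra_simps)
        finally show ?thesis .
      qed
      moreover have "exp (- (c * real x)) * ((A + 1) / 2 + 1) \<le> exp (- (c * real x)) * (2 * A)"
        proof (rule mult_left_mono)
        show "(A + 1) / 2 + 1 \<le> 2 * A" using A unfolding add_divide_distrib by linarith
      qed simp
      ultimately show "l * ((l' * A + exp (- g) ^ x / l') / 2) + exp (F (u + 1 + 1) - F (u + 1)) / l
          \<le> 2 * A * exp (- (c * real x))"
        by (simp add: algebra_simps)
    qed simp
    also have "\<dots> = 2 / (1 - exp (- 1)) * exp (c3 * t - c * real x)"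
      by (simp add: A_def exp_diff exp_minus field_simps)
    also have "\<dots> \<le> C * exp (C * t - c * real x)"
    proof (rule mult_mono)
      show "2 / (1 - exp (- 1)) \<le> C" "0 \<le> C" using c3 by (auto simp: C_def)
      have "c3 * t \<le> C * t" using t by (intro mult_right_mono) (auto simp: C_def)
      then show "exp (c3 * t - c * real x) \<le> exp (C * t - c * real x)" by simp
    qed simp
    finally show "excess_limit \<rho> t x \<le> C * exp (C * t - c * real x)" .
  qed
qed

text \<open>The unshifted increment of F is controlled by its own expansion, the shifted one by the
  mean value theorem and the expansion of the derivative. Both sides of the characteristic lead to
  the same expression in the distance r, so one choice of \<delta> and s serves both.\<close>

lemma near_characteristic_upper:
  fixes \<rho> K :: real
  assumes \<rho>: "0 < \<rho>" and K: "0 \<le> K"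
  obtains C where "0 < C"
    "\<And>\<tau> x. 1 \<le> \<tau> \<Longrightarrow> real x \<le> K * \<tau> ^ 3 \<Longrightarrow> real x \<le> char_speed \<rho> * \<tau> ^ 3 \<Longrightarrow>
      cov_limit \<rho> (\<tau> ^ 3) x \<le> C * \<tau>\<^sup>2 / sqrt (1 + (char_speed \<rho> * \<tau> ^ 3 - x) / \<tau>\<^sup>2) ^ 3"
    "\<And>\<tau> x. 1 \<le> \<tau> \<Longrightarrow> real x \<le> K * \<tau> ^ 3 \<Longrightarrow> char_speed \<rho> * \<tau> ^ 3 \<le> real x \<Longrightarrow>
      excess_limit \<rho> (\<tau> ^ 3) x \<le> C * \<tau>\<^sup>2 / sqrt (1 + (x - char_speed \<rho> * \<tau> ^ 3) / \<tau>\<^sup>2) ^ 3"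
proof -
  define u where "u = fugacity \<rho>"
  define V where "V = char_speed \<rho>"
  define \<kappa> where "\<kappa> = \<rho> * (1 + \<rho>)"
  have u: "0 < u" unfolding u_def by (rule fugacity(1)[OF \<rho>])
  have V: "0 \<le> V" by (simp add: V_def char_speed_def)
  have \<kappa>: "0 < \<kappa>" using \<rho> by (simp add: \<kappa>_def)
  obtain L where L: "1 \<le> L"
    and T1: "\<And>x t h. 0 < t \<Longrightarrow> real x \<le> K * t \<Longrightarrow> \<bar>h\<bar> \<le> u / 2 \<Longrightarrow>
      \<bar>limit_partition x t (u + h) - limit_partition x t u - h * drift \<rho> t x - \<kappa> * (V * t - x) * h\<^sup>2 / 2\<bar>
        \<le> L * t * \<bar>h\<bar> ^ 3"
    and T2: "\<And>x t h. 0 < t \<Longrightarrow> real x \<le> K * t \<Longrightarrow> \<bar>h\<bar> \<le> u / 2 \<Longrightarrow>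
      \<bar>x * mean_occ (u + h) - t * exp (- (u + h)) - drift \<rho> t x - \<kappa> * (V * t - x) * h\<bar> \<le> L * t * \<bar>h\<bar> ^ 2"
    unfolding u_def V_def \<kappa>_def by (rule limit_partition_taylor[OF \<rho> K]) blast
  obtain C where C: "0 < C" and choice: "\<And>\<tau> r. 1 \<le> \<tau> \<Longrightarrow> 0 \<le> r \<Longrightarrow> r \<le> (K + V) * \<tau> ^ 3 \<Longrightarrow>
    \<exists>\<delta> s. 0 < \<delta> \<and> 0 < s \<and> \<delta> + s \<le> u / 2 \<and>
      (exp (\<kappa> * r * s\<^sup>2 / 2 + L * \<tau> ^ 3 * s ^ 3) + exp (s * (L * \<tau> ^ 3 * (\<delta> + s)\<^sup>2 - \<kappa> * r * \<delta>)) - 1) / (\<delta> * s)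
        \<le> C * \<tau>\<^sup>2 / sqrt (1 + r / \<tau>\<^sup>2) ^ 3"
    using scale_choice[OF \<kappa> L, of "K + V" u] K V u by (metis add_nonneg_nonneg)
  show ?thesis
  \<comment> \<open>The factor 1 + u pays for 1 - exp (- \<delta>) \<ge> \<delta> / (1 + u), which
    enters to the right of the characteristic.\<close>
  proof (rule that[of "(1 + u) * C"])
    show "0 < (1 + u) * C" using u C by simp
    fix \<tau> :: real and x :: nat
    assume \<tau>: "1 \<le> \<tau>" and x: "real x \<le> K * \<tau> ^ 3"
    define t where "t = \<tau> ^ 3"
    have t: "0 < t" using \<tau> by (simp add: t_def)
    have xt: "real x \<le> K * t" using x by (simp add: t_def)
    define F where "F = limit_partition x t"
    define F' where "F' v = x * mean_occ v - t * exp (- v)" for v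
    define k where "k = drift \<rho> t x"
    have mvt: "\<exists>z. v < z \<and> z < v + s \<and> F (v + s) - F v = s * F' z" if "0 < v" "0 < s" for v s
    proof -
      have "\<exists>z>v. z < v + s \<and> F (v + s) - F v = (v + s - v) * F' z"
        unfolding F_def F'_def using that by (intro MVT2 DERIV_limit_partition) auto
      then show ?thesis by auto
    qed
    note T1 = T1[OF t xt, folded F_def k_def] and T2 = T2[OF t xt, folded F'_def k_def]
    {
      assume below: "real x \<le> char_speed \<rho> * \<tau> ^ 3"
      define r where "r = V * t - x"
      have r: "0 \<le> r" using below by (simp add: r_def V_def t_def)
      have "r \<le> V * t" by (simp add: r_def)
      also have "V * t \<le> (K + V) * \<tau> ^ 3" unfolding t_def[symmetric] using K t by (intro mult_right_mono) auto
      finally obtain \<delta> s where s: "0 < \<delta>" "0 < s" "\<delta> + s \<le> u / 2" and bd: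
        "(exp (\<kappa> * r * s\<^sup>2 / 2 + L * t * s ^ 3) + exp (s * (L * t * (\<delta> + s)\<^sup>2 - \<kappa> * r * \<delta>)) - 1) / (\<delta> * s)
          \<le> C * \<tau>\<^sup>2 / sqrt (1 + r / \<tau>\<^sup>2) ^ 3"
        using choice[OF \<tau> r] unfolding t_def by auto
      have "F (u + s) - F u - s * k \<le> \<kappa> * r * s\<^sup>2 / 2 + L * t * s ^ 3"
        using T1[of s] s unfolding r_def[symmetric] by (simp add: abs_le_iff)
      moreover have "F (u - \<delta>) - F (u - \<delta> - s) - s * k \<le> s * (L * t * (\<delta> + s)\<^sup>2 - \<kappa> * r * \<delta>)"
      proof -
        obtain z where z: "u - \<delta> - s < z" "z < u - \<delta>" and eq: "F (u - \<delta>) - F (u - \<delta> - s) = s * F' z"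
          using mvt[of "u - \<delta> - s" s] s u by auto
        have "\<bar>F' (u + (z - u)) - k - \<kappa> * r * (z - u)\<bar> \<le> L * t * \<bar>z - u\<bar> ^ 2"
          using T2[of "z - u"] z s unfolding r_def[symmetric] by auto
        then have "F' z \<le> k + \<kappa> * r * (z - u) + L * t * (z - u)\<^sup>2" by (simp add: abs_le_iff)
        moreover have "\<kappa> * r * (z - u) \<le> \<kappa> * r * (- \<delta>)"
          using z \<kappa> r by (intro mult_left_mono) auto
        moreover have "L * t * (z - u)\<^sup>2 \<le> L * t * (\<delta> + s)\<^sup>2"
          using z s L t by (intro mult_left_mono abs_le_square_iff[THEN iffD1]) auto
        ultimately have "F' z - k \<le> L * t * (\<delta> + s)\<^sup>2 - \<kappa> * r * \<delta>" by simp
        then have "s * (F' z - k) \<le> s * (L * t * (\<delta> + s)\<^sup>2 - \<kappa> * r * \<delta>)"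
          using s by (intro mult_left_mono) auto
        then show ?thesis unfolding eq by (simp add: algebra_simps)
      qed
      ultimately have "(exp (F (u + s) - F u - s * k) + exp (F (u - \<delta>) - F (u - \<delta> - s) - s * k) - 1) / (\<delta> * s) \<le>
        (exp (\<kappa> * r * s\<^sup>2 / 2 + L * t * s ^ 3) + exp (s * (L * t * (\<delta> + s)\<^sup>2 - \<kappa> * r * \<delta>)) - 1) / (\<delta> * s)"
        using s by (intro divide_right_mono diff_right_mono add_mono) auto
      then have "cov_limit \<rho> t x \<le>
        (exp (\<kappa> * r * s\<^sup>2 / 2 + L * t * s ^ 3) + exp (s * (L * t * (\<delta> + s)\<^sup>2 - \<kappa> * r * \<delta>)) - 1) / (\<delta> * s)"
        using cov_limit_upper[OF \<rho> t s(2,1), of x, folded u_def F_def k_def] s u by simp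
      also note bd
      also have "C * \<tau>\<^sup>2 / sqrt (1 + r / \<tau>\<^sup>2) ^ 3 \<le> ((1 + u) * C) * \<tau>\<^sup>2 / sqrt (1 + r / \<tau>\<^sup>2) ^ 3"
        using C u r by (intro divide_right_mono mult_right_mono) auto
      finally show "cov_limit \<rho> (\<tau> ^ 3) x \<le> (1 + u) * C * \<tau>\<^sup>2 / sqrt (1 + (char_speed \<rho> * \<tau> ^ 3 - x) / \<tau>\<^sup>2) ^ 3"
        unfolding t_def r_def V_def .
    }
    {
      assume above: "char_speed \<rho> * \<tau> ^ 3 \<le> real x"
      define r where "r = x - V * t"
      have r: "0 \<le> r" using above by (simp add: r_def V_def t_def)
      have rm: "V * t - x = - r" by (simp add: r_def)
      have "r \<le> K * t" using xt mult_nonneg_nonneg[OF V, of t] t by (simp add: r_def)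
      also have "K * t \<le> (K + V) * \<tau> ^ 3" unfolding t_def[symmetric] using V t by (intro mult_right_mono) auto
      finally obtain \<delta> s where s: "0 < \<delta>" "0 < s" "\<delta> + s \<le> u / 2" and bd:
        "(exp (\<kappa> * r * s\<^sup>2 / 2 + L * t * s ^ 3) + exp (s * (L * t * (\<delta> + s)\<^sup>2 - \<kappa> * r * \<delta>)) - 1) / (\<delta> * s)
          \<le> C * \<tau>\<^sup>2 / sqrt (1 + r / \<tau>\<^sup>2) ^ 3"
        using choice[OF \<tau> r] unfolding t_def by auto
      define N where "N = exp (\<kappa> * r * s\<^sup>2 / 2 + L * t * s ^ 3) + exp (s * (L * t * (\<delta> + s)\<^sup>2 - \<kappa> * r * \<delta>)) - 1"
      have N0: "0 \<le> N"
      proof -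
        have "0 \<le> \<kappa> * r * s\<^sup>2 / 2 + L * t * s ^ 3" using \<kappa> r s L t by (intro add_nonneg_nonneg) auto
        then have "1 \<le> exp (\<kappa> * r * s\<^sup>2 / 2 + L * t * s ^ 3)" by simp
        then show ?thesis unfolding N_def by (smt (verit) exp_ge_zero)
      qed
      have \<delta>: "\<delta> / (1 + u) \<le> 1 - exp (- \<delta>)"
      proof -
        have "1 + \<delta> \<le> exp \<delta>" by (rule exp_ge_add_one_self)
        then have "exp (- \<delta>) \<le> 1 / (1 + \<delta>)" using s by (simp add: exp_minus field_simps)
        then have "\<delta> / (1 + \<delta>) \<le> 1 - exp (- \<delta>)" using s by (simp add: field_simps)
        moreover have "\<delta> / (1 + u) \<le> \<delta> / (1 + \<delta>)" using s u by (intro divide_left_mono) auto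
        ultimately show ?thesis by simp
      qed
      have "F u - F (u - s) - s * k \<le> \<kappa> * r * s\<^sup>2 / 2 + L * t * s ^ 3"
        using T1[of "- s"] s unfolding rm by (simp add: abs_le_iff)
      moreover have "F (u + \<delta> + s) - F (u + \<delta>) - s * k \<le> s * (L * t * (\<delta> + s)\<^sup>2 - \<kappa> * r * \<delta>)"
      proof -
        obtain z where z: "u + \<delta> < z" "z < u + \<delta> + s" and eq: "F (u + \<delta> + s) - F (u + \<delta>) = s * F' z"
          using mvt[of "u + \<delta>" s] s u by auto
        have "\<bar>F' (u + (z - u)) - k - \<kappa> * (- r) * (z - u)\<bar> \<le> L * t * \<bar>z - u\<bar> ^ 2"
          using T2[of "z - u"] z s unfolding rm by auto
        then have "F' z \<le> k - \<kappa> * r * (z - u) + L * t * (z - u)\<^sup>2" by (simp add: abs_le_iff)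
        moreover have "\<kappa> * r * \<delta> \<le> \<kappa> * r * (z - u)"
          using z \<kappa> r by (intro mult_left_mono) auto
        moreover have "L * t * (z - u)\<^sup>2 \<le> L * t * (\<delta> + s)\<^sup>2"
          using z s L t by (intro mult_left_mono abs_le_square_iff[THEN iffD1]) auto
        ultimately have "F' z - k \<le> L * t * (\<delta> + s)\<^sup>2 - \<kappa> * r * \<delta>" by simp
        then have "s * (F' z - k) \<le> s * (L * t * (\<delta> + s)\<^sup>2 - \<kappa> * r * \<delta>)"
          using s by (intro mult_left_mono) auto
        then show ?thesis unfolding eq by (simp add: algebra_simps)
      qed
      ultimately have le: "exp (F (u + \<delta> + s) - F (u + \<delta>) - s * k) + exp (F u - F (u - s) - s * k) - 1 \<le> N"
        unfolding N_def by (smt (verit) exp_le_cancel_iff)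
      have "excess_limit \<rho> t x \<le>
        (exp (F (u + \<delta> + s) - F (u + \<delta>) - s * k) + exp (F u - F (u - s) - s * k) - 1) / ((1 - exp (- \<delta>)) * s)"
        using excess_limit_upper[OF \<rho> t s(2,1), of x, folded u_def F_def k_def] s u by simp
      also have "\<dots> \<le> N / ((1 - exp (- \<delta>)) * s)"
        using le s by (intro divide_right_mono) auto
      also have "\<dots> \<le> N / (\<delta> / (1 + u) * s)"
        using N0 s u \<delta> by (intro divide_left_mono mult_right_mono mult_pos_pos) auto
      also have "\<dots> = (1 + u) * (N / (\<delta> * s))" by simp
      also have "\<dots> \<le> (1 + u) * (C * \<tau>\<^sup>2 / sqrt (1 + r / \<tau>\<^sup>2) ^ 3)"
        using bd u unfolding N_def by (intro mult_left_mono) auto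
      finally show "excess_limit \<rho> (\<tau> ^ 3) x \<le> (1 + u) * C * \<tau>\<^sup>2 / sqrt (1 + (x - char_speed \<rho> * \<tau> ^ 3) / \<tau>\<^sup>2) ^ 3"
        unfolding t_def r_def V_def by simp
    }
  qed
qed

lemma excess_limit_eq:
  assumes "0 < \<rho>"
  shows "excess_limit \<rho> t x = cov_limit \<rho> t x + \<rho> * (1 + \<rho>) * (char_speed \<rho> * t - real x)"
proof -
  have "\<rho> * (1 + \<rho>) * (char_speed \<rho> * t) = t * (\<rho> / (1 + \<rho>))"
    using assms by (simp add: char_speed_def power2_eq_square)
  then show ?thesis by (simp add: excess_limit_def right_diff_distrib)
qed

text \<open>For s = K / \<tau> the main cubic term of the expansion does not depend on \<tau>, so a
  fixed large K supplies the exponential moment above 4. What results is a bound for covariance plus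
  excess, and near the characteristic these two are almost equal.\<close>

lemma near_characteristic_lower:
  fixes \<rho> :: real
  assumes \<rho>: "0 < \<rho>"
  obtains c \<eta> T where "0 < c" "0 < \<eta>" "1 \<le> T"
    "\<And>\<tau> x. T \<le> \<tau> \<Longrightarrow> real x \<le> char_speed \<rho> * \<tau> ^ 3 \<Longrightarrow> char_speed \<rho> * \<tau> ^ 3 - real x \<le> \<eta> * \<tau>\<^sup>2 \<Longrightarrow>
      c * \<tau>\<^sup>2 \<le> cov_limit \<rho> (\<tau> ^ 3) x"
proof -
  define u where "u = fugacity \<rho>"
  define V where "V = char_speed \<rho>"
  define \<kappa> where "\<kappa> = \<rho> * (1 + \<rho>)"
  have u: "0 < u" unfolding u_def by (rule fugacity(1)[OF \<rho>])
  have V: "0 < V" using \<rho> by (simp add: V_def char_speed_def)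
  have \<kappa>: "0 < \<kappa>" using \<rho> by (simp add: \<kappa>_def)
  obtain L where L: "1 \<le> L"
    and T1: "\<And>x t h. 0 < t \<Longrightarrow> real x \<le> V * t \<Longrightarrow> \<bar>h\<bar> \<le> u / 2 \<Longrightarrow>
      \<bar>limit_partition x t (u + h) - limit_partition x t u - h * drift \<rho> t x - \<kappa> * (V * t - x) * h\<^sup>2 / 2\<bar>
        \<le> L * t * \<bar>h\<bar> ^ 3"
    and T2: "\<And>x t h. 0 < t \<Longrightarrow> real x \<le> V * t \<Longrightarrow> \<bar>h\<bar> \<le> u / 2 \<Longrightarrow>
      \<bar>limit_partition x t (u + h) - limit_partition x t u - h * drift \<rho> t x - \<kappa> * (V * t - x) * h\<^sup>2 / 2 -
        (x * (1 + 2 * \<rho>) - V * t) * \<kappa> * h ^ 3 / 6\<bar> \<le> L * t * \<bar>h\<bar> ^ 4"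
    unfolding u_def V_def \<kappa>_def by (rule limit_partition_taylor[OF \<rho>, of "char_speed \<rho>"]) (use V in \<open>auto simp: V_def\<close>)
  \<comment> \<open>As K \<le> K^3, the value 9 / (\<kappa> \<rho> V) makes the cubic term \<kappa>
    \<rho> V K^3 / 3 at least 3. One unit is lost to the corrections collected in \<open>M\<close>,
    and exp 2 still exceeds 4.\<close>
  define K where "K = max 1 (9 / (\<kappa> * \<rho> * V))"
  have K: "1 \<le> K" "3 \<le> \<kappa> * \<rho> * V * K ^ 3 / 3"
  proof -
    show K1: "1 \<le> K" by (simp add: K_def)
    have p: "0 < \<kappa> * \<rho> * V" using \<kappa> \<rho> V by simp
    have "9 / (\<kappa> * \<rho> * V) \<le> K" by (simp add: K_def)
    also have "K \<le> K ^ 3" using power_increasing[of 1 3 K] K1 by simp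
    finally have "9 \<le> \<kappa> * \<rho> * V * K ^ 3" using p by (simp add: field_simps)
    then show "3 \<le> \<kappa> * \<rho> * V * K ^ 3 / 3" by simp
  qed
  define B where "B = 2 * exp (2 * \<kappa> * K\<^sup>2 + 8 * L * K ^ 3) + 1"
  have B: "0 < B" unfolding B_def by (intro add_pos_pos) auto
  define c where "c = (ln 2 / K)\<^sup>2 / B"
  have c: "0 < c" using K B by (simp add: c_def)
  \<comment> \<open>The sum of covariance and excess is at least 4 c \<tau>^2, and the excess is the
    covariance plus \<kappa> r. The choice gives \<kappa> r \<le> 2 c \<tau>^2, so twice the
    covariance is at least 2 c \<tau>^2.\<close>
  define \<eta> where "\<eta> = min 1 (2 * c / \<kappa>)"
  have \<eta>: "0 < \<eta>" "\<eta> \<le> 1" "\<kappa> * \<eta> \<le> 2 * c"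
  proof -
    show "0 < \<eta>" "\<eta> \<le> 1" unfolding \<eta>_def using c \<kappa> by auto
    have "\<eta> \<le> 2 * c / \<kappa>" by (simp add: \<eta>_def)
    then show "\<kappa> * \<eta> \<le> 2 * c" using \<kappa> by (simp add: field_simps)
  qed
  define M where "M = \<kappa> * K ^ 3 * (1 + 2 * \<rho>) / 6 + L * K ^ 4"
  define T where "T = max 1 (max (4 * K / u) M)"
  show ?thesis
  proof (rule that[of c \<eta> T])
    show "0 < c" "0 < \<eta>" "1 \<le> T" using c \<eta> by (auto simp: T_def)
    fix \<tau> :: real and x :: nat
    assume \<tau>: "T \<le> \<tau>" and below: "real x \<le> char_speed \<rho> * \<tau> ^ 3"
      and near: "char_speed \<rho> * \<tau> ^ 3 - real x \<le> \<eta> * \<tau>\<^sup>2"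
    have \<tau>1: "1 \<le> \<tau>" "4 * K / u \<le> \<tau>" "M \<le> \<tau>" using \<tau> by (auto simp: T_def)
    define t where "t = \<tau> ^ 3"
    define r where "r = V * t - x"
    define s where "s = K / \<tau>"
    have t: "0 < t" using \<tau>1 by (simp add: t_def)
    have xt: "real x \<le> V * t" using below by (simp add: t_def V_def)
    have r: "0 \<le> r" "r \<le> \<eta> * \<tau>\<^sup>2" "r \<le> \<tau>\<^sup>2"
    proof -
      show "0 \<le> r" "r \<le> \<eta> * \<tau>\<^sup>2" using xt near by (auto simp: r_def t_def V_def)
      moreover have "\<eta> * \<tau>\<^sup>2 \<le> 1 * \<tau>\<^sup>2" using \<eta> by (intro mult_right_mono) auto
      ultimately show "r \<le> \<tau>\<^sup>2" by simp
    qed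
    have s0: "0 < s" using K \<tau>1 by (simp add: s_def)
    have su: "2 * s \<le> u / 2" using \<tau>1 u by (simp add: s_def field_simps)
    have ts: "t * s ^ 3 = K ^ 3" "t * s ^ 4 = K ^ 4 / \<tau>" "\<tau>\<^sup>2 * s\<^sup>2 = K\<^sup>2"
      using \<tau>1 by (simp_all add: t_def s_def field_simps power_numeral_reduce)
    define F where "F = limit_partition x t"
    define k where "k = drift \<rho> t x"
    note T1 = T1[OF t xt, folded F_def k_def r_def] and T2 = T2[OF t xt, folded F_def k_def r_def]
    have large: "4 < exp (F (u + s) - F u - s * k)"
    proof -
      have "x * (1 + 2 * \<rho>) - V * t = 2 * \<rho> * V * t - r * (1 + 2 * \<rho>)" by (simp add: r_def algebra_simps)
      then have "\<kappa> * r * s\<^sup>2 / 2 + (2 * \<rho> * V * t - r * (1 + 2 * \<rho>)) * \<kappa> * s ^ 3 / 6 - L * t * s ^ 4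
          \<le> F (u + s) - F u - s * k"
        using T2[of s] s0 su by (simp add: abs_le_iff)
      moreover have "0 \<le> \<kappa> * r * s\<^sup>2 / 2" using \<kappa> r by simp
      moreover have "(2 * \<rho> * V * t - r * (1 + 2 * \<rho>)) * \<kappa> * s ^ 3 / 6 =
          \<kappa> * \<rho> * V * (t * s ^ 3) / 3 - r * (\<kappa> * (1 + 2 * \<rho>) * s ^ 3 / 6)"
        by (simp add: field_simps)
      moreover have "r * (\<kappa> * (1 + 2 * \<rho>) * s ^ 3 / 6) \<le> \<tau>\<^sup>2 * (\<kappa> * (1 + 2 * \<rho>) * s ^ 3 / 6)"
        using r \<kappa> \<rho> s0 by (intro mult_right_mono) auto
      moreover have "\<tau>\<^sup>2 * (\<kappa> * (1 + 2 * \<rho>) * s ^ 3 / 6) + L * t * s ^ 4 = M / \<tau>"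
        unfolding M_def t_def s_def using \<tau>1 by (simp add: field_simps power_numeral_reduce)
      moreover have "M / \<tau> \<le> 1" using \<tau>1 by (simp add: divide_le_eq)
      ultimately have "2 \<le> F (u + s) - F u - s * k" using K(2) unfolding ts by linarith
      moreover have "4 < exp (2 :: real)" using exp_lower_Taylor_quadratic[of "2 :: real"] by simp
      ultimately show ?thesis by (smt (verit) exp_le_cancel_iff)
    qed
    have Ts: "\<kappa> * r * (2 * s)\<^sup>2 / 2 \<le> 2 * \<kappa> * K\<^sup>2" "L * t * (2 * s) ^ 3 = 8 * L * K ^ 3"
    proof -
      have "\<kappa> * r * (2 * s)\<^sup>2 / 2 = 2 * \<kappa> * (r * s\<^sup>2)" by (simp add: power2_eq_square)
      also have "\<dots> \<le> 2 * \<kappa> * (\<tau>\<^sup>2 * s\<^sup>2)" using \<kappa> r by (intro mult_left_mono mult_right_mono) auto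
      finally show "\<kappa> * r * (2 * s)\<^sup>2 / 2 \<le> 2 * \<kappa> * K\<^sup>2" unfolding ts .
      have "L * t * (2 * s) ^ 3 = 8 * L * (t * s ^ 3)" by (simp add: power3_eq_cube)
      then show "L * t * (2 * s) ^ 3 = 8 * L * K ^ 3" unfolding ts .
    qed
    have "F (u + 2 * s) - F u - 2 * s * k \<le> 2 * \<kappa> * K\<^sup>2 + 8 * L * K ^ 3"
    proof -
      have "\<bar>F (u + 2 * s) - F u - 2 * s * k - \<kappa> * r * (2 * s)\<^sup>2 / 2\<bar> \<le> 8 * L * K ^ 3"
        using T1[of "2 * s"] s0 su unfolding Ts(2)[symmetric] by simp
      then show ?thesis using Ts(1) by linarith
    qed
    moreover have "F u - F (u - 2 * s) - 2 * s * k \<le> 2 * \<kappa> * K\<^sup>2 + 8 * L * K ^ 3"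
    proof -
      have "\<bar>F (u + - (2 * s)) - F u - - (2 * s) * k - \<kappa> * r * (- (2 * s))\<^sup>2 / 2\<bar> \<le> 8 * L * K ^ 3"
        using T1[of "- (2 * s)"] s0 su unfolding Ts(2)[symmetric] by simp
      moreover have "0 \<le> \<kappa> * r * (- (2 * s))\<^sup>2 / 2" "0 \<le> 2 * \<kappa> * K\<^sup>2" using \<kappa> r by auto
      ultimately show ?thesis by (simp add: abs_le_iff)
    qed
    ultimately have "exp (F (u + 2 * s) - F u - 2 * s * k) + exp (F u - F (u - 2 * s) - 2 * s * k) < B"
      unfolding B_def by (smt (verit) exp_le_cancel_iff)
    then have "4 * (ln 2 / s)\<^sup>2 / B \<le> cov_limit \<rho> t x + excess_limit \<rho> t x"
      unfolding F_def u_def k_def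
      using cov_limit_lower[OF \<rho> t s0, of x B] large su u by (simp add: F_def u_def k_def)
    moreover have "4 * (ln 2 / s)\<^sup>2 / B = 4 * c * \<tau>\<^sup>2"
      using K \<tau>1 by (simp add: c_def s_def field_simps)
    moreover have "excess_limit \<rho> t x = cov_limit \<rho> t x + \<kappa> * r"
      using excess_limit_eq[OF \<rho>, of t x] by (simp add: \<kappa>_def r_def V_def)
    moreover have "\<kappa> * r \<le> 2 * c * \<tau>\<^sup>2"
    proof -
      have "\<kappa> * r \<le> \<kappa> * (\<eta> * \<tau>\<^sup>2)" using r \<kappa> by (intro mult_left_mono) auto
      also have "\<dots> = (\<kappa> * \<eta>) * \<tau>\<^sup>2" by simp
      also have "\<dots> \<le> (2 * c) * \<tau>\<^sup>2" using \<eta> by (intro mult_right_mono) auto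
      finally show ?thesis .
    qed
    ultimately show "c * \<tau>\<^sup>2 \<le> cov_limit \<rho> (\<tau> ^ 3) x" unfolding t_def[symmetric] by simp
  qed
qed

text \<open>The telescoping bound is \<open>1 / z\<^sub>j\<^sub>+\<^sub>1\<^sup>3 \<le> 2 \<tau>\<^sup>2 (1 / z\<^sub>j - 1 / z\<^sub>j\<^sub>+\<^sub>1)\<close> for \<open>z\<^sub>j = sqrt (1 + j / \<tau>\<^sup>2)\<close>.\<close>

lemma sum_inverse_sqrt_cube_le:
  fixes \<tau> :: real
  assumes \<tau>: "1 \<le> \<tau>"
  shows "(\<Sum>j<n. 1 / sqrt (1 + real j / \<tau>\<^sup>2) ^ 3) \<le> 3 * \<tau>\<^sup>2"
proof -
  define z where "z j = sqrt (1 + real j / \<tau>\<^sup>2)" for j :: nat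
  have z1: "1 \<le> z j" for j unfolding z_def by simp
  have z2: "(z j)\<^sup>2 = 1 + real j / \<tau>\<^sup>2" for j unfolding z_def by (intro real_sqrt_pow2) (simp add: add_nonneg_nonneg)
  have step: "1 / z (Suc j) ^ 3 \<le> 2 * \<tau>\<^sup>2 * (1 / z j - 1 / z (Suc j))" for j
  proof -
    define a b where "a = z j" and "b = z (Suc j)"
    have a: "1 \<le> a" "1 \<le> b" using z1 by (auto simp: a_def b_def)
    have sq: "b\<^sup>2 - a\<^sup>2 = 1 / \<tau>\<^sup>2" unfolding a_def b_def z2 by (simp add: add_divide_distrib)
    have ab: "a \<le> b" unfolding a_def b_def z_def by (auto intro!: divide_right_mono)
    have "(b - a) * (b + a) = 1 / \<tau>\<^sup>2" using sq by (simp add: power2_eq_square algebra_simps)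
    moreover have "b - a = (b - a) * (b + a) / (b + a)" using a by simp
    ultimately have d: "b - a = 1 / (\<tau>\<^sup>2 * (b + a))" by simp
    have "2 * \<tau>\<^sup>2 * (1 / a - 1 / b) = 2 * \<tau>\<^sup>2 * ((b - a) / (a * b))" using a by (simp add: field_simps)
    also have "\<dots> = 2 / ((b + a) * (a * b))" unfolding d using \<tau> by simp
    also have "\<dots> \<ge> 2 / ((b + b) * (b * b))"
      using a ab by (intro divide_left_mono mult_mono mult_pos_pos) auto
    also have "2 / ((b + b) * (b * b)) = 1 / b ^ 3" using a by (simp add: power3_eq_cube)
    finally show ?thesis by (simp add: a_def b_def)
  qed
  have "(\<Sum>j<Suc n. 1 / z j ^ 3) \<le> 1 + 2 * \<tau>\<^sup>2 * (1 - 1 / z n)" for n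
  proof (induction n)
    case 0
    then show ?case by (simp add: z_def)
  next
    case (Suc n)
    then show ?case using step[of n] unfolding sum.lessThan_Suc[of _ "Suc n"] by (simp add: algebra_simps)
  qed
  moreover have "1 + 2 * \<tau>\<^sup>2 * (1 - 1 / z n) \<le> 3 * \<tau>\<^sup>2" for n
  proof -
    have "2 * \<tau>\<^sup>2 * (1 - 1 / z n) \<le> 2 * \<tau>\<^sup>2 * 1" using z1[of n] by (intro mult_left_mono) auto
    then show ?thesis using one_le_power[OF \<tau>, of 2] by simp
  qed
  ultimately have *: "(\<Sum>j<Suc n. 1 / z j ^ 3) \<le> 3 * \<tau>\<^sup>2" for n by (rule order_trans)
  have "(\<Sum>j<n. 1 / z j ^ 3) \<le> (\<Sum>j<Suc n. 1 / z j ^ 3)"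
    using z1[of n] by simp
  also note *
  finally show ?thesis unfolding z_def .
qed

section \<open>The second moment\<close>

lemma cov_limit_Suc: "cov_limit \<rho> t (Suc x) = cov_limit \<rho> t x + (\<Sum>i\<le>x. two_point \<rho> (int i) t)"
proof -
  have "cov_limit \<rho> t (Suc x) = (\<Sum>i\<le>x. real (x - i) * two_point \<rho> (int i) t + two_point \<rho> (int i) t)"
    unfolding cov_limit_def lessThan_Suc_atMost
    by (intro sum.cong refl) (simp add: Suc_diff_le algebra_simps)
  also have "\<dots> = (\<Sum>i\<le>x. real (x - i) * two_point \<rho> (int i) t) + (\<Sum>i\<le>x. two_point \<rho> (int i) t)"
    by (rule sum.distrib)
  also have "(\<Sum>i\<le>x. real (x - i) * two_point \<rho> (int i) t) = cov_limit \<rho> t x"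
    by (simp add: cov_limit_def lessThan_Suc_atMost[symmetric])
  finally show ?thesis .
qed

text \<open>\<open>two_point\<close> is the second difference of \<open>cov_limit\<close>, and
  \<open>excess_limit\<close> differs from it by a linear function of x, which second differences do
  not see.\<close>

lemma two_point_eq_second_difference:
  assumes "0 < \<rho>"
  shows "two_point \<rho> (int (Suc i)) t =
    excess_limit \<rho> t (Suc (Suc i)) - 2 * excess_limit \<rho> t (Suc i) + excess_limit \<rho> t i"
  unfolding excess_limit_eq[OF assms] cov_limit_Suc sum.atMost_Suc by (simp add: algebra_simps)

lemma cov_second_moment_partial_sum:
  "(\<Sum>i\<le>N. (real i - m)\<^sup>2 * two_point \<rho> (int i) t) =
    2 * (\<Sum>i\<le>N. cov_limit \<rho> t i) + (real N - m)\<^sup>2 * cov_limit \<rho> t (Suc N) - (real N + 1 - m)\<^sup>2 * cov_limit \<rho> t N"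
proof (induction N)
  case 0
  then show ?case by (simp add: cov_limit_Suc) (simp add: cov_limit_def)
next
  case (Suc N)
  define S where "S = two_point \<rho> (int (Suc N)) t"
  define c0 c1 where "c0 = cov_limit \<rho> t N" and "c1 = cov_limit \<rho> t (Suc N)"
  have c2: "cov_limit \<rho> t (Suc (Suc N)) = 2 * c1 - c0 + S"
    unfolding cov_limit_Suc[of \<rho> t "Suc N"] c0_def c1_def cov_limit_Suc[of \<rho> t N] S_def by simp
  define y where "y = real N - m"
  have y: "real (Suc N) - m = y + 1" "real N + 1 - m = y + 1" "real (Suc N) + 1 - m = y + 2"
    by (simp_all add: y_def)
  show ?case
    unfolding sum.atMost_Suc Suc.IH c2 y S_def[symmetric] c0_def[symmetric] c1_def[symmetric] y_def[symmetric]
    by (simp add: algebra_simps power2_eq_square)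
qed

text \<open>Summation by parts twice, the second difference of (i - m)^2 being 2. At k the sum
  changes from \<open>cov_limit\<close> to \<open>excess_limit\<close>, whose end terms vanish as n
  grows; their linear difference leaves the term in m - k.\<close>

lemma second_moment_partial_sum:
  fixes \<rho> t :: real
  assumes \<rho>: "0 < \<rho>"
  defines "m \<equiv> char_speed \<rho> * t"
  shows "(\<Sum>i\<le>k + n. (real i - m)\<^sup>2 * two_point \<rho> (int i) t) =
    \<rho> * (1 + \<rho>) * ((m - real k) - (m - real k)\<^sup>2) + 2 * (\<Sum>i\<le>k. cov_limit \<rho> t i) +
    2 * (\<Sum>i<n. excess_limit \<rho> t (Suc (k + i))) +
    (real (k + n) - m)\<^sup>2 * excess_limit \<rho> t (Suc (k + n)) - (real (k + n) + 1 - m)\<^sup>2 * excess_limit \<rho> t (k + n)"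
proof (induction n)
  case 0
  define \<kappa> where "\<kappa> = \<rho> * (1 + \<rho>)"
  define y where "y = real k - m"
  have e: "excess_limit \<rho> t x = cov_limit \<rho> t x + \<kappa> * (m - real x)" for x
    unfolding \<kappa>_def m_def by (rule excess_limit_eq[OF \<rho>])
  have y: "m - real k = - y" "real k + 1 - m = y + 1" "m - real (Suc k) = - y - 1"
    by (simp_all add: y_def)
  show ?case
    unfolding add_0_right cov_second_moment_partial_sum e \<kappa>_def[symmetric] y y_def[symmetric]
    by (simp add: algebra_simps power2_eq_square)
next
  case (Suc n)
  define y where "y = real (k + n) - m"
  have y: "real (k + Suc n) - m = y + 1" "real (k + n) + 1 - m = y + 1" "real (k + Suc n) + 1 - m = y + 2"
    "real (Suc (k + n)) - m = y + 1"
    by (simp_all add: y_def)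
  show ?case
    unfolding add_Suc_right sum.atMost_Suc sum.lessThan_Suc Suc.IH two_point_eq_second_difference[OF \<rho>] y(4) y_def[symmetric]
      y(2) y(1)[unfolded add_Suc_right] y(3)[unfolded add_Suc_right]
    by (simp add: algebra_simps power2_eq_square)
qed

lemma summable_power2_times_exp:
  fixes c m :: real
  assumes c: "0 < c"
  shows "summable (\<lambda>n. (real n - m)\<^sup>2 * exp (- c * real n))"
proof (rule summable_comparison_test')
  define K where "K = fact 2 / (c / 2) ^ 2 * exp (c / 2 * \<bar>m\<bar>)"
  have "summable (\<lambda>n. exp (- (c / 2)) ^ n)" using c by (intro summable_geometric) simp
  then show "summable (\<lambda>n. K * exp (- (c / 2)) ^ n)" by (rule summable_mult)
  show "norm ((real n - m)\<^sup>2 * exp (- c * real n)) \<le> K * exp (- (c / 2)) ^ n" if "0 \<le> n" for n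
  proof -
    have "(real n - m)\<^sup>2 \<le> (real n + \<bar>m\<bar>)\<^sup>2" by (rule abs_le_square_iff[THEN iffD1]) simp
    also have "\<dots> \<le> fact 2 / (c / 2) ^ 2 * exp (c / 2 * (real n + \<bar>m\<bar>))"
      using c by (intro power_le_exp) auto
    also have "\<dots> = K * exp (c / 2 * real n)" by (simp add: K_def distrib_left exp_add)
    finally have "(real n - m)\<^sup>2 * exp (- c * real n) \<le> K * exp (c / 2 * real n) * exp (- c * real n)"
      by (intro mult_right_mono) auto
    also have "\<dots> = K * exp (- (c / 2)) ^ n"
      by (simp add: mult.assoc mult_exp_exp exp_of_nat_mult[symmetric])
    finally show ?thesis by simp
  qed
qed

text \<open>Exponential decay of the excess makes its second differences summable against squares
  and removes the end terms of the partial sums. The summand is zero for negative i, so the sum over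
  the integers is an ordinary series.\<close>

lemma second_moment_limit:
  fixes \<rho> t :: real
  assumes \<rho>: "0 < \<rho>" and t: "0 < t"
  defines "m \<equiv> char_speed \<rho> * t"
  shows "(\<lambda>n. \<rho> * (1 + \<rho>) * ((m - real k) - (m - real k)\<^sup>2) + 2 * (\<Sum>i\<le>k. cov_limit \<rho> t i) +
      2 * (\<Sum>i<n. excess_limit \<rho> t (Suc (k + i)))) \<longlonglongrightarrow> (\<Sum>\<^sub>\<infinity>i\<in>UNIV. (real_of_int i - m)\<^sup>2 * two_point \<rho> i t)"
    (is "?A \<longlonglongrightarrow> ?W")
proof -
  obtain c C where c: "0 < c" "0 < C" and decay: "\<And>x. excess_limit \<rho> t x \<le> C * exp (C * t - c * real x)"
    using excess_limit_exp_decay[OF \<rho>] t by metis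
  define D where "D = C * exp (C * t)"
  have D: "0 < D" using c by (simp add: D_def)
  define dd where "dd = excess_limit \<rho> t"
  have dd: "0 \<le> dd x" "dd x \<le> D * exp (- c * real x)" for x
    using decay[of x] excess_limit_nonneg[OF \<rho> t, of x] by (simp_all add: dd_def D_def mult.assoc mult_exp_exp)
  have dd': "dd x \<le> D * exp (- c * real y)" if "y \<le> x" for x y
  proof -
    have "D * exp (- c * real x) \<le> D * exp (- c * real y)" using D c that by simp
    then show ?thesis using dd(2)[of x] by linarith
  qed
  have lim: "(\<lambda>n. (real n - m')\<^sup>2 * dd (n + j)) \<longlonglongrightarrow> 0" for m' j
  proof (rule Lim_null_comparison)
    show "\<forall>\<^sub>F n in sequentially. norm ((real n - m')\<^sup>2 * dd (n + j)) \<le> D * ((real n - m')\<^sup>2 * exp (- c * real n))"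
    proof (rule always_eventually, rule allI)
      fix n
      have "(real n - m')\<^sup>2 * dd (n + j) \<le> (real n - m')\<^sup>2 * (D * exp (- c * real n))"
        by (intro mult_left_mono dd') auto
      then show "norm ((real n - m')\<^sup>2 * dd (n + j)) \<le> D * ((real n - m')\<^sup>2 * exp (- c * real n))"
        using dd(1)[of "n + j"] by (simp add: algebra_simps)
    qed
    show "(\<lambda>n. D * ((real n - m')\<^sup>2 * exp (- c * real n))) \<longlonglongrightarrow> 0"
      by (intro tendsto_mult_right_zero summable_LIMSEQ_zero summable_power2_times_exp c)
  qed
  define f where "f i = (real i - m)\<^sup>2 * two_point \<rho> (int i) t" for i
  have "summable (\<lambda>i. norm (f (Suc i)))"
  proof (rule summable_comparison_test')
    show "summable (\<lambda>i. 4 * D * ((real i - (m - 1))\<^sup>2 * exp (- c * real i)))"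
      by (intro summable_mult summable_power2_times_exp c)
    fix i :: nat
    have "\<bar>two_point \<rho> (int (Suc i)) t\<bar> \<le> 4 * D * exp (- c * real i)"
      unfolding two_point_eq_second_difference[OF \<rho>] dd_def[symmetric]
      using dd(1)[of i] dd(1)[of "Suc i"] dd(1)[of "Suc (Suc i)"]
        dd'[of i i] dd'[of i "Suc i"] dd'[of i "Suc (Suc i)"] by simp
    then have "(real i - (m - 1))\<^sup>2 * \<bar>two_point \<rho> (int (Suc i)) t\<bar> \<le> (real i - (m - 1))\<^sup>2 * (4 * D * exp (- c * real i))"
      by (intro mult_left_mono) auto
    moreover have "norm (f (Suc i)) = (real i - (m - 1))\<^sup>2 * \<bar>two_point \<rho> (int (Suc i)) t\<bar>"
      unfolding f_def real_norm_def abs_mult by (simp add: algebra_simps)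
    ultimately show "norm (norm (f (Suc i))) \<le> 4 * D * ((real i - (m - 1))\<^sup>2 * exp (- c * real i))"
      by (simp add: mult_ac)
  qed
  then have sm: "summable (\<lambda>i. norm (f i))" using summable_Suc_iff[of "\<lambda>i. norm (f i)"] by blast
  then have sums: "f sums suminf f" by (rule summable_sums[OF summable_norm_cancel])
  have "(f has_sum suminf f) UNIV" by (rule norm_summable_imp_has_sum[OF sm sums])
  moreover have "f = (\<lambda>i. (real_of_int i - m)\<^sup>2 * two_point \<rho> i t) \<circ> int" by (simp add: fun_eq_iff f_def)
  ultimately have "((\<lambda>i. (real_of_int i - m)\<^sup>2 * two_point \<rho> i t) has_sum suminf f) (range int)"
    by (subst has_sum_reindex) (auto simp: inj_on_def)
  then have "((\<lambda>i. (real_of_int i - m)\<^sup>2 * two_point \<rho> i t) has_sum suminf f) UNIV"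
  proof (subst (asm) has_sum_cong_neutral)
    fix i :: int assume "i \<in> UNIV - range int"
    then have "i < 0" by (metis DiffD2 nonneg_int_cases not_le rangeI)
    then show "(real_of_int i - m)\<^sup>2 * two_point \<rho> i t = 0" by (simp add: two_point_left[OF \<rho> t])
  qed auto
  then have W: "?W = suminf f" by (rule infsumI)
  have "(\<lambda>N. \<Sum>i\<le>N. f i) \<longlonglongrightarrow> ?W" unfolding W using sums by (simp add: sums_def_le)
  then have "(\<lambda>n. \<Sum>i\<le>n + k. f i) \<longlonglongrightarrow> ?W" by (rule LIMSEQ_ignore_initial_segment)
  moreover have "(\<lambda>n. (real (n + k) - m)\<^sup>2 * dd (n + k + 1) - (real (n + k) - (m - 1))\<^sup>2 * dd (n + k + 0)) \<longlonglongrightarrow> 0 - 0"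
    by (intro tendsto_diff LIMSEQ_ignore_initial_segment[of "\<lambda>n. (real n - m)\<^sup>2 * dd (n + 1)"]
        LIMSEQ_ignore_initial_segment[of "\<lambda>n. (real n - (m - 1))\<^sup>2 * dd (n + 0)"] lim)
  ultimately have "(\<lambda>n. (\<Sum>i\<le>n + k. f i) -
      ((real (n + k) - m)\<^sup>2 * dd (n + k + 1) - (real (n + k) - (m - 1))\<^sup>2 * dd (n + k + 0))) \<longlonglongrightarrow> ?W - (0 - 0)"
    by (rule tendsto_diff)
  moreover have "(\<Sum>i\<le>n + k. f i) -
      ((real (n + k) - m)\<^sup>2 * dd (n + k + 1) - (real (n + k) - (m - 1))\<^sup>2 * dd (n + k + 0)) = ?A n" for n
  proof -
    have "(\<Sum>i\<le>n + k. f i) = ?A n + (real (n + k) - m)\<^sup>2 * dd (n + k + 1) - (real (n + k) + 1 - m)\<^sup>2 * dd (n + k)"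
      using second_moment_partial_sum[OF \<rho>, where k = k and n = n and t = t] unfolding m_def f_def dd_def by (simp add: add.commute)
    then show ?thesis by (simp add: diff_diff_eq2)
  qed
  ultimately show ?thesis by simp
qed

text \<open>Effectively about \<tau>^2 sites around V t contribute a term of order \<tau>^2 each,
  with t = \<tau>^3.\<close>

lemma second_moment_bounds:
  fixes \<rho> :: real
  assumes \<rho>: "0 < \<rho>"
  obtains a b T where "0 < a" "0 < b" "1 \<le> T"
    "\<And>\<tau>. T \<le> \<tau> \<Longrightarrow> a * \<tau> ^ 4 \<le>
      (\<Sum>\<^sub>\<infinity>i\<in>UNIV. (real_of_int i - char_speed \<rho> * \<tau> ^ 3)\<^sup>2 * two_point \<rho> i (\<tau> ^ 3))"
    "\<And>\<tau>. T \<le> \<tau> \<Longrightarrow>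
      (\<Sum>\<^sub>\<infinity>i\<in>UNIV. (real_of_int i - char_speed \<rho> * \<tau> ^ 3)\<^sup>2 * two_point \<rho> i (\<tau> ^ 3)) \<le> b * \<tau> ^ 4"
proof -
  define V where "V = char_speed \<rho>"
  define \<kappa> where "\<kappa> = \<rho> * (1 + \<rho>)"
  have V: "0 < V" "V \<le> 1"
  proof -
    show "0 < V" using \<rho> by (simp add: V_def char_speed_def)
    have "1 \<le> (1 + \<rho>)\<^sup>2" using \<rho> by (intro one_le_power) auto
    moreover have "0 < (1 + \<rho>)\<^sup>2" using \<rho> by simp
    ultimately show "V \<le> 1" by (simp add: V_def char_speed_def divide_le_eq)
  qed
  have \<kappa>: "0 < \<kappa>" using \<rho> by (simp add: \<kappa>_def)
  obtain c1 \<eta> T where c1: "0 < c1" and \<eta>: "0 < \<eta>" and T: "1 \<le> T" and lower: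
    "\<And>\<tau> x. T \<le> \<tau> \<Longrightarrow> real x \<le> V * \<tau> ^ 3 \<Longrightarrow> V * \<tau> ^ 3 - real x \<le> \<eta> * \<tau>\<^sup>2 \<Longrightarrow>
      c1 * \<tau>\<^sup>2 \<le> cov_limit \<rho> (\<tau> ^ 3) x"
    unfolding V_def by (rule near_characteristic_lower[OF \<rho>]) blast
  obtain c C0 where c: "0 < c" "0 < C0" and decay:
    "\<And>t x. 0 < t \<Longrightarrow> excess_limit \<rho> t x \<le> C0 * exp (C0 * t - c * real x)"
    by (rule excess_limit_exp_decay[OF \<rho>]) blast
  \<comment> \<open>Beyond K t half of the exponential decay in x already compensates the growth in
    t. The summand 1 makes K at least V, so that the sites up to V t are covered as well.\<close>
  define K where "K = 2 * C0 / c + 1"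
  have K: "0 \<le> K" "1 \<le> K" using c by (auto simp: K_def)
  obtain C1 where C1: "0 < C1" and cov:
    "\<And>\<tau> x. 1 \<le> \<tau> \<Longrightarrow> real x \<le> K * \<tau> ^ 3 \<Longrightarrow> real x \<le> V * \<tau> ^ 3 \<Longrightarrow>
      cov_limit \<rho> (\<tau> ^ 3) x \<le> C1 * \<tau>\<^sup>2 / sqrt (1 + (V * \<tau> ^ 3 - x) / \<tau>\<^sup>2) ^ 3"
    and excess:
    "\<And>\<tau> x. 1 \<le> \<tau> \<Longrightarrow> real x \<le> K * \<tau> ^ 3 \<Longrightarrow> V * \<tau> ^ 3 \<le> real x \<Longrightarrow>
      excess_limit \<rho> (\<tau> ^ 3) x \<le> C1 * \<tau>\<^sup>2 / sqrt (1 + (x - V * \<tau> ^ 3) / \<tau>\<^sup>2) ^ 3"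
    unfolding V_def by (rule near_characteristic_upper[OF \<rho> K(1)]) blast
  define q where "q = exp (- (c / 2))"
  have q: "0 < q" "q < 1" using c by (auto simp: q_def)
  define b where "b = \<kappa> + 12 * C1 + 2 * C0 / (1 - q)"
  \<comment> \<open>From \<eta> / V on, the window of \<eta> \<tau>^2 sites fits to the left of V t;
    from 2 / \<eta> on, rounding it down to whole sites keeps at least half of it.\<close>
  define T' where "T' = max T (max (\<eta> / V) (2 / \<eta>))"
  show ?thesis
  proof (rule that[of "\<eta> * c1" b T'])
    show "0 < \<eta> * c1" "1 \<le> T'" using \<eta> c1 T by (auto simp: T'_def)
    show "0 < b" unfolding b_def using \<kappa> C1 c q by (intro add_pos_pos) auto
    fix \<tau> :: real
    assume "T' \<le> \<tau>"
    then have \<tau>: "T \<le> \<tau>" "\<eta> / V \<le> \<tau>" "2 / \<eta> \<le> \<tau>" "1 \<le> \<tau>" using T by (auto simp: T'_def)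
    define t where "t = \<tau> ^ 3"
    have t: "0 < t" using \<tau> by (simp add: t_def)
    define m where "m = V * t"
    have m: "0 < m" using V t by (simp add: m_def)
    define k where "k = nat \<lfloor>m\<rfloor>"
    have k: "real k \<le> m" "m < real k + 1" unfolding k_def using m by linarith+
    define W where "W = (\<Sum>\<^sub>\<infinity>i\<in>UNIV. (real_of_int i - m)\<^sup>2 * two_point \<rho> i t)"
    define A where "A n = \<kappa> * ((m - real k) - (m - real k)\<^sup>2) + 2 * (\<Sum>i\<le>k. cov_limit \<rho> t i) +
      2 * (\<Sum>i<n. excess_limit \<rho> t (Suc (k + i)))" for n
    have A: "A \<longlonglongrightarrow> W"
      using second_moment_limit[OF \<rho> t, where k = k] unfolding A_def W_def \<kappa>_def m_def V_def .
    have f: "0 \<le> (m - real k) - (m - real k)\<^sup>2" "(m - real k) - (m - real k)\<^sup>2 \<le> 1"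
    proof -
      have "(m - real k) * (m - real k) \<le> (m - real k) * 1" using k by (intro mult_left_mono) auto
      then show "0 \<le> (m - real k) - (m - real k)\<^sup>2" by (simp add: power2_eq_square)
      have "0 \<le> (m - real k)\<^sup>2" by simp
      then show "(m - real k) - (m - real k)\<^sup>2 \<le> 1" using k by linarith
    qed
    have "(\<eta> * c1) * \<tau> ^ 4 \<le> W"
    proof (rule LIMSEQ_le_const[OF A], intro exI allI impI)
      fix n' :: nat
      define n where "n = nat \<lfloor>\<eta> * \<tau>\<^sup>2\<rfloor>"
      have n: "real n \<le> \<eta> * \<tau>\<^sup>2" "\<eta> * \<tau>\<^sup>2 - 1 \<le> real n"
        unfolding n_def using \<eta> by (auto simp: le_nat_floor)
      have "\<eta> * \<tau>\<^sup>2 \<le> (V * \<tau>) * \<tau>\<^sup>2" using \<tau> V by (intro mult_right_mono) (auto simp: divide_le_eq mult.commute)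
      also have "\<dots> = m" by (simp add: m_def t_def power3_eq_cube power2_eq_square)
      finally have "n \<le> k" using n k by linarith
      have "1 \<le> \<eta> * \<tau>\<^sup>2 / 2"
      proof -
        have "2 / \<eta> \<le> \<tau>\<^sup>2" using \<tau> self_le_power[of \<tau> 2] by simp
        then show ?thesis using \<eta> by (simp add: field_simps)
      qed
      then have "\<eta> * \<tau>\<^sup>2 / 2 * (c1 * \<tau>\<^sup>2) \<le> real n * (c1 * \<tau>\<^sup>2)"
        using n c1 by (intro mult_right_mono) auto
      also have "\<dots> = (\<Sum>i\<in>{k + 1 - n..k}. c1 * \<tau>\<^sup>2)" using \<open>n \<le> k\<close> by simp
      also have "\<dots> \<le> (\<Sum>i\<in>{k + 1 - n..k}. cov_limit \<rho> t i)"
      proof (rule sum_mono)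
        fix i assume i: "i \<in> {k + 1 - n..k}"
        then have "real k + 1 - real n \<le> real i" by auto
        then show "c1 * \<tau>\<^sup>2 \<le> cov_limit \<rho> t i"
          using i k n unfolding t_def m_def[unfolded t_def] by (intro lower \<tau>) auto
      qed
      also have "\<dots> \<le> (\<Sum>i\<le>k. cov_limit \<rho> t i)"
        by (intro sum_mono2 cov_limit_nonneg \<rho> t) auto
      finally have "\<eta> * c1 * \<tau> ^ 4 \<le> 2 * (\<Sum>i\<le>k. cov_limit \<rho> t i)"
        by (simp add: power2_eq_square power4_eq_xxxx mult_ac)
      moreover have "0 \<le> (\<Sum>i<n'. excess_limit \<rho> t (Suc (k + i)))"
        by (intro sum_nonneg excess_limit_nonneg \<rho> t)
      moreover have "0 \<le> \<kappa> * ((m - real k) - (m - real k)\<^sup>2)" using \<kappa> f by (intro mult_nonneg_nonneg) auto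
      ultimately show "\<eta> * c1 * \<tau> ^ 4 \<le> A n'" unfolding A_def by linarith
    qed
    then show "\<eta> * c1 * \<tau> ^ 4 \<le>
      (\<Sum>\<^sub>\<infinity>i\<in>UNIV. (real_of_int i - char_speed \<rho> * \<tau> ^ 3)\<^sup>2 * two_point \<rho> i (\<tau> ^ 3))"
      unfolding W_def m_def t_def V_def .
    define g where "g y = 1 / sqrt (1 + y / \<tau>\<^sup>2) ^ 3" for y :: real
    have g: "g z \<le> g y" if "0 \<le> y" "y \<le> z" for y z
    proof -
      have "0 \<le> y / \<tau>\<^sup>2" using that by simp
      moreover have "y / \<tau>\<^sup>2 \<le> z / \<tau>\<^sup>2" using that by (intro divide_right_mono) auto
      ultimately have "0 < sqrt (1 + y / \<tau>\<^sup>2)" "sqrt (1 + y / \<tau>\<^sup>2) \<le> sqrt (1 + z / \<tau>\<^sup>2)" by auto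
      then show ?thesis unfolding g_def by (intro divide_left_mono power_mono mult_pos_pos zero_less_power) auto
    qed
    have gsum: "(\<Sum>j<n. g (real j)) \<le> 3 * \<tau>\<^sup>2" for n
      unfolding g_def by (rule sum_inverse_sqrt_cube_le[OF \<tau>(4)])
    have "W \<le> b * \<tau> ^ 4"
    proof (rule LIMSEQ_le_const2[OF A], intro exI allI impI)
      fix n :: nat
      \<comment> \<open>The distance from i to m is replaced by the smaller integer distance from i
        to k, and the sum is reversed, to reach the form of
        \<open>sum_inverse_sqrt_cube_le\<close>.\<close>
      have "(\<Sum>i\<le>k. cov_limit \<rho> t i) \<le> (\<Sum>i<Suc k. C1 * \<tau>\<^sup>2 * g (real (Suc k - Suc i)))"
        unfolding lessThan_Suc_atMost
      proof (rule sum_mono)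
        fix i assume i: "i \<in> {..k}"
        have "real i \<le> m" using i k by simp
        moreover have "m \<le> K * t" unfolding m_def using V K t by (intro mult_right_mono) auto
        ultimately have "cov_limit \<rho> t i \<le> C1 * \<tau>\<^sup>2 * g (m - real i)"
          using cov[OF \<tau>(4), of i] unfolding g_def m_def t_def by simp
        also have "\<dots> \<le> C1 * \<tau>\<^sup>2 * g (real (Suc k - Suc i))"
          using i k C1 by (intro mult_left_mono g) auto
        finally show "cov_limit \<rho> t i \<le> C1 * \<tau>\<^sup>2 * g (real (Suc k - Suc i))" .
      qed
      also have "\<dots> = C1 * \<tau>\<^sup>2 * (\<Sum>j<Suc k. g (real j))"
        unfolding sum_distrib_left[symmetric] by (subst sum.nat_diff_reindex[where g = "\<lambda>j. g (real j)"]) (rule refl)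
      also have "\<dots> \<le> C1 * \<tau>\<^sup>2 * (3 * \<tau>\<^sup>2)" using C1 by (intro mult_left_mono gsum) auto
      finally have 1: "(\<Sum>i\<le>k. cov_limit \<rho> t i) \<le> 3 * C1 * \<tau> ^ 4"
        by (simp add: power2_eq_square power4_eq_xxxx)
      have "(\<Sum>i<n. excess_limit \<rho> t (Suc (k + i))) \<le> (\<Sum>i<n. C1 * \<tau>\<^sup>2 * g (real i) + C0 * q ^ i)"
      proof (rule sum_mono)
        fix i
        define x where "x = Suc (k + i)"
        have x: "m \<le> real x" "real i \<le> real x - m" using k by (auto simp: x_def)
        have g0: "0 \<le> g (real i)" unfolding g_def by simp
        show "excess_limit \<rho> t (Suc (k + i)) \<le> C1 * \<tau>\<^sup>2 * g (real i) + C0 * q ^ i"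
        proof (cases "real x \<le> K * t")
          case True
          have "excess_limit \<rho> t x \<le> C1 * \<tau>\<^sup>2 * g (real x - m)"
            using excess[OF \<tau>(4), of x] True x unfolding g_def m_def t_def by simp
          also have "\<dots> \<le> C1 * \<tau>\<^sup>2 * g (real i)"
            using x C1 by (intro mult_left_mono g) auto
          finally show ?thesis using c q by (simp add: x_def add_increasing2)
        next
          case False
          have "2 * C0 / c * t \<le> K * t" unfolding K_def using t by (intro mult_right_mono) auto
          then have "2 * C0 / c * t \<le> real x" using False by simp
          then have "C0 * t \<le> c / 2 * real x" using c by (simp add: field_simps)
          moreover have "c / 2 * real i \<le> c / 2 * real x" using c by (intro mult_left_mono) (auto simp: x_def)
          ultimately have "exp (C0 * t - c * real x) \<le> exp (real i * (- (c / 2)))" by (simp add: algebra_simps)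
          then have "C0 * exp (C0 * t - c * real x) \<le> C0 * q ^ i"
            using c unfolding q_def exp_of_nat_mult by (intro mult_left_mono) auto
          then show ?thesis using decay[OF t, of x] C1 g0 by (simp add: x_def add_increasing)
        qed
      qed
      also have "\<dots> = C1 * \<tau>\<^sup>2 * (\<Sum>i<n. g (real i)) + C0 * (\<Sum>i<n. q ^ i)"
        by (simp add: sum.distrib sum_distrib_left)
      also have "\<dots> \<le> C1 * \<tau>\<^sup>2 * (3 * \<tau>\<^sup>2) + C0 * (1 / (1 - q))"
      proof (intro add_mono mult_left_mono gsum)
        have "(\<Sum>i<n. q ^ i) = (1 - q ^ n) / (1 - q)" using q by (simp add: sum_gp_strict)
        also have "\<dots> \<le> 1 / (1 - q)" using q by (intro divide_right_mono) auto
        finally show "(\<Sum>i<n. q ^ i) \<le> 1 / (1 - q)" .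
      qed (use C1 c in auto)
      finally have 2: "(\<Sum>i<n. excess_limit \<rho> t (Suc (k + i))) \<le> 3 * C1 * \<tau> ^ 4 + C0 / (1 - q)"
        by (simp add: power2_eq_square power4_eq_xxxx)
      have 3: "\<kappa> * ((m - real k) - (m - real k)\<^sup>2) \<le> \<kappa> * 1" using \<kappa> f by (intro mult_left_mono) auto
      have "A n \<le> 12 * C1 * \<tau> ^ 4 + (\<kappa> + 2 * C0 / (1 - q)) * 1"
        unfolding A_def using 1 2 3 by simp
      also have "\<dots> \<le> 12 * C1 * \<tau> ^ 4 + (\<kappa> + 2 * C0 / (1 - q)) * \<tau> ^ 4"
        using \<kappa> c q one_le_power[OF \<tau>(4)] by (intro add_left_mono mult_left_mono) auto
      also have "\<dots> = b * \<tau> ^ 4" by (simp add: b_def algebra_simps)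
      finally show "A n \<le> b * \<tau> ^ 4" .
    qed
    then show "(\<Sum>\<^sub>\<infinity>i\<in>UNIV. (real_of_int i - char_speed \<rho> * \<tau> ^ 3)\<^sup>2 * two_point \<rho> i (\<tau> ^ 3)) \<le> b * \<tau> ^ 4"
      unfolding W_def m_def t_def V_def .
  qed
qed

theorem corollary2p4:
  fixes \<rho> :: real
  assumes "\<rho> > 0"
  shows "\<exists>t\<^sub>0 C :: real. 0 < t\<^sub>0 \<and> 0 < C \<and>
    (\<forall>t\<ge>t\<^sub>0. inverse C * t powr (1 / 3) \<le> diffusivity \<rho> t \<and>
              diffusivity \<rho> t \<le> C * t powr (1 / 3))"
proof -
  obtain a b T where ab: "0 < a" "0 < b" and T: "1 \<le> T"
    and lower: "\<And>\<tau>. T \<le> \<tau> \<Longrightarrow> a * \<tau> ^ 4 \<le>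
      (\<Sum>\<^sub>\<infinity>i\<in>UNIV. (real_of_int i - char_speed \<rho> * \<tau> ^ 3)\<^sup>2 * two_point \<rho> i (\<tau> ^ 3))"
    and upper: "\<And>\<tau>. T \<le> \<tau> \<Longrightarrow>
      (\<Sum>\<^sub>\<infinity>i\<in>UNIV. (real_of_int i - char_speed \<rho> * \<tau> ^ 3)\<^sup>2 * two_point \<rho> i (\<tau> ^ 3)) \<le> b * \<tau> ^ 4"
    by (rule second_moment_bounds[OF assms]) blast
  define \<kappa> where "\<kappa> = \<rho> * (1 + \<rho>)"
  have \<kappa>: "0 < \<kappa>" using assms by (simp add: \<kappa>_def)
  define C where "C = max (b / \<kappa>) (\<kappa> / a)"
  have C: "0 < C" "b / \<kappa> \<le> C" "\<kappa> / a \<le> C" using ab \<kappa> by (auto simp: C_def less_max_iff_disj)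
  have "inverse C * t powr (1 / 3) \<le> diffusivity \<rho> t \<and> diffusivity \<rho> t \<le> C * t powr (1 / 3)" if t: "T ^ 3 \<le> t" for t
  proof -
    define \<tau> where "\<tau> = t powr (1 / 3)"
    have t0: "0 < t" using t one_le_power[OF T, of 3] by linarith
    have pw: "y powr 3 = y ^ 3" if "0 < y" for y :: real
      using powr_realpow[OF that, of 3] by simp
    have "0 < \<tau>" using t0 by (simp add: \<tau>_def)
    have t\<tau>: "\<tau> ^ 3 = t"
      unfolding pw[OF \<open>0 < \<tau>\<close>, symmetric] unfolding \<tau>_def powr_powr using t0 by simp
    have "0 < T" using T by simp
    have "(T ^ 3) powr (1 / 3) = T"
      unfolding pw[OF \<open>0 < T\<close>, symmetric] powr_powr using T by simp
    moreover have "(T ^ 3) powr (1 / 3) \<le> \<tau>" unfolding \<tau>_def using t T by (intro powr_mono2) auto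
    ultimately have \<tau>: "T \<le> \<tau>" "0 < \<tau>" using T by auto
    define W where "W = (\<Sum>\<^sub>\<infinity>i\<in>UNIV. (real_of_int i - char_speed \<rho> * t)\<^sup>2 * two_point \<rho> i t)"
    have W: "a * \<tau> ^ 4 \<le> W" "W \<le> b * \<tau> ^ 4"
      using lower[OF \<tau>(1)] upper[OF \<tau>(1)] unfolding t\<tau> W_def .
    have D: "diffusivity \<rho> t = W / (\<kappa> * \<tau> ^ 3)"
      unfolding diffusivity_def W_def[symmetric] \<kappa>_def t\<tau> by (simp add: mult_ac)
    have "inverse C \<le> a / \<kappa>"
      using le_imp_inverse_le[OF C(3)] ab \<kappa> by simp
    then have "inverse C * \<tau> \<le> a / \<kappa> * \<tau>" using \<tau> by (intro mult_right_mono) auto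
    also have "\<dots> = a * \<tau> ^ 4 / (\<kappa> * \<tau> ^ 3)" using \<tau> \<kappa> by (simp add: field_simps power_numeral_reduce)
    also have "\<dots> \<le> diffusivity \<rho> t" unfolding D using W \<tau> \<kappa> by (intro divide_right_mono) auto
    finally have low: "inverse C * \<tau> \<le> diffusivity \<rho> t" .
    have "diffusivity \<rho> t \<le> b * \<tau> ^ 4 / (\<kappa> * \<tau> ^ 3)" unfolding D using W \<tau> \<kappa> by (intro divide_right_mono) auto
    also have "\<dots> = b / \<kappa> * \<tau>" using \<tau> \<kappa> by (simp add: field_simps power_numeral_reduce)
    also have "\<dots> \<le> C * \<tau>" using C \<tau> by (intro mult_right_mono) auto
    finally show ?thesis using low unfolding \<tau>_def by simp
  qed
  then show ?thesis using C(1) T by (intro exI[of _ "T ^ 3"] exI[of _ C]) auto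
qed

end
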